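(* Let $(Y,Z,W)$ be random variables with values in $\mathbb{R}\times[0,1]\times\mathbb{R}^p$ satisfying $Y=g_0(Z)+\varepsilon$, $E[\varepsilon\mid W]=0$, and let $(Y_i,Z_i,W_i)$, $i=1,\dots,n$, be an i.i.d. sample from the law of $(Y,Z,W)$. Assume: (1) (a) $E[Y^2]<\infty$; (b) $Z$ has a bounded density $f_Z$ on $[0,1]$; (c) $\mu$ is a symmetric probability measure on $\mathbb{R}^p$ with support $\mathbb{R}^p$; (d) $\int\int_0^1 |E[\exp(\mathbf{i}W^\top t)f_Z(z)]|^2\,dz\,d\mu(t)<\infty$; (e) $W$ has at least one continuous component. (2) $g_0\in\mathcal{G}$ and the mapping $g\in\mathcal{G}\mapsto E[g(Z)\mid W=\cdot]$ is injective. Let $\lambda=\lambda_n>0$ be deterministic and let $$\widehat g\in\arg\min_{g\in\mathcal{G}}\ \int\Big|\frac1n\sum_{i=1}^n (Y_i-g(Z_i))\exp(\mathbf{i}W_i^\top t)\Big|^2d\mu(t)+\lambda\int_0^1|g''(z)|^2dz .$$ If $\lambda\to0$ and $n\lambda\to\infty$ as $n\to\infty$, then $$\sup_{z\in[0,1]}|\widehat g(z)-g_0(z)|=o_p(1)\quad\text{and}\quad \sup_{z\in[0,1]}|\widehat g'(z)-g_0'(z)|=o_p(1).$$ If moreover the following source condition holds: (3) there exists $\gamma>0$ such that $\sum_j\sigma_j^{-2\gamma}|\langle h_0,\varphi_j\rangle_{\mathcal{H}}|^2<\infty$, where $h_0(z)=g_0(z)-g_0(0)-g_0'(0)z$ and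 $(\sigma_j,\varphi_j,\psi_j)_j$ is the singular system of the operator $T$ defined in the context, then $$\sup_{z\in[0,1]}|\widehat g(z)-g_0(z)|\quad\text{and}\quad\sup_{z\in[0,1]}|\widehat g'(z)-g_0'(z)|\quad\text{are both}\quad O_p\Big(\frac{1}{\sqrt{n\lambda}}+\lambda^{\frac{\gamma\wedge2}{2}}\Big).$$
   Context: $\mathbf{i}$ is the imaginary unit. $\mathcal{G}$ is the set of twice weakly differentiable functions $g:[0,1]\to\mathbb{R}$ (i.e. $g$ is differentiable with absolutely continuous $g'$) such that $\int_0^1|g''(t)|^2dt<\infty$. $\mathcal{H}=\{h\in\mathcal{G}:h(0)=h'(0)=0\}$ with inner product $\langle h_1,h_2\rangle_{\mathcal{H}}=\int_0^1h_1''(z)h_2''(z)\,dz$. Every $g\in\mathcal{G}$ is uniquely $g(z)=(1,z)\beta+h(z)$ with $\beta=(g(0),g'(0))\in\mathbb{R}^2$ and $h\in\mathcal{H}$. $L^2_\mu$ is the space of functions $l:\mathbb{R}^p\to\mathbb{C}$ with $\|l\|_\mu^2=\int|l(t)|^2d\mu(t)<\infty$ (regarded as a real Hilbert space, since the operators below are real-linear). Define $A:\mathcal{H}\to L^2_\mu$ by $Ah=E[h(Z)\exp(\mathbf{i}W^\top\cdot)]$ and $B:\mathbb{R}^2\to L^2_\mu$ by $B\beta=E[(1,Z)\beta\,\exp(\mathbf{i}W^\top\cdot)]$. $M$ is the orthogonal projection in $L^2_\mu$ onto the orthogonal complement of the range of $B$, and $T=MA$ (a compact operator). The singular system $(\sigma_j,\varphi_j,\psi_j)_j$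 of $T$ consists of strictly positive singular values $\sigma_j$, orthonormal $(\varphi_j)_j$ in $\mathcal{H}$ and orthonormal $(\psi_j)_j$ in $L^2_\mu$ with $T\varphi_j=\sigma_j\psi_j$, $T^*\psi_j=\sigma_j\varphi_j$. A "continuous component" of $W$ means a coordinate whose distribution is continuous (no atoms). Under the assumptions the minimizer $\widehat g$ exists and is unique with probability one (for $n\ge2$). $a\wedge b=\min(a,b)$. *)

theory Defs
  imports "HOL-Probability.Probability"
begin

section \<open>Function spaces on the unit interval\<close>

text \<open>
  Functions on \<open>[0,1]\<close> are functions \<open>real \<Rightarrow> real\<close> whose values outside \<open>[0,1]\<close> are
  irrelevant; equality means equality on \<open>[0,1]\<close>.
\<close>

definition absolutely_continuous_on :: "real set \<Rightarrow> (real \<Rightarrow> real) \<Rightarrow> bool" where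
  "absolutely_continuous_on S f \<longleftrightarrow>
     (\<forall>e>0. \<exists>d>0. \<forall>D :: (real \<times> real) set.
        finite D \<and> (\<forall>(a, b)\<in>D. a \<le> b \<and> {a..b} \<subseteq> S) \<and>
        disjoint_family_on (\<lambda>(a, b). {a<..<b}) D \<and> (\<Sum>(a, b)\<in>D. b - a) < d
        \<longrightarrow> (\<Sum>(a, b)\<in>D. \<bar>f b - f a\<bar>) < e)"

text \<open>
  Derivative on \<open>[0,1]\<close>, one-sided at the end points. If \<open>deriv01 g\<close> is absolutely continuous,
  \<open>deriv01 (deriv01 g)\<close> is its almost everywhere derivative. On the null set where that derivative
  does not exist it has an arbitrary constant value, whence the completed measure \<open>lebesgue\<close> below.
\<close>

definition deriv01 :: "(real \<Rightarrow> real) \<Rightarrow> real \<Rightarrow> real" where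
  "deriv01 g z = vector_derivative g (at z within {0..1})"

abbreviation deriv2_01 :: "(real \<Rightarrow> real) \<Rightarrow> real \<Rightarrow> real" where
  "deriv2_01 g \<equiv> deriv01 (deriv01 g)"

definition G_space :: "(real \<Rightarrow> real) set" where
  "G_space = {g. g differentiable_on {0..1} \<and>
                 absolutely_continuous_on {0..1} (deriv01 g) \<and>
                 set_integrable lebesgue {0..1} (\<lambda>t. (deriv2_01 g t)\<^sup>2)}"

definition H_space :: "(real \<Rightarrow> real) set" where
  "H_space = {h \<in> G_space. h 0 = 0 \<and> deriv01 h 0 = 0}"

definition H_inner :: "(real \<Rightarrow> real) \<Rightarrow> (real \<Rightarrow> real) \<Rightarrow> real" where
  "H_inner h1 h2 = (LINT z:{0..1}|lebesgue. deriv2_01 h1 z * deriv2_01 h2 z)"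


section \<open>The real Hilbert space \<open>L\<^sup>2\<close> of complex-valued functions\<close>

text \<open>Its elements are represented by functions, identified when equal almost everywhere.\<close>

definition L2_space :: "'b measure \<Rightarrow> ('b \<Rightarrow> complex) set" where
  "L2_space \<mu> = {l \<in> borel_measurable \<mu>. integrable \<mu> (\<lambda>t. (cmod (l t))\<^sup>2)}"

definition L2_inner :: "'b measure \<Rightarrow> ('b \<Rightarrow> complex) \<Rightarrow> ('b \<Rightarrow> complex) \<Rightarrow> real" where
  "L2_inner \<mu> l1 l2 = (LINT t|\<mu>. Re (l1 t * cnj (l2 t)))"

text \<open>Orthogonal projection of \<open>l\<close> onto the orthogonal complement of a (closed) subspace \<open>V\<close>.\<close>

definition proj_orth_compl ::
    "'b measure \<Rightarrow> ('b \<Rightarrow> complex) set \<Rightarrow> ('b \<Rightarrow> complex) \<Rightarrow> 'b \<Rightarrow> complex" where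
  "proj_orth_compl \<mu> V l =
     (SOME m. m \<in> L2_space \<mu> \<and> (\<lambda>t. l t - m t) \<in> V \<and> (\<forall>v\<in>V. L2_inner \<mu> m v = 0))"

definition measure_support :: "'b::topological_space measure \<Rightarrow> 'b set" where
  "measure_support \<mu> = {x. \<forall>U. open U \<and> x \<in> U \<longrightarrow> emeasure \<mu> U > 0}"


section \<open>The operators and their singular system\<close>

definition op_A :: "'a measure \<Rightarrow> ('a \<Rightarrow> real) \<Rightarrow> ('a \<Rightarrow> real ^ 'p) \<Rightarrow>
    (real \<Rightarrow> real) \<Rightarrow> real ^ 'p \<Rightarrow> complex" where
  "op_A P Z W h t = (LINT \<omega>|P. complex_of_real (h (Z \<omega>)) * iexp (W \<omega> \<bullet> t))"

definition op_B :: "'a measure \<Rightarrow> ('a \<Rightarrow> real) \<Rightarrow> ('a \<Rightarrow> real ^ 'p) \<Rightarrow>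
    real ^ 2 \<Rightarrow> real ^ 'p \<Rightarrow> complex" where
  "op_B P Z W \<beta> t = (LINT \<omega>|P. complex_of_real (\<beta> $ 1 + Z \<omega> * \<beta> $ 2) * iexp (W \<omega> \<bullet> t))"

definition op_T :: "'a measure \<Rightarrow> ('a \<Rightarrow> real) \<Rightarrow> ('a \<Rightarrow> real ^ 'p) \<Rightarrow> (real ^ 'p) measure \<Rightarrow>
    (real \<Rightarrow> real) \<Rightarrow> real ^ 'p \<Rightarrow> complex" where
  "op_T P Z W \<mu> h = proj_orth_compl \<mu> (range (op_B P Z W)) (op_A P Z W h)"

text \<open>\<open>T_adjoint_at T \<mu> l k\<close> says that the adjoint of \<open>T\<close> maps \<open>l\<close> to \<open>k\<close>.\<close>

definition T_adjoint_at :: "((real \<Rightarrow> real) \<Rightarrow> 'b \<Rightarrow> complex) \<Rightarrow> 'b measure \<Rightarrow>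
    ('b \<Rightarrow> complex) \<Rightarrow> (real \<Rightarrow> real) \<Rightarrow> bool" where
  "T_adjoint_at T \<mu> l k \<longleftrightarrow>
     k \<in> H_space \<and> (\<forall>h\<in>H_space. L2_inner \<mu> (T h) l = H_inner h k)"

text \<open>
  The index set \<open>J\<close> may be finite or infinite. The last conjunct expresses that the system is
  complete (all positive singular values are listed, with multiplicity): the \<open>\<phi> j\<close> span the
  orthogonal complement of the kernel of \<open>T\<close>.
\<close>

definition singular_system :: "((real \<Rightarrow> real) \<Rightarrow> 'b \<Rightarrow> complex) \<Rightarrow> 'b measure \<Rightarrow>
    nat set \<Rightarrow> (nat \<Rightarrow> real) \<Rightarrow> (nat \<Rightarrow> real \<Rightarrow> real) \<Rightarrow> (nat \<Rightarrow> 'b \<Rightarrow> complex) \<Rightarrow> bool" where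
  "singular_system T \<mu> J \<sigma> \<phi> \<psi> \<longleftrightarrow>
     (\<forall>j\<in>J. \<sigma> j > 0 \<and> \<phi> j \<in> H_space \<and> \<psi> j \<in> L2_space \<mu>) \<and>
     (\<forall>i\<in>J. \<forall>j\<in>J. H_inner (\<phi> i) (\<phi> j) = (if i = j then 1 else 0)) \<and>
     (\<forall>i\<in>J. \<forall>j\<in>J. L2_inner \<mu> (\<psi> i) (\<psi> j) = (if i = j then 1 else 0)) \<and>
     (\<forall>j\<in>J. AE t in \<mu>. T (\<phi> j) t = complex_of_real (\<sigma> j) * \<psi> j t) \<and>
     (\<forall>j\<in>J. T_adjoint_at T \<mu> (\<psi> j) (\<lambda>z. \<sigma> j * \<phi> j z)) \<and>
     (\<forall>h\<in>H_space. (\<forall>j\<in>J. H_inner h (\<phi> j) = 0) \<longrightarrow> (AE t in \<mu>. T h t = 0))"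


section \<open>Estimation\<close>

text \<open>Penalized criterion; the observations \<open>1, \<dots>, n\<close> are indexed by \<open>0, \<dots>, n - 1\<close>.\<close>

definition criterion :: "(real ^ 'p) measure \<Rightarrow> nat \<Rightarrow> real \<Rightarrow>
    (nat \<Rightarrow> real) \<Rightarrow> (nat \<Rightarrow> real) \<Rightarrow> (nat \<Rightarrow> real ^ 'p) \<Rightarrow> (real \<Rightarrow> real) \<Rightarrow> real" where
  "criterion \<mu> n lam y z w g =
     (LINT t|\<mu>. (cmod (complex_of_real (1 / real n) *
         (\<Sum>i<n. complex_of_real (y i - g (z i)) * iexp (w i \<bullet> t))))\<^sup>2)
     + lam * (LINT x:{0..1}|lebesgue. (deriv2_01 g x)\<^sup>2)"

definition sigma_gen :: "'a measure \<Rightarrow> ('a \<Rightarrow> 'b::topological_space) \<Rightarrow> 'a measure" where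
  "sigma_gen P W = vimage_algebra (space P) W borel"

definition sup01 :: "(real \<Rightarrow> real) \<Rightarrow> real" where
  "sup01 f = (SUP z\<in>{0..1}. \<bar>f z\<bar>)"

text \<open>
  Stochastic order symbols. Outer probabilities are used because no measurability of the selected
  minimizers is assumed; for measurable \<open>X n\<close> these are the usual notions.
\<close>

definition little_o_p :: "'a measure \<Rightarrow> (nat \<Rightarrow> 'a \<Rightarrow> real) \<Rightarrow> (nat \<Rightarrow> real) \<Rightarrow> bool" where
  "little_o_p P X r \<longleftrightarrow>
     (\<forall>e>0. (\<lambda>n. outer_measure_of P {\<omega> \<in> space P. \<bar>X n \<omega>\<bar> > e * r n}) \<longlonglongrightarrow> 0)"

definition big_O_p :: "'a measure \<Rightarrow> (nat \<Rightarrow> 'a \<Rightarrow> real) \<Rightarrow> (nat \<Rightarrow> real) \<Rightarrow> bool" where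
  "big_O_p P X r \<longleftrightarrow>
     (\<forall>e>0. \<exists>K>0. \<forall>\<^sub>F n in sequentially.
        outer_measure_of P {\<omega> \<in> space P. \<bar>X n \<omega>\<bar> > K * r n} < ennreal e)"

end

theory Submission
  imports Defs "HOL-Complex_Analysis.Great_Picard"
begin

text \<open>
  Write \<open>\<bar>g\<bar>\<close> for \<open>\<bar>g 0\<bar> + \<bar>g' 0\<bar> + \<parallel>g''\<parallel>\<close>, a norm on the Sobolev space \<open>\<G>\<close> that dominates the
  suprema of \<open>g\<close> and \<open>g'\<close>. The operator \<open>A g = E[g(Z) exp(i W\<cdot>t)]\<close> is injective on \<open>\<G>\<close>: if \<open>A g = 0\<close>
  almost everywhere for \<open>\<mu>\<close>, then everywhere, by continuity and full support, so \<open>E[g(Z) | W] = 0\<close>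
  by uniqueness of characteristic functions. Since sets bounded for \<open>\<bar>\<cdot>\<bar>\<close> are relatively compact
  in \<open>C\<^sup>1\<close> and the balls \<open>\<parallel>g''\<parallel> \<le> R\<close> are closed there, injectivity gives both the coercivity
  \<open>\<bar>g\<bar> \<le> C (\<parallel>A g\<parallel> + \<parallel>g''\<parallel>)\<close> and the fact that \<open>\<parallel>A g\<parallel> \<rightarrow> 0\<close> forces \<open>g \<rightarrow> 0\<close> in \<open>C\<^sup>1\<close> as
  long as \<open>\<parallel>g''\<parallel>\<close> stays bounded.

  The estimator is compared with the minimiser \<open>x\<close> of the population criterion
  \<open>\<parallel>A (g\<^sub>0 - x)\<parallel>\<^sup>2 + \<lambda> \<parallel>x''\<parallel>\<^sup>2\<close>. The empirical operator satisfies
  \<open>\<parallel>A\<^sub>n g - A g\<parallel> \<le> \<Delta> \<bar>g\<bar>\<close> uniformly in \<open>g\<close>, and both \<open>\<Delta>\<close> and the empirical noise are of order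
  \<open>n\<^sup>-\<^sup>1\<^sup>/\<^sup>2\<close> in probability; subtracting the two first-order conditions then bounds the distance
  between the estimator and \<open>x\<close> by a multiple of \<open>(n \<lambda>)\<^sup>-\<^sup>1\<^sup>/\<^sup>2\<close>. The bias \<open>g\<^sub>0 - x\<close> tends to zero by
  the stability above. Under the source condition its coefficient along \<open>\<phi>\<^sub>j\<close> is
  \<open>\<lambda> / (\<lambda> + \<sigma>\<^sub>j\<^sup>2)\<close> times that of \<open>h\<^sub>0\<close>; as \<open>T\<close> is injective, the \<open>\<phi>\<^sub>j\<close> satisfy Parseval's identity, and
  the rate follows from the elementary bound on the filter.
\<close>

section \<open>Absolutely continuous functions on the unit interval\<close>

text \<open>The obstacle is a mismatch of norms. Minimality controls the difference \<open>d\<close>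
  between estimator and population minimiser only through \<open>R\<close>, where
  \<open>R * R\<close> is the squared empirical norm of \<open>d\<close> plus
  \<open>lam * H_inner d d\<close>, while the operator error is measured by \<open>Gn d\<close>,
  which is larger by a factor of order \<open>1 / sqrt lam\<close>. In the error identity the
  operator error at \<open>d\<close> is paired with \<open>A\<close> of the bias alone, and that is
  of order \<open>sqrt lam\<close>, so the factor cancels. This is the gain from comparing with the
  population minimiser \<open>x\<close>: its first-order condition trades
  \<open>lam * H_inner x d\<close> for that pairing, and membership of \<open>g0\<close> in
  \<open>G_space\<close> suffices. Coercivity concerns \<open>A\<close> and has no explicit
  constant; it reaches the empirical operator once \<open>C * \<Delta> \<le> 1/2\<close>. Uniformity
  in \<open>g\<close> needs no entropy argument: \<open>g\<close> minus its value at 0 is an average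
  of indicators weighted by the derivative, so one Hilbert-space second moment for the indicators
  serves every \<open>g\<close>. The real analysis is there because \<open>G_space\<close> speaks of
  pointwise derivatives, whereas completeness and Fatou arguments need Borel versions.\<close>

definition ac_mod :: "real set \<Rightarrow> (real \<Rightarrow> real) \<Rightarrow> real \<Rightarrow> real \<Rightarrow> bool" where
  "ac_mod S f e d \<longleftrightarrow> (\<forall>D :: (real \<times> real) set.
        finite D \<and> (\<forall>(a, b)\<in>D. a \<le> b \<and> {a..b} \<subseteq> S) \<and>
        disjoint_family_on (\<lambda>(a, b). {a<..<b}) D \<and> (\<Sum>(a, b)\<in>D. b - a) < d
        \<longrightarrow> (\<Sum>(a, b)\<in>D. \<bar>f b - f a\<bar>) < e)"

lemma absolutely_continuous_on_iff_ac_mod: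
  "absolutely_continuous_on S f \<longleftrightarrow> (\<forall>e>0. \<exists>d>0. ac_mod S f e d)"
  unfolding absolutely_continuous_on_def ac_mod_def ..

text \<open>Indexed form. Passing from an index set to the set of pairs may merge equal intervals,
  but two equal intervals with disjoint interiors are degenerate, so every merged term is zero and
  both sums survive the reindexing.\<close>

lemma ac_modD:
  fixes l r :: "'i \<Rightarrow> real"
  assumes ac: "ac_mod S f e d" and "finite I"
    and lr: "\<And>i. i \<in> I \<Longrightarrow> l i \<le> r i" "\<And>i. i \<in> I \<Longrightarrow> {l i..r i} \<subseteq> S"
    and disj: "\<And>i j. i \<in> I \<Longrightarrow> j \<in> I \<Longrightarrow> i \<noteq> j \<Longrightarrow> {l i<..<r i} \<inter> {l j<..<r j} = {}"
    and len: "(\<Sum>i\<in>I. r i - l i) < d"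
  shows "(\<Sum>i\<in>I. \<bar>f (r i) - f (l i)\<bar>) < e"
proof -
  define h where "h = (\<lambda>i. (l i, r i))"
  have eq: "l i = r i" if "i \<in> I" "j \<in> I" "i \<noteq> j" "h i = h j" for i j
  proof -
    have "{l i<..<r i} = {}" using disj[OF that(1-3)] that(4) by (auto simp: h_def)
    then show ?thesis using lr(1)[OF that(1)] by auto
  qed
  have "(\<Sum>(a, b)\<in>h ` I. b - a) = (\<Sum>i\<in>I. r i - l i)"
    using eq by (subst sum.reindex_nontrivial[OF \<open>finite I\<close>]) (force simp: h_def)+
  moreover have "(\<Sum>(a, b)\<in>h ` I. \<bar>f b - f a\<bar>) = (\<Sum>i\<in>I. \<bar>f (r i) - f (l i)\<bar>)"
    using eq by (subst sum.reindex_nontrivial[OF \<open>finite I\<close>]) (force simp: h_def)+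
  moreover have "disjoint_family_on (\<lambda>(a, b). {a<..<b}) (h ` I)"
    using disj unfolding disjoint_family_on_def h_def by fastforce
  ultimately show ?thesis
    using ac[unfolded ac_mod_def, rule_format, of "h ` I"] \<open>finite I\<close> lr len
    by (auto simp: h_def)
qed

lemma absolutely_continuous_on_add:
  assumes "absolutely_continuous_on S f" "absolutely_continuous_on S g"
  shows "absolutely_continuous_on S (\<lambda>x. f x + g x)"
  unfolding absolutely_continuous_on_iff_ac_mod
proof (intro allI impI)
  fix e :: real assume "e > 0"
  then obtain d1 d2 where d: "d1 > 0" "ac_mod S f (e/2) d1" "d2 > 0" "ac_mod S g (e/2) d2"
    using assms unfolding absolutely_continuous_on_iff_ac_mod by (meson half_gt_zero)
  have "ac_mod S (\<lambda>x. f x + g x) e (min d1 d2)"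
    unfolding ac_mod_def
  proof (intro allI impI)
    fix D :: "(real \<times> real) set"
    assume D: "finite D \<and> (\<forall>(a, b)\<in>D. a \<le> b \<and> {a..b} \<subseteq> S) \<and>
        disjoint_family_on (\<lambda>(a, b). {a<..<b}) D \<and> (\<Sum>(a, b)\<in>D. b - a) < min d1 d2"
    then have "(\<Sum>(a, b)\<in>D. \<bar>f b - f a\<bar>) < e/2" "(\<Sum>(a, b)\<in>D. \<bar>g b - g a\<bar>) < e/2"
      using d unfolding ac_mod_def by (meson min_less_iff_conj)+
    moreover have "(\<Sum>(a, b)\<in>D. \<bar>f b + g b - (f a + g a)\<bar>)
        \<le> (\<Sum>(a, b)\<in>D. \<bar>f b - f a\<bar>) + (\<Sum>(a, b)\<in>D. \<bar>g b - g a\<bar>)"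
      unfolding sum.distrib[symmetric] by (rule sum_mono) auto
    ultimately show "(\<Sum>(a, b)\<in>D. \<bar>f b + g b - (f a + g a)\<bar>) < e" by linarith
  qed
  then show "\<exists>d>0. ac_mod S (\<lambda>x. f x + g x) e d" using d by (intro exI[of _ "min d1 d2"]) auto
qed

lemma absolutely_continuous_on_cmult:
  assumes "absolutely_continuous_on S f"
  shows "absolutely_continuous_on S (\<lambda>x. c * f x)"
  unfolding absolutely_continuous_on_iff_ac_mod
proof (intro allI impI)
  fix e :: real assume "e > 0"
  \<comment> \<open>The summand 1 keeps the divisor positive for \<open>c = 0\<close>.\<close>
  then have "e / (\<bar>c\<bar> + 1) > 0" by (simp add: add_nonneg_pos)
  then obtain d where d: "d > 0" "ac_mod S f (e / (\<bar>c\<bar> + 1)) d"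
    using assms unfolding absolutely_continuous_on_iff_ac_mod by meson
  have "ac_mod S (\<lambda>x. c * f x) e d"
    unfolding ac_mod_def
  proof (intro allI impI)
    fix D :: "(real \<times> real) set"
    assume D: "finite D \<and> (\<forall>(a, b)\<in>D. a \<le> b \<and> {a..b} \<subseteq> S) \<and>
        disjoint_family_on (\<lambda>(a, b). {a<..<b}) D \<and> (\<Sum>(a, b)\<in>D. b - a) < d"
    then have s: "(\<Sum>(a, b)\<in>D. \<bar>f b - f a\<bar>) < e / (\<bar>c\<bar> + 1)"
      using d unfolding ac_mod_def by meson
    have "(\<Sum>(a, b)\<in>D. \<bar>c * f b - c * f a\<bar>) = \<bar>c\<bar> * (\<Sum>(a, b)\<in>D. \<bar>f b - f a\<bar>)"
      by (simp add: sum_distrib_left case_prod_unfold abs_mult[symmetric] right_diff_distrib)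
    also have "\<dots> \<le> (\<bar>c\<bar> + 1) * (\<Sum>(a, b)\<in>D. \<bar>f b - f a\<bar>)"
      by (intro mult_right_mono sum_nonneg) auto
    also have "\<dots> < e" using s by (simp add: pos_less_divide_eq mult.commute add_nonneg_pos)
    finally show "(\<Sum>(a, b)\<in>D. \<bar>c * f b - c * f a\<bar>) < e" .
  qed
  then show "\<exists>d>0. ac_mod S (\<lambda>x. c * f x) e d" using d by auto
qed

lemma ac_mod_close:
  assumes "ac_mod {0..1} f e d" "x \<in> {0..1}" "y \<in> {0..1}" "\<bar>y - x\<bar> < d"
  shows "\<bar>f y - f x\<bar> < e"
  using ac_modD[OF assms(1), of "{()}" "\<lambda>_. min x y" "\<lambda>_. max x y"] assms
  by (cases "x \<le> y") (auto simp: min_def max_def abs_minus_commute)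

lemma absolutely_continuous_on_imp_continuous_on:
  assumes "absolutely_continuous_on {0..1} f"
  shows "continuous_on {0..1} f"
  unfolding continuous_on_iff dist_real_def
proof (intro ballI allI impI)
  fix x e :: real assume x: "x \<in> {0..1}" "e > 0"
  then obtain d where "d > 0" "ac_mod {0..1} f e d"
    using assms unfolding absolutely_continuous_on_iff_ac_mod by blast
  then show "\<exists>d>0. \<forall>x'\<in>{0..1}. \<bar>x' - x\<bar> < d \<longrightarrow> \<bar>f x' - f x\<bar> < e"
    using ac_mod_close x by blast
qed

section \<open>The variation function of an absolutely continuous function\<close>

text \<open>Projection onto \<open>[a,b]\<close> for \<open>a \<le> b\<close>. It serves twice: to
  restrict a dyadic grid to a subinterval and, as \<open>clampi 0 1\<close>, to extend a function on
  the unit interval by constants to a continuous function on the line.\<close>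

definition clampi :: "real \<Rightarrow> real \<Rightarrow> real \<Rightarrow> real" where
  "clampi a b x = max a (min b x)"

text \<open>The variation of \<open>f\<close> on \<open>[0,x]\<close> along the dyadic grid of mesh \<open>2\<^sup>-\<^sup>n\<close>, truncated at \<open>x\<close>.\<close>

definition vsum :: "(real \<Rightarrow> real) \<Rightarrow> nat \<Rightarrow> real \<Rightarrow> real" where
  "vsum f n x = (\<Sum>k<2^n. \<bar>f (min (real (Suc k) / 2^n) x) - f (min (real k / 2^n) x)\<bar>)"

lemma vsum_0: "vsum f n 0 = 0"
  unfolding vsum_def by (rule sum.neutral) (auto simp: min_absorb2)

text \<open>Each cell of the coarse grid is the union of two cells of the fine one, so this is the
  triangle inequality, cell by cell.\<close>

lemma vsum_Suc_le: "vsum f n x \<le> vsum f (Suc n) x"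
proof -
  have "vsum f n x \<le> (\<Sum>k<2^n. \<Sum>j\<in>{k*2..<k*2+2}.
      \<bar>f (min (real (Suc j) / 2^Suc n) x) - f (min (real j / 2^Suc n) x)\<bar>)"
    unfolding vsum_def
  proof (rule sum_mono)
    fix k :: nat
    have "{k*2..<k*2+2} = {2*k, 2*k+1}" by auto
    moreover have "real (Suc (2*k+1)) / 2^Suc n = real (Suc k) / 2^n"
      "real (2*k) / 2^Suc n = real k / 2^n" by (auto simp: field_simps)
    ultimately show "\<bar>f (min (real (Suc k) / 2^n) x) - f (min (real k / 2^n) x)\<bar> \<le> (\<Sum>j\<in>{k*2..<k*2+2}.
      \<bar>f (min (real (Suc j) / 2^Suc n) x) - f (min (real j / 2^Suc n) x)\<bar>)"
      by (simp del: of_nat_Suc power_Suc) (smt (verit) of_nat_mult of_nat_numeral)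
  qed
  also have "\<dots> = vsum f (Suc n) x"
    unfolding vsum_def by (subst sum.nat_group) (simp add: mult.commute)
  finally show ?thesis .
qed

text \<open>The constant \<open>f a\<close> cancels in increments over \<open>x\<close>: an
  increment along the grid truncated at \<open>b\<close> minus the one truncated at \<open>a\<close>
  is an increment along the grid clamped to \<open>[a,b]\<close>.\<close>

lemma clampi_diff:
  fixes f :: "real \<Rightarrow> real"
  assumes "a \<le> b" shows "f (min b x) - f (min a x) = f (clampi a b x) - f a"
proof -
  consider "x \<le> a" | "a \<le> x" by linarith
  then show ?thesis using assms by cases (simp_all add: clampi_def min_absorb2 min_absorb1 max_absorb1 max_absorb2)
qed

lemma vsum_diff_le:
  assumes "a \<le> b"
  shows "vsum f n b - vsum f n a \<le>
    (\<Sum>k<2^n. \<bar>f (clampi a b (real (Suc k) / 2^n)) - f (clampi a b (real k / 2^n))\<bar>)"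
  unfolding vsum_def sum_subtractf[symmetric]
proof (rule sum_mono)
  fix k :: nat
  show "\<bar>f (min (real (Suc k) / 2^n) b) - f (min (real k / 2^n) b)\<bar> -
      \<bar>f (min (real (Suc k) / 2^n) a) - f (min (real k / 2^n) a)\<bar>
      \<le> \<bar>f (clampi a b (real (Suc k) / 2^n)) - f (clampi a b (real k / 2^n))\<bar>"
    using clampi_diff[OF assms, of f "real (Suc k) / 2^n"] clampi_diff[OF assms, of f "real k / 2^n"]
    by (simp add: min.commute) linarith
qed

text \<open>Inside each interval the clamped grid produces adjacent subintervals of the same total
  length, so the refined family is again admissible for \<open>ac_mod\<close>. The point is that
  \<open>e\<close> and \<open>d\<close> do not depend on \<open>n\<close>: the modulus survives the
  limit of the dyadic sums.\<close>

lemma vsum_ac: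
  fixes l r :: "'i \<Rightarrow> real"
  assumes ac: "ac_mod {0..1} f e d" and "finite I"
    and lr: "\<And>i. i \<in> I \<Longrightarrow> l i \<le> r i" "\<And>i. i \<in> I \<Longrightarrow> {l i..r i} \<subseteq> {0..1}"
    and disj: "\<And>i j. i \<in> I \<Longrightarrow> j \<in> I \<Longrightarrow> i \<noteq> j \<Longrightarrow> {l i<..<r i} \<inter> {l j<..<r j} = {}"
    and len: "(\<Sum>i\<in>I. r i - l i) < d"
  shows "(\<Sum>i\<in>I. vsum f n (r i) - vsum f n (l i)) < e"
proof -
  let ?N = "2^n :: nat"
  define L where "L = (\<lambda>(i, k). clampi (l i) (r i) (real k / 2^n))"
  define R where "R = (\<lambda>(i, k). clampi (l i) (r i) (real (Suc k) / 2^n))"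
  have mono: "clampi a b x \<le> clampi a b y" if "x \<le> y" for a b x y
    using that by (auto simp: clampi_def)
  have bds: "l i \<le> clampi (l i) (r i) x" "clampi (l i) (r i) x \<le> r i" if "i \<in> I" for i x
    using lr(1)[OF that] by (auto simp: clampi_def)
  have "(\<Sum>p\<in>I \<times> {..<?N}. \<bar>f (R p) - f (L p)\<bar>) < e"
  proof (rule ac_modD[OF ac])
    show "finite (I \<times> {..<?N})" using \<open>finite I\<close> by simp
    show "L p \<le> R p" for p
      unfolding L_def R_def by (auto intro!: mono divide_right_mono split: prod.split)
    show "{L p..R p} \<subseteq> {0..1}" if "p \<in> I \<times> {..<?N}" for p
    proof -
      obtain i k where p: "p = (i, k)" "i \<in> I" using \<open>p \<in> _\<close> by blast
      then have "{L p..R p} \<subseteq> {l i..r i}" using bds[OF p(2)] by (auto simp: L_def R_def intro: order_trans)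
      then show ?thesis using lr(2)[OF p(2)] by auto
    qed
    show "{L p<..<R p} \<inter> {L q<..<R q} = {}"
      if "p \<in> I \<times> {..<?N}" "q \<in> I \<times> {..<?N}" "p \<noteq> q" for p q
    proof -
      obtain i k j m where p: "p = (i, k)" "i \<in> I" "q = (j, m)" "j \<in> I"
        using \<open>p \<in> _\<close> \<open>q \<in> _\<close> by blast
      show ?thesis
      proof (cases "i = j")
        case True
        then have "k < m \<or> m < k" using that p by auto
        then have "R p \<le> L q \<or> R q \<le> L p"
          unfolding p L_def R_def True by (auto intro!: mono divide_right_mono)
        then show ?thesis by auto
      next
        case False
        have "{L p<..<R p} \<subseteq> {l i<..<r i}" "{L q<..<R q} \<subseteq> {l j<..<r j}"
          using bds[OF p(2), of "real k / 2^n"] bds[OF p(2), of "real (Suc k) / 2^n"]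
            bds[OF p(4), of "real m / 2^n"] bds[OF p(4), of "real (Suc m) / 2^n"]
          by (auto simp: L_def R_def p(1,3) simp del: of_nat_Suc)
        then show ?thesis using disj[OF p(2,4) False] by blast
      qed
    qed
    have "(\<Sum>p\<in>I \<times> {..<?N}. R p - L p) = (\<Sum>i\<in>I. \<Sum>k<?N. R (i, k) - L (i, k))"
      by (simp add: sum.cartesian_product)
    also have "\<dots> = (\<Sum>i\<in>I. r i - l i)"
    proof (rule sum.cong[OF refl])
      fix i assume i: "i \<in> I"
      have "(\<Sum>k<?N. R (i, k) - L (i, k)) = clampi (l i) (r i) (real ?N / 2^n) - clampi (l i) (r i) 0"
        unfolding R_def L_def
        using sum_lessThan_telescope[of "\<lambda>k. clampi (l i) (r i) (real k / 2^n)" ?N] by simp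
      also have "\<dots> = r i - l i" using lr[OF i] by (auto simp: clampi_def)
      finally show "(\<Sum>k<?N. R (i, k) - L (i, k)) = r i - l i" .
    qed
    finally show "(\<Sum>p\<in>I \<times> {..<?N}. R p - L p) < d" using len by simp
  qed
  moreover have "(\<Sum>i\<in>I. vsum f n (r i) - vsum f n (l i)) \<le> (\<Sum>p\<in>I \<times> {..<?N}. \<bar>f (R p) - f (L p)\<bar>)"
  proof -
    have "(\<Sum>i\<in>I. vsum f n (r i) - vsum f n (l i)) \<le> (\<Sum>i\<in>I. \<Sum>k<?N. \<bar>f (R (i, k)) - f (L (i, k))\<bar>)"
      unfolding L_def R_def prod.case by (intro sum_mono vsum_diff_le lr)
    then show ?thesis by (simp add: sum.cartesian_product case_prod_unfold)
  qed
  ultimately show ?thesis by linarith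
qed

text \<open>Steps shorter than \<open>d\<close> raise \<open>vsum\<close> by less than 1 each, and
  \<open>Suc N\<close> such steps reach any \<open>x\<close>; the bound counts the steps and is
  independent of the grid.\<close>

lemma vsum_bounded:
  assumes "absolutely_continuous_on {0..1} f"
  obtains K where "\<And>n x. x \<in> {0..1} \<Longrightarrow> vsum f n x \<le> K"
proof -
  obtain d where d: "d > 0" "ac_mod {0..1} f 1 d"
    using assms unfolding absolutely_continuous_on_iff_ac_mod by (meson zero_less_one)
  obtain N :: nat where N: "1 / real (Suc N) < d" using d nat_approx_posE by blast
  have "vsum f n x \<le> real (Suc N)" if x: "x \<in> {0..1}" for n x
  proof -
    have "vsum f n (x * (real j / real (Suc N))) \<le> real j" if "j \<le> Suc N" for j
      using that
    proof (induction j)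
      case 0 then show ?case by (simp add: vsum_0)
    next
      case (Suc j)
      let ?l = "x * (real j / real (Suc N))" and ?r = "x * (real (Suc j) / real (Suc N))"
      have "?r \<le> 1 * 1" using x Suc(2) by (intro mult_mono) auto
      moreover have "?l \<le> ?r" using x by (intro mult_left_mono divide_right_mono) auto
      moreover have "?l \<ge> 0" using x by auto
      moreover have "?r - ?l = x * (1 / real (Suc N))"
        by (simp add: right_diff_distrib[symmetric] diff_divide_distrib[symmetric])
      moreover have "x * (1 / real (Suc N)) \<le> 1 * (1 / real (Suc N))" using x by (intro mult_right_mono) auto
      ultimately have "vsum f n ?r - vsum f n ?l < 1"
        using vsum_ac[OF d(2), of "{()}" "\<lambda>_. ?l" "\<lambda>_. ?r" n] N x by auto
      then show ?case using Suc by simp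
    qed
    from this[of "Suc N"] show ?thesis by simp
  qed
  then show ?thesis using that by blast
qed

text \<open>The clamped increments on \<open>[x,y]\<close> add up to at least
  \<open>\<bar>f y - f x\<bar>\<close>, but \<open>x\<close> cuts the cell with index
  \<open>j\<close>. Repairing that cell costs twice the increment of \<open>f\<close> from its left
  end to \<open>x\<close>, which continuity sends to zero as the grid is refined.\<close>

lemma vsum_diff_ge:
  assumes xy: "0 \<le> x" "x \<le> y" "y \<le> 1" and j: "j = nat \<lfloor>x * 2^n\<rfloor>"
  shows "\<bar>f y - f x\<bar> - 2 * \<bar>f x - f (real j / 2^n)\<bar> \<le> vsum f n y - vsum f n x"
proof -
  let ?c = "\<lambda>k. clampi x y (real k / 2^n)"
  define e where "e = (\<lambda>k. if k = j then \<bar>f x - f (real j / 2^n)\<bar> else 0)"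
  have jx: "real j / 2^n \<le> x" "x < real (Suc j) / 2^n"
  proof -
    have "real j = of_int \<lfloor>x * 2^n\<rfloor>" using j xy by simp
    then have "real j \<le> x * 2^n" "x * 2^n < real j + 1" by linarith+
    then show "real j / 2^n \<le> x" "x < real (Suc j) / 2^n" by (simp_all add: field_simps)
  qed
  have "\<bar>f y - f x\<bar> = \<bar>\<Sum>k<2^n. f (?c (Suc k)) - f (?c k)\<bar>"
    using sum_lessThan_telescope[of "\<lambda>k. f (?c k)" "2^n"] xy by (simp add: clampi_def)
  also have "\<dots> \<le> (\<Sum>k<2^n. \<bar>f (?c (Suc k)) - f (?c k)\<bar>)" by (rule sum_abs)
  finally have 1: "\<bar>f y - f x\<bar> \<le> (\<Sum>k<2^n. \<bar>f (?c (Suc k)) - f (?c k)\<bar>)" .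
  have 2: "\<bar>f (?c (Suc k)) - f (?c k)\<bar> - 2 * e k \<le>
    \<bar>f (min (real (Suc k) / 2^n) y) - f (min (real k / 2^n) y)\<bar> -
    \<bar>f (min (real (Suc k) / 2^n) x) - f (min (real k / 2^n) x)\<bar>" for k
  proof -
    have mono: "real a / 2^n \<le> real b / 2^n" if "a \<le> b" for a b :: nat
      using that by (intro divide_right_mono) auto
    consider "k < j" | "k = j" | "k > j" by linarith
    then show ?thesis
    proof cases
      case 1
      then have "real (Suc k) / 2^n \<le> x" "real k / 2^n \<le> x" using mono[of "Suc k" j] mono[of k j] jx by auto
      then have "min (real k / 2^n) y = real k / 2^n" "min (real k / 2^n) x = real k / 2^n"
        "min (real (Suc k) / 2^n) x = real (Suc k) / 2^n" "min (real (Suc k) / 2^n) y = real (Suc k) / 2^n"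
        "?c k = x" "?c (Suc k) = x"
        using xy by (auto simp: clampi_def)
      moreover have "e k = 0" using 1 by (simp add: e_def)
      ultimately show ?thesis by (simp only:)
    next
      case 2
      have "min (real k / 2^n) y = real k / 2^n" "min (real k / 2^n) x = real k / 2^n"
        "min (real (Suc k) / 2^n) x = x" "?c k = x" "?c (Suc k) = min (real (Suc k) / 2^n) y"
        using 2 jx xy by (auto simp: clampi_def)
      moreover have "\<bar>A - C\<bar> - 2 * \<bar>C - B\<bar> \<le> \<bar>A - B\<bar> - \<bar>C - B\<bar>" for A B C :: real
        using abs_triangle_ineq[of "A - B" "B - C"] abs_minus_commute[of C B] by simp
      ultimately show ?thesis unfolding e_def using 2 by (simp only: if_True if_False refl)
    next
      case 3
      then have "real (Suc j) / 2^n \<le> real k / 2^n" "real (Suc j) / 2^n \<le> real (Suc k) / 2^n" by (intro mono; simp)+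
      then have "x \<le> real (Suc k) / 2^n" "x \<le> real k / 2^n" using jx(2) by linarith+
      then have "min (real k / 2^n) x = x" "min (real (Suc k) / 2^n) x = x"
        "?c k = min (real k / 2^n) y" "?c (Suc k) = min (real (Suc k) / 2^n) y"
        using xy by (auto simp: clampi_def)
      moreover have "e k = 0" using 3 by (simp add: e_def)
      ultimately show ?thesis by (simp only: mult_zero_right diff_self abs_zero diff_zero order_refl)
    qed
  qed
  \<comment> \<open>Only an inequality: for \<open>x = 1\<close> the index \<open>j\<close> equals
    \<open>2^n\<close> and falls outside the sum.\<close>
  have "(\<Sum>k<2^n. 2 * e k) \<le> 2 * \<bar>f x - f (real j / 2^n)\<bar>"
  proof -
    have "(\<Sum>k<2^n. 2 * e k) = 2 * (\<Sum>k<2^n. e k)" by (rule sum_distrib_left[symmetric])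
    also have "(\<Sum>k<2^n. e k) \<le> \<bar>f x - f (real j / 2^n)\<bar>" unfolding e_def by (subst sum.delta) auto
    finally show ?thesis by simp
  qed
  moreover have "(\<Sum>k<2^n. \<bar>f (?c (Suc k)) - f (?c k)\<bar> - 2 * e k) \<le> vsum f n y - vsum f n x"
    using sum_mono[of "{..<2^n}", OF 2] by (simp only: vsum_def sum_subtractf)
  ultimately show ?thesis using 1 by (simp add: sum_subtractf)
qed

text \<open>\<open>V\<close> is the limit of the increasing, bounded dyadic sums. Since one fixed
  sequence of grids is refined, \<open>V\<close> is a pointwise limit, and both the modulus of
  absolute continuity and the lower bound on increments are inherited from the sums.\<close>

lemma ac_variation:
  assumes ac: "absolutely_continuous_on {0..1} f"
  obtains V where "absolutely_continuous_on {0..1} V"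
    "\<And>x y. 0 \<le> x \<Longrightarrow> x \<le> y \<Longrightarrow> y \<le> 1 \<Longrightarrow> \<bar>f y - f x\<bar> \<le> V y - V x"
proof -
  obtain K where K: "\<And>n x. x \<in> {0..1} \<Longrightarrow> vsum f n x \<le> K" using vsum_bounded[OF ac] by blast
  have inc: "incseq (\<lambda>n. vsum f n x)" for x by (rule incseq_SucI) (rule vsum_Suc_le)
  define V where "V = (\<lambda>x. lim (\<lambda>n. vsum f n x))"
  have lim: "(\<lambda>n. vsum f n x) \<longlonglongrightarrow> V x" if "x \<in> {0..1}" for x
  proof -
    have "convergent (\<lambda>n. vsum f n x)"
      using incseq_convergent[OF inc[of x], of K] K[OF that] unfolding convergent_def by metis
    then show ?thesis unfolding V_def by (simp add: convergent_LIMSEQ_iff)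
  qed
  have inc_V: "\<bar>f y - f x\<bar> \<le> V y - V x" if xy: "0 \<le> x" "x \<le> y" "y \<le> 1" for x y
  proof -
    define j where "j = (\<lambda>n::nat. nat \<lfloor>x * 2^n\<rfloor>)"
    have cont: "continuous_on {0..1} f" by (rule absolutely_continuous_on_imp_continuous_on[OF ac])
    have jb: "0 \<le> real (j n) / 2^n" "real (j n) / 2^n \<le> x" "x - 1 / 2^n \<le> real (j n) / 2^n" for n
    proof -
      have "real (j n) = of_int \<lfloor>x * 2^n\<rfloor>" using xy by (simp add: j_def)
      then have j: "real (j n) \<le> x * 2^n" "x * 2^n \<le> real (j n) + 1" by linarith+
      have "(x * 2^n - 1) / 2^n \<le> real (j n) / 2^n" using j by (intro divide_right_mono) auto
      then have "x - 1 / 2^n \<le> real (j n) / 2^n" by (simp add: diff_divide_distrib)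
      with j show "0 \<le> real (j n) / 2^n" "real (j n) / 2^n \<le> x" "x - 1 / 2^n \<le> real (j n) / 2^n"
        by (simp_all add: divide_le_eq)
    qed
    have "(\<lambda>n. x - 1 / 2^n) \<longlonglongrightarrow> x - 0"
      by (intro tendsto_intros LIMSEQ_divide_realpow_zero) auto
    then have "(\<lambda>n. real (j n) / 2^n) \<longlonglongrightarrow> x"
      by (intro tendsto_sandwich[OF always_eventually[OF allI[OF jb(3)]] always_eventually[OF allI[OF jb(2)]]])
        simp_all
    then have "(\<lambda>n. f (real (j n) / 2^n)) \<longlonglongrightarrow> f x"
      by (rule continuous_on_tendsto_compose[OF cont]) (use order_trans[OF jb(2) order_trans[OF xy(2,3)]] jb(1) xy in auto)
    then have "(\<lambda>n. \<bar>f y - f x\<bar> - 2 * \<bar>f x - f (real (j n) / 2^n)\<bar>) \<longlonglongrightarrow> \<bar>f y - f x\<bar> - 2 * \<bar>f x - f x\<bar>"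
      by (intro tendsto_intros)
    moreover have "(\<lambda>n. vsum f n y - vsum f n x) \<longlonglongrightarrow> V y - V x"
      using xy by (intro tendsto_intros lim) auto
    ultimately show ?thesis
      using LIMSEQ_le[of "\<lambda>n. \<bar>f y - f x\<bar> - 2 * \<bar>f x - f (real (j n) / 2^n)\<bar>" "\<bar>f y - f x\<bar> - 2 * \<bar>f x - f x\<bar>"
          "\<lambda>n. vsum f n y - vsum f n x" "V y - V x"] vsum_diff_ge[OF xy, of "j _"] by (simp add: j_def)
  qed
  show ?thesis
  proof (rule that[of V])
    show "absolutely_continuous_on {0..1} V"
      unfolding absolutely_continuous_on_iff_ac_mod
    proof (intro allI impI)
      fix e :: real assume "e > 0"
      \<comment> \<open>Half of \<open>e\<close>, because the limit turns a strict inequality into a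
        weak one.\<close>
      then obtain d where d: "d > 0" "ac_mod {0..1} f (e/2) d"
        using ac unfolding absolutely_continuous_on_iff_ac_mod by (meson half_gt_zero)
      have "ac_mod {0..1} V e d"
        unfolding ac_mod_def
      proof (intro allI impI)
        fix D :: "(real \<times> real) set"
        assume D: "finite D \<and> (\<forall>(a, b)\<in>D. a \<le> b \<and> {a..b} \<subseteq> {0..1}) \<and>
          disjoint_family_on (\<lambda>(a, b). {a<..<b}) D \<and> (\<Sum>(a, b)\<in>D. b - a) < d"
        have in01: "fst p \<in> {0..1}" "snd p \<in> {0..1}" "fst p \<le> snd p" if "p \<in> D" for p
          using D that by force+
        have tl: "(\<lambda>n. \<Sum>p\<in>D. \<bar>vsum f n (snd p) - vsum f n (fst p)\<bar>) \<longlonglongrightarrow> (\<Sum>p\<in>D. \<bar>V (snd p) - V (fst p)\<bar>)"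
          using in01 by (intro tendsto_intros lim) auto
        have tl2: "(\<lambda>n. \<Sum>p\<in>D. (vsum f n (snd p) - vsum f n (fst p))) \<longlonglongrightarrow> (\<Sum>p\<in>D. V (snd p) - V (fst p))"
          using in01 by (intro tendsto_intros lim) auto
        have "(\<Sum>p\<in>D. vsum f n (snd p) - vsum f n (fst p)) < e/2" for n
        proof (rule vsum_ac[OF d(2)])
          show "finite D" using D by simp
          show "fst p \<le> snd p" if "p \<in> D" for p using in01 that by simp
          show "{fst p..snd p} \<subseteq> {0..1}" if "p \<in> D" for p using in01[OF that] by auto
          show "{fst i<..<snd i} \<inter> {fst j<..<snd j} = {}" if "i \<in> D" "j \<in> D" "i \<noteq> j" for i j
            using D that unfolding disjoint_family_on_def by (simp add: case_prod_unfold)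
          show "(\<Sum>p\<in>D. snd p - fst p) < d" using D by (simp add: case_prod_unfold)
        qed
        then have le: "(\<Sum>p\<in>D. V (snd p) - V (fst p)) \<le> e/2"
          by (intro LIMSEQ_le_const2[OF tl2]) (auto intro: less_imp_le)
        have "\<bar>V (snd p) - V (fst p)\<bar> = V (snd p) - V (fst p)" if "p \<in> D" for p
        proof -
          have "V (snd p) - V (fst p) \<ge> 0" using inc_V in01[OF that] by force
          then show ?thesis by simp
        qed
        then have "(\<Sum>p\<in>D. \<bar>V (snd p) - V (fst p)\<bar>) \<le> e/2" using le by simp
        then show "(\<Sum>(a, b)\<in>D. \<bar>V b - V a\<bar>) < e" using \<open>e > 0\<close> by (simp add: case_prod_unfold)
      qed
      then show "\<exists>d>0. ac_mod {0..1} V e d" using d by auto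
    qed
    show "\<bar>f y - f x\<bar> \<le> V y - V x" if "0 \<le> x" "x \<le> y" "y \<le> 1" for x y
      using inc_V that by simp
  qed
qed

section \<open>Stieltjes measures, densities and differentiation almost everywhere\<close>

lemma continuous_on_clampi: "continuous_on UNIV (clampi 0 1)"
  unfolding clampi_def by (intro continuous_intros)

text \<open>A bounded null set is covered by countably many nonoverlapping intervals inside an open
  set of measure below \<open>d\<close>. Finite subfamilies have small total increment by absolute
  continuity of \<open>F\<close>, and the countable union follows by monotone limits. Bounded sets
  come first because the covering lemma works inside a box.\<close>

lemma ac_interval_measure_null:
  assumes ac: "absolutely_continuous_on {0..1} F" and mono: "mono_on {0..1} F"
  defines "G \<equiv> \<lambda>x. F (clampi 0 1 x)"
  shows "mono G" "continuous_on UNIV G" "absolutely_continuous lborel (interval_measure G)"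
proof -
  let ?M = "interval_measure G"
  have cl: "clampi 0 1 x \<in> {0..1}" for x by (auto simp: clampi_def)
  have clm: "clampi 0 1 x \<le> clampi 0 1 y" if "x \<le> y" for x y using that by (auto simp: clampi_def)
  show mG: "mono G" unfolding G_def
    by (intro monoI mono_onD[OF mono] cl clm)
  show cG: "continuous_on UNIV G" unfolding G_def
    by (rule continuous_on_compose2[OF absolutely_continuous_on_imp_continuous_on[OF ac] continuous_on_clampi])
      (use cl in auto)
  have Icc: "emeasure ?M {a..b} = ennreal (G b - G a)" if "a \<le> b" for a b
    by (rule emeasure_interval_measure_Icc[OF that _ cG]) (use mG monoD in blast)
  have bdd: "emeasure ?M N = 0" if N: "N \<in> null_sets lborel" "N \<subseteq> cbox p q" and pq: "box p q \<noteq> {}" for N p q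
  proof -
    have Nb: "N \<in> sets borel" using N by auto
    have "emeasure ?M N \<le> ennreal e" if "e > 0" for e
    proof -
      obtain d where d: "d > 0" "ac_mod {0..1} F e d"
        using ac \<open>e > 0\<close> unfolding absolutely_continuous_on_iff_ac_mod by meson
      obtain U where U: "open U" "N \<subseteq> U" "emeasure lborel (U - N) < ennreal d"
        using outer_regular_lborel[OF Nb d(1)] by blast
      have Ud: "emeasure lborel U < ennreal d"
        using U emeasure_Un_null_set[of "U - N" lborel N] N Nb by (simp add: Un_absorb2 sup.absorb1)
      \<comment> \<open>Every interval of the covering lies in the gauge set of one of its points in
        \<open>N\<close>, and at points of \<open>N\<close> the gauge set is
        \<open>U\<close>.\<close>
      have "gauge (\<lambda>x. if x \<in> U then U else UNIV)" using U by (auto simp: gauge_def)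
      from covering_lemma[OF N(2) pq this] obtain D where D: "countable D" "\<Union>D \<subseteq> cbox p q"
        "\<And>K. K \<in> D \<Longrightarrow> interior K \<noteq> {} \<and> (\<exists>c d. K = cbox c d)"
        "pairwise (\<lambda>A B. interior A \<inter> interior B = {}) D"
        "\<And>K. K \<in> D \<Longrightarrow> \<exists>x\<in>N \<inter> K. K \<subseteq> (if x \<in> U then U else UNIV)"
        "N \<subseteq> \<Union>D"
        by metis
      have "\<exists>l r. l < r \<and> K = {l..r} \<and> K \<subseteq> U" if KD: "K \<in> D" for K
      proof -
        obtain c d where K: "K = {c..d}" "interior K \<noteq> {}" using D(3)[OF KD] by (auto simp: cbox_interval)
        then have "c < d" by (simp add: interior_atLeastAtMost_real)
        moreover have "K \<subseteq> U" using D(5)[OF that] U(2) by (auto split: if_splits)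
        ultimately show ?thesis using K by blast
      qed
      then obtain l r where lr: "\<And>K. K \<in> D \<Longrightarrow> l K < r K" "\<And>K. K \<in> D \<Longrightarrow> K = {l K..r K}"
        "\<And>K. K \<in> D \<Longrightarrow> K \<subseteq> U" by metis
      have fin: "emeasure ?M (\<Union>E) \<le> ennreal e" if E: "finite E" "E \<subseteq> D" for E
      proof -
        have disj: "{l K<..<r K} \<inter> {l K'<..<r K'} = {}" if "K \<in> E" "K' \<in> E" "K \<noteq> K'" for K K'
        proof -
          have "K \<in> D" "K' \<in> D" using that E by auto
          then show ?thesis
            using pairwiseD[OF D(4), of K K'] that lr(2)[of K] lr(2)[of K'] interior_atLeastAtMost_real by metis
        qed
        have "ennreal (\<Sum>K\<in>E. r K - l K) = (\<Sum>K\<in>E. emeasure lborel {l K<..<r K})"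
        proof -
          have "(\<Sum>K\<in>E. emeasure lborel {l K<..<r K}) = (\<Sum>K\<in>E. ennreal (r K - l K))"
            by (intro sum.cong refl emeasure_lborel_Ioo) (use lr(1) E(2) in \<open>fastforce intro: less_imp_le\<close>)
          also have "\<dots> = ennreal (\<Sum>K\<in>E. r K - l K)"
            by (rule sum_ennreal) (use lr(1) E(2) in \<open>fastforce intro: less_imp_le\<close>)
          finally show ?thesis ..
        qed
        also have "\<dots> = emeasure lborel (\<Union>K\<in>E. {l K<..<r K})"
          by (rule sum_emeasure) (use disj E in \<open>auto simp: disjoint_family_on_def\<close>)
        also have "\<dots> \<le> emeasure lborel U"
        proof (rule emeasure_mono)
          show "(\<Union>K\<in>E. {l K<..<r K}) \<subseteq> U"
          proof
            fix t assume "t \<in> (\<Union>K\<in>E. {l K<..<r K})"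
            then obtain K where K: "K \<in> D" "l K < t" "t < r K" using E by auto
            then show "t \<in> U" using lr(2,3)[OF K(1)] by (auto simp: subset_eq)
          qed
        qed (use U in auto)
        also note Ud
        finally have len: "(\<Sum>K\<in>E. r K - l K) < d"
          using \<open>d > 0\<close> by (simp add: ennreal_less_iff sum_nonneg lr less_imp_le subsetD[OF E(2)])
        \<comment> \<open>Covering intervals may stick out of \<open>[0,1]\<close>. \<open>G\<close>
          is constant there, and clamping keeps the interiors disjoint without lengthening the
          intervals.\<close>
        have "(\<Sum>K\<in>E. \<bar>F (clampi 0 1 (r K)) - F (clampi 0 1 (l K))\<bar>) < e"
        proof (rule ac_modD[OF d(2) E(1)])
          show "clampi 0 1 (l K) \<le> clampi 0 1 (r K)" if "K \<in> E" for K
            using lr(1)[of K] that E by (intro clm) auto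
          show "{clampi 0 1 (l K)..clampi 0 1 (r K)} \<subseteq> {0..1}" for K
            using cl[of "l K"] cl[of "r K"] by auto
          have sub: "{clampi 0 1 a<..<clampi 0 1 b} \<subseteq> {a<..<b}" for a b by (auto simp: clampi_def split: if_splits)
          show "{clampi 0 1 (l K)<..<clampi 0 1 (r K)} \<inter> {clampi 0 1 (l K')<..<clampi 0 1 (r K')} = {}"
            if "K \<in> E" "K' \<in> E" "K \<noteq> K'" for K K'
            using disj[OF that] sub by blast
          have "(\<Sum>K\<in>E. clampi 0 1 (r K) - clampi 0 1 (l K)) \<le> (\<Sum>K\<in>E. r K - l K)"
          proof (rule sum_mono)
            fix K assume "K \<in> E"
            then show "clampi 0 1 (r K) - clampi 0 1 (l K) \<le> r K - l K"
              using lr(1)[of K] E by (auto simp: clampi_def)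
          qed
          then show "(\<Sum>K\<in>E. clampi 0 1 (r K) - clampi 0 1 (l K)) < d" using len by linarith
        qed
        moreover have "(\<Sum>K\<in>E. G (r K) - G (l K)) \<le> (\<Sum>K\<in>E. \<bar>F (clampi 0 1 (r K)) - F (clampi 0 1 (l K))\<bar>)"
          by (rule sum_mono) (simp add: G_def)
        ultimately have s: "(\<Sum>K\<in>E. G (r K) - G (l K)) < e" by linarith
        have "emeasure ?M (\<Union>E) = emeasure ?M (\<Union>K\<in>E. {l K..r K})"
          using lr(2) E by (intro arg_cong[where f="emeasure ?M"]) auto
        also have "\<dots> \<le> (\<Sum>K\<in>E. emeasure ?M {l K..r K})"
          by (rule emeasure_subadditive_finite) (use E in auto)
        also have "\<dots> = (\<Sum>K\<in>E. ennreal (G (r K) - G (l K)))"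
          by (intro sum.cong refl Icc less_imp_le lr(1)) (use E in auto)
        also have "\<dots> = ennreal (\<Sum>K\<in>E. G (r K) - G (l K))"
          by (rule sum_ennreal) (simp add: monoD[OF mG] less_imp_le[OF lr(1)] subsetD[OF E(2)])
        also have "\<dots> \<le> ennreal e" using s by (intro ennreal_leI) simp
        finally show ?thesis .
      qed
      have Db: "K \<in> sets borel" if "K \<in> D" for K using lr(2)[OF that] by (metis borel_closed closed_atLeastAtMost)
      have "emeasure ?M (\<Union>D) \<le> ennreal e"
      proof (cases "D = {}")
        case False
        define A where "A = (\<lambda>n. \<Union>(from_nat_into D ` {..<n}))"
        have inD: "from_nat_into D i \<in> D" for i using False by (rule from_nat_into)
        have Ae: "emeasure ?M (A n) \<le> ennreal e" for n
          unfolding A_def by (rule fin) (use inD in auto)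
        have "(\<lambda>n. emeasure ?M (A n)) \<longlonglongrightarrow> emeasure ?M (\<Union>n. A n)"
          proof (rule Lim_emeasure_incseq)
            show "range A \<subseteq> sets ?M" unfolding A_def using Db inD by (auto intro!: sets.finite_Union)
            show "incseq A" unfolding A_def incseq_def by (auto intro: less_le_trans)
          qed
        moreover have "(\<Union>n. A n) = \<Union>D"
        proof -
          have "(\<Union>n. A n) = \<Union>(range (from_nat_into D))" unfolding A_def by auto
          then show ?thesis using range_from_nat_into[OF False D(1)] by simp
        qed
        ultimately show ?thesis using Ae by (metis LIMSEQ_le_const2)
      qed simp
      moreover have "\<Union>D \<in> sets borel" using D(1) Db by (intro sets.countable_Union) auto
      ultimately show ?thesis using emeasure_mono[OF D(6), of ?M] order_trans by fastforce
    qed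
    then have "emeasure ?M N \<le> 0 + ennreal e" if "e > 0" for e using that by simp
    then show ?thesis using ennreal_le_epsilon[of 0 "emeasure ?M N"] by simp
  qed
  show "absolutely_continuous lborel ?M"
    unfolding absolutely_continuous_def
  proof
    fix N :: "real set" assume N: "N \<in> null_sets lborel"
    have Nn: "N \<inter> cbox (- real (Suc n)) (real (Suc n)) \<in> null_sets ?M" for n
    proof -
      have "N \<inter> cbox (- real (Suc n)) (real (Suc n)) \<in> null_sets lborel" using N by (auto intro: null_set_Int2)
      then show ?thesis using bdd[of "N \<inter> cbox (- real (Suc n)) (real (Suc n))" "- real (Suc n)" "real (Suc n)"]
        by (auto simp: null_sets_def)
    qed
    have "N = (\<Union>n. N \<inter> cbox (- real (Suc n)) (real (Suc n)))"
    proof -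
      have "\<exists>n. x \<in> cbox (- real (Suc n)) (real (Suc n))" for x
      proof -
        obtain n where "\<bar>x\<bar> \<le> real n" using real_arch_simple by blast
        then show ?thesis by (intro exI[of _ n]) auto
      qed
      then show ?thesis by blast
    qed
    moreover have "(\<Union>n. N \<inter> cbox (- real (Suc n)) (real (Suc n))) \<in> null_sets ?M"
      using Nn by (intro null_sets_UN) auto
    ultimately show "N \<in> null_sets ?M" by simp
  qed
qed

text \<open>The density is the Radon-Nikodym derivative of the Stieltjes measure of
  \<open>F\<close>. It is finite almost everywhere because the measure of \<open>[0,1]\<close> is
  finite, and it is cut off outside so as to be integrable on the line.\<close>

lemma mono_ac_density:
  assumes ac: "absolutely_continuous_on {0..1} F" and mono: "mono_on {0..1} F"
  obtains u :: "real \<Rightarrow> real" where "integrable lborel u" "\<And>t. t \<notin> {0..1} \<Longrightarrow> u t = 0"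
    "\<And>a b. 0 \<le> a \<Longrightarrow> a \<le> b \<Longrightarrow> b \<le> 1 \<Longrightarrow> F b - F a = (LINT t:{a..b}|lborel. u t)"
proof -
  define G where "G = (\<lambda>x. F (clampi 0 1 x))"
  note G = ac_interval_measure_null[OF ac mono, folded G_def]
  obtain v where v[measurable]: "v \<in> borel_measurable lborel" and vd: "density lborel v = interval_measure G"
    using sigma_finite_measure.Radon_Nikodym[OF sigma_finite_lborel G(3)] by auto
  have Icc: "(\<integral>\<^sup>+t. v t * indicator {a..b} t \<partial>lborel) = ennreal (F b - F a)" if "0 \<le> a" "a \<le> b" "b \<le> 1" for a b
  proof -
    have "(\<integral>\<^sup>+t. v t * indicator {a..b} t \<partial>lborel) = emeasure (density lborel v) {a..b}"
      by (simp add: emeasure_density)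
    also have "\<dots> = ennreal (G b - G a)"
      unfolding vd by (rule emeasure_interval_measure_Icc) (use that G monoD in auto)
    finally show ?thesis using that by (simp add: G_def clampi_def)
  qed
  define u where "u = (\<lambda>t. enn2real (v t * indicator {0..1} t))"
  have um[measurable]: "u \<in> borel_measurable lborel" unfolding u_def by measurable
  have "AE t in lborel. v t * indicator {0..1} t \<noteq> \<infinity>"
    by (rule nn_integral_PInf_AE) (use Icc[of 0 1] in \<open>auto simp: top_unique\<close>)
  then have eq: "AE t in lborel. ennreal (u t) = v t * indicator {0..1} t"
    by eventually_elim (auto simp: u_def less_top)
  have u0: "u t \<ge> 0" for t by (simp add: u_def)
  have int: "integrable lborel u"
    unfolding real_integrable_def
  proof (intro conjI)
    have "(\<integral>\<^sup>+t. ennreal (u t) \<partial>lborel) = (\<integral>\<^sup>+t. v t * indicator {0..1} t \<partial>lborel)"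
      by (rule nn_integral_cong_AE[OF eq])
    then show "(\<integral>\<^sup>+t. ennreal (u t) \<partial>lborel) \<noteq> \<infinity>" using Icc[of 0 1] by simp
    show "(\<integral>\<^sup>+t. ennreal (- u t) \<partial>lborel) \<noteq> \<infinity>" using u0 by (simp add: ennreal_neg)
  qed simp
  show ?thesis
  proof (rule that[OF int])
    show "u t = 0" if "t \<notin> {0..1}" for t using that by (simp add: u_def)
    fix a b :: real assume ab: "0 \<le> a" "a \<le> b" "b \<le> 1"
    have "ennreal (LINT t:{a..b}|lborel. u t) = (\<integral>\<^sup>+t. ennreal (indicator {a..b} t * u t) \<partial>lborel)"
      unfolding set_lebesgue_integral_def
      by (subst nn_integral_eq_integral) (use integrable_mult_indicator[OF _ int, of "{a..b}"] u0 in auto)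
    also have "\<dots> = (\<integral>\<^sup>+t. v t * indicator {a..b} t \<partial>lborel)"
      by (rule nn_integral_cong_AE) (rule AE_mp[OF eq], rule AE_I2, use ab in \<open>auto simp: indicator_def\<close>)
    also have "\<dots> = ennreal (F b - F a)" using Icc ab by blast
    finally have "ennreal (LINT t:{a..b}|lborel. u t) = ennreal (F b - F a)" .
    moreover have "F b - F a \<ge> 0" using mono_onD[OF mono, of a b] ab by auto
    moreover have "(LINT t:{a..b}|lborel. u t) \<ge> 0"
      unfolding set_lebesgue_integral_def by (rule integral_nonneg_AE) (use u0 in auto)
    ultimately show "F b - F a = (LINT t:{a..b}|lborel. u t)" by simp
  qed
qed

text \<open>Averages over intervals to the right of a point converge outside a null set. Averages to
  the left are averages to the right of the reflected function, with a reflected exceptional set;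
  together they give the derivative within \<open>[0,1]\<close>.\<close>

lemma lebesgue_differentiation:
  fixes u :: "real \<Rightarrow> real"
  assumes int: "integrable lborel u"
    and f: "\<And>a b. 0 \<le> a \<Longrightarrow> a \<le> b \<Longrightarrow> b \<le> 1 \<Longrightarrow> f b - f a = (LINT t:{a..b}|lborel. u t)"
  shows "AE x in lebesgue. x \<in> {0..1} \<longrightarrow> (f has_vector_derivative u x) (at x within {0..1})"
proof -
  have io: "u integrable_on cbox a b" for a b
    using int integrable_on_lborel integrable_on_subcbox by blast
  have fI: "f b - f a = integral {a..b} u" if "0 \<le> a" "a \<le> b" "b \<le> 1" for a b
  proof -
    have "set_integrable lborel {a..b} u"
      unfolding set_integrable_def by (rule integrable_mult_indicator[OF _ int]) auto
    then show ?thesis using f[OF that] set_borel_integral_eq_integral(2) by simp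
  qed
  obtain N1 where N1: "negligible N1"
    "\<And>x e. x \<notin> N1 \<Longrightarrow> 0 < e \<Longrightarrow> \<exists>d>0. \<forall>h. 0 < h \<and> h < d \<longrightarrow>
       norm (integral (cbox x (x + h *\<^sub>R One)) u /\<^sub>R h ^ DIM(real) - u x) < e"
    using integrable_ccontinuous_explicit[OF io] by metis
  have "(\<lambda>t. u (- t)) integrable_on cbox a b" for a b
    using io[of "- b" "- a"] integrable_reflect[of u "-a" "-b"] by simp
  from integrable_ccontinuous_explicit[OF this]
  obtain N2 where N2: "negligible N2"
    "\<And>x e. x \<notin> N2 \<Longrightarrow> 0 < e \<Longrightarrow> \<exists>d>0. \<forall>h. 0 < h \<and> h < d \<longrightarrow>
       norm (integral (cbox x (x + h *\<^sub>R One)) (\<lambda>t. u (- t)) /\<^sub>R h ^ DIM(real) - u (- x)) < e"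
    by metis
  have "negligible (uminus ` N2)"
    by (rule negligible_differentiable_image_negligible[OF order_refl N2(1)])
      (intro derivative_intros differentiable_on_id[unfolded id_def] | simp add: differentiable_on_def)+
  then have "negligible (N1 \<union> uminus ` N2)" using N1 by simp
  then have "N1 \<union> uminus ` N2 \<in> null_sets lebesgue" by (simp add: negligible_iff_null_sets)
  then have "AE x in lebesgue. x \<notin> N1 \<union> uminus ` N2" by (rule AE_not_in)
  then show ?thesis
  proof eventually_elim
    fix x assume x: "x \<notin> N1 \<union> uminus ` N2"
    have x1: "x \<notin> N1" and x2: "- x \<notin> N2" using x by (auto simp: image_iff)
    show "x \<in> {0..1} \<longrightarrow> (f has_vector_derivative u x) (at x within {0..1})"
    proof
      assume x01: "x \<in> {0..1}"
      have "((\<lambda>y. (f y - f x) / (y - x)) \<longlongrightarrow> u x) (at x within {0..1})"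
        unfolding Lim_within
      proof (intro allI impI)
        fix e :: real assume "e > 0"
        obtain d1 where d1: "d1 > 0" "\<And>h. 0 < h \<Longrightarrow> h < d1 \<Longrightarrow> \<bar>integral {x..x+h} u / h - u x\<bar> < e"
          using N1(2)[OF x1 \<open>e > 0\<close>] by (auto simp: cbox_interval divide_inverse mult.commute)
        obtain d2 where d2: "d2 > 0" "\<And>h. 0 < h \<Longrightarrow> h < d2 \<Longrightarrow> \<bar>integral {-x..-x+h} (\<lambda>t. u (- t)) / h - u x\<bar> < e"
          using N2(2)[OF x2 \<open>e > 0\<close>] by (auto simp: cbox_interval divide_inverse mult.commute)
        have refl: "integral {-x..-x+h} (\<lambda>t. u (- t)) = integral {x-h..x} u" for h
          using integral_reflect[of x "x - h" u] by (simp add: cbox_interval)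
        have "dist ((f y - f x) / (y - x)) (u x) < e"
          if y: "y \<in> {0..1}" "0 < dist y x" "dist y x < min d1 d2" for y
        proof (cases "y > x")
          case True
          then show ?thesis using d1(2)[of "y - x"] y x01 fI[of x y] by (simp add: dist_real_def)
        next
          case False
          then have yx: "y < x" using y by auto
          have "(f y - f x) / (y - x) = integral {y..x} u / (x - y)"
            using fI[of y x] yx y x01 by (simp add: field_simps)
          then show ?thesis using d2(2)[of "x - y"] refl[of "x - y"] yx y by (simp add: dist_real_def)
        qed
        then show "\<exists>d>0. \<forall>y\<in>{0..1}. 0 < dist y x \<and> dist y x < d \<longrightarrow> dist ((f y - f x) / (y - x)) (u x) < e"
          using d1(1) d2(1) by (intro exI[of _ "min d1 d2"]) auto
      qed
      then show "(f has_vector_derivative u x) (at x within {0..1})"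
        by (simp add: has_real_derivative_iff_has_vector_derivative[symmetric] has_field_derivative_iff)
    qed
  qed
qed

text \<open>Since \<open>deriv2_01\<close> is unspecified wherever \<open>deriv01 g\<close> is not differentiable, an almost everywhere
  derivative is needed, not just a density.\<close>

lemma ac_ftc:
  assumes ac: "absolutely_continuous_on {0..1} f"
  obtains u :: "real \<Rightarrow> real" where "integrable lborel u" "\<And>t. t \<notin> {0..1} \<Longrightarrow> u t = 0"
    "\<And>a b. 0 \<le> a \<Longrightarrow> a \<le> b \<Longrightarrow> b \<le> 1 \<Longrightarrow> f b - f a = (LINT t:{a..b}|lborel. u t)"
    "AE x in lebesgue. x \<in> {0..1} \<longrightarrow> (f has_vector_derivative u x) (at x within {0..1})"
proof -
  obtain V where V: "absolutely_continuous_on {0..1} V"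
    "\<And>x y. 0 \<le> x \<Longrightarrow> x \<le> y \<Longrightarrow> y \<le> 1 \<Longrightarrow> \<bar>f y - f x\<bar> \<le> V y - V x"
    using ac_variation[OF ac] by blast
  \<comment> \<open>Jordan decomposition: \<open>f\<close> is the difference of the increasing
    absolutely continuous functions \<open>V + f\<close> and \<open>V\<close>.\<close>
  have m: "mono_on {0..1} V" "mono_on {0..1} (\<lambda>x. V x + f x)"
  proof -
    have "V x \<le> V y \<and> V x + f x \<le> V y + f y" if "0 \<le> x" "x \<le> y" "y \<le> 1" for x y
      using V(2)[OF that] by linarith
    then show "mono_on {0..1} V" "mono_on {0..1} (\<lambda>x. V x + f x)" by (auto intro!: mono_onI)
  qed
  obtain u1 where u1: "integrable lborel u1" "\<And>t. t \<notin> {0..1} \<Longrightarrow> u1 t = 0"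
    "\<And>a b. 0 \<le> a \<Longrightarrow> a \<le> b \<Longrightarrow> b \<le> 1 \<Longrightarrow> V b - V a = (LINT t:{a..b}|lborel. u1 t)"
    using mono_ac_density[OF V(1) m(1)] by metis
  obtain u2 where u2: "integrable lborel u2" "\<And>t. t \<notin> {0..1} \<Longrightarrow> u2 t = 0"
    "\<And>a b. 0 \<le> a \<Longrightarrow> a \<le> b \<Longrightarrow> b \<le> 1 \<Longrightarrow> (V b + f b) - (V a + f a) = (LINT t:{a..b}|lborel. u2 t)"
    using mono_ac_density[OF absolutely_continuous_on_add[OF V(1) ac] m(2)] by metis
  have si: "set_integrable lborel {a..b} u1" "set_integrable lborel {a..b} u2" for a b
    unfolding set_integrable_def by (rule integrable_mult_indicator; use u1(1) u2(1) in simp)+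
  have int: "integrable lborel (\<lambda>t. u2 t - u1 t)" using u1 u2 by auto
  have rep: "f b - f a = (LINT t:{a..b}|lborel. u2 t - u1 t)" if "0 \<le> a" "a \<le> b" "b \<le> 1" for a b
    using u1(3)[OF that] u2(3)[OF that] set_integral_diff(2)[OF si(2,1)] by simp
  show ?thesis
    by (rule that[OF int _ rep lebesgue_differentiation[OF int rep]]) (use u1 u2 in auto)
qed

section \<open>Positive semidefinite forms\<close>

text \<open>The carriers below are sets of raw functions, to be identified almost everywhere or even
  up to affine parts, so the forms are only semidefinite. One proof of the Cauchy-Schwarz and
  triangle inequalities serves all four of them.\<close>

locale psd_form =
  fixes V :: "('x \<Rightarrow> 'y::real_vector) set" and ip :: "('x \<Rightarrow> 'y) \<Rightarrow> ('x \<Rightarrow> 'y) \<Rightarrow> real"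
  assumes add_mem: "f \<in> V \<Longrightarrow> g \<in> V \<Longrightarrow> (\<lambda>x. f x + g x) \<in> V"
    and scale_mem: "f \<in> V \<Longrightarrow> (\<lambda>x. c *\<^sub>R f x) \<in> V"
    and sym: "f \<in> V \<Longrightarrow> g \<in> V \<Longrightarrow> ip f g = ip g f"
    and ip_add: "f \<in> V \<Longrightarrow> g \<in> V \<Longrightarrow> h \<in> V \<Longrightarrow> ip (\<lambda>x. f x + g x) h = ip f h + ip g h"
    and ip_scale: "f \<in> V \<Longrightarrow> h \<in> V \<Longrightarrow> ip (\<lambda>x. c *\<^sub>R f x) h = c * ip f h"
    and nonneg: "f \<in> V \<Longrightarrow> 0 \<le> ip f f"
begin

definition nrm :: "('x \<Rightarrow> 'y) \<Rightarrow> real" where "nrm f = sqrt (ip f f)"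

lemma ip_add': "f \<in> V \<Longrightarrow> g \<in> V \<Longrightarrow> h \<in> V \<Longrightarrow> ip h (\<lambda>x. f x + g x) = ip h f + ip h g"
  using ip_add[of f g h] sym[of h f] sym[of h g] sym[of h "\<lambda>x. f x + g x"] add_mem[of f g] by presburger

lemma ip_scale': "f \<in> V \<Longrightarrow> h \<in> V \<Longrightarrow> ip h (\<lambda>x. c *\<^sub>R f x) = c * ip h f"
  using ip_scale[of f h c] sym[of h f] sym[of h "\<lambda>x. c *\<^sub>R f x"] scale_mem[of f c] by presburger

lemma diff_mem: "f \<in> V \<Longrightarrow> g \<in> V \<Longrightarrow> (\<lambda>x. f x - g x) \<in> V"
  using add_mem[OF _ scale_mem[of g "-1"], of f] by simp

lemma ip_diff: "f \<in> V \<Longrightarrow> g \<in> V \<Longrightarrow> h \<in> V \<Longrightarrow> ip (\<lambda>x. f x - g x) h = ip f h - ip g h"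
  using ip_add[OF _ scale_mem[of g "-1"], of f h] ip_scale[of g h "-1"] by simp

lemma ip_diff': "f \<in> V \<Longrightarrow> g \<in> V \<Longrightarrow> h \<in> V \<Longrightarrow> ip h (\<lambda>x. f x - g x) = ip h f - ip h g"
  using ip_diff[of f g h] sym[of h f] sym[of h g] sym[of h "\<lambda>x. f x - g x"] diff_mem[of f g] by presburger

lemma expand_add:
  "f \<in> V \<Longrightarrow> g \<in> V \<Longrightarrow> ip (\<lambda>x. f x + s *\<^sub>R g x) (\<lambda>x. f x + s *\<^sub>R g x) = ip f f + 2 * s * ip f g + s\<^sup>2 * ip g g"
  using sym[of g f]
  by (simp add: ip_add ip_add' ip_scale ip_scale' add_mem scale_mem) (simp add: power2_eq_square algebra_simps)

lemma expand_diff: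
  assumes "f \<in> V" "g \<in> V"
  shows "ip (\<lambda>x. f x - g x) (\<lambda>x. f x - g x) = ip f f - 2 * ip f g + ip g g"
  using expand_add[OF assms, of "-1"] by simp

lemma cauchy_schwarz_sq:
  assumes "f \<in> V" "g \<in> V" shows "(ip f g)\<^sup>2 \<le> ip f f * ip g g"
proof -
  have q: "0 \<le> ip f f + 2 * s * ip f g + s\<^sup>2 * ip g g" for s
    using nonneg[OF add_mem[OF assms(1) scale_mem[OF assms(2)]], of s] expand_add[OF assms] by simp
  show ?thesis
  proof (cases "ip g g = 0")
    case True
    have "ip f g = 0"
    proof (rule ccontr)
      assume "ip f g \<noteq> 0"
      \<comment> \<open>At this \<open>s\<close> the quadratic takes the value -1.\<close>
      then show False using q[of "- (ip f f + 1) / (2 * ip f g)"] True by (simp add: field_simps)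
    qed
    then show ?thesis using True by simp
  next
    case False
    then have p: "ip g g > 0" using nonneg[OF assms(2)] by simp
    have "0 \<le> ip f f - (ip f g)\<^sup>2 / ip g g"
      using q[of "- ip f g / ip g g"] p by (simp add: field_simps power2_eq_square)
    then show ?thesis using p by (simp add: field_simps)
  qed
qed

lemma nrm_nonneg: "f \<in> V \<Longrightarrow> 0 \<le> nrm f" unfolding nrm_def using nonneg by simp

lemma nrm_sq: "f \<in> V \<Longrightarrow> (nrm f)\<^sup>2 = ip f f" unfolding nrm_def using nonneg by simp

lemma cauchy_schwarz:
  assumes "f \<in> V" "g \<in> V" shows "\<bar>ip f g\<bar> \<le> nrm f * nrm g"
  unfolding nrm_def real_sqrt_mult[symmetric]
  using real_sqrt_le_mono[OF cauchy_schwarz_sq[OF assms]] by simp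

lemma nrm_add: assumes "f \<in> V" "g \<in> V" shows "nrm (\<lambda>x. f x + g x) \<le> nrm f + nrm g"
proof (rule power2_le_imp_le)
  show "(nrm (\<lambda>x. f x + g x))\<^sup>2 \<le> (nrm f + nrm g)\<^sup>2"
    using expand_add[OF assms, of 1] cauchy_schwarz[OF assms] nrm_sq[OF assms(1)] nrm_sq[OF assms(2)]
      nrm_sq[OF add_mem[OF assms]]
    by (simp add: power2_sum)
qed (use assms nrm_nonneg in auto)

lemma nrm_scale: "f \<in> V \<Longrightarrow> nrm (\<lambda>x. c *\<^sub>R f x) = \<bar>c\<bar> * nrm f"
proof -
  assume f: "f \<in> V"
  have "ip (\<lambda>x. c *\<^sub>R f x) (\<lambda>x. c *\<^sub>R f x) = c\<^sup>2 * ip f f"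
    using ip_scale[OF f scale_mem[OF f], of c c] ip_scale'[OF f f, of c] by (simp add: power2_eq_square)
  then show ?thesis unfolding nrm_def by (simp add: real_sqrt_mult)
qed

lemma nrm_diff: assumes "f \<in> V" "g \<in> V" shows "nrm (\<lambda>x. f x - g x) \<le> nrm f + nrm g"
  using nrm_add[OF assms(1) scale_mem[OF assms(2)], of "-1"] nrm_scale[OF assms(2), of "-1"] by simp

lemma nrm_triangle_diff: assumes "f \<in> V" "g \<in> V" shows "nrm f \<le> nrm g + nrm (\<lambda>x. f x - g x)"
proof -
  have "(\<lambda>x. g x + (f x - g x)) = f" by auto
  then show ?thesis using nrm_add[OF assms(2) diff_mem[OF assms]] by simp
qed

end

definition l2 :: "'a measure \<Rightarrow> ('a \<Rightarrow> real) set" where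
  "l2 M = {f \<in> borel_measurable M. integrable M (\<lambda>x. (f x)\<^sup>2)}"

lemma l2_mult_integrable:
  assumes "f \<in> l2 M" "g \<in> l2 M" shows "integrable M (\<lambda>x. f x * g x)"
proof (rule Bochner_Integration.integrable_bound)
  show "integrable M (\<lambda>x. (f x)\<^sup>2 + (g x)\<^sup>2)" using assms by (simp add: l2_def)
  show "(\<lambda>x. f x * g x) \<in> borel_measurable M"
    using assms by (intro borel_measurable_times) (auto simp: l2_def)
  show "AE x in M. norm (f x * g x) \<le> norm ((f x)\<^sup>2 + (g x)\<^sup>2)"
  proof (rule AE_I2)
    fix x
    have "2 * \<bar>f x * g x\<bar> \<le> (f x)\<^sup>2 + (g x)\<^sup>2"
      using sum_squares_bound[of "\<bar>f x\<bar>" "\<bar>g x\<bar>"] by (simp add: abs_mult)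
    then show "norm (f x * g x) \<le> norm ((f x)\<^sup>2 + (g x)\<^sup>2)" by simp
  qed
qed

interpretation l2: psd_form "l2 M" "\<lambda>f g. \<integral>x. f x * g x \<partial>M" for M :: "'a measure"
proof
  fix f g h :: "'a \<Rightarrow> real" and c :: real
  assume f: "f \<in> l2 M"
  show "(\<lambda>x. c *\<^sub>R f x) \<in> l2 M" using f by (auto simp: l2_def power_mult_distrib)
  show "0 \<le> (\<integral>x. f x * f x \<partial>M)" by (rule integral_nonneg_AE) simp
  { assume h: "h \<in> l2 M"
    show "(\<integral>x. (c *\<^sub>R f x) * h x \<partial>M) = c * (\<integral>x. f x * h x \<partial>M)" by (simp add: mult.assoc) }
  assume g: "g \<in> l2 M"
  show "(\<lambda>x. f x + g x) \<in> l2 M"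
    using f g l2_mult_integrable[OF f g] by (auto simp: l2_def power2_sum mult.assoc)
  show "(\<integral>x. f x * g x \<partial>M) = (\<integral>x. g x * f x \<partial>M)" by (simp add: mult.commute)
  assume h: "h \<in> l2 M"
  show "(\<integral>x. (f x + g x) * h x \<partial>M) = (\<integral>x. f x * h x \<partial>M) + (\<integral>x. g x * h x \<partial>M)"
    using l2_mult_integrable[OF f h] l2_mult_integrable[OF g h] by (simp add: distrib_right)
qed

lemma l2_indicator_Icc: "(\<lambda>t. indicator {a..b::real} t) \<in> l2 lborel"
proof -
  have "(\<lambda>x. (indicator {a..b} x)\<^sup>2 :: real) = indicator {a..b}"
    by (auto simp: indicator_def fun_eq_iff)
  then show ?thesis by (auto simp: l2_def simp del: indicator_simps intro!: integrable_real_indicator simp: emeasure_lborel_Icc_eq)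
qed

text \<open>Cauchy-Schwarz against the indicator of \<open>[a,b]\<close>, whose squared norm is
  \<open>b - a\<close>.\<close>

lemma set_integral_sq_le:
  assumes "u \<in> l2 lborel" "a \<le> b"
  shows "(LINT t:{a..b}|lborel. u t)\<^sup>2 \<le> (b - a) * (LINT t:{a..b}|lborel. (u t)\<^sup>2)"
proof -
  have ui: "(\<lambda>t. indicator {a..b} t * u t) \<in> l2 lborel"
  proof -
    have "integrable lborel (\<lambda>t. indicator {a..b} t *\<^sub>R (u t)\<^sup>2)"
      using assms by (intro integrable_mult_indicator) (auto simp: l2_def)
    moreover have "indicator {a..b} t *\<^sub>R (u t)\<^sup>2 = (indicator {a..b} t * u t)\<^sup>2" for t
      by (auto simp: indicator_def)
    ultimately have "integrable lborel (\<lambda>t. (indicator {a..b} t * u t)\<^sup>2)" by simp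
    moreover have "(\<lambda>t. indicator {a..b} t * u t) \<in> borel_measurable lborel"
      using assms by (intro borel_measurable_times borel_measurable_indicator) (auto simp: l2_def)
    ultimately show ?thesis unfolding l2_def by blast
  qed
  have e: "indicator {a..b} t * (indicator {a..b} t * u t) = indicator {a..b} t * u t"
    "indicator {a..b} t * indicator {a..b} t = (indicator {a..b} t :: real)"
    "indicator {a..b} t * u t * (indicator {a..b} t * u t) = indicator {a..b} t * (u t)\<^sup>2" for t
    by (auto simp: indicator_def power2_eq_square)
  show ?thesis
    using l2.cauchy_schwarz_sq[OF l2_indicator_Icc[of a b] ui] assms(2)
    unfolding set_lebesgue_integral_def real_scaleR_def e by simp
qed

section \<open>The Sobolev space on the unit interval\<close>

text \<open>The choice in \<open>vector_derivative\<close> is harmless on a nondegenerate interval: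
  derivatives within \<open>[0,1]\<close> are unique, also the one-sided ones at the end
  points.\<close>

lemma vector_derivative_01:
  assumes "(f has_vector_derivative d) (at x within {0..1})" "x \<in> {0..1}"
  shows "deriv01 f x = d"
  unfolding deriv01_def
  using vector_derivative_within_cbox[OF _ _ assms(1)[folded cbox_interval]] assms by (simp add: cbox_interval)

lemma has_deriv01:
  assumes "f differentiable_on {0..1}" "x \<in> {0..1}"
  shows "(f has_vector_derivative deriv01 f x) (at x within {0..1})"
  using assms unfolding deriv01_def differentiable_on_def vector_derivative_works by blast

lemma deriv01_cong:
  assumes "\<And>x. x \<in> {0..1} \<Longrightarrow> f x = g x" "x \<in> {0..1}"
  shows "deriv01 f x = deriv01 g x"
proof -
  have "(f has_vector_derivative d) (at x within {0..1}) = (g has_vector_derivative d) (at x within {0..1})" for d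
    by (rule has_vector_derivative_cong_ev) (use assms in \<open>auto intro!: always_eventually\<close>)
  then show ?thesis unfolding deriv01_def vector_derivative_def by simp
qed

lemma deriv01_lincomb:
  assumes "f differentiable_on {0..1}" "g differentiable_on {0..1}"
  shows "(\<lambda>x. a * f x + b * g x) differentiable_on {0..1}"
    "x \<in> {0..1} \<Longrightarrow> deriv01 (\<lambda>x. a * f x + b * g x) x = a * deriv01 f x + b * deriv01 g x"
proof -
  show "(\<lambda>x. a * f x + b * g x) differentiable_on {0..1}" using assms by (intro derivative_intros)
  assume x: "x \<in> {0..1}"
  show "deriv01 (\<lambda>x. a * f x + b * g x) x = a * deriv01 f x + b * deriv01 g x"
    by (rule vector_derivative_01[OF _ x])
      (use has_deriv01[OF assms(1) x] has_deriv01[OF assms(2) x] in \<open>auto intro!: derivative_eq_intros simp: has_real_derivative_iff_has_vector_derivative[symmetric]\<close>)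
qed

lemma absolutely_continuous_on_cong:
  assumes "\<And>x. x \<in> S \<Longrightarrow> f x = g x" "absolutely_continuous_on S f"
  shows "absolutely_continuous_on S g"
proof -
  have "(\<Sum>(a, b)\<in>D. \<bar>g b - g a\<bar>) = (\<Sum>(a, b)\<in>D. \<bar>f b - f a\<bar>)" if "\<forall>(a, b)\<in>D. a \<le> b \<and> {a..b} \<subseteq> S" for D
  proof (rule sum.cong[OF refl])
    fix p assume "p \<in> D"
    then have "fst p \<in> S" "snd p \<in> S" using that by fastforce+
    then show "(case p of (a, b) \<Rightarrow> \<bar>g b - g a\<bar>) = (case p of (a, b) \<Rightarrow> \<bar>f b - f a\<bar>)"
      using assms(1) by (simp add: case_prod_unfold)
  qed
  then show ?thesis using assms(2) unfolding absolutely_continuous_on_def by (metis (no_types, lifting))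
qed

text \<open>\<open>d2rep g u\<close> says that \<open>g\<close> is in \<open>G_space\<close> and that the Borel function \<open>u\<close>, zero off \<open>[0,1]\<close>,
  is a version of its second derivative.\<close>

definition d2rep :: "(real \<Rightarrow> real) \<Rightarrow> (real \<Rightarrow> real) \<Rightarrow> bool" where
  "d2rep g u \<longleftrightarrow> g differentiable_on {0..1} \<and> absolutely_continuous_on {0..1} (deriv01 g) \<and>
     u \<in> l2 lborel \<and> integrable lborel u \<and> (\<forall>t. t \<notin> {0..1} \<longrightarrow> u t = 0) \<and>
     (\<forall>a b. 0 \<le> a \<longrightarrow> a \<le> b \<longrightarrow> b \<le> 1 \<longrightarrow> deriv01 g b - deriv01 g a = (LINT t:{a..b}|lborel. u t)) \<and>
     (AE x in lebesgue. x \<in> {0..1} \<longrightarrow> (deriv01 g has_vector_derivative u x) (at x within {0..1}))"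

lemma d2rep_AE: "d2rep g u \<Longrightarrow> AE x in lebesgue. x \<in> {0..1} \<longrightarrow> deriv2_01 g x = u x"
proof -
  assume "d2rep g u"
  then have "AE x in lebesgue. x \<in> {0..1} \<longrightarrow> (deriv01 g has_vector_derivative u x) (at x within {0..1})"
    by (simp add: d2rep_def)
  then show ?thesis by eventually_elim (use vector_derivative_01 in blast)
qed

text \<open>The almost everywhere derivative of \<open>deriv01 g\<close> provides \<open>u\<close>.
  Being Borel, it lets square integrability pass from the completed measure to
  \<open>lborel\<close>, where Fubini's theorem is at hand.\<close>

lemma G_space_imp_d2rep:
  assumes "g \<in> G_space" obtains u where "d2rep g u"
proof -
  have g: "g differentiable_on {0..1}" "absolutely_continuous_on {0..1} (deriv01 g)"
    "set_integrable lebesgue {0..1} (\<lambda>t. (deriv2_01 g t)\<^sup>2)"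
    using assms by (auto simp: G_space_def)
  obtain u where u: "integrable lborel u" "\<And>t. t \<notin> {0..1} \<Longrightarrow> u t = 0"
    "\<And>a b. 0 \<le> a \<Longrightarrow> a \<le> b \<Longrightarrow> b \<le> 1 \<Longrightarrow> deriv01 g b - deriv01 g a = (LINT t:{a..b}|lborel. u t)"
    "AE x in lebesgue. x \<in> {0..1} \<longrightarrow> (deriv01 g has_vector_derivative u x) (at x within {0..1})"
    by (rule ac_ftc[OF g(2)]) (rule that)
  have m: "u \<in> borel_measurable lborel" using u(1) by auto
  have "AE x in lebesgue. indicator {0..1} x *\<^sub>R (deriv2_01 g x)\<^sup>2 = (u x)\<^sup>2"
    using u(4) by eventually_elim (use u(2) vector_derivative_01 in \<open>auto simp: indicator_def\<close>)
  then have "integrable lebesgue (\<lambda>x. (u x)\<^sup>2)"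
    using g(3) unfolding set_integrable_def
    by (subst integrable_cong_AE[symmetric, where f="\<lambda>x. indicator {0..1} x *\<^sub>R (deriv2_01 g x)\<^sup>2"])
      (use m in \<open>auto intro: measurable_completion borel_measurable_integrable\<close>)
  then have "u \<in> l2 lborel" using m by (simp add: l2_def integrable_completion)
  then show ?thesis using that g u unfolding d2rep_def by blast
qed

text \<open>Measurability of \<open>deriv2_01 g\<close> is obtained only through its agreement with
  \<open>u\<close> off a null set, which is enough for the completed measure.\<close>

lemma d2rep_imp_G_space:
  assumes "d2rep g u" shows "g \<in> G_space"
proof -
  have m: "u \<in> l2 lborel" and u0: "\<And>t. t \<notin> {0..1} \<Longrightarrow> u t = 0" using assms by (auto simp: d2rep_def)
  have i: "integrable lebesgue (\<lambda>x. (u x)\<^sup>2)" using m by (auto simp: l2_def integrable_completion)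
  have e: "AE x in lebesgue. indicator {0..1} x *\<^sub>R (deriv2_01 g x)\<^sup>2 = (u x)\<^sup>2"
    using d2rep_AE[OF assms] by eventually_elim (use u0 in \<open>auto simp: indicator_def\<close>)
  have "integrable lebesgue (\<lambda>x. indicator {0..1} x *\<^sub>R (deriv2_01 g x)\<^sup>2)"
  proof (rule integrable_cong_AE_imp[OF i])
    show e': "AE x in lebesgue. (u x)\<^sup>2 = indicator {0..1} x *\<^sub>R (deriv2_01 g x)\<^sup>2"
      using e by eventually_elim simp
    show "(\<lambda>x. indicator {0..1} x *\<^sub>R (deriv2_01 g x)\<^sup>2) \<in> borel_measurable lebesgue"
      using borel_measurable_AE[OF borel_measurable_integrable[OF i] e'] .
  qed
  then show ?thesis using assms by (auto simp: G_space_def d2rep_def set_integrable_def)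
qed

text \<open>Reduces the form on pointwise derivatives to an inner product of Borel functions, so
  that its algebraic laws come from \<open>l2\<close>.\<close>

lemma H_inner_d2rep:
  assumes "d2rep g u" "d2rep h v"
  shows "H_inner g h = (\<integral>t. u t * v t \<partial>lborel)"
proof -
  have m: "u \<in> l2 lborel" "v \<in> l2 lborel" and u0: "\<And>t. t \<notin> {0..1} \<Longrightarrow> u t = 0" using assms by (auto simp: d2rep_def)
  have e: "AE x in lebesgue. indicator {0..1} x *\<^sub>R (deriv2_01 g x * deriv2_01 h x) = u x * v x"
    using d2rep_AE[OF assms(1)] d2rep_AE[OF assms(2)]
    by eventually_elim (use u0 in \<open>auto simp: indicator_def\<close>)
  have i: "integrable lebesgue (\<lambda>x. u x * v x)"
    using l2_mult_integrable[OF m] by (simp add: integrable_completion)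
  have "H_inner g h = (\<integral>t. u t * v t \<partial>lebesgue)"
    unfolding H_inner_def set_lebesgue_integral_def
  proof (rule integral_cong_AE[OF _ _ e])
    have "AE x in lebesgue. u x * v x = indicator {0..1} x *\<^sub>R (deriv2_01 g x * deriv2_01 h x)"
      using e by eventually_elim simp
    from borel_measurable_AE[OF borel_measurable_integrable[OF i] this]
    show "(\<lambda>x. indicator {0..1} x *\<^sub>R (deriv2_01 g x * deriv2_01 h x)) \<in> borel_measurable lebesgue" .
  qed (use i in auto)
  also have "\<dots> = (\<integral>t. u t * v t \<partial>lborel)"
    using l2_mult_integrable[OF m] by (intro integral_completion) auto
  finally show ?thesis .
qed

lemma d2rep_lincomb:
  assumes g: "d2rep g u" and h: "d2rep h v"
  shows "d2rep (\<lambda>x. a * g x + b * h x) (\<lambda>x. a * u x + b * v x)"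
proof -
  let ?f = "\<lambda>x. a * g x + b * h x"
  have dg: "g differentiable_on {0..1}" "h differentiable_on {0..1}" using assms by (auto simp: d2rep_def)
  note D = deriv01_lincomb[OF dg]
  have ac: "absolutely_continuous_on {0..1} (deriv01 ?f)"
    by (rule absolutely_continuous_on_cong[OF D(2)[symmetric] absolutely_continuous_on_add[OF absolutely_continuous_on_cmult absolutely_continuous_on_cmult]])
      (use assms in \<open>auto simp: d2rep_def\<close>)
  have l: "u \<in> l2 lborel" "v \<in> l2 lborel" "integrable lborel u" "integrable lborel v"
    using assms by (auto simp: d2rep_def)
  have l2: "(\<lambda>x. a * u x + b * v x) \<in> l2 lborel"
    using l2.add_mem[OF l2.scale_mem l2.scale_mem] l by simp
  have "deriv01 ?f t - deriv01 ?f s = (LINT x:{s..t}|lborel. a * u x + b * v x)" if st: "0 \<le> s" "s \<le> t" "t \<le> 1" for s t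
  proof -
    have "set_integrable lborel {s..t} u" "set_integrable lborel {s..t} v"
      unfolding set_integrable_def by (rule integrable_mult_indicator; use l in simp)+
    then have "(LINT x:{s..t}|lborel. a * u x + b * v x) = a * (LINT x:{s..t}|lborel. u x) + b * (LINT x:{s..t}|lborel. v x)"
      by (simp add: set_integral_add)
    moreover have "deriv01 g t - deriv01 g s = (LINT x:{s..t}|lborel. u x)" "deriv01 h t - deriv01 h s = (LINT x:{s..t}|lborel. v x)"
      using g h st by (auto simp: d2rep_def)
    ultimately show ?thesis using st by (simp add: D(2)) (metis add_diff_add right_diff_distrib)
  qed
  moreover have "AE x in lebesgue. x \<in> {0..1} \<longrightarrow> (deriv01 ?f has_vector_derivative (a * u x + b * v x)) (at x within {0..1})"
  proof -
    have "AE x in lebesgue. x \<in> {0..1} \<longrightarrow> (deriv01 g has_vector_derivative u x) (at x within {0..1})"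
      "AE x in lebesgue. x \<in> {0..1} \<longrightarrow> (deriv01 h has_vector_derivative v x) (at x within {0..1})"
      using g h by (auto simp: d2rep_def)
    then show ?thesis
    proof eventually_elim
      fix x assume x: "x \<in> {0..1} \<longrightarrow> (deriv01 g has_vector_derivative u x) (at x within {0..1})"
        "x \<in> {0..1} \<longrightarrow> (deriv01 h has_vector_derivative v x) (at x within {0..1})"
      show "x \<in> {0..1} \<longrightarrow> (deriv01 ?f has_vector_derivative (a * u x + b * v x)) (at x within {0..1})"
      proof
        assume x1: "x \<in> {0..1}"
        have "((\<lambda>x. a * deriv01 g x + b * deriv01 h x) has_vector_derivative (a * u x + b * v x)) (at x within {0..1})"
          using x x1 by (auto intro!: derivative_eq_intros simp: has_real_derivative_iff_has_vector_derivative[symmetric])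
        then show "(deriv01 ?f has_vector_derivative (a * u x + b * v x)) (at x within {0..1})"
          by (rule has_vector_derivative_transform[OF x1, rotated]) (rule D(2))
      qed
    qed
  qed
  moreover have "a * u t + b * v t = 0" if "t \<notin> {0..1}" for t
    using g h that by (auto simp: d2rep_def)
  moreover have "integrable lborel (\<lambda>x. a * u x + b * v x)" using l by auto
  ultimately show ?thesis
    unfolding d2rep_def using D(1) ac l2 by blast
qed

text \<open>Taken on all of \<open>G_space\<close>, where affine functions have seminorm zero, so
  that the estimator and its target can be compared without first splitting off their affine
  parts.\<close>

interpretation GH: psd_form G_space H_inner
proof
  fix f g h :: "real \<Rightarrow> real" and c :: real
  assume f: "f \<in> G_space"
  then obtain u where u: "d2rep f u" using G_space_imp_d2rep by blast
  then have ul: "u \<in> l2 lborel" by (simp add: d2rep_def)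
  have cu: "d2rep (\<lambda>x. c * f x) (\<lambda>x. c * u x)" using d2rep_lincomb[OF u u, of c 0] by simp
  then show "(\<lambda>x. c *\<^sub>R f x) \<in> G_space" using d2rep_imp_G_space by simp
  show "0 \<le> H_inner f f" using H_inner_d2rep[OF u u] l2.nonneg[OF ul] by simp
  { assume h: "h \<in> G_space"
    then obtain v where v: "d2rep h v" using G_space_imp_d2rep by blast
    show "H_inner (\<lambda>x. c *\<^sub>R f x) h = c * H_inner f h"
      using H_inner_d2rep[OF cu v] H_inner_d2rep[OF u v] by (simp add: mult.assoc) }
  assume g: "g \<in> G_space"
  then obtain v where v: "d2rep g v" using G_space_imp_d2rep by blast
  then have vl: "v \<in> l2 lborel" by (simp add: d2rep_def)
  have uv: "d2rep (\<lambda>x. f x + g x) (\<lambda>x. u x + v x)" using d2rep_lincomb[OF u v, of 1 1] by simp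
  then show "(\<lambda>x. f x + g x) \<in> G_space" using d2rep_imp_G_space by simp
  show "H_inner f g = H_inner g f" unfolding H_inner_def by (simp add: mult.commute)
  assume h: "h \<in> G_space"
  then obtain w where w: "d2rep h w" using G_space_imp_d2rep by blast
  then have wl: "w \<in> l2 lborel" by (simp add: d2rep_def)
  show "H_inner (\<lambda>x. f x + g x) h = H_inner f h + H_inner g h"
    using H_inner_d2rep[OF uv w] H_inner_d2rep[OF u w] H_inner_d2rep[OF v w] l2.ip_add[OF ul vl wl] by simp
qed

section \<open>Embedding into continuously differentiable functions\<close>

abbreviation Hn :: "(real \<Rightarrow> real) \<Rightarrow> real" where "Hn \<equiv> GH.nrm"

lemma G_differentiable: "g \<in> G_space \<Longrightarrow> g differentiable_on {0..1}" by (simp add: G_space_def)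

lemma deriv01_continuous: "g \<in> G_space \<Longrightarrow> continuous_on {0..1} (deriv01 g)"
  using absolutely_continuous_on_imp_continuous_on by (simp add: G_space_def)

lemma G_continuous: "g \<in> G_space \<Longrightarrow> continuous_on {0..1} g"
  by (simp add: G_differentiable differentiable_imp_continuous_on)

lemma G_ftc:
  assumes "g \<in> G_space" "0 \<le> a" "a \<le> b" "b \<le> 1"
  shows "(deriv01 g has_integral (g b - g a)) {a..b}"
proof (rule fundamental_theorem_of_calculus[OF assms(3)])
  fix x assume "x \<in> {a..b}"
  then show "(g has_vector_derivative deriv01 g x) (at x within {a..b})"
    using has_deriv01[OF G_differentiable[OF assms(1)], of x] assms
    by (auto intro: has_vector_derivative_within_subset)
qed

text \<open>Cauchy-Schwarz for the integral of the second derivative between \<open>x\<close> and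
  \<open>y\<close>. The modulus depends on \<open>g\<close> through \<open>Hn g\<close> only, which
  makes the derivatives of a bounded sequence equicontinuous.\<close>

lemma deriv01_holder:
  assumes g: "g \<in> G_space" and xy: "x \<in> {0..1}" "y \<in> {0..1}"
  shows "\<bar>deriv01 g y - deriv01 g x\<bar> \<le> Hn g * sqrt \<bar>y - x\<bar>"
proof -
  obtain u where u: "d2rep g u" using G_space_imp_d2rep[OF g] by blast
  then have ul: "u \<in> l2 lborel" by (simp add: d2rep_def)
  have main: "\<bar>deriv01 g b - deriv01 g a\<bar> \<le> Hn g * sqrt (b - a)" if ab: "0 \<le> a" "a \<le> b" "b \<le> 1" for a b
  proof (rule power2_le_imp_le)
    have "(LINT t:{a..b}|lborel. (u t)\<^sup>2) \<le> (\<integral>t. (u t)\<^sup>2 \<partial>lborel)"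
      unfolding set_lebesgue_integral_def
    proof (rule integral_mono)
      show i: "integrable lborel (\<lambda>t. (u t)\<^sup>2)" using ul by (simp add: l2_def)
      show "integrable lborel (\<lambda>t. indicator {a..b} t *\<^sub>R (u t)\<^sup>2)" by (rule integrable_mult_indicator[OF _ i]) simp
    qed (auto simp: indicator_def)
    also have "\<dots> = (Hn g)\<^sup>2" using GH.nrm_sq[OF g] H_inner_d2rep[OF u u] by (simp add: power2_eq_square)
    finally have "(b - a) * (LINT t:{a..b}|lborel. (u t)\<^sup>2) \<le> (b - a) * (Hn g)\<^sup>2" using ab by (intro mult_left_mono) auto
    then show "\<bar>deriv01 g b - deriv01 g a\<bar>\<^sup>2 \<le> (Hn g * sqrt (b - a))\<^sup>2"
      using set_integral_sq_le[OF ul ab(2)] u ab by (auto simp: d2rep_def power_mult_distrib mult.commute)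
    show "0 \<le> Hn g * sqrt (b - a)" using GH.nrm_nonneg[OF g] ab by simp
  qed
  show ?thesis using main[of x y] main[of y x] xy by (cases "x \<le> y") (auto simp: abs_minus_commute)
qed

lemma deriv01_bound:
  assumes g: "g \<in> G_space" and x: "x \<in> {0..1}"
  shows "\<bar>deriv01 g x\<bar> \<le> \<bar>deriv01 g 0\<bar> + Hn g"
proof -
  have "\<bar>deriv01 g x - deriv01 g 0\<bar> \<le> Hn g * sqrt \<bar>x - 0\<bar>" using deriv01_holder[OF g, of 0 x] x by simp
  also have "\<dots> \<le> Hn g * 1" by (intro mult_left_mono) (use x GH.nrm_nonneg[OF g] in auto)
  finally show ?thesis by linarith
qed

lemma G_bound:
  assumes g: "g \<in> G_space" and x: "x \<in> {0..1}"
  shows "\<bar>g x\<bar> \<le> \<bar>g 0\<bar> + \<bar>deriv01 g 0\<bar> + Hn g"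
proof -
  have "norm (g x - g 0) \<le> (\<bar>deriv01 g 0\<bar> + Hn g) * Henstock_Kurzweil_Integration.content {0..x}"
    using has_integral_bound[of "\<bar>deriv01 g 0\<bar> + Hn g" "deriv01 g" "g x - g 0" 0 x]
      G_ftc[OF g, of 0 x] deriv01_bound[OF g] GH.nrm_nonneg[OF g] x by (auto simp: cbox_interval)
  also have "\<dots> \<le> (\<bar>deriv01 g 0\<bar> + Hn g) * 1"
    using x GH.nrm_nonneg[OF g] by (intro mult_left_mono) auto
  finally show ?thesis by simp
qed

lemma H_inner_cong:
  assumes "\<And>x. x \<in> {0..1} \<Longrightarrow> f x = f' x" "\<And>x. x \<in> {0..1} \<Longrightarrow> g x = g' x"
  shows "H_inner f g = H_inner f' g'"
  unfolding H_inner_def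
proof (rule set_lebesgue_integral_cong)
  have "deriv2_01 f x = deriv2_01 f' x" "deriv2_01 g x = deriv2_01 g' x" if "x \<in> {0..1}" for x
    by (rule deriv01_cong[OF deriv01_cong[OF assms(1)] that] deriv01_cong[OF deriv01_cong[OF assms(2)] that]; assumption)+
  then show "\<forall>x. x \<in> {0..1} \<longrightarrow> deriv2_01 f x * deriv2_01 g x = deriv2_01 f' x * deriv2_01 g' x" by simp
qed simp

lemma affine_d2rep: "d2rep (\<lambda>x. a + b * x) (\<lambda>x. 0)"
  and affine_deriv01: "x \<in> {0..1} \<Longrightarrow> deriv01 (\<lambda>x. a + b * x) x = b"
proof -
  have h: "((\<lambda>x. a + b * x) has_vector_derivative b) (at x within {0..1})" for x
    by (auto intro!: derivative_eq_intros simp: has_real_derivative_iff_has_vector_derivative[symmetric])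
  show d: "deriv01 (\<lambda>x. a + b * x) x = b" if "x \<in> {0..1}" for x
    using vector_derivative_01[OF h that] .
  have h2: "(deriv01 (\<lambda>x. a + b * x) has_vector_derivative 0) (at x within {0..1})" if "x \<in> {0..1}" for x
    by (rule has_vector_derivative_transform[OF that _ has_vector_derivative_const[of b]]) (use d in auto)
  have ac: "absolutely_continuous_on {0..1} (\<lambda>_::real. b)"
    unfolding absolutely_continuous_on_def by (auto simp: case_prod_unfold intro: exI[of _ 1])
  show "d2rep (\<lambda>x. a + b * x) (\<lambda>x. 0)"
    unfolding d2rep_def
    using absolutely_continuous_on_cong[OF d[symmetric] ac] h2
    by (auto simp: l2_def d set_lebesgue_integral_def intro!: derivative_intros)
qed

lemma affine_G: "(\<lambda>x. a + b * x) \<in> G_space"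
  using affine_d2rep d2rep_imp_G_space by blast

lemma H_inner_affine: "g \<in> G_space \<Longrightarrow> H_inner g (\<lambda>x. a + b * x) = 0"
proof -
  assume "g \<in> G_space"
  then obtain u where "d2rep g u" using G_space_imp_d2rep by blast
  from H_inner_d2rep[OF this affine_d2rep] show ?thesis by simp
qed

section \<open>Limits of sequences with bounded second derivatives\<close>

lemma nn_integral_le_of_tendsto:
  fixes F :: "nat \<Rightarrow> 'a \<Rightarrow> ennreal"
  assumes "\<And>n. F n \<in> borel_measurable M" "AE x in M. (\<lambda>n. F n x) \<longlonglongrightarrow> f x"
    and "\<And>n. (\<integral>\<^sup>+x. F n x \<partial>M) \<le> C"
  shows "(\<integral>\<^sup>+x. f x \<partial>M) \<le> C"
proof -
  have "(\<integral>\<^sup>+x. f x \<partial>M) = (\<integral>\<^sup>+x. liminf (\<lambda>n. F n x) \<partial>M)"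
    by (rule nn_integral_cong_AE) (use assms(2) in \<open>eventually_elim, simp add: lim_imp_Liminf\<close>)
  also have "\<dots> \<le> liminf (\<lambda>n. \<integral>\<^sup>+x. F n x \<partial>M)" by (rule nn_integral_liminf[OF assms(1)])
  also have "\<dots> \<le> liminf (\<lambda>n::nat. C)" by (intro Liminf_mono always_eventually allI assms(3))
  also have "\<dots> = C" by (simp add: Liminf_const)
  finally show ?thesis .
qed

lemma set_integral_Icc_Ioo:
  fixes u :: "real \<Rightarrow> real"
  assumes "u \<in> borel_measurable borel"
  shows "(LINT t:{a..b}|lborel. u t) = (LINT t:{a<..<b}|lborel. u t)"
  unfolding set_lebesgue_integral_def
proof (rule integral_cong_AE)
  show "AE t in lborel. indicator {a..b} t *\<^sub>R u t = indicator {a<..<b} t *\<^sub>R u t"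
    using AE_lborel_singleton[of a] AE_lborel_singleton[of b]
    by eventually_elim (auto simp: indicator_def)
qed (use assms in \<open>auto intro!: borel_measurable_scaleR\<close>)

text \<open>The quantitative form of F. Riesz' criterion: it is what survives \<open>C\<^sup>1\<close> limits, and it makes the
  derivative of the limit absolutely continuous.\<close>

lemma deriv01_riesz:
  assumes g: "g \<in> G_space" and "finite D" and D: "\<And>a b. (a, b) \<in> D \<Longrightarrow> a \<le> b \<and> {a..b} \<subseteq> {0..1}"
    and disj: "disjoint_family_on (\<lambda>(a, b). {a<..<b}) D"
  shows "(\<Sum>(a, b)\<in>D. \<bar>deriv01 g b - deriv01 g a\<bar>) \<le> Hn g * sqrt (\<Sum>(a, b)\<in>D. b - a)"
proof -
  obtain u where u: "d2rep g u" using G_space_imp_d2rep[OF g] by blast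
  then have ul: "u \<in> l2 lborel" and ui: "integrable lborel u" by (auto simp: d2rep_def)
  define I where "I = (\<lambda>p t::real. indicator {fst p<..<snd p} t :: real)"
  define s where "s = (\<lambda>p. sgn (deriv01 g (snd p) - deriv01 g (fst p)))"
  \<comment> \<open>Duality: the sum of absolute increments is the pairing of \<open>u\<close> with
    this step function of signs, whose squared norm is at most the total length because the
    intervals are disjoint.\<close>
  define \<phi> where "\<phi> = (\<lambda>t. \<Sum>p\<in>D. s p * I p t)"
  have I0: "I p t * I q t = 0" if "p \<in> D" "q \<in> D" "p \<noteq> q" for p q t
  proof -
    have "{fst p<..<snd p} \<inter> {fst q<..<snd q} = {}"
      using disj that unfolding disjoint_family_on_def by (simp add: case_prod_unfold)
    then show ?thesis unfolding I_def indicator_inter_arith[symmetric] by simp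
  qed
  have \<phi>sq: "(\<phi> t)\<^sup>2 = (\<Sum>p\<in>D. (s p)\<^sup>2 * I p t)" for t
  proof -
    have "(\<phi> t)\<^sup>2 = (\<Sum>p\<in>D. \<Sum>q\<in>D. (s p * I p t) * (s q * I q t))"
      unfolding \<phi>_def power2_eq_square by (rule sum_product)
    also have "\<dots> = (\<Sum>p\<in>D. \<Sum>q\<in>D. if q = p then (s p)\<^sup>2 * I p t else 0)"
    proof (intro sum.cong refl)
      fix p q assume pq: "p \<in> D" "q \<in> D"
      have "I p t * I p t = I p t" by (auto simp: I_def indicator_def)
      then show "s p * I p t * (s q * I q t) = (if q = p then (s p)\<^sup>2 * I p t else 0)"
        using I0[OF pq, of t] by (cases "q = p") (auto simp: power2_eq_square)
    qed
    also have "\<dots> = (\<Sum>p\<in>D. (s p)\<^sup>2 * I p t)" using \<open>finite D\<close> by (intro sum.cong refl) simp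
    finally show ?thesis .
  qed
  have Iint: "integrable lborel (I p)" "(\<integral>t. I p t \<partial>lborel) = snd p - fst p" if "p \<in> D" for p
    using D[of "fst p" "snd p"] that by (auto simp: I_def)
  have \<phi>l: "\<phi> \<in> l2 lborel"
  proof -
    have "\<phi> \<in> borel_measurable lborel" unfolding \<phi>_def I_def by measurable
    moreover have "integrable lborel (\<lambda>t. (\<phi> t)\<^sup>2)"
      unfolding \<phi>sq by (intro Bochner_Integration.integrable_sum integrable_mult_right Iint)
    ultimately show ?thesis by (simp add: l2_def)
  qed
  have s1: "(s p)\<^sup>2 \<le> 1" for p unfolding s_def by (auto simp: sgn_if)
  have \<phi>n: "(\<integral>t. \<phi> t * \<phi> t \<partial>lborel) \<le> (\<Sum>(a, b)\<in>D. b - a)"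
  proof -
    have "(\<integral>t. \<phi> t * \<phi> t \<partial>lborel) = (\<integral>t. (\<phi> t)\<^sup>2 \<partial>lborel)" by (simp add: power2_eq_square)
    also have "\<dots> = (\<Sum>p\<in>D. (s p)\<^sup>2 * (snd p - fst p))"
      unfolding \<phi>sq by (subst Bochner_Integration.integral_sum) (auto simp: Iint)
    also have "\<dots> \<le> (\<Sum>p\<in>D. 1 * (snd p - fst p))"
    proof (intro sum_mono mult_right_mono s1)
      fix p assume "p \<in> D" then show "0 \<le> snd p - fst p" using D[of "fst p" "snd p"] by simp
    qed
    finally show ?thesis by (simp add: case_prod_unfold)
  qed
  have uI: "integrable lborel (\<lambda>t. u t * I p t)" for p
    using integrable_mult_indicator[OF _ ui, of "{fst p<..<snd p}"] by (simp add: I_def mult.commute)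
  have "(\<integral>t. u t * \<phi> t \<partial>lborel) = (\<Sum>p\<in>D. s p * (\<integral>t. u t * I p t \<partial>lborel))"
  proof -
    have "(\<integral>t. u t * \<phi> t \<partial>lborel) = (\<integral>t. (\<Sum>p\<in>D. s p * (u t * I p t)) \<partial>lborel)"
      unfolding \<phi>_def by (simp add: sum_distrib_left mult_ac)
    also have "\<dots> = (\<Sum>p\<in>D. s p * (\<integral>t. u t * I p t \<partial>lborel))"
      using uI by (subst Bochner_Integration.integral_sum) auto
    finally show ?thesis .
  qed
  also have "\<dots> = (\<Sum>p\<in>D. \<bar>deriv01 g (snd p) - deriv01 g (fst p)\<bar>)"
  proof (intro sum.cong refl)
    fix p assume "p \<in> D"
    then have p: "0 \<le> fst p" "fst p \<le> snd p" "snd p \<le> 1" using D[of "fst p" "snd p"] by auto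
    have "(\<integral>t. u t * I p t \<partial>lborel) = (LINT t:{fst p<..<snd p}|lborel. u t)"
      unfolding I_def set_lebesgue_integral_def by (simp add: mult.commute)
    also have "\<dots> = deriv01 g (snd p) - deriv01 g (fst p)"
      using u p set_integral_Icc_Ioo[of u "fst p" "snd p"] borel_measurable_integrable[OF ui] by (simp add: d2rep_def)
    finally show "s p * (\<integral>t. u t * I p t \<partial>lborel) = \<bar>deriv01 g (snd p) - deriv01 g (fst p)\<bar>"
      by (simp add: s_def abs_sgn mult.commute)
  qed
  finally have "(\<Sum>p\<in>D. \<bar>deriv01 g (snd p) - deriv01 g (fst p)\<bar>) = (\<integral>t. u t * \<phi> t \<partial>lborel)" ..
  also have "\<dots> \<le> sqrt (\<integral>t. u t * u t \<partial>lborel) * sqrt (\<integral>t. \<phi> t * \<phi> t \<partial>lborel)"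
    using l2.cauchy_schwarz[OF ul \<phi>l] unfolding l2.nrm_def by linarith
  also have "\<dots> \<le> Hn g * sqrt (\<Sum>(a, b)\<in>D. b - a)"
    unfolding GH.nrm_def H_inner_d2rep[OF u u]
    using l2.nonneg[OF ul] \<phi>n by (intro mult_left_mono) auto
  finally show ?thesis by (simp add: case_prod_unfold)
qed

text \<open>Difference quotients are used because they converge along \<open>C\<^sup>1\<close> limits, unlike second derivatives;
  Fatou's lemma then bounds the second derivative of the limit.\<close>

lemma difference_quotient_bound:
  assumes g: "g \<in> G_space" and h: "h > 0"
  shows "(\<integral>\<^sup>+t. ennreal (((deriv01 g (clampi 0 1 (t + h)) - deriv01 g (clampi 0 1 t)) / h)\<^sup>2) \<partial>lborel)
    \<le> ennreal ((Hn g)\<^sup>2)"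
proof -
  obtain u where u: "d2rep g u" using G_space_imp_d2rep[OF g] by blast
  then have ul: "u \<in> l2 lborel" by (auto simp: d2rep_def)
  then have um[measurable]: "u \<in> borel_measurable borel" by (simp add: l2_def)
  \<comment> \<open>By Cauchy-Schwarz the squared quotient at \<open>t\<close> is at most the mean
    of \<open>u^2\<close> over \<open>[t, t + h]\<close>. Integrating \<open>t\<close> out first
    leaves, for each \<open>s\<close>, an interval of length \<open>h\<close>, which cancels the
    division by \<open>h\<close>.\<close>
  define k where "k = (\<lambda>p. if fst p \<le> snd p \<and> snd p \<le> fst p + h then ennreal ((u (snd p))\<^sup>2 / h) else 0)"
  have km[measurable]: "k \<in> borel_measurable (lborel \<Otimes>\<^sub>M lborel)" unfolding k_def by measurable
  have "ennreal (((deriv01 g (clampi 0 1 (t + h)) - deriv01 g (clampi 0 1 t)) / h)\<^sup>2) \<le> (\<integral>\<^sup>+s. k (t, s) \<partial>lborel)" for t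
  proof (cases "clampi 0 1 t = clampi 0 1 (t + h)")
    case True then show ?thesis by simp
  next
    case False
    define a b where "a = clampi 0 1 t" and "b = clampi 0 1 (t + h)"
    have ab: "0 \<le> a" "a \<le> b" "b \<le> 1" "t \<le> a" "b \<le> t + h" "b - a \<le> h"
      using False h by (auto simp: a_def b_def clampi_def min_def max_def split: if_splits)
    let ?S = "LINT s:{a..b}|lborel. (u s)\<^sup>2"
    have iS: "integrable lborel (\<lambda>s. indicator {a..b} s * (u s)\<^sup>2)"
      using integrable_mult_indicator[of "{a..b}" lborel "\<lambda>s. (u s)\<^sup>2"] ul by (simp add: l2_def)
    have S0: "?S \<ge> 0" unfolding set_lebesgue_integral_def by (rule integral_nonneg_AE) simp
    have "(deriv01 g b - deriv01 g a)\<^sup>2 \<le> (b - a) * ?S"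
      using u ab set_integral_sq_le[OF ul ab(2)] by (simp add: d2rep_def)
    also have "\<dots> \<le> h * ?S" using ab S0 by (intro mult_right_mono) auto
    finally have "((deriv01 g b - deriv01 g a) / h)\<^sup>2 \<le> (h * ?S) / h\<^sup>2"
      unfolding power_divide by (intro divide_right_mono) auto
    also have "\<dots> = ?S / h" using h by (simp add: power2_eq_square)
    finally have "((deriv01 g b - deriv01 g a) / h)\<^sup>2 \<le> ?S / h" .
    also have "\<dots> = (\<integral>s. indicator {a..b} s * (u s)\<^sup>2 / h \<partial>lborel)"
      by (simp add: set_lebesgue_integral_def)
    finally have "ennreal (((deriv01 g b - deriv01 g a) / h)\<^sup>2) \<le> ennreal (\<integral>s. indicator {a..b} s * (u s)\<^sup>2 / h \<partial>lborel)"
      by (rule ennreal_leI)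
    also have "\<dots> = (\<integral>\<^sup>+s. ennreal (indicator {a..b} s * (u s)\<^sup>2 / h) \<partial>lborel)"
      using h iS by (intro nn_integral_eq_integral[symmetric]) auto
    also have "\<dots> \<le> (\<integral>\<^sup>+s. k (t, s) \<partial>lborel)"
      by (rule nn_integral_mono) (use ab in \<open>auto simp: k_def indicator_def\<close>)
    finally show ?thesis by (simp add: a_def b_def)
  qed
  then have "(\<integral>\<^sup>+t. ennreal (((deriv01 g (clampi 0 1 (t + h)) - deriv01 g (clampi 0 1 t)) / h)\<^sup>2) \<partial>lborel)
      \<le> (\<integral>\<^sup>+t. \<integral>\<^sup>+s. k (t, s) \<partial>lborel \<partial>lborel)" by (intro nn_integral_mono)
  also have "\<dots> = (\<integral>\<^sup>+s. \<integral>\<^sup>+t. k (t, s) \<partial>lborel \<partial>lborel)"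
    by (rule lborel_pair.Fubini'[symmetric]) (simp add: case_prod_unfold km)
  also have "\<dots> = (\<integral>\<^sup>+s. ennreal ((u s)\<^sup>2) \<partial>lborel)"
  proof (rule nn_integral_cong)
    fix s :: real
    have "(\<integral>\<^sup>+t. k (t, s) \<partial>lborel) = (\<integral>\<^sup>+t. ennreal ((u s)\<^sup>2 / h) * indicator {s - h..s} t \<partial>lborel)"
      by (rule nn_integral_cong) (auto simp: k_def indicator_def)
    also have "\<dots> = ennreal ((u s)\<^sup>2 / h) * ennreal h"
      using h by (subst nn_integral_cmult_indicator) auto
    also have "\<dots> = ennreal ((u s)\<^sup>2)" using h by (simp add: ennreal_mult'[symmetric])
    finally show "(\<integral>\<^sup>+t. k (t, s) \<partial>lborel) = ennreal ((u s)\<^sup>2)" .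
  qed
  also have "\<dots> = ennreal ((Hn g)\<^sup>2)"
    unfolding GH.nrm_sq[OF g] H_inner_d2rep[OF u u]
    using ul by (subst nn_integral_eq_integral) (auto simp: l2_def power2_eq_square)
  finally show ?thesis .
qed

text \<open>The limit \<open>f\<close> of the derivatives inherits the estimate of
  \<open>deriv01_riesz\<close> with the constant \<open>R\<close>, hence is absolutely continuous.
  Its density is bounded in \<open>l2\<close> by using Fatou's lemma twice: along the sequence for a
  fixed step, then as the step of the difference quotient tends to zero.\<close>

lemma G_closed:
  assumes g: "\<And>k. g k \<in> G_space" "\<And>k. Hn (g k) \<le> R"
    and lim: "\<And>x. x \<in> {0..1} \<Longrightarrow> (\<lambda>k. g k x) \<longlonglongrightarrow> G x"
    and unif: "uniform_limit {0..1} (\<lambda>k. deriv01 (g k)) f sequentially"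
  shows "G \<in> G_space" "\<And>x. x \<in> {0..1} \<Longrightarrow> deriv01 G x = f x" "Hn G \<le> R"
proof -
  have R0: "R \<ge> 0" using GH.nrm_nonneg[OF g(1)] g(2) order_trans by blast
  have flim: "(\<lambda>k. deriv01 (g k) x) \<longlonglongrightarrow> f x" if "x \<in> {0..1}" for x
    using tendsto_uniform_limitI[OF unif that] .
  have "\<exists>G'. \<forall>x\<in>{0..1}. (\<lambda>k. g k x) \<longlonglongrightarrow> G' x \<and> (G' has_derivative (\<lambda>h. h *\<^sub>R f x)) (at x within {0..1})"
  proof (rule has_derivative_sequence)
    show "(g n has_derivative (\<lambda>h. h *\<^sub>R deriv01 (g n) x)) (at x within {0..1})" if "x \<in> {0..1}" for n x
      using has_deriv01[OF G_differentiable[OF g(1)] that] by (simp add: has_vector_derivative_def)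
    show "\<forall>\<^sub>F n in sequentially. \<forall>x\<in>{0..1}. \<forall>h. norm (h *\<^sub>R deriv01 (g n) x - h *\<^sub>R f x) \<le> e * norm h"
      if "e > 0" for e
      using uniform_limitD[OF unif that]
    proof eventually_elim
      fix n assume "\<forall>x\<in>{0..1}. dist (deriv01 (g n) x) (f x) < e"
      then have "\<bar>h\<bar> * \<bar>deriv01 (g n) x - f x\<bar> \<le> \<bar>h\<bar> * e" if "x \<in> {0..1}" for x h
        using that by (intro mult_left_mono) (auto simp: dist_real_def less_imp_le)
      then show "\<forall>x\<in>{0..1}. \<forall>h. norm (h *\<^sub>R deriv01 (g n) x - h *\<^sub>R f x) \<le> e * norm h"
        by (auto simp: right_diff_distrib[symmetric] abs_mult mult.commute)
    qed
    show "(\<lambda>n. g n 0) \<longlonglongrightarrow> G 0" by (rule lim) simp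
  qed auto
  then obtain G' where G': "\<And>x. x \<in> {0..1} \<Longrightarrow> (\<lambda>k. g k x) \<longlonglongrightarrow> G' x"
    "\<And>x. x \<in> {0..1} \<Longrightarrow> (G' has_vector_derivative f x) (at x within {0..1})"
    unfolding has_vector_derivative_def by blast
  have GG: "G x = G' x" if "x \<in> {0..1}" for x using LIMSEQ_unique[OF lim[OF that] G'(1)[OF that]] .
  have Gd: "(G has_vector_derivative f x) (at x within {0..1})" if "x \<in> {0..1}" for x
    by (rule has_vector_derivative_transform[OF that GG G'(2)[OF that]])
  show dG: "deriv01 G x = f x" if "x \<in> {0..1}" for x using vector_derivative_01[OF Gd[OF that] that] .
  have diff: "G differentiable_on {0..1}"
    using Gd unfolding differentiable_on_def has_vector_derivative_def differentiable_def by blast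
  have ac: "absolutely_continuous_on {0..1} f"
    unfolding absolutely_continuous_on_iff_ac_mod
  proof (intro allI impI)
    fix e :: real assume e: "e > 0"
    \<comment> \<open>Then \<open>R * sqrt d = R / (R + 1) * e < e\<close>; the summand 1 also
      covers \<open>R = 0\<close>.\<close>
    define d where "d = (e / (R + 1))\<^sup>2"
    have "d > 0" using e R0 by (simp add: d_def add_nonneg_pos)
    have "ac_mod {0..1} f e d"
      unfolding ac_mod_def
    proof (intro allI impI, elim conjE)
      fix D :: "(real \<times> real) set"
      assume D: "finite D" "\<forall>(a, b)\<in>D. a \<le> b \<and> {a..b} \<subseteq> {0..1}" "disjoint_family_on (\<lambda>(a, b). {a<..<b}) D"
        "(\<Sum>(a, b)\<in>D. b - a) < d"
      have in01: "fst p \<in> {0..1}" "snd p \<in> {0..1}" "fst p \<le> snd p" if "p \<in> D" for p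
        using D(2) that by force+
      have l: "(\<lambda>k. \<Sum>p\<in>D. \<bar>deriv01 (g k) (snd p) - deriv01 (g k) (fst p)\<bar>) \<longlonglongrightarrow> (\<Sum>p\<in>D. \<bar>f (snd p) - f (fst p)\<bar>)"
        using in01 by (intro tendsto_intros flim) auto
      have "(\<Sum>p\<in>D. \<bar>deriv01 (g k) (snd p) - deriv01 (g k) (fst p)\<bar>) \<le> R * sqrt (\<Sum>(a, b)\<in>D. b - a)" for k
      proof -
        have "(\<Sum>p\<in>D. \<bar>deriv01 (g k) (snd p) - deriv01 (g k) (fst p)\<bar>) \<le> Hn (g k) * sqrt (\<Sum>(a, b)\<in>D. b - a)"
          using deriv01_riesz[OF g(1) D(1) _ D(3)] D(2) by (fastforce simp: case_prod_unfold)
        also have "\<dots> \<le> R * sqrt (\<Sum>(a, b)\<in>D. b - a)"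
          using in01 by (intro mult_right_mono g(2)) (auto intro!: sum_nonneg simp: case_prod_unfold)
        finally show ?thesis .
      qed
      then have "(\<Sum>p\<in>D. \<bar>f (snd p) - f (fst p)\<bar>) \<le> R * sqrt (\<Sum>(a, b)\<in>D. b - a)"
        by (intro LIMSEQ_le_const2[OF l]) auto
      also have "\<dots> \<le> R * sqrt d" using D(4) R0 by (intro mult_left_mono) auto
      also have "\<dots> = R / (R + 1) * e" using e R0 by (simp add: d_def real_sqrt_abs)
      also have "\<dots> < 1 * e" using e R0 by (intro mult_strict_right_mono) auto
      finally show "(\<Sum>(a, b)\<in>D. \<bar>f b - f a\<bar>) < e" by (simp add: case_prod_unfold)
    qed
    then show "\<exists>d>0. ac_mod {0..1} f e d" using \<open>d > 0\<close> by blast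
  qed
  obtain u where u: "integrable lborel u" "\<And>t. t \<notin> {0..1} \<Longrightarrow> u t = 0"
    "\<And>a b. 0 \<le> a \<Longrightarrow> a \<le> b \<Longrightarrow> b \<le> 1 \<Longrightarrow> f b - f a = (LINT t:{a..b}|lborel. u t)"
    "AE x in lebesgue. x \<in> {0..1} \<longrightarrow> (f has_vector_derivative u x) (at x within {0..1})"
    by (rule ac_ftc[OF ac]) (rule that)
  have cl: "clampi 0 1 x \<in> {0..1}" for x by (auto simp: clampi_def)
  have cm: "(\<lambda>t. F (clampi 0 1 (t + h))) \<in> borel_measurable borel" if "continuous_on {0..1} F" for F :: "real \<Rightarrow> real" and h
  proof -
    have "continuous_on UNIV (\<lambda>t. clampi 0 1 (t + h))" unfolding clampi_def by (intro continuous_intros)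
    then have "continuous_on UNIV (\<lambda>t. F (clampi 0 1 (t + h)))"
      by (rule continuous_on_compose2[OF that]) (use cl in blast)
    then show ?thesis by (rule borel_measurable_continuous_onI)
  qed
  have cm': "(\<lambda>t. ((F (clampi 0 1 (t + h)) - F (clampi 0 1 t)) / h)\<^sup>2) \<in> borel_measurable borel"
    if "continuous_on {0..1} F" for F :: "real \<Rightarrow> real" and h
    using cm[OF that, of h] cm[OF that, of 0] by simp
  \<comment> \<open>The forward difference quotient of the constant extension of \<open>f\<close>.
    At 0 and 1 the extension may have a kink, so these two points are put into the null set.\<close>
  define q where "q = (\<lambda>n t. (f (clampi 0 1 (t + inverse (real (Suc n)))) - f (clampi 0 1 t)) / inverse (real (Suc n)))"
  have "AE x in lborel. x \<in> {0..1} \<longrightarrow> (f has_vector_derivative u x) (at x within {0..1})"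
    using u(4) by (simp add: AE_completion_iff)
  then have AEq: "AE t in lborel. (\<lambda>n. ennreal ((q n t)\<^sup>2)) \<longlonglongrightarrow> ennreal ((u t)\<^sup>2)"
    using AE_lborel_singleton[of 0] AE_lborel_singleton[of 1]
  proof eventually_elim
    fix t :: real
    assume d: "t \<in> {0..1} \<longrightarrow> (f has_vector_derivative u t) (at t within {0..1})" and t: "t \<noteq> 0" "t \<noteq> 1"
    have "(\<lambda>n. q n t) \<longlonglongrightarrow> u t"
    proof (cases "t \<in> {0..1}")
      case True
      then have "(f has_vector_derivative u t) (at t)"
        using d t at_within_interior[of t "{0..1}"] by simp
      then have "((\<lambda>h. (f (t + h) - f t) / h) \<longlongrightarrow> u t) (at 0)"
        by (simp add: has_real_derivative_iff_has_vector_derivative[symmetric] DERIV_def)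
      moreover have "filterlim (\<lambda>n. inverse (real (Suc n))) (at 0) sequentially"
        unfolding filterlim_at using LIMSEQ_inverse_real_of_nat by simp
      ultimately have "(\<lambda>n. (f (t + inverse (real (Suc n))) - f t) / inverse (real (Suc n))) \<longlonglongrightarrow> u t"
        by (rule filterlim_compose)
      moreover have "\<forall>\<^sub>F n in sequentially. inverse (real (Suc n)) < 1 - t"
        by (rule order_tendstoD[OF LIMSEQ_inverse_real_of_nat]) (use True t in auto)
      then have "\<forall>\<^sub>F n in sequentially. (f (t + inverse (real (Suc n))) - f t) / inverse (real (Suc n)) = q n t"
        by eventually_elim (use True in \<open>simp add: q_def clampi_def\<close>)
      ultimately show ?thesis by (rule Lim_transform_eventually)
    next
      case False
      have "\<forall>\<^sub>F n in sequentially. inverse (real (Suc n)) < (if t < 0 then - t else 1)"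
        by (rule order_tendstoD[OF LIMSEQ_inverse_real_of_nat]) auto
      then have "\<forall>\<^sub>F n in sequentially. 0 = q n t"
      proof eventually_elim
        fix n assume n: "inverse (real (Suc n)) < (if t < 0 then - t else 1)"
        have "clampi 0 1 (t + h) = clampi 0 1 t" if "h > 0" "h < (if t < 0 then - t else 1)" for h
          using that False by (auto simp: clampi_def split: if_splits)
        from this[OF _ n] have "clampi 0 1 (t + inverse (real (Suc n))) = clampi 0 1 t" by simp
        then show "0 = q n t" by (simp add: q_def)
      qed
      then have "(\<lambda>n. q n t) \<longlonglongrightarrow> 0" by (rule Lim_transform_eventually[OF tendsto_const])
      then show ?thesis using u(2)[OF False] by simp
    qed
    then show "(\<lambda>n. ennreal ((q n t)\<^sup>2)) \<longlonglongrightarrow> ennreal ((u t)\<^sup>2)"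
      by (intro tendsto_ennrealI tendsto_power)
  qed
  have "(\<integral>\<^sup>+t. ennreal ((u t)\<^sup>2) \<partial>lborel) \<le> ennreal (R\<^sup>2)"
  proof (rule nn_integral_le_of_tendsto[OF _ AEq])
    fix n
    let ?h = "inverse (real (Suc n))"
    show "(\<lambda>t. ennreal ((q n t)\<^sup>2)) \<in> borel_measurable lborel"
      unfolding q_def using cm'[OF absolutely_continuous_on_imp_continuous_on[OF ac], of ?h] by simp
    show "(\<integral>\<^sup>+t. ennreal ((q n t)\<^sup>2) \<partial>lborel) \<le> ennreal (R\<^sup>2)"
    proof (rule nn_integral_le_of_tendsto)
      show "(\<lambda>t. ennreal (((deriv01 (g k) (clampi 0 1 (t + ?h)) - deriv01 (g k) (clampi 0 1 t)) / ?h)\<^sup>2))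
          \<in> borel_measurable lborel" for k
        using cm'[OF deriv01_continuous[OF g(1)], of k ?h] by simp
      show "AE t in lborel. (\<lambda>k. ennreal (((deriv01 (g k) (clampi 0 1 (t + ?h)) - deriv01 (g k) (clampi 0 1 t)) / ?h)\<^sup>2))
          \<longlonglongrightarrow> ennreal ((q n t)\<^sup>2)"
        unfolding q_def using cl by (intro AE_I2 tendsto_ennrealI tendsto_intros flim) auto
      show "(\<integral>\<^sup>+t. ennreal (((deriv01 (g k) (clampi 0 1 (t + ?h)) - deriv01 (g k) (clampi 0 1 t)) / ?h)\<^sup>2) \<partial>lborel)
          \<le> ennreal (R\<^sup>2)" for k
        by (rule order_trans[OF difference_quotient_bound[OF g(1)]])
          (auto intro!: ennreal_leI power_mono g(2) GH.nrm_nonneg[OF g(1)])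
    qed
  qed
  note nnu = this
  have um: "u \<in> borel_measurable lborel" using u(1) by auto
  have ui: "integrable lborel (\<lambda>t. (u t)\<^sup>2)"
    using nnu um by (intro integrableI_nonneg) (auto simp: le_less_trans)
  have rep: "d2rep G u"
    unfolding d2rep_def
  proof (intro conjI allI impI)
    show "absolutely_continuous_on {0..1} (deriv01 G)"
      by (rule absolutely_continuous_on_cong[OF dG[symmetric] ac])
    show "deriv01 G b - deriv01 G a = (LINT t:{a..b}|lborel. u t)" if "0 \<le> a" "a \<le> b" "b \<le> 1" for a b
      using u(3)[OF that] dG that by simp
    show "AE x in lebesgue. x \<in> {0..1} \<longrightarrow> (deriv01 G has_vector_derivative u x) (at x within {0..1})"
      using u(4)
    proof eventually_elim
      case (elim x)
      then show ?case using has_vector_derivative_transform[of x "{0..1}" "deriv01 G" f "u x"] dG by blast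
    qed
  qed (use diff u um ui in \<open>auto simp: l2_def\<close>)
  then show "G \<in> G_space" by (rule d2rep_imp_G_space)
  have "ennreal (H_inner G G) \<le> ennreal (R\<^sup>2)"
    unfolding H_inner_d2rep[OF rep rep] using nnu ui
    by (subst nn_integral_eq_integral[symmetric]) (auto simp: power2_eq_square)
  then have "H_inner G G \<le> R\<^sup>2" by simp
  then show "Hn G \<le> R" unfolding GH.nrm_def using R0 by (simp add: real_le_lsqrt)
qed

definition Gn :: "(real \<Rightarrow> real) \<Rightarrow> real" where
  "Gn g = \<bar>g 0\<bar> + \<bar>deriv01 g 0\<bar> + Hn g"

lemma deriv01_diff:
  assumes "f \<in> G_space" "g \<in> G_space" "x \<in> {0..1}"
  shows "deriv01 (\<lambda>x. f x - g x) x = deriv01 f x - deriv01 g x"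
  using deriv01_lincomb(2)[OF G_differentiable[OF assms(1)] G_differentiable[OF assms(2)] assms(3), of 1 "-1"] by simp

lemma deriv01_scale:
  assumes "f \<in> G_space" "x \<in> {0..1}"
  shows "deriv01 (\<lambda>x. c * f x) x = c * deriv01 f x"
  using deriv01_lincomb(2)[OF G_differentiable[OF assms(1)] G_differentiable[OF assms(1)] assms(2), of c 0] by simp

lemma Gn_bounds:
  assumes "g \<in> G_space" "x \<in> {0..1}"
  shows "\<bar>g x\<bar> \<le> Gn g" "\<bar>deriv01 g x\<bar> \<le> Gn g" "Hn g \<le> Gn g" "0 \<le> Gn g"
  using G_bound[OF assms] deriv01_bound[OF assms] GH.nrm_nonneg[OF assms(1)] by (auto simp: Gn_def)

text \<open>A Cauchy sequence for \<open>Gn\<close> converges together with its derivatives, which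
  says nothing yet about second derivatives. Their convergence comes from applying
  \<open>G_closed\<close> to the differences with a fixed \<open>g n\<close>: the bound
  \<open>e\<close> on the seminorms of these differences passes to their limit.\<close>

lemma G_complete:
  assumes g: "\<And>k. g k \<in> G_space"
    and cauchy: "\<And>e. e > 0 \<Longrightarrow> \<exists>N. \<forall>m\<ge>N. \<forall>n\<ge>N. Gn (\<lambda>x. g m x - g n x) < e"
  obtains G where "G \<in> G_space" "(\<lambda>n. Gn (\<lambda>x. g n x - G x)) \<longlonglongrightarrow> 0"
proof -
  note gd = GH.diff_mem[OF g g]
  have "uniformly_convergent_on {0..1} (\<lambda>k. deriv01 (g k))"
  proof (rule Cauchy_uniformly_convergent, unfold uniformly_Cauchy_on_def, intro allI impI)
    fix e :: real assume "e > 0"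
    then obtain N where N: "\<And>m n. m \<ge> N \<Longrightarrow> n \<ge> N \<Longrightarrow> Gn (\<lambda>x. g m x - g n x) < e" using cauchy by blast
    have "dist (deriv01 (g m) x) (deriv01 (g n) x) < e" if "x \<in> {0..1}" "m \<ge> N" "n \<ge> N" for x m n
      using Gn_bounds(2)[OF gd that(1), of m n] N[OF that(2,3)] deriv01_diff[OF g g that(1), of m n]
      by (simp add: dist_real_def)
    then show "\<exists>M. \<forall>x\<in>{0..1}. \<forall>m\<ge>M. \<forall>n\<ge>M. dist (deriv01 (g m) x) (deriv01 (g n) x) < e" by blast
  qed
  then obtain f where f: "uniform_limit {0..1} (\<lambda>k. deriv01 (g k)) f sequentially"
    unfolding uniformly_convergent_on_def by blast
  have "\<exists>l. (\<lambda>k. g k x) \<longlonglongrightarrow> l" if x: "x \<in> {0..1}" for x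
  proof -
    have "Cauchy (\<lambda>k. g k x)"
      unfolding Cauchy_def
    proof (intro allI impI)
      fix e :: real assume "e > 0"
      then obtain N where N: "\<And>m n. m \<ge> N \<Longrightarrow> n \<ge> N \<Longrightarrow> Gn (\<lambda>x. g m x - g n x) < e" using cauchy by blast
      have "dist (g m x) (g n x) < e" if "m \<ge> N" "n \<ge> N" for m n
        using Gn_bounds(1)[OF gd x, of m n] N[OF that] by (simp add: dist_real_def)
      then show "\<exists>M. \<forall>m\<ge>M. \<forall>n\<ge>M. dist (g m x) (g n x) < e" by blast
    qed
    then show ?thesis using real_Cauchy_convergent convergent_def by blast
  qed
  then obtain G where G: "\<And>x. x \<in> {0..1} \<Longrightarrow> (\<lambda>k. g k x) \<longlonglongrightarrow> G x" by metis
  \<comment> \<open>One \<open>e\<close> for each of the three summands of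
    \<open>Gn\<close>.\<close>
  have tail: "(\<lambda>x. G x - g n x) \<in> G_space \<and> Gn (\<lambda>x. G x - g n x) \<le> 3 * e"
    if N: "\<And>m n. m \<ge> N \<Longrightarrow> n \<ge> N \<Longrightarrow> Gn (\<lambda>x. g m x - g n x) < e" and n: "n \<ge> N" for e N n
  proof -
    have a1: "(\<lambda>x. g (k + N) x - g n x) \<in> G_space" for k by (rule gd)
    have a2: "Hn (\<lambda>x. g (k + N) x - g n x) \<le> e" for k
      using Gn_bounds(3)[OF a1, of 0 k] N[OF _ n, of "k + N"] by simp
    have a3: "(\<lambda>k. g (k + N) x - g n x) \<longlonglongrightarrow> G x - g n x" if "x \<in> {0..1}" for x
      by (intro tendsto_intros LIMSEQ_ignore_initial_segment G that)
    have "uniform_limit {0..1} (\<lambda>k. deriv01 (g (k + N))) f sequentially"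
      using f unfolding uniform_limit_sequentially_iff by (meson trans_le_add1)
    then have "uniform_limit {0..1} (\<lambda>k x. deriv01 (g (k + N)) x - deriv01 (g n) x) (\<lambda>x. f x - deriv01 (g n) x) sequentially"
      by (intro uniform_limit_minus uniform_limit_const)
    then have a4: "uniform_limit {0..1} (\<lambda>k. deriv01 (\<lambda>x. g (k + N) x - g n x)) (\<lambda>x. f x - deriv01 (g n) x) sequentially"
      by (rule uniform_limit_cong'[THEN iffD1, rotated 2]) (simp_all add: deriv01_diff g)
    note c = G_closed[OF a1 a2 a3 a4]
    have e0: "e > 0" using N[OF n n] Gn_bounds(4)[OF gd, of 0 n n] by simp
    have "\<bar>G 0 - g n 0\<bar> \<le> e"
    proof (rule LIMSEQ_le_const2[OF tendsto_rabs[OF a3]])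
      show "\<exists>M. \<forall>k\<ge>M. \<bar>g (k + N) 0 - g n 0\<bar> \<le> e"
      proof -
        have "\<bar>g (k + N) 0 - g n 0\<bar> \<le> e" for k
          using Gn_bounds(1)[OF a1, of 0 k] N[OF _ n, of "k + N"] by simp
        then show ?thesis by blast
      qed
    qed simp
    moreover have "\<bar>deriv01 (\<lambda>x. G x - g n x) 0\<bar> \<le> e"
    proof -
      have "(\<lambda>k. deriv01 (\<lambda>x. g (k + N) x - g n x) 0) \<longlonglongrightarrow> deriv01 (\<lambda>x. G x - g n x) 0"
        using tendsto_uniform_limitI[OF a4, of 0] c(2)[of 0] by simp
      moreover have "\<bar>deriv01 (\<lambda>x. g (k + N) x - g n x) 0\<bar> \<le> e" for k
        using Gn_bounds(2)[OF a1, of 0 k] N[OF _ n, of "k + N"] by simp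
      ultimately show ?thesis using LIMSEQ_le_const2[OF tendsto_rabs] by blast
    qed
    ultimately show ?thesis using c by (simp add: Gn_def)
  qed
  obtain N0 where N0: "\<And>m n. m \<ge> N0 \<Longrightarrow> n \<ge> N0 \<Longrightarrow> Gn (\<lambda>x. g m x - g n x) < 1" using cauchy[of 1] by auto
  have "(\<lambda>x. (G x - g N0 x) + g N0 x) \<in> G_space"
    using tail[OF N0, of N0] by (intro GH.add_mem g) auto
  then have GG: "G \<in> G_space" by simp
  have Gn_sym: "Gn (\<lambda>x. a x - b x) = Gn (\<lambda>x. b x - a x)" if "a \<in> G_space" "b \<in> G_space" for a b
    using deriv01_diff[OF that, of 0] deriv01_diff[OF that(2,1), of 0] GH.nrm_scale[OF GH.diff_mem[OF that], of "-1"]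
    by (simp add: Gn_def)
  have "(\<lambda>n. Gn (\<lambda>x. g n x - G x)) \<longlonglongrightarrow> 0"
  proof (rule LIMSEQ_I)
    fix r :: real assume "r > 0"
    then obtain N where N: "\<And>m n. m \<ge> N \<Longrightarrow> n \<ge> N \<Longrightarrow> Gn (\<lambda>x. g m x - g n x) < r / 4"
      using cauchy[of "r/4"] by auto
    have "norm (Gn (\<lambda>x. g n x - G x) - 0) < r" if "n \<ge> N" for n
      using tail[OF N that] Gn_sym[OF g GG, of n] Gn_bounds(4)[OF GH.diff_mem[OF g GG], of 0 n] \<open>r > 0\<close> by simp
    then show "\<exists>N. \<forall>n\<ge>N. norm (Gn (\<lambda>x. g n x - G x) - 0) < r" by blast
  qed
  then show ?thesis using that GG by blast
qed

section \<open>Uniqueness of characteristic functions\<close>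

text \<open>The positive and negative parts of \<open>X\<close> are densities of two finite
  measures. Their masses agree by the case \<open>s = 0\<close>, and after division by the mass
  their images under \<open>U\<close> are distributions with equal characteristic functions. If the
  mass is zero, \<open>X\<close> vanishes almost everywhere.\<close>

lemma integral_zero_of_char_zero_real:
  fixes X U :: "'a \<Rightarrow> real"
  assumes X: "integrable P X" and U[measurable]: "U \<in> borel_measurable P"
    and zero: "\<And>s. (\<integral>\<omega>. complex_of_real (X \<omega>) * iexp (s * U \<omega>) \<partial>P) = 0"
    and B: "B \<in> sets borel"
  shows "(\<integral>\<omega>. X \<omega> * indicator B (U \<omega>) \<partial>P) = 0"
proof -
  have Xm[measurable]: "X \<in> borel_measurable P" using X by auto
  define p where "p = (\<lambda>\<omega>. max 0 (X \<omega>))"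
  define q where "q = (\<lambda>\<omega>. max 0 (- X \<omega>))"
  have pq[measurable]: "p \<in> borel_measurable P" "q \<in> borel_measurable P" unfolding p_def q_def by measurable
  have ip: "integrable P p" "integrable P q" unfolding p_def q_def using X by auto
  have Xpq: "X \<omega> = p \<omega> - q \<omega>" for \<omega> by (simp add: p_def q_def max_def)
  have nn: "0 \<le> p \<omega>" "0 \<le> q \<omega>" for \<omega> by (auto simp: p_def q_def)
  define m where "m = (\<integral>\<omega>. p \<omega> \<partial>P)"
  have iexp_int: "integrable P (\<lambda>\<omega>. complex_of_real (f \<omega>) * iexp (s * U \<omega>))" if "integrable P f" for f s
  proof (rule Bochner_Integration.integrable_bound[OF that])
    have "f \<in> borel_measurable P" using that by auto
    then show "(\<lambda>\<omega>. complex_of_real (f \<omega>) * iexp (s * U \<omega>)) \<in> borel_measurable P" by measurable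
  qed (simp add: norm_mult)
  have split: "(\<integral>\<omega>. complex_of_real (p \<omega>) * iexp (s * U \<omega>) \<partial>P) = (\<integral>\<omega>. complex_of_real (q \<omega>) * iexp (s * U \<omega>) \<partial>P)" for s
    using zero[of s] iexp_int[OF ip(1), of s] iexp_int[OF ip(2), of s] by (simp add: Xpq left_diff_distrib)
  have mq: "m = (\<integral>\<omega>. q \<omega> \<partial>P)"
    using split[of 0] unfolding m_def by simp
  show ?thesis
  proof (cases "m = 0")
    case True
    then have "AE \<omega> in P. p \<omega> = 0" "AE \<omega> in P. q \<omega> = 0"
      using integral_nonneg_eq_0_iff_AE[OF ip(1)] integral_nonneg_eq_0_iff_AE[OF ip(2)] nn mq by (auto simp: m_def)
    then have "AE \<omega> in P. X \<omega> * indicator B (U \<omega>) = 0" by eventually_elim (simp add: Xpq)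
    then show ?thesis by (simp add: integral_eq_zero_AE)
  next
    case False
    then have m0: "m > 0" using integral_nonneg_AE[of p P] nn by (simp add: m_def less_le)
    define D where "D = (\<lambda>f. distr (density P (\<lambda>\<omega>. ennreal (f \<omega> / m))) borel U)"
    have rd: "real_distribution (D f)" and ch: "char (D f) s = (\<integral>\<omega>. complex_of_real (f \<omega>) * iexp (s * U \<omega>) \<partial>P) / m"
      and ms: "measure (D f) B = (\<integral>\<omega>. f \<omega> * indicator B (U \<omega>) \<partial>P) / m"
      if f[measurable]: "f \<in> borel_measurable P" and i: "integrable P f" and n: "\<And>\<omega>. 0 \<le> f \<omega>" and tot: "(\<integral>\<omega>. f \<omega> \<partial>P) = m" for f s
    proof -
      have e1: "emeasure (density P (\<lambda>\<omega>. ennreal (f \<omega> / m))) (space P) = 1"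
      proof -
        have "emeasure (density P (\<lambda>\<omega>. ennreal (f \<omega> / m))) (space P) = (\<integral>\<^sup>+\<omega>. ennreal (f \<omega> / m) \<partial>P)"
          by (subst emeasure_density) (auto intro!: nn_integral_cong)
        also have "\<dots> = ennreal (\<integral>\<omega>. f \<omega> / m \<partial>P)"
          using i n m0 by (intro nn_integral_eq_integral) auto
        also have "(\<integral>\<omega>. f \<omega> / m \<partial>P) = 1" using tot m0 by simp
        finally show ?thesis by simp
      qed
      interpret D: prob_space "density P (\<lambda>\<omega>. ennreal (f \<omega> / m))"
        using e1 by (intro prob_spaceI) (simp only: space_density)
      show rd: "real_distribution (D f)"
        unfolding D_def by (rule D.real_distribution_distr) simp
      show "char (D f) s = (\<integral>\<omega>. complex_of_real (f \<omega>) * iexp (s * U \<omega>) \<partial>P) / m"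
        unfolding char_def D_def
        using m0 n by (subst integral_distr) (auto simp: integral_density scaleR_conv_of_real)
      have "measure (D f) B = (\<integral>x. indicator B x \<partial>D f)"
        using B by (simp add: D_def)
      also have "\<dots> = (\<integral>\<omega>. f \<omega> * indicator B (U \<omega>) \<partial>P) / m"
        unfolding D_def using m0 n B by (subst integral_distr) (auto simp: integral_density)
      finally show "measure (D f) B = (\<integral>\<omega>. f \<omega> * indicator B (U \<omega>) \<partial>P) / m" .
    qed
    have "char (D p) = char (D q)"
      using ch[OF pq(1) ip(1) nn(1) m_def[symmetric]] ch[OF pq(2) ip(2) nn(2) mq[symmetric]] split by auto
    then have "D p = D q"
      using rd[OF pq(1) ip(1) nn(1) m_def[symmetric]] rd[OF pq(2) ip(2) nn(2) mq[symmetric]] Levy_uniqueness by blast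
    then have eq: "(\<integral>\<omega>. p \<omega> * indicator B (U \<omega>) \<partial>P) = (\<integral>\<omega>. q \<omega> * indicator B (U \<omega>) \<partial>P)"
      using ms[OF pq(1) ip(1) nn(1) m_def[symmetric]] ms[OF pq(2) ip(2) nn(2) mq[symmetric]] m0 by simp
    have "integrable P (\<lambda>\<omega>. f \<omega> * indicator B (U \<omega>))" if "integrable P f" for f :: "'a \<Rightarrow> real"
      by (rule Bochner_Integration.integrable_bound[OF that]) (use that B in \<open>auto simp: indicator_def\<close>)
    then show ?thesis using eq ip by (simp add: Xpq left_diff_distrib)
  qed
qed

text \<open>Replacing \<open>s\<close> by \<open>-s\<close> and conjugating shows that the conjugate
  of \<open>X\<close> satisfies the same hypothesis; hence so do the real and imaginary parts of
  \<open>X\<close>.\<close>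

lemma integral_zero_of_char_zero_complex:
  fixes X :: "'a \<Rightarrow> complex" and U :: "'a \<Rightarrow> real"
  assumes X: "integrable P X" and U[measurable]: "U \<in> borel_measurable P"
    and zero: "\<And>s. (\<integral>\<omega>. X \<omega> * iexp (s * U \<omega>) \<partial>P) = 0"
    and B: "B \<in> sets borel"
  shows "(\<integral>\<omega>. X \<omega> * indicator B (U \<omega>) \<partial>P) = 0"
proof -
  have Xm[measurable]: "X \<in> borel_measurable P" using X by auto
  have int: "integrable P (\<lambda>\<omega>. Y \<omega> * iexp (s * U \<omega>))" if "integrable P Y" for Y :: "'a \<Rightarrow> complex" and s
  proof (rule Bochner_Integration.integrable_bound[OF that])
    have "Y \<in> borel_measurable P" using that by auto
    then show "(\<lambda>\<omega>. Y \<omega> * iexp (s * U \<omega>)) \<in> borel_measurable P" by measurable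
  qed (simp add: norm_mult)
  have czero: "(\<integral>\<omega>. cnj (X \<omega>) * iexp (s * U \<omega>) \<partial>P) = 0" for s
  proof -
    have "(\<integral>\<omega>. cnj (X \<omega>) * iexp (s * U \<omega>) \<partial>P) = (\<integral>\<omega>. cnj (X \<omega> * iexp ((- s) * U \<omega>)) \<partial>P)"
      by (intro Bochner_Integration.integral_cong refl) (simp add: exp_cnj)
    also have "\<dots> = cnj (\<integral>\<omega>. X \<omega> * iexp ((- s) * U \<omega>) \<partial>P)" by (rule Bochner_Integration.integral_cnj)
    finally show ?thesis using zero[of "- s"] by simp
  qed
  have iX: "integrable P (\<lambda>\<omega>. cnj (X \<omega>))" using X by simp
  have "(\<integral>\<omega>. complex_of_real (Re (X \<omega>)) * iexp (s * U \<omega>) \<partial>P) = 0" for s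
  proof -
    have "complex_of_real (Re (X \<omega>)) * iexp (s * U \<omega>) = (X \<omega> * iexp (s * U \<omega>) + cnj (X \<omega>) * iexp (s * U \<omega>)) / 2" for \<omega>
      by (simp add: complex_add_cnj distrib_right[symmetric])
    then have "(\<integral>\<omega>. complex_of_real (Re (X \<omega>)) * iexp (s * U \<omega>) \<partial>P) =
        (\<integral>\<omega>. (X \<omega> * iexp (s * U \<omega>) + cnj (X \<omega>) * iexp (s * U \<omega>)) / 2 \<partial>P)" by presburger
    also have "\<dots> = 0" using zero[of s] czero[of s] int[OF X, of s] int[OF iX, of s] by simp
    finally show ?thesis .
  qed
  then have re: "(\<integral>\<omega>. Re (X \<omega>) * indicator B (U \<omega>) \<partial>P) = 0"
    by (intro integral_zero_of_char_zero_real[OF _ U _ B]) (use X in auto)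
  have "(\<integral>\<omega>. complex_of_real (Im (X \<omega>)) * iexp (s * U \<omega>) \<partial>P) = 0" for s
  proof -
    have "complex_of_real (Im (X \<omega>)) * iexp (s * U \<omega>) = (X \<omega> * iexp (s * U \<omega>) - cnj (X \<omega>) * iexp (s * U \<omega>)) / (2 * \<i>)" for \<omega>
    proof -
      have "complex_of_real (Im (X \<omega>)) = (X \<omega> - cnj (X \<omega>)) / (2 * \<i>)" by (simp add: complex_eq_iff)
      then show ?thesis by (simp only:) (simp add: left_diff_distrib diff_divide_distrib)
    qed
    then have "(\<integral>\<omega>. complex_of_real (Im (X \<omega>)) * iexp (s * U \<omega>) \<partial>P) =
        (\<integral>\<omega>. (X \<omega> * iexp (s * U \<omega>) - cnj (X \<omega>) * iexp (s * U \<omega>)) / (2 * \<i>) \<partial>P)" by presburger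
    also have "\<dots> = 0" using zero[of s] czero[of s] int[OF X, of s] int[OF iX, of s] by simp
    finally show ?thesis .
  qed
  then have im: "(\<integral>\<omega>. Im (X \<omega>) * indicator B (U \<omega>) \<partial>P) = 0"
    by (intro integral_zero_of_char_zero_real[OF _ U _ B]) (use X in auto)
  have XB: "integrable P (\<lambda>\<omega>. X \<omega> * indicator B (U \<omega>))"
    by (rule Bochner_Integration.integrable_bound[OF X]) (use B in \<open>auto simp: indicator_def\<close>)
  show ?thesis
  proof (rule complex_eqI)
    have "Re (\<integral>\<omega>. X \<omega> * indicator B (U \<omega>) \<partial>P) = (\<integral>\<omega>. Re (X \<omega> * indicator B (U \<omega>)) \<partial>P)" by (rule integral_Re[symmetric, OF XB])
    also have "\<dots> = (\<integral>\<omega>. Re (X \<omega>) * indicator B (U \<omega>) \<partial>P)" by (intro Bochner_Integration.integral_cong refl) (auto simp: indicator_def)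
    finally show "Re (\<integral>\<omega>. X \<omega> * indicator B (U \<omega>) \<partial>P) = Re 0" using re by simp
    have "Im (\<integral>\<omega>. X \<omega> * indicator B (U \<omega>) \<partial>P) = (\<integral>\<omega>. Im (X \<omega> * indicator B (U \<omega>)) \<partial>P)" by (rule integral_Im[symmetric, OF XB])
    also have "\<dots> = (\<integral>\<omega>. Im (X \<omega>) * indicator B (U \<omega>) \<partial>P)" by (intro Bochner_Integration.integral_cong refl) (auto simp: indicator_def)
    finally show "Im (\<integral>\<omega>. X \<omega> * indicator B (U \<omega>) \<partial>P) = Im 0" using im by simp
  qed
qed

text \<open>Levy's uniqueness theorem is used for one coordinate at a time: a step of the induction
  trades the exponential in coordinate \<open>k\<close> for an indicator. The exponentials not yet
  traded belong to the weight, which is why the one-dimensional statement is required for complex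
  \<open>X\<close>.\<close>

lemma integral_zero_of_char_zero_partial:
  fixes X :: "'a \<Rightarrow> complex" and W :: "'a \<Rightarrow> real ^ 'p" and S :: "'p set"
  assumes X: "integrable P X" and W[measurable]: "W \<in> borel_measurable P"
    and zero: "\<And>t. (\<integral>\<omega>. X \<omega> * iexp (W \<omega> \<bullet> t) \<partial>P) = 0"
    and B: "\<And>k. B k \<in> sets borel"
  shows "(\<integral>\<omega>. X \<omega> * (\<Prod>k\<in>S. indicator (B k) (W \<omega> $ k)) * iexp (\<Sum>k\<in>-S. W \<omega> $ k * t $ k) \<partial>P) = 0"
proof -
  have "finite S" by simp
  then show ?thesis
  proof (induction S arbitrary: t rule: finite_induct)
    case empty
    then show ?case using zero[of t] by (simp add: inner_vec_def)
  next
    case (insert k S)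
    have Xm[measurable]: "X \<in> borel_measurable P" using X by auto
    have Wk[measurable]: "(\<lambda>\<omega>. W \<omega> $ j) \<in> borel_measurable P" for j
      unfolding cart_eq_inner_axis by measurable
    define X' where "X' = (\<lambda>\<omega>. X \<omega> * (\<Prod>k\<in>S. indicator (B k) (W \<omega> $ k)) * iexp (\<Sum>j\<in>-insert k S. W \<omega> $ j * t $ j))"
    have Xm': "X' \<in> borel_measurable P" unfolding X'_def using B by measurable
    have iX': "integrable P X'"
    proof (rule Bochner_Integration.integrable_bound[OF X Xm'])
      have "norm (\<Prod>k\<in>S. indicator (B k) (W \<omega> $ k) :: complex) \<le> 1" for \<omega>
        unfolding prod_norm[symmetric] by (rule prod_le_1) (auto simp: indicator_def)
      then show "AE \<omega> in P. norm (X' \<omega>) \<le> norm (X \<omega>)"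
        by (auto simp: X'_def norm_mult mult_left_le)
    qed
    have split: "(\<Sum>j\<in>-S. f j) = f k + (\<Sum>j\<in>-insert k S. f j)" for f :: "'p \<Rightarrow> real"
    proof -
      have "- S = insert k (- insert k S)" using insert.hyps by auto
      then show ?thesis by (metis (no_types, lifting) ComplD finite insertI1 sum.insert)
    qed
    have "(\<integral>\<omega>. X' \<omega> * iexp (s * W \<omega> $ k) \<partial>P) = 0" for s
    proof -
      have "X' \<omega> * iexp (s * W \<omega> $ k) = X \<omega> * (\<Prod>k\<in>S. indicator (B k) (W \<omega> $ k)) *
          iexp (\<Sum>j\<in>-S. W \<omega> $ j * (\<chi> j. if j = k then s else t $ j) $ j)" for \<omega>
      proof -
        have "(\<Sum>j\<in>-insert k S. W \<omega> $ j * (if j = k then s else t $ j)) = (\<Sum>j\<in>-insert k S. W \<omega> $ j * t $ j)"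
          by (rule sum.cong) auto
        then show ?thesis
          unfolding X'_def split by (simp add: exp_add distrib_left mult_ac)
      qed
      then show ?thesis using insert.IH[of "\<chi> j. if j = k then s else t $ j"] by simp
    qed
    from integral_zero_of_char_zero_complex[OF iX' Wk this B[of k]]
    show ?case using insert.hyps by (simp add: X'_def mult_ac)
  qed
qed

text \<open>The product of interval indicators over all coordinates is the indicator of a box. Boxes
  generate the Borel sets and are stable under intersection, so the measures whose densities are the
  two parts of \<open>X\<close> have equal images under \<open>W\<close>.\<close>

lemma integral_zero_of_char_zero:
  fixes X :: "'a \<Rightarrow> real" and W :: "'a \<Rightarrow> real ^ 'p"
  assumes X: "integrable P X" and W[measurable]: "W \<in> borel_measurable P"
    and zero: "\<And>t. (\<integral>\<omega>. complex_of_real (X \<omega>) * iexp (W \<omega> \<bullet> t) \<partial>P) = 0"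
    and B: "B \<in> sets borel"
  shows "(\<integral>\<omega>. X \<omega> * indicator B (W \<omega>) \<partial>P) = 0"
proof -
  have Xm[measurable]: "X \<in> borel_measurable P" using X by auto
  have box: "(\<integral>\<omega>. X \<omega> * indicator (box a b) (W \<omega>) \<partial>P) = 0" for a b
  proof -
    have "(\<integral>\<omega>. complex_of_real (X \<omega>) * (\<Prod>k\<in>UNIV. indicator {a $ k<..<b $ k} (W \<omega> $ k)) \<partial>P) = 0"
      using integral_zero_of_char_zero_partial[of P "\<lambda>\<omega>. complex_of_real (X \<omega>)" W "\<lambda>k. {a $ k<..<b $ k}" UNIV] X zero by simp
    moreover have "(\<Prod>k\<in>UNIV. indicator {a $ k<..<b $ k} (w $ k)) = (indicator (box a b) w :: complex)" for w :: "real^'p"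
    proof (cases "w \<in> box a b")
      case True
      then show ?thesis by (simp add: mem_box_cart)
    next
      case False
      then obtain k where "w $ k \<notin> {a $ k<..<b $ k}" by (auto simp: mem_box_cart)
      then have "(\<Prod>k\<in>UNIV. indicator {a $ k<..<b $ k} (w $ k)) = (0 :: complex)"
        by (intro prod_zero) (auto simp: indicator_def intro!: exI[of _ k] split: if_splits)
      then show ?thesis using False by simp
    qed
    moreover have "complex_of_real (X \<omega>) * indicator (box a b) (W \<omega>) = complex_of_real (X \<omega> * indicator (box a b) (W \<omega>))" for \<omega>
      by (simp add: indicator_def)
    ultimately have "(\<integral>\<omega>. complex_of_real (X \<omega> * indicator (box a b) (W \<omega>)) \<partial>P) = 0"
      by simp
    then show ?thesis by (simp only: integral_complex_of_real of_real_eq_0_iff)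
  qed
  define p where "p = (\<lambda>\<omega>. max 0 (X \<omega>))"
  define q where "q = (\<lambda>\<omega>. max 0 (- X \<omega>))"
  have pq[measurable]: "p \<in> borel_measurable P" "q \<in> borel_measurable P" unfolding p_def q_def by measurable
  have ip: "integrable P p" "integrable P q" unfolding p_def q_def using X by auto
  have Xpq: "X \<omega> = p \<omega> - q \<omega>" for \<omega> by (simp add: p_def q_def max_def)
  have nn: "0 \<le> p \<omega>" "0 \<le> q \<omega>" for \<omega> by (auto simp: p_def q_def)
  define D where "D = (\<lambda>f. distr (density P (\<lambda>\<omega>. ennreal (f \<omega>))) borel W)"
  have iB: "integrable P (\<lambda>\<omega>. f \<omega> * indicator C (W \<omega>))" if "integrable P f" "C \<in> sets borel" for f :: "'a \<Rightarrow> real" and C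
    by (rule Bochner_Integration.integrable_bound[OF that(1)]) (use that in \<open>auto simp: indicator_def\<close>)
  have em: "emeasure (D f) C = ennreal (\<integral>\<omega>. f \<omega> * indicator C (W \<omega>) \<partial>P)"
    if f[measurable]: "f \<in> borel_measurable P" and i: "integrable P f" and n: "\<And>\<omega>. 0 \<le> f \<omega>" and C: "C \<in> sets borel" for f C
  proof -
    have "emeasure (D f) C = (\<integral>\<^sup>+\<omega>. ennreal (f \<omega>) * indicator (W -` C \<inter> space P) \<omega> \<partial>P)"
      unfolding D_def using C by (subst emeasure_distr) (auto intro!: emeasure_density measurable_sets[OF W])
    also have "\<dots> = (\<integral>\<^sup>+\<omega>. ennreal (f \<omega> * indicator C (W \<omega>)) \<partial>P)"
      by (rule nn_integral_cong) (auto simp: indicator_def)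
    also have "\<dots> = ennreal (\<integral>\<omega>. f \<omega> * indicator C (W \<omega>) \<partial>P)"
      using iB[OF i C] n by (intro nn_integral_eq_integral) auto
    finally show ?thesis .
  qed
  note emp = em[OF pq(1) ip(1) nn(1)] and emq = em[OF pq(2) ip(2) nn(2)]
  have "D p = D q"
  proof (rule measure_eqI_generator_eq[where E="range (\<lambda>(a, b). box a b)" and \<Omega>=UNIV and A="\<lambda>n. box (\<chi> i. - real n) (\<chi> i. real n)"])
    show "Int_stable (range (\<lambda>(a, b :: real^'p). box a b))"
      unfolding Int_stable_def by (auto simp: box_Int_box)
    show "emeasure (D p) Y = emeasure (D q) Y" if "Y \<in> range (\<lambda>(a, b). box a b)" for Y
    proof -
      obtain a b where Y: "Y = box a b" using \<open>Y \<in> _\<close> by auto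
      have "(\<integral>\<omega>. p \<omega> * indicator Y (W \<omega>) \<partial>P) = (\<integral>\<omega>. q \<omega> * indicator Y (W \<omega>) \<partial>P)"
        using box[of a b] iB[OF ip(1), of Y] iB[OF ip(2), of Y] by (simp add: Xpq left_diff_distrib Y)
      then show ?thesis using emp[of Y] emq[of Y] by (simp add: Y)
    qed
    show "sets (D p) = sigma_sets UNIV (range (\<lambda>(a, b). box a b))"
      "sets (D q) = sigma_sets UNIV (range (\<lambda>(a, b). box a b))"
      by (simp_all add: D_def borel_eq_box)
    show "range (\<lambda>n. box (\<chi> i. - real n) (\<chi> i. real n)) \<subseteq> range (\<lambda>(a, b :: real^'p). box a b)" by auto
    show "(\<Union>n. box (\<chi> i. - real n) (\<chi> i. real n)) = (UNIV :: (real^'p) set)"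
    proof -
      have "\<exists>n. x \<in> box (\<chi> i. - real n) (\<chi> i. real n)" for x :: "real^'p"
      proof -
        obtain n where n: "norm x < real n" using reals_Archimedean2 by blast
        have "- real n < x $ i \<and> x $ i < real n" for i
          using component_le_norm_cart[of x i] n by linarith
        then show ?thesis by (auto simp: mem_box_cart)
      qed
      then show ?thesis by blast
    qed
    show "emeasure (D p) (box (\<chi> i. - real n) (\<chi> i. real n)) \<noteq> \<infinity>" for n by (subst emp) auto
  qed auto
  then have "(\<integral>\<omega>. p \<omega> * indicator B (W \<omega>) \<partial>P) = (\<integral>\<omega>. q \<omega> * indicator B (W \<omega>) \<partial>P)"
    using emp[OF B] emq[OF B] nn by (simp add: integral_nonneg_AE)
  then show ?thesis using iB[OF ip(1) B] iB[OF ip(2) B] by (simp add: Xpq left_diff_distrib)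
qed

section \<open>The operator\<close>

lemma Re_mult_cnj_inner: "Re (a * cnj b) = a \<bullet> b"
  by (simp add: inner_complex_def)

lemma L2_space_inner_integrable:
  assumes "f \<in> L2_space M" "g \<in> L2_space M"
  shows "integrable M (\<lambda>t. f t \<bullet> g t)"
proof (rule Bochner_Integration.integrable_bound)
  show "integrable M (\<lambda>t. (cmod (f t))\<^sup>2 + (cmod (g t))\<^sup>2)" using assms by (simp add: L2_space_def)
  show "(\<lambda>t. f t \<bullet> g t) \<in> borel_measurable M"
    using assms by (intro borel_measurable_inner) (auto simp: L2_space_def)
  show "AE t in M. norm (f t \<bullet> g t) \<le> norm ((cmod (f t))\<^sup>2 + (cmod (g t))\<^sup>2)"
  proof (rule AE_I2)
    fix t
    have "\<bar>f t \<bullet> g t\<bar> \<le> cmod (f t) * cmod (g t)" by (rule Cauchy_Schwarz_ineq2)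
    also have "2 * \<dots> \<le> (cmod (f t))\<^sup>2 + (cmod (g t))\<^sup>2"
      using sum_squares_bound[of "cmod (f t)" "cmod (g t)"] by (simp add: mult.assoc)
    finally show "norm (f t \<bullet> g t) \<le> norm ((cmod (f t))\<^sup>2 + (cmod (g t))\<^sup>2)"
      using mult_nonneg_nonneg[of "cmod (f t)" "cmod (g t)"] by simp
  qed
qed

interpretation L2: psd_form "L2_space M" "L2_inner M" for M :: "'b measure"
proof
  fix f g h :: "'b \<Rightarrow> complex" and c :: real
  assume f: "f \<in> L2_space M"
  then have fm: "f \<in> borel_measurable M" by (simp add: L2_space_def)
  show "(\<lambda>x. c *\<^sub>R f x) \<in> L2_space M"
    using f by (auto simp: L2_space_def power_mult_distrib intro!: borel_measurable_scaleR)
  show "0 \<le> L2_inner M f f"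
    unfolding L2_inner_def Re_mult_cnj_inner by (rule integral_nonneg_AE) simp
  show "L2_inner M (\<lambda>x. c *\<^sub>R f x) h = c * L2_inner M f h"
    unfolding L2_inner_def Re_mult_cnj_inner by simp
  assume g: "g \<in> L2_space M"
  then have gm: "g \<in> borel_measurable M" by (simp add: L2_space_def)
  have "(cmod (f x + g x))\<^sup>2 = (cmod (f x))\<^sup>2 + 2 * (f x \<bullet> g x) + (cmod (g x))\<^sup>2" for x
    by (simp add: power2_norm_eq_inner inner_add inner_commute)
  then have "integrable M (\<lambda>x. (cmod (f x + g x))\<^sup>2)"
    using f g L2_space_inner_integrable[OF f g] by (simp add: L2_space_def)
  then show "(\<lambda>x. f x + g x) \<in> L2_space M"
    using fm gm by (auto simp: L2_space_def intro!: borel_measurable_add)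
  show "L2_inner M f g = L2_inner M g f"
    unfolding L2_inner_def Re_mult_cnj_inner by (simp add: inner_commute)
  assume h: "h \<in> L2_space M"
  show "L2_inner M (\<lambda>x. f x + g x) h = L2_inner M f h + L2_inner M g h"
    unfolding L2_inner_def Re_mult_cnj_inner
    using L2_space_inner_integrable[OF f h] L2_space_inner_integrable[OF g h] by (simp add: inner_add_left)
qed

lemma L2_inner_self: "L2_inner M f f = (\<integral>t. (cmod (f t))\<^sup>2 \<partial>M)"
  unfolding L2_inner_def Re_mult_cnj_inner by (simp add: power2_norm_eq_inner)

lemma L2_inner_zero_AE:
  assumes "f \<in> L2_space M" "L2_inner M f f = 0" shows "AE t in M. f t = 0"
proof -
  have "integrable M (\<lambda>t. (cmod (f t))\<^sup>2)" using assms by (simp add: L2_space_def)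
  from integral_nonneg_eq_0_iff_AE[OF this] have "AE t in M. (cmod (f t))\<^sup>2 = 0"
    using assms(2) by (simp add: L2_inner_self)
  then show ?thesis by simp
qed

lemma L2_inner_cong_AE:
  assumes "f \<in> L2_space M" "f' \<in> L2_space M" "g \<in> L2_space M" "AE t in M. f t = f' t"
  shows "L2_inner M f g = L2_inner M f' g"
  unfolding L2_inner_def Re_mult_cnj_inner
  by (rule integral_cong_AE) (use assms L2_space_inner_integrable[of _ M g] in \<open>auto elim!: eventually_mono\<close>)

lemma bounded_mem_L2_space:
  assumes "finite_measure M" "f \<in> borel_measurable M" "\<And>t. cmod (f t) \<le> K"
  shows "f \<in> L2_space M"
proof -
  interpret finite_measure M by fact
  have "integrable M (\<lambda>t. (cmod (f t))\<^sup>2)"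
  proof (rule integrable_const_bound[of _ "K\<^sup>2"])
    show "AE t in M. norm ((cmod (f t))\<^sup>2) \<le> K\<^sup>2" using assms(3) by (auto intro!: power_mono)
  qed (use assms(2) in measurable)
  then show ?thesis using assms(2) by (simp add: L2_space_def)
qed

lemma L2_nrm_le:
  assumes "prob_space M" "f \<in> borel_measurable M" "\<And>t. cmod (f t) \<le> K"
  shows "L2.nrm M f \<le> K"
proof -
  interpret prob_space M by fact
  have K: "K \<ge> 0" using assms(3) norm_ge_zero order_trans by blast
  have f: "f \<in> L2_space M" using bounded_mem_L2_space[OF finite_measure_axioms assms(2,3)] .
  have "L2_inner M f f \<le> K\<^sup>2"
    unfolding L2_inner_self
  proof (rule integral_le_const)
    show "integrable M (\<lambda>t. (cmod (f t))\<^sup>2)" using f by (simp add: L2_space_def)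
    show "AE t in M. (cmod (f t))\<^sup>2 \<le> K\<^sup>2" using assms(3) by (auto intro!: power_mono)
  qed
  then show ?thesis unfolding L2.nrm_def using K by (simp add: real_le_lsqrt)
qed

text \<open>Collects what concerns only the joint law of \<open>Z\<close> and \<open>W\<close>; the
  response and the sample are added later. Injectivity is phrased as equality on
  \<open>[0,1]\<close>, since functions in \<open>G_space\<close> are arbitrary elsewhere.\<close>

locale npiv = prob_space P + mu: prob_space \<mu>
  for P :: "'a measure" and \<mu> :: "(real ^ 'p) measure" +
  fixes Z :: "'a \<Rightarrow> real" and W :: "'a \<Rightarrow> real ^ 'p"
  assumes Zm[measurable]: "Z \<in> borel_measurable P" and Wm[measurable]: "W \<in> borel_measurable P"
    and Z01: "\<And>\<omega>. \<omega> \<in> space P \<Longrightarrow> Z \<omega> \<in> {0..1}"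
    and sets_mu[measurable_cong, simp]: "sets \<mu> = sets borel"
    and supp: "measure_support \<mu> = UNIV"
    and inj: "\<And>g1 g2 z. g1 \<in> G_space \<Longrightarrow> g2 \<in> G_space \<Longrightarrow>
      (AE \<omega> in P. real_cond_exp P (sigma_gen P W) (\<lambda>\<omega>. g1 (Z \<omega>)) \<omega>
         = real_cond_exp P (sigma_gen P W) (\<lambda>\<omega>. g2 (Z \<omega>)) \<omega>) \<Longrightarrow> z \<in> {0..1} \<Longrightarrow> g1 z = g2 z"
begin

text \<open>Used on all of \<open>G_space\<close> and not only on \<open>H_space\<close>: the
  operator \<open>op_B\<close> is then its restriction to affine functions.\<close>

abbreviation A :: "(real \<Rightarrow> real) \<Rightarrow> real ^ 'p \<Rightarrow> complex" where "A \<equiv> op_A P Z W"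

abbreviation An :: "(real \<Rightarrow> real) \<Rightarrow> real" where "An g \<equiv> L2.nrm \<mu> (A g)"

lemma space_mu[simp]: "space \<mu> = UNIV"
  using sets_eq_imp_space_eq[OF sets_mu] by simp

text \<open>Only the values on \<open>[0,1]\<close> are regular, so \<open>g\<close> is replaced by
  its constant extension before composing.\<close>

lemma G_comp_measurable:
  assumes "g \<in> G_space" shows "(\<lambda>\<omega>. g (Z \<omega>)) \<in> borel_measurable P"
proof -
  have "continuous_on UNIV (\<lambda>x. g (clampi 0 1 x))"
    by (rule continuous_on_compose2[OF G_continuous[OF assms] continuous_on_clampi]) (auto simp: clampi_def)
  then have "(\<lambda>x. g (clampi 0 1 x)) \<in> borel_measurable borel" by (rule borel_measurable_continuous_onI)
  then have "(\<lambda>\<omega>. g (clampi 0 1 (Z \<omega>))) \<in> borel_measurable P" by (rule measurable_compose[OF Zm])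
  moreover have "g (clampi 0 1 (Z \<omega>)) = g (Z \<omega>)" if "\<omega> \<in> space P" for \<omega>
    using Z01[OF that] by (simp add: clampi_def)
  ultimately show ?thesis by (simp cong: measurable_cong)
qed

lemma A_integrand:
  assumes "g \<in> G_space"
  shows "integrable P (\<lambda>\<omega>. complex_of_real (g (Z \<omega>)) * iexp (W \<omega> \<bullet> t))" "integrable P (\<lambda>\<omega>. g (Z \<omega>))"
proof -
  have gm[measurable]: "(\<lambda>\<omega>. g (Z \<omega>)) \<in> borel_measurable P" by (rule G_comp_measurable[OF assms])
  have b: "\<bar>g (Z \<omega>)\<bar> \<le> Gn g" if "\<omega> \<in> space P" for \<omega> using Gn_bounds(1)[OF assms Z01[OF that]] .
  show "integrable P (\<lambda>\<omega>. complex_of_real (g (Z \<omega>)) * iexp (W \<omega> \<bullet> t))"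
    by (rule integrable_const_bound[of _ "Gn g"]) (use b in \<open>auto simp: norm_mult\<close>)
  show "integrable P (\<lambda>\<omega>. g (Z \<omega>))"
    by (rule integrable_const_bound[of _ "Gn g"]) (use b in auto)
qed

lemma A_lincomb:
  assumes "f \<in> G_space" "g \<in> G_space"
  shows "A (\<lambda>x. a * f x + b * g x) t = a *\<^sub>R A f t + b *\<^sub>R A g t"
  using A_integrand(1)[OF assms(1), of t] A_integrand(1)[OF assms(2), of t]
  by (simp add: op_A_def distrib_right mult.assoc scaleR_conv_of_real)

lemma A_add: "f \<in> G_space \<Longrightarrow> g \<in> G_space \<Longrightarrow> A (\<lambda>x. f x + g x) = (\<lambda>t. A f t + A g t)"
  using A_lincomb[of f g 1 1] by (simp add: fun_eq_iff)

lemma A_diff: "f \<in> G_space \<Longrightarrow> g \<in> G_space \<Longrightarrow> A (\<lambda>x. f x - g x) = (\<lambda>t. A f t - A g t)"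
  using A_lincomb[of f g 1 "-1"] by (simp add: fun_eq_iff)

lemma A_scale: "f \<in> G_space \<Longrightarrow> A (\<lambda>x. c * f x) = (\<lambda>t. c *\<^sub>R A f t)"
  using A_lincomb[of f f c 0] by (simp add: fun_eq_iff)

lemma A_bound:
  assumes "g \<in> G_space" and K: "\<And>z. z \<in> {0..1} \<Longrightarrow> \<bar>g z\<bar> \<le> K"
  shows "cmod (A g t) \<le> K"
proof -
  have "cmod (A g t) \<le> (\<integral>\<omega>. norm (complex_of_real (g (Z \<omega>)) * iexp (W \<omega> \<bullet> t)) \<partial>P)"
    unfolding op_A_def by (rule integral_norm_bound)
  also have "\<dots> \<le> K"
  proof (rule integral_le_const[OF integrable_norm[OF A_integrand(1)[OF assms(1)]]])
    show "AE \<omega> in P. norm (complex_of_real (g (Z \<omega>)) * iexp (W \<omega> \<bullet> t)) \<le> K"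
      using K[OF Z01] by (intro AE_I2) (simp add: norm_mult)
  qed
  finally show ?thesis .
qed

lemma A_continuous: assumes "g \<in> G_space" shows "continuous_on UNIV (A g)"
proof (rule continuous_on_sequentiallyI)
  fix X :: "nat \<Rightarrow> real^'p" and a assume X: "X \<longlonglongrightarrow> a"
  have gm[measurable]: "(\<lambda>\<omega>. g (Z \<omega>)) \<in> borel_measurable P" by (rule G_comp_measurable[OF assms])
  show "(\<lambda>n. A g (X n)) \<longlonglongrightarrow> A g a"
    unfolding op_A_def
  proof (rule integral_dominated_convergence[where w="\<lambda>_. Gn g"])
    show "AE \<omega> in P. (\<lambda>n. complex_of_real (g (Z \<omega>)) * iexp (W \<omega> \<bullet> X n)) \<longlonglongrightarrow> complex_of_real (g (Z \<omega>)) * iexp (W \<omega> \<bullet> a)"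
      using X by (intro AE_I2 tendsto_intros)
    show "AE \<omega> in P. norm (complex_of_real (g (Z \<omega>)) * iexp (W \<omega> \<bullet> X n)) \<le> Gn g" for n
      using Gn_bounds(1)[OF assms Z01] by (intro AE_I2) (simp add: norm_mult)
  qed auto
qed

lemma A_measurable: "g \<in> G_space \<Longrightarrow> A g \<in> borel_measurable \<mu>"
  using borel_measurable_continuous_onI[OF A_continuous] by simp

lemma A_mem: "g \<in> G_space \<Longrightarrow> A g \<in> L2_space \<mu>"
  by (rule bounded_mem_L2_space[OF mu.finite_measure_axioms A_measurable, of g "Gn g"])
    (auto intro: A_bound Gn_bounds(1))

lemma An_le_sup: "g \<in> G_space \<Longrightarrow> (\<And>z. z \<in> {0..1} \<Longrightarrow> \<bar>g z\<bar> \<le> K) \<Longrightarrow> An g \<le> K"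
  by (rule L2_nrm_le[OF mu.prob_space_axioms A_measurable A_bound]) auto

lemma An_le_Gn: "g \<in> G_space \<Longrightarrow> An g \<le> Gn g"
  using An_le_sup Gn_bounds(1) by blast

lemma An_nonneg: "g \<in> G_space \<Longrightarrow> 0 \<le> An g" using L2.nrm_nonneg[OF A_mem] .

lemma A_injective:
  assumes g: "g \<in> G_space" and zero: "AE t in \<mu>. A g t = 0" and z: "z \<in> {0..1}"
  shows "g z = 0"
proof -
  have all0: "A g t = 0" for t
  proof (rule ccontr)
    assume t: "A g t \<noteq> 0"
    let ?U = "{t. A g t \<noteq> 0}"
    have U: "open ?U" using A_continuous[OF g] by (intro open_Collect_neq) (auto intro: continuous_intros)
    then have "emeasure \<mu> ?U > 0" using supp t unfolding measure_support_def by blast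
    moreover have "?U \<in> sets \<mu>" using U by simp
    then have "emeasure \<mu> ?U = 0" using zero AE_iff_measurable[of ?U \<mu> "\<lambda>t. A g t = 0"] by simp
    ultimately show False by simp
  qed
  have gi: "integrable P (\<lambda>\<omega>. g (Z \<omega>))" by (rule A_integrand(2)[OF g])
  have sub: "subalgebra P (sigma_gen P W)"
    unfolding subalgebra_def sigma_gen_def by (simp add: sets_vimage_algebra2 measurable_sets subset_eq) 
      (auto intro: measurable_sets[OF Wm])
  interpret S: finite_measure_subalgebra P "sigma_gen P W"
    by standard (rule sub)
  have i0: "integrable P (\<lambda>\<omega>. 0 :: real)" by simp
  have "AE \<omega> in P. real_cond_exp P (sigma_gen P W) (\<lambda>\<omega>. g (Z \<omega>)) \<omega> = 0"
  proof (rule S.real_cond_exp_charact[OF _ gi i0])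
    fix C assume "C \<in> sets (sigma_gen P W)"
    then obtain B where B: "B \<in> sets borel" "C = W -` B \<inter> space P"
      unfolding sigma_gen_def by (auto simp: sets_vimage_algebra2)
    have "(LINT \<omega>:C|P. g (Z \<omega>)) = (\<integral>\<omega>. g (Z \<omega>) * indicator B (W \<omega>) \<partial>P)"
      unfolding set_lebesgue_integral_def B by (rule Bochner_Integration.integral_cong) (auto simp: indicator_def)
    also have "\<dots> = 0"
      by (rule integral_zero_of_char_zero[OF gi Wm _ B(1)]) (use all0 in \<open>simp add: op_A_def\<close>)
    finally show "(LINT \<omega>:C|P. g (Z \<omega>)) = (LINT \<omega>:C|P. 0)" by (simp add: set_lebesgue_integral_def)
  qed simp
  moreover have "AE \<omega> in P. real_cond_exp P (sigma_gen P W) (\<lambda>\<omega>. 0) \<omega> = 0"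
    using S.real_cond_exp_F_meas[OF i0] by simp
  ultimately have "AE \<omega> in P. real_cond_exp P (sigma_gen P W) (\<lambda>\<omega>. g (Z \<omega>)) \<omega> = real_cond_exp P (sigma_gen P W) (\<lambda>\<omega>. 0) \<omega>"
    by eventually_elim simp
  then show ?thesis using inj[OF g affine_G[of 0 0], of z] z by simp
qed

text \<open>Arzela-Ascoli for the pair of \<open>g\<close> and its derivative, equicontinuous by a
  Lipschitz and a Hoelder bound. The limit lies in \<open>G_space\<close> by
  \<open>G_closed\<close>, and \<open>An\<close> is continuous for uniform convergence, so the limit
  is in the kernel of \<open>A\<close> and vanishes on \<open>[0,1]\<close>.\<close>

lemma A_compact:
  assumes g: "\<And>k. g k \<in> G_space" "\<And>k. Hn (g k) \<le> R" "\<And>k. \<bar>g k 0\<bar> \<le> M" "\<And>k. \<bar>deriv01 (g k) 0\<bar> \<le> M"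
    and A0: "(\<lambda>k. An (g k)) \<longlonglongrightarrow> 0"
  obtains r :: "nat \<Rightarrow> nat" where "strict_mono r"
    "\<And>e. e > 0 \<Longrightarrow> \<forall>\<^sub>F n in sequentially. \<forall>x\<in>{0..1}. \<bar>g (r n) x\<bar> < e \<and> \<bar>deriv01 (g (r n)) x\<bar> < e"
proof -
  have R0: "R \<ge> 0" using GH.nrm_nonneg[OF g(1)] g(2) order_trans by blast
  have M0: "M \<ge> 0" using g(3) abs_ge_zero order_trans by blast
  define K where "K = 2 * M + R + 1"
  have gb: "\<bar>g k x\<bar> \<le> K" "\<bar>deriv01 (g k) x\<bar> \<le> K" if "x \<in> {0..1}" for k x
    using Gn_bounds(1,2)[OF g(1) that, of k] g(2)[of k] g(3)[of k] g(4)[of k] by (auto simp: Gn_def K_def)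
  have K0: "K > 0" using R0 M0 by (simp add: K_def)
  have lip: "\<bar>g k y - g k x\<bar> \<le> K * \<bar>y - x\<bar>" if xy: "x \<in> {0..1}" "y \<in> {0..1}" for k x y
  proof -
    have *: "\<bar>g k b - g k a\<bar> \<le> K * \<bar>b - a\<bar>" if "a \<in> {0..1}" "b \<in> {0..1}" "a \<le> b" for a b
    proof -
      have "norm (g k b - g k a) \<le> K * Henstock_Kurzweil_Integration.content {a..b}"
        using has_integral_bound[of K "deriv01 (g k)" "g k b - g k a" a b] G_ftc[OF g(1), of a b k] gb(2) K0 that
        by (auto simp: cbox_interval)
      then show ?thesis using that by simp
    qed
    show ?thesis using *[of x y] *[of y x] xy by (cases "x \<le> y") (auto simp: abs_minus_commute)
  qed
  obtain F and r :: "nat \<Rightarrow> nat" where F: "continuous_on {0..1} F" "strict_mono r"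
    "\<And>e. 0 < e \<Longrightarrow> \<exists>N. \<forall>n x. n \<ge> N \<and> x \<in> {0..1} \<longrightarrow> norm ((g (r n) x, deriv01 (g (r n)) x) - F x) < e"
  proof (rule Arzela_Ascoli[of "{0..1::real}" "\<lambda>n x. (g n x, deriv01 (g n) x)" "2 * K"])
    show "norm (g n x, deriv01 (g n) x) \<le> 2 * K" if "x \<in> {0..1}" for n x
      using norm_Pair_le[of "g n x" "deriv01 (g n) x"] gb[OF that, of n] by simp
    show "\<exists>d>0. \<forall>n y. y \<in> {0..1} \<and> norm (x - y) < d \<longrightarrow>
        norm ((g n x, deriv01 (g n) x) - (g n y, deriv01 (g n) y)) < e" if x: "x \<in> {0..1}" and e: "0 < e" for x e
    proof -
      define d where "d = min (e / (2 * K)) ((e / (2 * (R + 1)))\<^sup>2)"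
      have d0: "d > 0" using e K0 R0 by (auto simp: d_def)
      have "norm ((g n x, deriv01 (g n) x) - (g n y, deriv01 (g n) y)) < e"
        if y: "y \<in> {0..1}" "norm (x - y) < d" for n y
      proof -
        have "\<bar>g n x - g n y\<bar> \<le> K * \<bar>x - y\<bar>" by (rule lip[OF y(1) x])
        also have "\<dots> < K * (e / (2 * K))" using y(2) K0 by (intro mult_strict_left_mono) (auto simp: d_def)
        also have "\<dots> = e / 2" using K0 by simp
        finally have 1: "\<bar>g n x - g n y\<bar> < e / 2" .
        have "\<bar>deriv01 (g n) x - deriv01 (g n) y\<bar> \<le> Hn (g n) * sqrt \<bar>x - y\<bar>" by (rule deriv01_holder[OF g(1) y(1) x])
        also have "\<dots> \<le> (R + 1) * sqrt \<bar>x - y\<bar>" using g(2)[of n] by (intro mult_right_mono) auto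
        also have "\<dots> < (R + 1) * sqrt ((e / (2 * (R + 1)))\<^sup>2)"
          using y(2) R0 by (intro mult_strict_left_mono real_sqrt_less_mono) (auto simp: d_def)
        also have "\<dots> = (R + 1) * (e / (2 * (R + 1)))" using R0 e by (simp add: real_sqrt_abs)
        also have "\<dots> = e / 2"
        proof -
          have "R + 1 \<noteq> 0" using R0 by simp
          then show ?thesis by (metis mult.commute nonzero_mult_divide_mult_cancel_left times_divide_eq_right)
        qed
        finally have 2: "\<bar>deriv01 (g n) x - deriv01 (g n) y\<bar> < e / 2" .
        show ?thesis using norm_Pair_le[of "g n x - g n y" "deriv01 (g n) x - deriv01 (g n) y"] 1 2 by simp
      qed
      then show ?thesis using d0 by blast
    qed
  qed auto
  have unif: "\<forall>\<^sub>F n in sequentially. \<forall>x\<in>{0..1}. \<bar>g (r n) x - fst (F x)\<bar> < e \<and> \<bar>deriv01 (g (r n)) x - snd (F x)\<bar> < e"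
    if e: "e > 0" for e
  proof -
    obtain N where N: "\<And>n x. n \<ge> N \<Longrightarrow> x \<in> {0..1} \<Longrightarrow> norm ((g (r n) x, deriv01 (g (r n)) x) - F x) < e"
      using F(3)[OF e] by blast
    have "\<bar>g (r n) x - fst (F x)\<bar> < e \<and> \<bar>deriv01 (g (r n)) x - snd (F x)\<bar> < e" if "n \<ge> N" "x \<in> {0..1}" for n x
    proof -
      have "norm (g (r n) x - fst (F x), deriv01 (g (r n)) x - snd (F x)) < e"
        using N[OF that] by (cases "F x") simp
      then show ?thesis
        using norm_fst_le[of "g (r n) x - fst (F x)" "deriv01 (g (r n)) x - snd (F x)"]
          norm_snd_le[of "deriv01 (g (r n)) x - snd (F x)" "g (r n) x - fst (F x)"] by simp
    qed
    then show ?thesis unfolding eventually_sequentially by blast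
  qed
  define G where "G = (\<lambda>x. fst (F x))"
  have ul: "uniform_limit {0..1} (\<lambda>n. deriv01 (g (r n))) (\<lambda>x. snd (F x)) sequentially"
    unfolding uniform_limit_iff dist_real_def by (intro allI impI eventually_mono[OF unif]) auto
  have ul0: "uniform_limit {0..1} (\<lambda>n. g (r n)) G sequentially"
    unfolding uniform_limit_iff dist_real_def G_def by (intro allI impI eventually_mono[OF unif]) auto
  have pl: "(\<lambda>n. g (r n) x) \<longlonglongrightarrow> G x" if "x \<in> {0..1}" for x
    using tendsto_uniform_limitI[OF ul0 that] .
  have Gc: "G \<in> G_space" "\<And>x. x \<in> {0..1} \<Longrightarrow> deriv01 G x = snd (F x)"
    using G_closed[where g="\<lambda>n. g (r n)", OF g(1) g(2) pl ul] by blast+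
  have "An G \<le> 0"
  proof (rule field_le_epsilon)
    fix e :: real assume e: "e > 0"
    have "\<forall>\<^sub>F n in sequentially. An (g (r n)) < e / 2"
      using order_tendstoD(2)[OF LIMSEQ_subseq_LIMSEQ[OF A0 F(2)], of "e/2"] e by (simp add: o_def)
    moreover have "\<forall>\<^sub>F n in sequentially. \<forall>x\<in>{0..1}. \<bar>g (r n) x - G x\<bar> < e / 2"
      using unif[of "e/2"] e by (auto simp: G_def elim!: eventually_mono)
    ultimately have "\<forall>\<^sub>F n in sequentially. An G \<le> 0 + e"
    proof eventually_elim
      case (elim n)
      have "An (\<lambda>x. g (r n) x - G x) \<le> e / 2"
        by (rule An_le_sup[OF GH.diff_mem[OF g(1) Gc(1)]]) (use elim in \<open>auto intro: less_imp_le\<close>)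
      moreover have "An G \<le> An (g (r n)) + An (\<lambda>x. g (r n) x - G x)"
      proof -
        have eq: "(\<lambda>t. A (g (r n)) t - A (\<lambda>x. g (r n) x - G x) t) = A G"
        proof -
          have "G \<in> G_space" by (rule Gc(1))
          from A_diff[OF g(1)[of "r n"] this] show ?thesis by simp
        qed
        show ?thesis
          using L2.nrm_diff[OF A_mem[OF g(1)] A_mem[OF GH.diff_mem[OF g(1) Gc(1)]], of "r n" "r n"]
          unfolding eq .
      qed
      ultimately show ?case using elim by simp
    qed
    then show "An G \<le> 0 + e" using eventually_happens[of _ sequentially] by auto
  qed
  then have "L2_inner \<mu> (A G) (A G) = 0"
    using L2.nonneg[OF A_mem[OF Gc(1)]] unfolding L2.nrm_def by simp
  then have "AE t in \<mu>. A G t = 0" by (rule L2_inner_zero_AE[OF A_mem[OF Gc(1)]])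
  then have G0: "G x = 0" if "x \<in> {0..1}" for x using A_injective[OF Gc(1) _ that] by blast
  have "deriv01 G x = deriv01 (\<lambda>x. 0 + 0 * x) x" if "x \<in> {0..1}" for x
    by (rule deriv01_cong[OF _ that]) (simp add: G0)
  then have F0: "snd (F x) = 0" if "x \<in> {0..1}" for x using Gc(2)[OF that] affine_deriv01[OF that, of 0 0] that by simp
  show ?thesis
  proof (rule that[OF F(2)])
    fix e :: real assume "e > 0"
    from unif[OF this] show "\<forall>\<^sub>F n in sequentially. \<forall>x\<in>{0..1}. \<bar>g (r n) x\<bar> < e \<and> \<bar>deriv01 (g (r n)) x\<bar> < e"
      by (rule eventually_mono) (use G0 F0 in \<open>auto simp: G_def\<close>)
  qed
qed

text \<open>Nothing bounds the affine part of \<open>g\<close>, so a sequence of counterexamples is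
  first divided by the maximum of 1 and its data at 0. A subsequence of the normalised functions
  tends to zero with its derivatives; so the normalised data at 0 drop below 1, the divisor must
  have been 1, and the original functions are small after all.\<close>

lemma A_stable:
  assumes "\<delta> > 0" "R \<ge> 0"
  obtains \<eta> where "\<eta> > 0"
    "\<And>g x. g \<in> G_space \<Longrightarrow> Hn g \<le> R \<Longrightarrow> An g \<le> \<eta> \<Longrightarrow> x \<in> {0..1} \<Longrightarrow> \<bar>g x\<bar> \<le> \<delta> \<and> \<bar>deriv01 g x\<bar> \<le> \<delta>"
proof (rule ccontr)
  assume "\<not> thesis"
  with that have "\<exists>g x. g \<in> G_space \<and> Hn g \<le> R \<and> An g \<le> \<eta> \<and> x \<in> {0..1} \<and> \<not> (\<bar>g x\<bar> \<le> \<delta> \<and> \<bar>deriv01 g x\<bar> \<le> \<delta>)" if "\<eta> > 0" for \<eta>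
    using \<open>\<eta> > 0\<close> by blast
  then have "\<exists>g x. g \<in> G_space \<and> Hn g \<le> R \<and> An g \<le> inverse (real (Suc k)) \<and> x \<in> {0..1} \<and> \<not> (\<bar>g x\<bar> \<le> \<delta> \<and> \<bar>deriv01 g x\<bar> \<le> \<delta>)" for k
    by simp
  then obtain g x where g: "\<And>k. g k \<in> G_space" "\<And>k. Hn (g k) \<le> R" "\<And>k. An (g k) \<le> inverse (real (Suc k))"
    "\<And>k. x k \<in> {0..1}" "\<And>k. \<not> (\<bar>g k (x k)\<bar> \<le> \<delta> \<and> \<bar>deriv01 (g k) (x k)\<bar> \<le> \<delta>)"
    by metis
  define N where "N = (\<lambda>k. max \<bar>g k 0\<bar> \<bar>deriv01 (g k) 0\<bar>)"
  define c where "c = (\<lambda>k. inverse (max 1 (N k)))"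
  have c: "0 < c k" "c k \<le> 1" for k by (auto simp: c_def inverse_le_1_iff)
  have cN: "c k * N k \<le> 1" for k by (auto simp: c_def field_simps)
  define f where "f = (\<lambda>k x. c k * g k x)"
  have fG: "f k \<in> G_space" for k unfolding f_def using GH.scale_mem[OF g(1)] by simp
  have fH: "Hn (f k) \<le> R" for k
  proof -
    have "Hn (f k) = c k * Hn (g k)" unfolding f_def using GH.nrm_scale[OF g(1)[of k], of "c k"] c[of k] by simp
    also have "\<dots> \<le> 1 * R" using c[of k] g(2)[of k] GH.nrm_nonneg[OF g(1)] by (intro mult_mono) (auto intro: less_imp_le)
    finally show ?thesis by simp
  qed
  have df: "deriv01 (f k) y = c k * deriv01 (g k) y" if "y \<in> {0..1}" for k y
    unfolding f_def by (rule deriv01_scale[OF g(1) that])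
  have f0: "\<bar>f k 0\<bar> \<le> 1" "\<bar>deriv01 (f k) 0\<bar> \<le> 1" for k
  proof -
    have "\<bar>f k 0\<bar> \<le> c k * N k" "\<bar>deriv01 (f k) 0\<bar> \<le> c k * N k"
      using c(1)[of k] df[of 0 k] by (auto simp: f_def N_def abs_mult)
    then show "\<bar>f k 0\<bar> \<le> 1" "\<bar>deriv01 (f k) 0\<bar> \<le> 1" using cN[of k] by linarith+
  qed
  have "(\<lambda>k. An (f k)) \<longlonglongrightarrow> 0"
  proof (rule tendsto_sandwich[OF _ _ tendsto_const LIMSEQ_inverse_real_of_nat])
    show "\<forall>\<^sub>F k in sequentially. 0 \<le> An (f k)" using An_nonneg[OF fG] by simp
    have "An (f k) \<le> inverse (real (Suc k))" for k
    proof -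
      have "An (f k) = c k * An (g k)" unfolding f_def A_scale[OF g(1)]
        using L2.nrm_scale[OF A_mem[OF g(1)[of k]], of "c k"] c(1)[of k] by simp
      also have "\<dots> \<le> 1 * inverse (real (Suc k))"
        using c[of k] g(3)[of k] An_nonneg[OF g(1)] by (intro mult_mono) (auto intro: less_imp_le)
      finally show ?thesis by simp
    qed
    then show "\<forall>\<^sub>F k in sequentially. An (f k) \<le> inverse (real (Suc k))" by simp
  qed
  from A_compact[OF fG fH f0 this] obtain r :: "nat \<Rightarrow> nat" where r: "strict_mono r"
    "\<And>e. e > 0 \<Longrightarrow> \<forall>\<^sub>F n in sequentially. \<forall>x\<in>{0..1}. \<bar>f (r n) x\<bar> < e \<and> \<bar>deriv01 (f (r n)) x\<bar> < e"
    by blast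
  have "\<forall>\<^sub>F n in sequentially. \<forall>x\<in>{0..1}. \<bar>f (r n) x\<bar> < min 1 \<delta> \<and> \<bar>deriv01 (f (r n)) x\<bar> < min 1 \<delta>"
    by (rule r(2)) (use assms in auto)
  then obtain n where n: "\<And>x. x \<in> {0..1} \<Longrightarrow> \<bar>f (r n) x\<bar> < min 1 \<delta> \<and> \<bar>deriv01 (f (r n)) x\<bar> < min 1 \<delta>"
    using eventually_happens'[OF sequentially_bot] by blast
  have "c (r n) * N (r n) < 1"
    using n[of 0] df[of 0 "r n"] c(1)[of "r n"] by (auto simp: N_def f_def abs_mult max_def)
  then have "N (r n) < 1" by (auto simp: c_def field_simps max_def split: if_splits)
  then have "c (r n) = 1" by (simp add: c_def)
  then have "\<bar>g (r n) (x (r n))\<bar> \<le> \<delta> \<and> \<bar>deriv01 (g (r n)) (x (r n))\<bar> \<le> \<delta>"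
    using n[OF g(4)[of "r n"]] df[OF g(4)[of "r n"], of "r n"] by (simp add: f_def less_imp_le)
  then show False using g(5) by blast
qed

text \<open>\<open>A_stable\<close> with both radii equal to 1, made homogeneous: it is applied to
  \<open>g / s\<close>, where \<open>s\<close> exceeds \<open>Hn g + An g / \<eta>\<close>.\<close>

lemma A_coercive:
  obtains C where "C > 0" "\<And>g. g \<in> G_space \<Longrightarrow> Gn g \<le> C * (An g + Hn g)"
proof -
  obtain \<eta> where \<eta>: "\<eta> > 0"
    "\<And>g x. g \<in> G_space \<Longrightarrow> Hn g \<le> 1 \<Longrightarrow> An g \<le> \<eta> \<Longrightarrow> x \<in> {0..1} \<Longrightarrow> \<bar>g x\<bar> \<le> 1 \<and> \<bar>deriv01 g x\<bar> \<le> 1"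
    using A_stable[of 1 1] by auto
  have main: "\<bar>g 0\<bar> \<le> Hn g + An g / \<eta> \<and> \<bar>deriv01 g 0\<bar> \<le> Hn g + An g / \<eta>" if g: "g \<in> G_space" for g
  proof -
    have nn: "0 \<le> Hn g" "0 \<le> An g / \<eta>" using GH.nrm_nonneg[OF g] An_nonneg[OF g] \<eta>(1) by auto
    \<comment> \<open>Strictly above, so that division is possible even when both seminorms vanish;
      letting \<open>s\<close> decrease gives the bound.\<close>
    have "\<bar>g 0\<bar> \<le> s \<and> \<bar>deriv01 g 0\<bar> \<le> s" if s: "Hn g + An g / \<eta> < s" for s
    proof -
      have s0: "s > 0" using s nn by linarith
      let ?f = "\<lambda>x. (1/s) * g x"
      have f: "?f \<in> G_space" using GH.scale_mem[OF g, of "1/s"] by simp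
      have "Hn ?f = Hn g / s" using GH.nrm_scale[OF g, of "1/s"] s0 by simp
      then have 1: "Hn ?f \<le> 1" using s nn s0 by simp
      have "An ?f = An g / s" unfolding A_scale[OF g]
        using L2.nrm_scale[OF A_mem[OF g], of "1/s"] s0 by simp
      moreover have "An g / \<eta> \<le> s" using s nn by linarith
      then have "An g / s \<le> \<eta>" using s0 \<eta>(1) by (simp add: field_simps)
      ultimately have 2: "An ?f \<le> \<eta>" by simp
      have "\<bar>(1/s) * g 0\<bar> \<le> 1 \<and> \<bar>(1/s) * deriv01 g 0\<bar> \<le> 1"
      proof -
        have d: "deriv01 ?f 0 = (1/s) * deriv01 g 0" by (rule deriv01_scale[OF g]) simp
        have "\<bar>?f 0\<bar> \<le> 1 \<and> \<bar>deriv01 ?f 0\<bar> \<le> 1" by (rule \<eta>(2)[OF f 1 2]) simp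
        then show ?thesis unfolding d .
      qed
      then show ?thesis using s0 by (simp add: abs_mult field_simps)
    qed
    then show ?thesis by (meson dense_ge)
  qed
  \<comment> \<open>The two bounds at 0 and the seminorm itself add up to
    \<open>3 * Hn g + (2 / \<eta>) * An g\<close>.\<close>
  let ?C = "3 + 2 / \<eta>"
  have "Gn g \<le> ?C * (An g + Hn g)" if g: "g \<in> G_space" for g
  proof -
    have "Gn g \<le> 3 * Hn g + (2 / \<eta>) * An g" using main[OF g] by (simp add: Gn_def)
    also have "\<dots> \<le> ?C * Hn g + ?C * An g"
      using GH.nrm_nonneg[OF g] An_nonneg[OF g] \<eta>(1) by (intro add_mono mult_right_mono) auto
    finally show ?thesis by (simp add: distrib_left add.commute)
  qed
  moreover have "?C > 0" using \<eta>(1) by (simp add: add_pos_pos)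
  ultimately show ?thesis using that by blast
qed

end

section \<open>Tikhonov regularisation and the source condition\<close>

text \<open>In the applications \<open>e\<close> is the excess of a near-minimiser over the infimum
  and \<open>F\<close> is minus half the directional derivative of the criterion. For
  \<open>e = 0\<close> the conclusion is the first-order condition.\<close>

lemma quadratic_nonneg_discriminant:
  fixes e F N :: real
  assumes "N \<ge> 0" "\<And>s. 0 \<le> e - 2 * s * F + s\<^sup>2 * N"
  shows "F\<^sup>2 \<le> e * N"
proof (cases "N = 0")
  case True
  have "F = 0"
  proof (rule ccontr)
    assume "F \<noteq> 0"
    then show False using assms(2)[of "(e + 1) / (2 * F)"] True by (simp add: field_simps)
  qed
  then show ?thesis using True by simp
next
  case False
  then have N: "N > 0" using assms(1) by simp
  have "0 \<le> e - F\<^sup>2 / N" using assms(2)[of "F / N"] N by (simp add: field_simps power2_eq_square)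
  then show ?thesis using N by (simp add: field_simps)
qed

context psd_form
begin

lemma sum_mem:
  assumes "finite F" "\<And>j. j \<in> F \<Longrightarrow> \<phi> j \<in> V" "h \<in> V"
  shows "(\<lambda>z. \<Sum>j\<in>F. c j *\<^sub>R \<phi> j z) \<in> V"
    "ip (\<lambda>z. \<Sum>j\<in>F. c j *\<^sub>R \<phi> j z) h = (\<Sum>j\<in>F. c j * ip (\<phi> j) h)"
proof -
  have "(\<lambda>z. \<Sum>j\<in>F. c j *\<^sub>R \<phi> j z) \<in> V \<and>
      ip (\<lambda>z. \<Sum>j\<in>F. c j *\<^sub>R \<phi> j z) h = (\<Sum>j\<in>F. c j * ip (\<phi> j) h)"
    using assms(1,2)
  proof (induction F rule: finite_induct)
    case empty
    then show ?case using scale_mem[OF assms(3), of 0] ip_scale[OF assms(3,3), of 0] by simp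
  next
    case (insert j F)
    then show ?case using add_mem[OF scale_mem] ip_add[OF scale_mem _ assms(3)] ip_scale[OF _ assms(3)] by simp
  qed
  then show "(\<lambda>z. \<Sum>j\<in>F. c j *\<^sub>R \<phi> j z) \<in> V"
    "ip (\<lambda>z. \<Sum>j\<in>F. c j *\<^sub>R \<phi> j z) h = (\<Sum>j\<in>F. c j * ip (\<phi> j) h)" by auto
qed

end

context npiv
begin

definition Aip :: "(real \<Rightarrow> real) \<Rightarrow> (real \<Rightarrow> real) \<Rightarrow> real" where
  "Aip f g = L2_inner \<mu> (A f) (A g)"

lemma Aip_psd: "psd_form G_space Aip"
proof
  fix f g h :: "real \<Rightarrow> real" and c :: real
  assume f: "f \<in> G_space"
  show "(\<lambda>x. c *\<^sub>R f x) \<in> G_space" by (rule GH.scale_mem[OF f])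
  show "0 \<le> Aip f f" unfolding Aip_def by (rule L2.nonneg[OF A_mem[OF f]])
  { assume h: "h \<in> G_space"
    show "Aip (\<lambda>x. c *\<^sub>R f x) h = c * Aip f h"
      unfolding Aip_def real_scaleR_def A_scale[OF f] by (rule L2.ip_scale[OF A_mem[OF f] A_mem[OF h]]) }
  assume g: "g \<in> G_space"
  show "(\<lambda>x. f x + g x) \<in> G_space" by (rule GH.add_mem[OF f g])
  show "Aip f g = Aip g f" unfolding Aip_def by (rule L2.sym[OF A_mem[OF f] A_mem[OF g]])
  assume h: "h \<in> G_space"
  show "Aip (\<lambda>x. f x + g x) h = Aip f h + Aip g h"
    unfolding Aip_def A_add[OF f g] by (rule L2.ip_add[OF A_mem[OF f] A_mem[OF g] A_mem[OF h]])
qed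

sublocale GA: psd_form G_space Aip by (rule Aip_psd)

lemma GA_nrm: "GA.nrm g = An g"
  unfolding GA.nrm_def L2.nrm_def Aip_def ..

lemma Aip_self: "g \<in> G_space \<Longrightarrow> Aip g g = (An g)\<^sup>2"
  using GA.nrm_sq by (simp add: GA_nrm)

text \<open>Near-minimisers satisfy the first-order condition up to
  \<open>sqrt (e k) * sqrt (N h)\<close>. Subtracting two such conditions bounds their difference in
  the norm \<open>sqrt (N h)\<close>, which coercivity turns into a Cauchy sequence for
  \<open>Gn\<close>; the condition then passes to the limit. It is returned in place of minimality
  because every later use tests it with some \<open>h\<close>.\<close>

lemma tikhonov_minimiser:
  assumes lam: "lam > 0" and g0: "g0 \<in> G_space"
  obtains x where "x \<in> G_space"
    "\<And>h. h \<in> G_space \<Longrightarrow> Aip (\<lambda>z. g0 z - x z) h = lam * H_inner x h"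
proof -
  obtain C where C: "C > 0" "\<And>g. g \<in> G_space \<Longrightarrow> Gn g \<le> C * (An g + Hn g)" using A_coercive by blast
  define J where "J = (\<lambda>x. Aip (\<lambda>z. g0 z - x z) (\<lambda>z. g0 z - x z) + lam * H_inner x x)"
  define N where "N = (\<lambda>h. Aip h h + lam * H_inner h h)"
  define F where "F = (\<lambda>x h. Aip (\<lambda>z. g0 z - x z) h - lam * H_inner x h)"
  have N0: "N h \<ge> 0" if "h \<in> G_space" for h
    using GA.nonneg[OF that] GH.nonneg[OF that] lam by (simp add: N_def)
  have J0: "J x \<ge> 0" if "x \<in> G_space" for x
    using GA.nonneg[OF GA.diff_mem[OF g0 that]] GH.nonneg[OF that] lam by (simp add: J_def)
  define m where "m = (INF x\<in>G_space. J x)"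
  have bb: "bdd_below (J ` G_space)" using J0 by (intro bdd_belowI[of _ 0]) auto
  have mle: "m \<le> J x" if "x \<in> G_space" for x unfolding m_def using bb that by (rule cINF_lower)
  have "\<exists>x\<in>G_space. J x < m + inverse (real (Suc k))" for k
  proof -
    have "Inf (J ` G_space) < m + inverse (real (Suc k))" by (simp add: m_def)
    then show ?thesis using cInf_lessD[of "J ` G_space"] g0 by blast
  qed
  then obtain x where x: "\<And>k. x k \<in> G_space" "\<And>k. J (x k) < m + inverse (real (Suc k))" by metis
  define e where "e = (\<lambda>k. inverse (real (Suc k)))"
  have e0: "e k > 0" for k by (simp add: e_def)
  have FN: "(F (x k) h)\<^sup>2 \<le> e k * N h" if h: "h \<in> G_space" for k h
  proof (rule quadratic_nonneg_discriminant[OF N0[OF h]])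
    fix s
    let ?d = "\<lambda>z. g0 z - x k z"
    have d: "?d \<in> G_space" by (rule GA.diff_mem[OF g0 x(1)])
    have 1: "(\<lambda>z. g0 z - (x k z + s *\<^sub>R h z)) = (\<lambda>z. ?d z + (- s) *\<^sub>R h z)" by auto
    have "J (\<lambda>z. x k z + s *\<^sub>R h z) = J (x k) - 2 * s * F (x k) h + s\<^sup>2 * N h"
      unfolding J_def 1 GA.expand_add[OF d h] GH.expand_add[OF x(1) h] N_def F_def
      by (simp add: algebra_simps)
    moreover have "m \<le> J (\<lambda>z. x k z + s *\<^sub>R h z)"
      by (rule mle[OF GH.add_mem[OF x(1) GH.scale_mem[OF h]]])
    ultimately show "0 \<le> e k - 2 * s * F (x k) h + s\<^sup>2 * N h"
      using x(2)[of k] by (simp add: e_def)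
  qed
  have FN': "\<bar>F (x k) h\<bar> \<le> sqrt (e k) * sqrt (N h)" if "h \<in> G_space" for k h
    using real_sqrt_le_mono[OF FN[OF that, of k]] by (simp add: real_sqrt_mult)
  have xd: "(\<lambda>z. x k z - x l z) \<in> G_space" for k l by (rule GH.diff_mem[OF x(1) x(1)])
  have Nd: "sqrt (N (\<lambda>z. x k z - x l z)) \<le> sqrt (e k) + sqrt (e l)" for k l
  proof -
    let ?h = "\<lambda>z. x k z - x l z"
    \<comment> \<open>\<open>F\<close> is affine in its first argument, and its linear part is minus
      the bilinear form of \<open>N\<close>.\<close>
    have "N ?h = F (x l) ?h - F (x k) ?h"
      unfolding N_def F_def
      by (simp add: GA.ip_diff[OF x(1) x(1) xd] GA.ip_diff[OF g0 x(1) xd] GH.ip_diff[OF x(1) x(1) xd] algebra_simps)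
    also have "\<dots> \<le> (sqrt (e k) + sqrt (e l)) * sqrt (N ?h)"
      using FN'[OF xd, of k k l] FN'[OF xd, of l k l] by (simp add: distrib_right)
    finally have "sqrt (N ?h) * sqrt (N ?h) \<le> (sqrt (e k) + sqrt (e l)) * sqrt (N ?h)"
      using N0[OF xd] by simp
    moreover have "sqrt (N ?h) \<ge> 0" "sqrt (e k) + sqrt (e l) \<ge> 0"
      using N0[OF xd, of k l] e0[of k] e0[of l] by auto
    ultimately show ?thesis
      using mult_right_le_imp_le[of "sqrt (N ?h)" "sqrt (N ?h)" "sqrt (e k) + sqrt (e l)"]
      by (cases "sqrt (N ?h) = 0") auto
  qed
  \<comment> \<open>The second summand comes from \<open>Hn h \<le> sqrt (N h) / sqrt lam\<close>.
    The constant depends on \<open>lam\<close>, which is fixed here.\<close>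
  define C' where "C' = C * (1 + 1 / sqrt lam)"
  have C'0: "C' > 0" using C lam by (simp add: C'_def add_pos_pos)
  have GN: "Gn h \<le> C' * sqrt (N h)" if h: "h \<in> G_space" for h
  proof -
    have "(An h)\<^sup>2 \<le> N h" "lam * (Hn h)\<^sup>2 \<le> N h"
      using GA.nonneg[OF h] GH.nonneg[OF h] lam by (auto simp: N_def Aip_self[OF h] GH.nrm_sq[OF h])
    then have "An h \<le> sqrt (N h)" and "sqrt lam * Hn h \<le> sqrt (N h)"
      using real_le_rsqrt real_sqrt_le_mono[of "lam * (Hn h)\<^sup>2" "N h"] GH.nrm_nonneg[OF h] by (auto simp: real_sqrt_mult)
    then have "An h + Hn h \<le> sqrt (N h) + sqrt (N h) / sqrt lam"
      using lam by (intro add_mono) (auto simp: field_simps)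
    then have "C * (An h + Hn h) \<le> C * (sqrt (N h) + sqrt (N h) / sqrt lam)" using C by (intro mult_left_mono) auto
    then show ?thesis using C(2)[OF h] by (simp add: C'_def algebra_simps)
  qed
  have se: "(\<lambda>k. sqrt (e k)) \<longlonglongrightarrow> 0"
    using tendsto_real_sqrt[OF LIMSEQ_inverse_real_of_nat] by (simp add: e_def)
  have "\<exists>M. \<forall>k\<ge>M. \<forall>l\<ge>M. Gn (\<lambda>z. x k z - x l z) < d" if "d > 0" for d
  proof -
    have "d / (2 * C') > 0" using that C'0 by simp
    then obtain M where M: "\<And>k. k \<ge> M \<Longrightarrow> sqrt (e k) < d / (2 * C')"
      using order_tendstoD(2)[OF se] unfolding eventually_sequentially by blast
    have "Gn (\<lambda>z. x k z - x l z) < d" if "k \<ge> M" "l \<ge> M" for k l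
    proof -
      have "Gn (\<lambda>z. x k z - x l z) \<le> C' * (sqrt (e k) + sqrt (e l))"
        using GN[OF xd, of k l] Nd[of k l] C'0 by (meson mult_left_mono less_imp_le order_trans)
      also have "\<dots> < C' * (d / (2 * C') + d / (2 * C'))"
        using M[OF that(1)] M[OF that(2)] C'0 by (intro mult_strict_left_mono) auto
      also have "\<dots> = d" using C'0 by simp
      finally show ?thesis .
    qed
    then show ?thesis by blast
  qed
  from G_complete[OF x(1) this] obtain X where X: "X \<in> G_space" "(\<lambda>k. Gn (\<lambda>z. x k z - X z)) \<longlonglongrightarrow> 0" by blast
  have "F X h = 0" if h: "h \<in> G_space" for h
  proof -
    have xX: "(\<lambda>z. x k z - X z) \<in> G_space" for k by (rule GH.diff_mem[OF x(1) X(1)])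
    have b: "\<bar>F X h\<bar> \<le> sqrt (e k) * sqrt (N h) + Gn (\<lambda>z. x k z - X z) * (An h + lam * Hn h)" for k
    proof -
      have "F X h = F (x k) h + Aip (\<lambda>z. x k z - X z) h + lam * H_inner (\<lambda>z. x k z - X z) h"
        unfolding F_def
        by (simp add: GA.ip_diff[OF g0 x(1) h] GA.ip_diff[OF g0 X(1) h] GA.ip_diff[OF x(1) X(1) h]
            GH.ip_diff[OF x(1) X(1) h] algebra_simps)
      moreover have "\<bar>Aip (\<lambda>z. x k z - X z) h\<bar> \<le> Gn (\<lambda>z. x k z - X z) * An h"
        using GA.cauchy_schwarz[OF xX h, of k] An_le_Gn[OF xX, of k] An_nonneg[OF h]
        unfolding GA_nrm by (meson mult_right_mono order_trans)
      moreover have "\<bar>H_inner (\<lambda>z. x k z - X z) h\<bar> \<le> Gn (\<lambda>z. x k z - X z) * Hn h"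
        using GH.cauchy_schwarz[OF xX h, of k] Gn_bounds(3)[OF xX, of 0 k] GH.nrm_nonneg[OF h]
        by (meson mult_right_mono order_trans atLeastAtMost_iff order_refl zero_le_one)
      then have "\<bar>lam * H_inner (\<lambda>z. x k z - X z) h\<bar> \<le> lam * (Gn (\<lambda>z. x k z - X z) * Hn h)"
        using lam by (simp add: abs_mult)
      ultimately show ?thesis using FN'[OF h, of k] by (simp add: algebra_simps)
    qed
    have "(\<lambda>k. sqrt (e k) * sqrt (N h) + Gn (\<lambda>z. x k z - X z) * (An h + lam * Hn h)) \<longlonglongrightarrow> 0 * sqrt (N h) + 0 * (An h + lam * Hn h)"
      by (intro tendsto_intros se X(2))
    then have "\<bar>F X h\<bar> \<le> 0 * sqrt (N h) + 0 * (An h + lam * Hn h)"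
      by (rule LIMSEQ_le_const) (use b in blast)
    then show ?thesis by simp
  qed
  then show ?thesis using that[OF X(1)] by (simp add: F_def)
qed

text \<open>The condition is tested with the bias itself. The bound on \<open>Hn\<close> does not
  tend to zero with \<open>lam\<close>, but boundedness is what \<open>A_stable\<close> asks for;
  the factor \<open>sqrt lam\<close> in the bound on \<open>An\<close> later pays for a division by
  \<open>sqrt lam\<close>.\<close>

lemma tikhonov_bounds:
  assumes lam: "lam > 0" and g0: "g0 \<in> G_space" and x: "x \<in> G_space"
    and foc: "\<And>h. h \<in> G_space \<Longrightarrow> Aip (\<lambda>z. g0 z - x z) h = lam * H_inner x h"
  shows "An (\<lambda>z. g0 z - x z) \<le> sqrt lam * Hn g0" "Hn (\<lambda>z. g0 z - x z) \<le> 2 * Hn g0"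
proof -
  let ?b = "\<lambda>z. g0 z - x z"
  have b: "?b \<in> G_space" by (rule GH.diff_mem[OF g0 x])
  have "(An ?b)\<^sup>2 + lam * (Hn x)\<^sup>2 = lam * H_inner x g0"
    using foc[OF b] by (simp add: Aip_self[OF b] GH.nrm_sq[OF x] GH.ip_diff'[OF g0 x x] algebra_simps)
  also have "\<dots> \<le> lam * (Hn x * Hn g0)"
    using GH.cauchy_schwarz[OF x g0] lam by (intro mult_left_mono) auto
  finally have m: "(An ?b)\<^sup>2 + lam * (Hn x)\<^sup>2 \<le> lam * (Hn x * Hn g0)" .
  have nn: "Hn x \<ge> 0" "Hn g0 \<ge> 0" using GH.nrm_nonneg x g0 by auto
  have "lam * (Hn x)\<^sup>2 \<le> lam * (Hn x * Hn g0)" using m zero_le_power2[of "An ?b"] by linarith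
  then have "Hn x * Hn x \<le> Hn x * Hn g0" using lam by (simp add: power2_eq_square)
  then have hx: "Hn x \<le> Hn g0" using nn by (cases "Hn x = 0") auto
  then show "Hn ?b \<le> 2 * Hn g0" using GH.nrm_diff[OF g0 x] by linarith
  have "0 \<le> lam * (Hn x)\<^sup>2" using lam by simp
  then have "(An ?b)\<^sup>2 \<le> lam * (Hn x * Hn g0)" using m by linarith
  also have "\<dots> \<le> lam * (Hn g0 * Hn g0)" using hx nn lam by (intro mult_left_mono mult_right_mono) auto
  finally have "An ?b \<le> sqrt (lam * (Hn g0 * Hn g0))" by (rule real_le_rsqrt)
  then show "An ?b \<le> sqrt lam * Hn g0" using nn by (simp add: real_sqrt_mult)
qed

section \<open>The projected operator and its singular system\<close>

abbreviation aff :: "real \<Rightarrow> real \<Rightarrow> real \<Rightarrow> real" where "aff a b \<equiv> \<lambda>z. a + b * z"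

lemma range_op_B: "range (op_B P Z W) = {A (aff a b) |a b. True}"
proof -
  have "op_B P Z W \<beta> = A (aff (\<beta> $ 1) (\<beta> $ 2))" for \<beta> by (simp add: op_B_def op_A_def fun_eq_iff mult.commute)
  moreover have "A (aff a b) = op_B P Z W (\<chi> i. if i = 1 then a else b)" for a b
    by (simp add: op_B_def op_A_def fun_eq_iff mult.commute)
  ultimately show ?thesis by auto
qed

text \<open>Two unknowns, found by Cramer's rule with the Gram matrix of the images of 1 and
  \<open>z\<close> under \<open>A\<close>. Its determinant is nonzero since \<open>A\<close> is
  injective on affine functions.\<close>

lemma proj_affine:
  assumes l: "l \<in> L2_space \<mu>"
  obtains a b where "\<And>a' b'. L2_inner \<mu> (\<lambda>t. l t - A (aff a b) t) (A (aff a' b')) = 0"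
proof -
  define e1 where "e1 = A (aff 1 0)"
  define e2 where "e2 = A (aff 0 1)"
  have e: "e1 \<in> L2_space \<mu>" "e2 \<in> L2_space \<mu>" unfolding e1_def e2_def by (rule A_mem[OF affine_G])+
  have Aff: "A (aff a b) = (\<lambda>t. a *\<^sub>R e1 t + b *\<^sub>R e2 t)" for a b
    using A_lincomb[OF affine_G[of 1 0] affine_G[of 0 1], of a b] by (simp add: e1_def e2_def fun_eq_iff)
  define p where "p = L2_inner \<mu> e1 e1"
  define q where "q = L2_inner \<mu> e1 e2"
  define r where "r = L2_inner \<mu> e2 e2"
  define u where "u = L2_inner \<mu> l e1"
  define v where "v = L2_inner \<mu> l e2"
  have sym: "L2_inner \<mu> e2 e1 = q" unfolding q_def by (rule L2.sym[OF e(2,1)])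
  have val: "L2_inner \<mu> (\<lambda>t. l t - A (aff a b) t) (A (aff a' b')) = a' * (u - a * p - b * q) + b' * (v - a * q - b * r)" for a b a' b'
  proof -
    have m: "A (aff a b) \<in> L2_space \<mu>" for a b by (rule A_mem[OF affine_G])
    have s1: "(\<lambda>t. a *\<^sub>R e1 t) \<in> L2_space \<mu>" for a by (rule L2.scale_mem[OF e(1)])
    have s2: "(\<lambda>t. b *\<^sub>R e2 t) \<in> L2_space \<mu>" for b by (rule L2.scale_mem[OF e(2)])
    have "L2_inner \<mu> k (A (aff a' b')) = a' * L2_inner \<mu> k e1 + b' * L2_inner \<mu> k e2" if "k \<in> L2_space \<mu>" for k
      unfolding Aff L2.ip_add'[OF s1 s2 that] L2.ip_scale'[OF e(1) that] L2.ip_scale'[OF e(2) that] ..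
    moreover have "L2_inner \<mu> (A (aff a b)) k = a * L2_inner \<mu> e1 k + b * L2_inner \<mu> e2 k" if "k \<in> L2_space \<mu>" for k
      unfolding Aff L2.ip_add[OF s1 s2 that] L2.ip_scale[OF e(1) that] L2.ip_scale[OF e(2) that] ..
    ultimately show ?thesis
      by (simp add: L2.ip_diff[OF l m m] l m e sym flip: p_def q_def r_def u_def v_def) (simp add: algebra_simps)
  qed
  have det: "p * r - q\<^sup>2 \<noteq> 0"
  proof
    assume d: "p * r - q\<^sup>2 = 0"
    have An2: "Aip (aff a b) (aff a b) = a\<^sup>2 * p + 2 * a * b * q + b\<^sup>2 * r" for a b
    proof -
      have "aff a b = (\<lambda>z. a *\<^sub>R aff 1 0 z + b *\<^sub>R aff 0 1 z)" by auto
      moreover have "Aip (aff 1 0) (aff 1 0) = p" "Aip (aff 1 0) (aff 0 1) = q" "Aip (aff 0 1) (aff 0 1) = r"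
        by (simp_all add: Aip_def p_def q_def r_def e1_def e2_def)
      ultimately show ?thesis
        using GA.expand_add[OF GH.scale_mem[OF affine_G[of 1 0], of a] affine_G[of 0 1], of b]
          GA.ip_scale[OF affine_G[of 1 0] GH.scale_mem[OF affine_G[of 1 0], of a], of a]
          GA.ip_scale'[OF affine_G[of 1 0] affine_G[of 1 0], of a]
          GA.ip_scale[OF affine_G[of 1 0] affine_G[of 0 1], of a]
        by (simp add: power2_eq_square algebra_simps)
    qed
    have zero: "a = 0 \<and> b = 0" if "a\<^sup>2 * p + 2 * a * b * q + b\<^sup>2 * r = 0" for a b
    proof -
      have "L2_inner \<mu> (A (aff a b)) (A (aff a b)) = 0" using An2[of a b] that by (simp add: Aip_def)
      from L2_inner_zero_AE[OF A_mem[OF affine_G] this]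
      have "aff a b z = 0" if "z \<in> {0..1}" for z using A_injective[OF affine_G _ that] by blast
      from this[of 0] this[of 1] show ?thesis by simp
    qed
    \<comment> \<open>On the vector \<open>(q, -p)\<close> the Gram form equals \<open>p\<close>
      times the determinant, hence 0; so \<open>p = 0\<close>, and then \<open>(1, 0)\<close> is a
      null vector as well.\<close>
    have "q\<^sup>2 * p + 2 * q * (- p) * q + (- p)\<^sup>2 * r = p * (p * r - q\<^sup>2)" by (simp add: power2_eq_square algebra_simps)
    then have "q = 0 \<and> - p = 0" using d by (intro zero) simp
    then have "1\<^sup>2 * p + 2 * 1 * 0 * q + 0\<^sup>2 * r = 0" by simp
    then show False using zero[of 1 0] by simp
  qed
  define D where "D = p * r - q\<^sup>2"
  define a where "a = (u * r - v * q) / D"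
  define b where "b = (v * p - u * q) / D"
  have D0: "D \<noteq> 0" using det by (simp add: D_def)
  then have aD: "D * a = u * r - v * q" and bD: "D * b = v * p - u * q" by (simp_all add: a_def b_def)
  have "D * (u - a * p - b * q) = u * D - (D * a) * p - (D * b) * q" by (simp add: algebra_simps)
  also have "\<dots> = 0" unfolding aD bD by (simp add: D_def power2_eq_square algebra_simps)
  finally have 1: "u - a * p - b * q = 0" using D0 by simp
  have "D * (v - a * q - b * r) = v * D - (D * a) * q - (D * b) * r" by (simp add: algebra_simps)
  also have "\<dots> = 0" unfolding aD bD by (simp add: D_def power2_eq_square algebra_simps)
  finally have "v - a * q - b * r = 0" using D0 by simp
  with 1 have "u - a * p - b * q = 0" "v - a * q - b * r = 0" by simp_all
  then show ?thesis using that[of a b] val[of a b] by simp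
qed

abbreviation T :: "(real \<Rightarrow> real) \<Rightarrow> real ^ 'p \<Rightarrow> complex" where "T \<equiv> op_T P Z W \<mu>"

text \<open>Existence of a projection lets the choice operator be evaluated. Because the defining
  difference lies in the range of \<open>op_B\<close> as a function, \<open>T h\<close> is
  \<open>A\<close> of \<open>h\<close> minus an affine function everywhere and not only almost
  everywhere.\<close>

lemma T_props:
  assumes h: "h \<in> G_space"
  obtains a b where "T h = A (\<lambda>z. h z - aff a b z)" "\<And>a' b'. L2_inner \<mu> (T h) (A (aff a' b')) = 0"
proof -
  define Q where "Q = (\<lambda>m. m \<in> L2_space \<mu> \<and> (\<lambda>t. A h t - m t) \<in> range (op_B P Z W) \<and>
    (\<forall>v\<in>range (op_B P Z W). L2_inner \<mu> m v = 0))"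
  obtain a b where ab: "\<And>a' b'. L2_inner \<mu> (\<lambda>t. A h t - A (aff a b) t) (A (aff a' b')) = 0"
    using proj_affine[OF A_mem[OF h]] by blast
  have "(\<lambda>t. A h t - (A h t - A (aff a b) t)) = A (aff a b)" by auto
  then have "Q (\<lambda>t. A h t - A (aff a b) t)"
    using ab L2.diff_mem[OF A_mem[OF h] A_mem[OF affine_G]] unfolding range_op_B Q_def by blast
  then have "Q (SOME m. Q m)" by (rule someI[of Q])
  moreover have "T h = (SOME m. Q m)" by (simp add: op_T_def proj_orth_compl_def Q_def)
  ultimately have Q: "Q (T h)" by simp
  then obtain a b where "(\<lambda>t. A h t - T h t) = A (aff a b)" unfolding range_op_B Q_def by blast
  then have "T h = A (\<lambda>z. h z - aff a b z)"
    unfolding A_diff[OF h affine_G] by (auto simp: fun_eq_iff algebra_simps)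
  moreover have "L2_inner \<mu> (T h) (A (aff a' b')) = 0" for a' b' using Q unfolding range_op_B Q_def by blast
  ultimately show ?thesis using that by blast
qed

lemma H_inner_diff_affine:
  assumes "g \<in> G_space" "k \<in> G_space"
  shows "H_inner (\<lambda>z. g z - aff a b z) k = H_inner g k" "H_inner k (\<lambda>z. g z - aff a b z) = H_inner k g"
  using GH.ip_diff[OF assms(1) affine_G assms(2), of a b] GH.ip_diff'[OF assms(1) affine_G assms(2), of a b]
    H_inner_affine[OF assms(2), of a b] GH.sym[OF assms(2) affine_G, of a b] by auto

lemma H_space_G: "h \<in> H_space \<Longrightarrow> h \<in> G_space" by (simp add: H_space_def)

lemma Gn_H_space: "h \<in> H_space \<Longrightarrow> Gn h = Hn h" by (simp add: H_space_def Gn_def)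

text \<open>If \<open>T h\<close> vanishes, then \<open>h\<close> minus some affine function lies in
  the kernel of \<open>A\<close>; so \<open>h\<close> is affine on \<open>[0,1]\<close> and has
  seminorm zero.\<close>

lemma T_injective:
  assumes h: "h \<in> H_space" and zero: "AE t in \<mu>. T h t = 0"
  shows "H_inner h h = 0"
proof -
  note hG = H_space_G[OF h]
  obtain a b where ab: "T h = A (\<lambda>z. h z - aff a b z)" using T_props[OF hG] by metis
  let ?g = "\<lambda>z. h z - aff a b z"
  have g: "?g \<in> G_space" by (rule GH.diff_mem[OF hG affine_G])
  have "?g z = 0" if "z \<in> {0..1}" for z using A_injective[OF g _ that] zero ab by simp
  then have "H_inner h h = H_inner (aff a b) (aff a b)" by (intro H_inner_cong) auto
  then show ?thesis using H_inner_affine[OF affine_G] by simp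
qed

text \<open>The partial sums of the expansion converge in \<open>\<G>\<close> to some \<open>s\<close>; then \<open>c - s\<close> is orthogonal to every
  \<open>\<phi>\<^sub>j\<close>, so it lies in the kernel of \<open>T\<close>, which is trivial.\<close>

lemma singular_bessel_le:
  assumes ss: "singular_system T \<mu> J \<sigma> \<phi> \<psi>" and c: "c \<in> H_space"
    and K: "\<And>F. finite F \<Longrightarrow> F \<subseteq> J \<Longrightarrow> (\<Sum>j\<in>F. (H_inner c (\<phi> j))\<^sup>2) \<le> K"
  shows "H_inner c c \<le> K"
proof -
  note cG = H_space_G[OF c]
  have \<phi>H: "\<phi> j \<in> H_space" if "j \<in> J" for j using ss that by (simp add: singular_system_def)
  note \<phi>G = H_space_G[OF \<phi>H]
  have on: "H_inner (\<phi> i) (\<phi> j) = (if i = j then 1 else 0)" if "i \<in> J" "j \<in> J" for i j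
    using ss that unfolding singular_system_def by blast
  define a where "a = (\<lambda>j. H_inner c (\<phi> j))"
  \<comment> \<open>Windows of \<open>J\<close>, so that the partial sums are finite whether
    \<open>J\<close> is finite or not.\<close>
  define I where "I = (\<lambda>m n. {j\<in>J. m \<le> j \<and> j < n})"
  have fI: "finite (I m n)" "I m n \<subseteq> J" for m n by (auto simp: I_def)
  define S where "S = (\<lambda>m n z. \<Sum>j\<in>I m n. a j *\<^sub>R \<phi> j z)"
  have SG: "S m n \<in> G_space" and Sip: "h \<in> G_space \<Longrightarrow> H_inner (S m n) h = (\<Sum>j\<in>I m n. a j * H_inner (\<phi> j) h)" for m n h
    unfolding S_def using GH.sum_mem[OF fI(1), of m n \<phi>] \<phi>G fI(2) cG by blast+
  have S\<phi>: "H_inner (S m n) (\<phi> i) = (if i \<in> I m n then a i else 0)" if i: "i \<in> J" for m n i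
  proof -
    have "H_inner (S m n) (\<phi> i) = (\<Sum>j\<in>I m n. if j = i then a i else 0)"
      unfolding Sip[OF \<phi>G[OF i]]
    proof (rule sum.cong[OF refl])
      fix j assume "j \<in> I m n"
      then have "j \<in> J" using fI(2) by blast
      then show "a j * H_inner (\<phi> j) (\<phi> i) = (if j = i then a i else 0)" using on[OF _ i] by auto
    qed
    then show ?thesis using fI(1) by (simp add: sum.delta)
  qed
  have SS: "H_inner (S m n) (S m n) = (\<Sum>j\<in>I m n. (a j)\<^sup>2)" for m n
  proof -
    have "H_inner (\<phi> j) (S m n) = a j" if "j \<in> I m n" for j
      using S\<phi>[of j m n] GH.sym[OF SG \<phi>G, of j m n] that fI(2) by auto
    then show ?thesis unfolding Sip[OF SG] by (intro sum.cong) (auto simp: power2_eq_square)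
  qed
  define s where "s = (\<lambda>n. \<Sum>j\<in>I 0 n. (a j)\<^sup>2)"
  have sdiff: "(\<Sum>j\<in>I m n. (a j)\<^sup>2) = s n - s m" if "m \<le> n" for m n
  proof -
    have "I 0 n = I 0 m \<union> I m n" "I 0 m \<inter> I m n = {}" using that by (auto simp: I_def)
    then show ?thesis unfolding s_def
      using sum.union_disjoint[OF fI(1)[of 0 m] fI(1)[of m n], of "\<lambda>j. (a j)\<^sup>2"] by simp
  qed
  have sK: "s n \<le> K" for n unfolding s_def a_def by (rule K[OF fI])
  have sinc: "incseq s"
  proof (rule incseq_SucI)
    fix n show "s n \<le> s (Suc n)" using sdiff[of n "Suc n"] sum_nonneg[of "I n (Suc n)" "\<lambda>j. (a j)\<^sup>2"] by simp
  qed
  have sC: "Cauchy s"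
  proof -
    obtain l where "s \<longlonglongrightarrow> l" using incseq_convergent[OF sinc allI[OF sK]] by blast
    then show ?thesis using convergent_Cauchy convergent_def by blast
  qed
  \<comment> \<open>The remainders are shown to converge: their limit \<open>R\<close> is the part
    of \<open>c\<close> orthogonal to every \<open>\<phi> j\<close>, and this is the part that must
    vanish.\<close>
  define r where "r = (\<lambda>n z. c z - S 0 n z)"
  have rG: "r n \<in> G_space" for n unfolding r_def by (rule GH.diff_mem[OF cG SG])
  have S0: "S m n 0 = 0" "deriv01 (S m n) 0 = 0" for m n
  proof -
    show "S m n 0 = 0" unfolding S_def using \<phi>H fI(2)[of m n] by (intro sum.neutral) (auto simp: H_space_def)
    have "(S m n has_vector_derivative (\<Sum>j\<in>I m n. a j *\<^sub>R deriv01 (\<phi> j) 0)) (at 0 within {0..1})"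
      unfolding S_def real_scaleR_def
      by (intro has_vector_derivative_sum has_vector_derivative_mult_right has_deriv01 G_differentiable \<phi>G)
        (use fI(2) in auto)
    then have "deriv01 (S m n) 0 = (\<Sum>j\<in>I m n. a j *\<^sub>R deriv01 (\<phi> j) 0)" by (rule vector_derivative_01) simp
    also have "\<dots> = 0" using \<phi>H fI(2)[of m n] by (intro sum.neutral) (auto simp: H_space_def)
    finally show "deriv01 (S m n) 0 = 0" .
  qed
  have GS: "Gn (S m n) = sqrt (s n - s m)" if "m \<le> n" for m n
    using S0[of m n] by (simp add: Gn_def GH.nrm_def SS sdiff[OF that])
  have rd: "(\<lambda>z. r m z - r n z) = S m n" if "m \<le> n" for m n
  proof
    fix z
    have "I 0 n = I 0 m \<union> I m n" "I 0 m \<inter> I m n = {}" using that by (auto simp: I_def)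
    then have "S 0 n z = S 0 m z + S m n z" unfolding S_def
      using sum.union_disjoint[OF fI(1)[of 0 m] fI(1)[of m n], of "\<lambda>j. a j *\<^sub>R \<phi> j z"] by simp
    then show "r m z - r n z = S m n z" by (simp add: r_def)
  qed
  have Gn_sym: "Gn (\<lambda>z. r m z - r n z) = Gn (\<lambda>z. r n z - r m z)" for m n
    using deriv01_diff[OF rG rG, of 0 m n] deriv01_diff[OF rG rG, of 0 n m]
      GH.nrm_scale[OF GH.diff_mem[OF rG rG], of "-1" m n] by (simp add: Gn_def)
  have "\<exists>N. \<forall>m\<ge>N. \<forall>n\<ge>N. Gn (\<lambda>z. r m z - r n z) < e" if e: "e > 0" for e
  proof -
    obtain N where N: "\<And>m n. m \<ge> N \<Longrightarrow> n \<ge> N \<Longrightarrow> norm (s m - s n) < e\<^sup>2"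
      using CauchyD[OF sC, of "e\<^sup>2"] e by auto
    have *: "Gn (\<lambda>z. r m z - r n z) < e" if "N \<le> m" "m \<le> n" for m n
      unfolding rd[OF that(2)] GS[OF that(2)] using N[of n m] that e by (auto intro!: real_less_lsqrt)
    have "Gn (\<lambda>z. r m z - r n z) < e" if "N \<le> m" "N \<le> n" for m n
      using *[of m n] *[of n m] Gn_sym[of m n] that by (cases "m \<le> n") auto
    then show ?thesis by blast
  qed
  from G_complete[OF rG this] obtain R where R: "R \<in> G_space" "(\<lambda>n. Gn (\<lambda>z. r n z - R z)) \<longlonglongrightarrow> 0" by blast
  have rR: "(\<lambda>z. r n z - R z) \<in> G_space" for n by (rule GH.diff_mem[OF rG R(1)])
  have r0: "r n 0 = 0" "deriv01 (r n) 0 = 0" for n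
    using c S0[of 0 n] deriv01_diff[OF cG SG, of 0 0 n] by (auto simp: r_def H_space_def)
  have lim0: "x = 0" if "\<And>n. \<bar>x\<bar> \<le> Gn (\<lambda>z. r n z - R z)" for x
    using LIMSEQ_le_const[OF R(2), of "\<bar>x\<bar>"] that by simp
  have "R 0 = 0" by (rule lim0) (use Gn_bounds(1)[OF rR, of 0] r0 in simp)
  moreover have "deriv01 R 0 = 0"
    by (rule lim0) (use Gn_bounds(2)[OF rR, of 0] deriv01_diff[OF rG R(1), of 0] r0 in simp)
  ultimately have RH: "R \<in> H_space" using R(1) by (simp add: H_space_def)
  have "H_inner R (\<phi> j) = 0" if j: "j \<in> J" for j
  proof -
    have r\<phi>: "H_inner (r n) (\<phi> j) = 0" if "n > j" for n
      unfolding r_def GH.ip_diff[OF cG SG \<phi>G[OF j]] S\<phi>[OF j] using that j by (simp add: I_def a_def)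
    have "\<bar>H_inner R (\<phi> j)\<bar> \<le> Gn (\<lambda>z. r n z - R z)" if "n > j" for n
    proof -
      have "\<bar>H_inner (\<lambda>z. r n z - R z) (\<phi> j)\<bar> \<le> Hn (\<lambda>z. r n z - R z) * Hn (\<phi> j)"
        by (rule GH.cauchy_schwarz[OF rR \<phi>G[OF j]])
      moreover have "Hn (\<phi> j) = 1" using on[OF j j] by (simp add: GH.nrm_def)
      ultimately show ?thesis
        using r\<phi>[OF that] Gn_bounds(3)[OF rR, of 0 n] by (simp add: GH.ip_diff[OF rG R(1) \<phi>G[OF j]])
    qed
    then have "\<bar>H_inner R (\<phi> j)\<bar> \<le> 0"
      by (intro LIMSEQ_le_const[OF R(2)]) (auto intro!: exI[of _ "Suc j"])
    then show ?thesis by simp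
  qed
  then have "AE t in \<mu>. T R t = 0" using ss RH unfolding singular_system_def by blast
  then have "H_inner R R = 0" by (rule T_injective[OF RH])
  then have R0: "Hn R = 0" by (simp add: GH.nrm_def)
  \<comment> \<open>The squared seminorm of a remainder is \<open>H_inner c c - s n\<close>, and it
    tends to zero with the distance to \<open>R\<close>.\<close>
  have "H_inner c c \<le> K + (Gn (\<lambda>z. r n z - R z))\<^sup>2" for n
  proof -
    have "Hn (r n) \<le> Hn R + Hn (\<lambda>z. r n z - R z)" by (rule GH.nrm_triangle_diff[OF rG R(1)])
    then have "Hn (r n) \<le> Gn (\<lambda>z. r n z - R z)" using R0 Gn_bounds(3)[OF rR, of 0 n] by simp
    then have 1: "(Hn (r n))\<^sup>2 \<le> (Gn (\<lambda>z. r n z - R z))\<^sup>2" using GH.nrm_nonneg[OF rG] by (intro power_mono)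
    have cs: "H_inner c (S 0 n) = s n"
    proof -
      have "H_inner c (S 0 n) = H_inner (S 0 n) c" by (rule GH.sym[OF cG SG])
      also have "\<dots> = (\<Sum>j\<in>I 0 n. a j * a j)"
        unfolding Sip[OF cG] using fI(2)[of 0 n] GH.sym[OF \<phi>G cG] by (intro sum.cong) (auto simp: a_def)
      finally show ?thesis by (simp add: s_def power2_eq_square)
    qed
    have "(Hn (r n))\<^sup>2 = H_inner (r n) (r n)" by (rule GH.nrm_sq[OF rG])
    also have "\<dots> = H_inner c c - 2 * s n + s n"
      unfolding r_def GH.expand_diff[OF cG SG] cs SS by (simp add: s_def)
    finally have "(Hn (r n))\<^sup>2 = H_inner c c - 2 * s n + s n" .
    then show ?thesis using 1 sK[of n] by simp
  qed
  moreover have "(\<lambda>n. K + (Gn (\<lambda>z. r n z - R z))\<^sup>2) \<longlonglongrightarrow> K + 0\<^sup>2" by (intro tendsto_intros R(2))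
  ultimately show ?thesis using LIMSEQ_le_const[of _ "K + 0\<^sup>2"] by fastforce
qed

text \<open>For \<open>\<gamma> \<le> 2\<close> the product of
  \<open>lam powr (1 - \<gamma> / 2)\<close> and \<open>(s\<^sup>2) powr (\<gamma> / 2)\<close> is
  at most the larger of \<open>lam\<close> and \<open>s\<^sup>2\<close>. For larger exponents the
  filter saturates: since \<open>s \<le> 1\<close>, the power of \<open>s\<close> is lowered to 2,
  and the bound is \<open>lam\<close>. This is the origin of \<open>min \<gamma> 2\<close>.\<close>

lemma spectral_filter_bound:
  fixes lam s \<gamma> :: real
  assumes lam: "0 < lam" "lam \<le> 1" and s: "0 < s" "s \<le> 1" and \<gamma>: "\<gamma> > 0"
  shows "lam * s powr \<gamma> / (lam + s\<^sup>2) \<le> lam powr (min \<gamma> 2 / 2)"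
proof (cases "\<gamma> \<le> 2")
  case True
  let ?M = "max lam (s\<^sup>2)" and ?p = "\<gamma> / 2"
  have M: "?M > 0" using lam by simp
  have "lam * s powr \<gamma> = lam powr ?p * (lam powr (1 - ?p) * (s\<^sup>2) powr ?p)"
  proof -
    have "lam powr ?p * lam powr (1 - ?p) = lam" using lam by (simp add: powr_add[symmetric])
    moreover have "(s\<^sup>2) powr ?p = s powr \<gamma>" using s by (simp add: powr_powr flip: powr_numeral)
    ultimately show ?thesis by (metis mult.assoc)
  qed
  also have "lam powr (1 - ?p) * (s\<^sup>2) powr ?p \<le> ?M powr (1 - ?p) * ?M powr ?p"
    using lam s True \<gamma> by (intro mult_mono powr_mono2) auto
  also have "?M powr (1 - ?p) * ?M powr ?p = ?M" using M by (simp add: powr_add[symmetric])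
  also have "?M \<le> lam + s\<^sup>2" using lam by simp
  finally have "lam * s powr \<gamma> \<le> lam powr ?p * (lam + s\<^sup>2)" by (simp add: mult_left_mono)
  moreover have "lam + s\<^sup>2 > 0" using lam by (simp add: add_pos_nonneg)
  ultimately show ?thesis using True by (simp add: divide_le_eq)
next
  case False
  have "s powr \<gamma> \<le> s powr 2" using s False by (intro powr_mono') auto
  also have "\<dots> \<le> lam + s\<^sup>2" using lam s by simp
  finally have "lam * s powr \<gamma> \<le> lam * (lam + s\<^sup>2)" using lam by simp
  moreover have "lam + s\<^sup>2 > 0" using lam by (simp add: add_pos_nonneg)
  ultimately show ?thesis using False lam by (simp add: divide_le_eq)
qed

text \<open>Coercivity reduces the bias to \<open>An\<close> and \<open>Hn\<close>. The seminorm
  \<open>Hn\<close> only sees the part \<open>c\<close> of the bias in \<open>H_space\<close>, whose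
  coefficients are explicit and are summed by \<open>singular_bessel_le\<close>; \<open>An\<close>
  is at most \<open>Hn c\<close> because \<open>A\<close> of the bias is orthogonal to the affine
  directions.\<close>

lemma tikhonov_source_rate:
  assumes g0: "g0 \<in> G_space"
    and ss: "singular_system T \<mu> J \<sigma> \<phi> \<psi>" and \<gamma>: "\<gamma> > 0"
    and source: "(\<lambda>j. \<sigma> j powr (- 2 * \<gamma>) * \<bar>H_inner (\<lambda>z. g0 z - g0 0 - deriv01 g0 0 * z) (\<phi> j)\<bar>\<^sup>2) summable_on J"
  obtains K where "K \<ge> 0" "\<And>lam x. 0 < lam \<Longrightarrow> lam \<le> 1 \<Longrightarrow> x \<in> G_space \<Longrightarrow>
     (\<And>h. h \<in> G_space \<Longrightarrow> Aip (\<lambda>z. g0 z - x z) h = lam * H_inner x h) \<Longrightarrow>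
     Gn (\<lambda>z. g0 z - x z) \<le> K * lam powr (min \<gamma> 2 / 2)"
proof -
  obtain C where C: "C > 0" "\<And>g. g \<in> G_space \<Longrightarrow> Gn g \<le> C * (An g + Hn g)" using A_coercive by blast
  have \<phi>H: "\<phi> j \<in> H_space" and \<sigma>0: "\<sigma> j > 0" and \<psi>L: "\<psi> j \<in> L2_space \<mu>"
    and on: "H_inner (\<phi> j) (\<phi> j) = 1" and Lon: "L2_inner \<mu> (\<psi> j) (\<psi> j) = 1"
    and T\<phi>: "AE t in \<mu>. T (\<phi> j) t = complex_of_real (\<sigma> j) * \<psi> j t"
    and adj: "\<And>h. h \<in> H_space \<Longrightarrow> L2_inner \<mu> (T h) (\<psi> j) = H_inner h (\<lambda>z. \<sigma> j * \<phi> j z)" if "j \<in> J" for j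
    using ss that by (auto simp: singular_system_def T_adjoint_at_def)
  note \<phi>G = H_space_G[OF \<phi>H]
  have TL: "T h \<in> L2_space \<mu>" if h: "h \<in> G_space" for h
  proof -
    obtain a b where "T h = A (\<lambda>z. h z - aff a b z)" using T_props[OF h] by metis
    then show ?thesis using A_mem[OF GH.diff_mem[OF h affine_G]] by simp
  qed
  have inner_T\<phi>: "L2_inner \<mu> l (T (\<phi> j)) = \<sigma> j * L2_inner \<mu> l (\<psi> j)" if j: "j \<in> J" and l: "l \<in> L2_space \<mu>" for j l
  proof -
    have "L2_inner \<mu> l (T (\<phi> j)) = L2_inner \<mu> (T (\<phi> j)) l" by (rule L2.sym[OF l TL[OF \<phi>G[OF j]]])
    also have "\<dots> = L2_inner \<mu> (\<lambda>t. \<sigma> j *\<^sub>R \<psi> j t) l"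
      by (rule L2_inner_cong_AE[OF TL[OF \<phi>G[OF j]] L2.scale_mem[OF \<psi>L[OF j]] l])
        (use T\<phi>[OF j] in \<open>simp add: scaleR_conv_of_real\<close>)
    also have "\<dots> = \<sigma> j * L2_inner \<mu> l (\<psi> j)"
      unfolding L2.ip_scale[OF \<psi>L[OF j] l] using L2.sym[OF l \<psi>L[OF j]] by simp
    finally show ?thesis .
  qed
  \<comment> \<open>The filter bound asks for this. It holds since a projection does not increase
    norms and \<open>An h \<le> Gn h = Hn h\<close> on \<open>H_space\<close>.\<close>
  have \<sigma>1: "\<sigma> j \<le> 1" if j: "j \<in> J" for j
  proof -
    obtain a b where ab: "T (\<phi> j) = A (\<lambda>z. \<phi> j z - aff a b z)" "\<And>a' b'. L2_inner \<mu> (T (\<phi> j)) (A (aff a' b')) = 0"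
      using T_props[OF \<phi>G[OF j]] by metis
    note TJ = TL[OF \<phi>G[OF j]]
    have "L2_inner \<mu> (T (\<phi> j)) (T (\<phi> j)) = L2_inner \<mu> (T (\<phi> j)) (A (\<phi> j))"
    proof -
      have "L2_inner \<mu> (T (\<phi> j)) (T (\<phi> j)) = L2_inner \<mu> (T (\<phi> j)) (\<lambda>t. A (\<phi> j) t - A (aff a b) t)"
        using ab(1) A_diff[OF \<phi>G[OF j] affine_G, of a b] by simp
      then show ?thesis using L2.ip_diff'[OF A_mem[OF \<phi>G[OF j]] A_mem[OF affine_G] TJ] ab(2) by simp
    qed
    also have "\<dots> \<le> L2.nrm \<mu> (T (\<phi> j)) * An (\<phi> j)"
      using L2.cauchy_schwarz[OF TJ A_mem[OF \<phi>G[OF j]]] by linarith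
    also have "\<dots> \<le> L2.nrm \<mu> (T (\<phi> j)) * 1"
      using An_le_Gn[OF \<phi>G[OF j]] L2.nrm_nonneg[OF TJ] Gn_H_space[OF \<phi>H[OF j]] on[OF j]
      by (intro mult_left_mono) (auto simp: GH.nrm_def)
    finally have le: "(L2.nrm \<mu> (T (\<phi> j)))\<^sup>2 \<le> L2.nrm \<mu> (T (\<phi> j))" using L2.nrm_sq[OF TJ] by simp
    have "L2_inner \<mu> (T (\<phi> j)) (T (\<phi> j)) = \<sigma> j * (\<sigma> j * L2_inner \<mu> (\<psi> j) (\<psi> j))"
      using inner_T\<phi>[OF j TJ] inner_T\<phi>[OF j \<psi>L[OF j]] L2.sym[OF TJ \<psi>L[OF j]] by simp
    then have "L2.nrm \<mu> (T (\<phi> j)) = \<sigma> j"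
      using Lon[OF j] \<sigma>0[OF j] by (simp add: L2.nrm_def)
    then show ?thesis using le \<sigma>0[OF j] by (simp add: power2_eq_square)
  qed
  have g0': "H_inner (\<lambda>z. g0 z - g0 0 - deriv01 g0 0 * z) k = H_inner g0 k" if "k \<in> G_space" for k
  proof -
    have "(\<lambda>z. g0 z - g0 0 - deriv01 g0 0 * z) = (\<lambda>z. g0 z - aff (g0 0) (deriv01 g0 0) z)" by auto
    then show ?thesis using H_inner_diff_affine(1)[OF g0 that] by simp
  qed
  define w where "w = (\<lambda>j. \<sigma> j powr (- 2 * \<gamma>) * \<bar>H_inner (\<lambda>z. g0 z - g0 0 - deriv01 g0 0 * z) (\<phi> j)\<bar>\<^sup>2)"
  define S where "S = infsum w J"
  have w0: "w j \<ge> 0" for j by (simp add: w_def)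
  have wS: "sum w F \<le> S" if "finite F" "F \<subseteq> J" for F
    unfolding S_def using source that w0 by (intro finite_sum_le_infsum) (auto simp: w_def)
  have S0: "S \<ge> 0" using wS[of "{}"] by simp
  have "Gn (\<lambda>z. g0 z - x z) \<le> (2 * C * sqrt S) * lam powr (min \<gamma> 2 / 2)"
    if lam: "0 < lam" "lam \<le> 1" and x: "x \<in> G_space"
      and foc: "\<And>h. h \<in> G_space \<Longrightarrow> Aip (\<lambda>z. g0 z - x z) h = lam * H_inner x h" for lam x
  proof -
    let ?\<theta> = "lam powr (min \<gamma> 2 / 2)"
    define b where "b = (\<lambda>z. g0 z - x z)"
    have bG: "b \<in> G_space" unfolding b_def by (rule GH.diff_mem[OF g0 x])
    have foc': "Aip b h + lam * H_inner b h = lam * H_inner g0 h" if h: "h \<in> G_space" for h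
      using foc[OF h] unfolding b_def GH.ip_diff[OF g0 x h] by (simp add: right_diff_distrib)
    \<comment> \<open>The bias minus its affine Taylor polynomial at 0: it lies in
      \<open>H_space\<close>, where the singular system applies, and has the same inner products for
      \<open>H_inner\<close>.\<close>
    define c where "c = (\<lambda>z. b z - aff (b 0) (deriv01 b 0) z)"
    have cG: "c \<in> G_space" unfolding c_def by (rule GH.diff_mem[OF bG affine_G])
    have cH: "c \<in> H_space"
      using cG deriv01_diff[OF bG affine_G, of 0] affine_deriv01[of 0] by (simp add: H_space_def c_def)
    have cb: "H_inner c k = H_inner b k" if "k \<in> G_space" for k
      unfolding c_def by (rule H_inner_diff_affine(1)[OF bG that])
    \<comment> \<open>Affine directions carry no penalty, so the first-order condition makes
      \<open>A b\<close> orthogonal to their images.\<close>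
    have orth: "Aip b (aff a' b') = 0" for a' b'
      using foc[OF affine_G] H_inner_affine[OF x] by (simp add: b_def)
    have Hc: "H_inner c (\<phi> j) = lam / (lam + (\<sigma> j)\<^sup>2) * H_inner g0 (\<phi> j)" if j: "j \<in> J" for j
    proof -
      obtain a' b' where ab: "T (\<phi> j) = A (\<lambda>z. \<phi> j z - aff a' b' z)" "\<And>a' b'. L2_inner \<mu> (T (\<phi> j)) (A (aff a' b')) = 0"
        using T_props[OF \<phi>G[OF j]] by metis
      \<comment> \<open>The test function is \<open>\<phi> j\<close> corrected by the affine
        function that makes \<open>A ?g\<close> equal to \<open>T (\<phi> j)\<close>, so that the
        adjoint relation can be used.\<close>
      let ?g = "\<lambda>z. \<phi> j z - aff a' b' z"
      have gG: "?g \<in> G_space" by (rule GH.diff_mem[OF \<phi>G[OF j] affine_G])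
      obtain a'' b'' where ab2: "T c = A (\<lambda>z. c z - aff a'' b'' z)" using T_props[OF cG] by metis
      let ?k = "aff (b 0 + a'') (deriv01 b 0 + b'')"
      have "(\<lambda>z. c z - aff a'' b'' z) = (\<lambda>z. b z - ?k z)" by (auto simp: c_def algebra_simps)
      then have Tc: "T c = (\<lambda>t. A b t - A ?k t)" using ab2 A_diff[OF bG affine_G] by simp
      have "L2_inner \<mu> (T c) (T (\<phi> j)) = L2_inner \<mu> (A b) (T (\<phi> j)) - L2_inner \<mu> (A ?k) (T (\<phi> j))"
        unfolding Tc by (rule L2.ip_diff[OF A_mem[OF bG] A_mem[OF affine_G] TL[OF \<phi>G[OF j]]])
      also have "L2_inner \<mu> (A ?k) (T (\<phi> j)) = 0"
        using ab(2) L2.sym[OF A_mem[OF affine_G] TL[OF \<phi>G[OF j]]] by simp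
      finally have "Aip b ?g = L2_inner \<mu> (T c) (T (\<phi> j))" using ab(1) by (simp add: Aip_def)
      also have "\<dots> = \<sigma> j * (\<sigma> j * H_inner c (\<phi> j))"
        using inner_T\<phi>[OF j TL[OF cG]] adj[OF j cH] GH.ip_scale'[OF \<phi>G[OF j] cG, of "\<sigma> j"] by simp
      finally have "\<sigma> j * (\<sigma> j * H_inner c (\<phi> j)) + lam * H_inner b ?g = lam * H_inner g0 ?g"
        using foc'[OF gG] by simp
      then have "(lam + (\<sigma> j)\<^sup>2) * H_inner c (\<phi> j) = lam * H_inner g0 (\<phi> j)"
        unfolding H_inner_diff_affine(2)[OF \<phi>G[OF j] bG] H_inner_diff_affine(2)[OF \<phi>G[OF j] g0] cb[OF \<phi>G[OF j]]
        by (simp add: power2_eq_square algebra_simps)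
      moreover have "lam + (\<sigma> j)\<^sup>2 > 0" using lam by (simp add: add_pos_nonneg)
      ultimately show ?thesis by (simp add: field_simps)
    qed
    have coeff_le: "(H_inner c (\<phi> j))\<^sup>2 \<le> ?\<theta>\<^sup>2 * w j" if j: "j \<in> J" for j
    proof -
      let ?q = "lam * \<sigma> j powr \<gamma> / (lam + (\<sigma> j)\<^sup>2)"
      have p: "\<sigma> j powr \<gamma> * \<sigma> j powr (- \<gamma>) = 1" using \<sigma>0[OF j] by (simp add: powr_add[symmetric])
      have "lam / (lam + (\<sigma> j)\<^sup>2) = ?q * \<sigma> j powr (- \<gamma>)"
        using p by (simp add: mult.assoc)
      then have "(H_inner c (\<phi> j))\<^sup>2 = ?q\<^sup>2 * ((\<sigma> j powr (- \<gamma>))\<^sup>2 * (H_inner g0 (\<phi> j))\<^sup>2)"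
        unfolding Hc[OF j] by (simp only: power_mult_distrib mult.assoc)
      also have "(\<sigma> j powr (- \<gamma>))\<^sup>2 * (H_inner g0 (\<phi> j))\<^sup>2 = w j"
        unfolding w_def g0'[OF \<phi>G[OF j]] power2_abs
        by (simp add: power2_eq_square powr_add[symmetric])
      also have "?q\<^sup>2 * w j \<le> ?\<theta>\<^sup>2 * w j"
        using spectral_filter_bound[OF lam \<sigma>0[OF j] \<sigma>1[OF j] \<gamma>] lam w0[of j]
        by (intro mult_right_mono power_mono) (auto intro!: divide_nonneg_nonneg add_nonneg_nonneg)
      finally show ?thesis .
    qed
    have "H_inner c c \<le> ?\<theta>\<^sup>2 * S"
    proof (rule singular_bessel_le[OF ss cH])
      fix F assume F: "finite F" "F \<subseteq> J"
      have "(\<Sum>j\<in>F. (H_inner c (\<phi> j))\<^sup>2) \<le> (\<Sum>j\<in>F. ?\<theta>\<^sup>2 * w j)"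
        using coeff_le F by (intro sum_mono) auto
      also have "\<dots> = ?\<theta>\<^sup>2 * sum w F" by (rule sum_distrib_left[symmetric])
      also have "\<dots> \<le> ?\<theta>\<^sup>2 * S" using wS[OF F] by (intro mult_left_mono) auto
      finally show "(\<Sum>j\<in>F. (H_inner c (\<phi> j))\<^sup>2) \<le> ?\<theta>\<^sup>2 * S" .
    qed
    then have Hnc: "Hn c \<le> ?\<theta> * sqrt S"
      using real_sqrt_le_mono[of "H_inner c c" "?\<theta>\<^sup>2 * S"] by (simp add: GH.nrm_def real_sqrt_mult)
    have Hnb: "Hn b = Hn c"
    proof -
      have "H_inner c c = H_inner b c" by (rule cb[OF cG])
      also have "\<dots> = H_inner b b" unfolding c_def by (rule H_inner_diff_affine(2)[OF bG bG])
      finally show ?thesis by (simp add: GH.nrm_def)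
    qed
    \<comment> \<open>By \<open>orth\<close>, \<open>Aip b c = Aip b b\<close>; Cauchy-Schwarz then
      bounds \<open>An b\<close> by \<open>An c\<close>, and the affine part of the bias drops
      out.\<close>
    have "An b \<le> Hn c"
    proof -
      have "Aip b c = Aip b b" unfolding c_def GA.ip_diff'[OF bG affine_G bG] orth by simp
      then have "(An b)\<^sup>2 \<le> An b * An c"
        using GA.cauchy_schwarz[OF bG cG] Aip_self[OF bG] unfolding GA_nrm by linarith
      then have "An b \<le> An c" using An_nonneg[OF bG] An_nonneg[OF cG] by (cases "An b = 0") (auto simp: power2_eq_square)
      then show ?thesis using An_le_Gn[OF cG] Gn_H_space[OF cH] by simp
    qed
    then have "C * (An b + Hn b) \<le> C * (Hn c + Hn c)" using Hnb C(1) by (intro mult_left_mono) auto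
    then have "Gn b \<le> C * (Hn c + Hn c)" using C(2)[OF bG] by linarith
    also have "\<dots> \<le> C * (?\<theta> * sqrt S + ?\<theta> * sqrt S)" using C(1) by (intro mult_left_mono add_mono Hnc) auto
    finally show ?thesis by (simp add: b_def algebra_simps)
  qed
  then show ?thesis using that[of "2 * C * sqrt S"] C(1) S0 by auto
qed

end

section \<open>The estimation error\<close>

text \<open>The weights are left free: residuals give the integrand of the criterion, and the values
  \<open>g (z i)\<close> give the empirical counterpart of \<open>A g\<close>.\<close>

definition ecf :: "nat \<Rightarrow> (nat \<Rightarrow> real) \<Rightarrow> (nat \<Rightarrow> real ^ 'p) \<Rightarrow> real ^ 'p \<Rightarrow> complex" where
  "ecf n c w t = complex_of_real (1 / real n) * (\<Sum>i<n. complex_of_real (c i) * iexp (w i \<bullet> t))"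

lemma ecf_lincomb: "ecf n (\<lambda>i. a * c i + b * d i) w t = a *\<^sub>R ecf n c w t + b *\<^sub>R ecf n d w t"
  by (simp add: ecf_def scaleR_conv_of_real sum_distrib_left sum.distrib distrib_right distrib_left mult_ac)

lemma ecf_add: "ecf n (\<lambda>i. c i + d i) w = (\<lambda>t. ecf n c w t + ecf n d w t)"
  using ecf_lincomb[of n 1 c 1 d w] by (simp add: fun_eq_iff)

lemma ecf_diff: "ecf n (\<lambda>i. c i - d i) w = (\<lambda>t. ecf n c w t - ecf n d w t)"
  using ecf_lincomb[of n 1 c "-1" d w] by (simp add: fun_eq_iff)

lemma criterion_ecf:
  "criterion \<mu> n lam y z w g =
     L2_inner \<mu> (ecf n (\<lambda>i. y i - g (z i)) w) (ecf n (\<lambda>i. y i - g (z i)) w) + lam * H_inner g g"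
  unfolding criterion_def L2_inner_self ecf_def H_inner_def by (simp only: power2_eq_square)

context npiv
begin

lemma ecf_mem: "ecf n c w \<in> L2_space \<mu>"
proof (rule bounded_mem_L2_space[OF mu.finite_measure_axioms])
  have "continuous_on UNIV (ecf n c w)" unfolding ecf_def by (intro continuous_intros)
  from borel_measurable_continuous_onI[OF this] show "ecf n c w \<in> borel_measurable \<mu>" by simp
  show "cmod (ecf n c w t) \<le> \<bar>1 / real n\<bar> * (\<Sum>i<n. \<bar>c i\<bar>)" for t
    unfolding ecf_def norm_mult norm_of_real
    by (intro mult_left_mono order_trans[OF norm_sum] sum_mono) (auto simp: norm_mult)
qed

text \<open>Along a line the criterion is exactly quadratic, so minimality and the discriminant
  bound with \<open>e = 0\<close> give an equality.\<close>

lemma arg_min_foc: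
  assumes min: "is_arg_min (criterion \<mu> n lam y z w) (\<lambda>g. g \<in> G_space) g"
    and lam: "lam > 0" and k: "k \<in> G_space"
  shows "L2_inner \<mu> (ecf n (\<lambda>i. y i - g (z i)) w) (ecf n (\<lambda>i. k (z i)) w) = lam * H_inner g k"
proof -
  have g: "g \<in> G_space" and le: "\<And>f. f \<in> G_space \<Longrightarrow> criterion \<mu> n lam y z w g \<le> criterion \<mu> n lam y z w f"
    using min by (auto simp: is_arg_min_linorder)
  define r where "r = ecf n (\<lambda>i. y i - g (z i)) w"
  define e where "e = ecf n (\<lambda>i. k (z i)) w"
  have re: "r \<in> L2_space \<mu>" "e \<in> L2_space \<mu>" unfolding r_def e_def by (rule ecf_mem)+
  have "(L2_inner \<mu> r e - lam * H_inner g k)\<^sup>2 \<le> 0 * (L2_inner \<mu> e e + lam * H_inner k k)"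
  proof (rule quadratic_nonneg_discriminant)
    show "0 \<le> L2_inner \<mu> e e + lam * H_inner k k" using L2.nonneg[OF re(2)] GH.nonneg[OF k] lam by simp
    fix s :: real
    let ?f = "\<lambda>x. g x + s *\<^sub>R k x"
    have "ecf n (\<lambda>i. y i - ?f (z i)) w = (\<lambda>t. r t + (- s) *\<^sub>R e t)"
      using ecf_lincomb[of n 1 "\<lambda>i. y i - g (z i)" "- s" "\<lambda>i. k (z i)" w]
      by (simp add: r_def e_def fun_eq_iff algebra_simps)
    then have "criterion \<mu> n lam y z w ?f =
        L2_inner \<mu> (\<lambda>t. r t + (- s) *\<^sub>R e t) (\<lambda>t. r t + (- s) *\<^sub>R e t) + lam * H_inner ?f ?f"
      unfolding criterion_ecf by simp
    then have "criterion \<mu> n lam y z w ?f - criterion \<mu> n lam y z w g =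
        0 - 2 * s * (L2_inner \<mu> r e - lam * H_inner g k) + s\<^sup>2 * (L2_inner \<mu> e e + lam * H_inner k k)"
      unfolding criterion_ecf L2.expand_add[OF re] GH.expand_add[OF g k]
      by (simp add: r_def[symmetric] algebra_simps)
    then show "0 \<le> 0 - 2 * s * (L2_inner \<mu> r e - lam * H_inner g k) + s\<^sup>2 * (L2_inner \<mu> e e + lam * H_inner k k)"
      using le[OF GH.add_mem[OF g GH.scale_mem[OF k]], of s] by linarith
  qed
  then show ?thesis by (simp add: r_def e_def)
qed

text \<open>A deterministic estimate for one realisation of the sample. Randomness appears only
  through the noise norm and the operator error \<open>\<Delta>\<close>, so probability is needed
  only to make these two small.\<close>

lemma estimator_error_bound:
  assumes min: "is_arg_min (criterion \<mu> n lam y z w) (\<lambda>g. g \<in> G_space) g"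
    and lam: "0 < lam" "lam \<le> 1" and g0: "g0 \<in> G_space" and x: "x \<in> G_space"
    and foc: "\<And>h. h \<in> G_space \<Longrightarrow> Aip (\<lambda>z. g0 z - x z) h = lam * H_inner x h"
    and C: "C > 0" "\<And>g. g \<in> G_space \<Longrightarrow> Gn g \<le> C * (An g + Hn g)"
    and \<Delta>: "0 \<le> \<Delta>" "C * \<Delta> \<le> 1/2"
      "\<And>g. g \<in> G_space \<Longrightarrow> L2.nrm \<mu> (\<lambda>t. ecf n (\<lambda>i. g (z i)) w t - A g t) \<le> \<Delta> * Gn g"
  shows "Gn (\<lambda>v. g v - x v) \<le> 4 * C / sqrt lam *
    (L2.nrm \<mu> (ecf n (\<lambda>i. y i - g0 (z i)) w) + \<Delta> * (Gn (\<lambda>v. g0 v - x v) + 4 * C * Hn g0))"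
proof -
  have g: "g \<in> G_space" using min by (auto simp: is_arg_min_linorder)
  define b where "b = (\<lambda>v. g0 v - x v)"
  define d where "d = (\<lambda>v. g v - x v)"
  have bG: "b \<in> G_space" and dG: "d \<in> G_space"
    unfolding b_def d_def by (rule GH.diff_mem[OF g0 x] GH.diff_mem[OF g x])+
  define E where "E = (\<lambda>f. ecf n (\<lambda>i. f (z i)) w)"
  have EL: "E f \<in> L2_space \<mu>" for f unfolding E_def by (rule ecf_mem)
  define e where "e = ecf n (\<lambda>i. y i - g0 (z i)) w"
  have eL: "e \<in> L2_space \<mu>" unfolding e_def by (rule ecf_mem)
  define D where "D = (\<lambda>f t. E f t - A f t)"
  have DL: "f \<in> G_space \<Longrightarrow> D f \<in> L2_space \<mu>" for f unfolding D_def by (rule L2.diff_mem[OF EL A_mem])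
  have Dn: "f \<in> G_space \<Longrightarrow> L2.nrm \<mu> (D f) \<le> \<Delta> * Gn f" for f using \<Delta>(3) by (simp add: D_def E_def)
  have "(\<lambda>i. y i - g (z i)) = (\<lambda>i. (y i - g0 (z i)) + (b (z i) - d (z i)))" by (auto simp: b_def d_def)
  then have "ecf n (\<lambda>i. y i - g (z i)) w = ecf n (\<lambda>i. (y i - g0 (z i)) + (b (z i) - d (z i))) w" by simp
  also have "\<dots> = (\<lambda>t. ecf n (\<lambda>i. y i - g0 (z i)) w t + ecf n (\<lambda>i. b (z i) - d (z i)) w t)" by (rule ecf_add)
  finally have r: "ecf n (\<lambda>i. y i - g (z i)) w = (\<lambda>t. e t + (E b t - E d t))"
    by (simp only: e_def E_def ecf_diff[of n "\<lambda>i. b (z i)" "\<lambda>i. d (z i)"])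
  note dfL = L2.diff_mem[OF EL EL]
  have "lam * H_inner g d = L2_inner \<mu> e (E d) + (L2_inner \<mu> (E b) (E d) - L2_inner \<mu> (E d) (E d))"
  proof -
    have "ecf n (\<lambda>i. d (z i)) w = E d" by (simp add: E_def)
    then show ?thesis
      using arg_min_foc[OF min lam(1) dG] unfolding r
      by (simp add: L2.ip_add[OF eL dfL EL] L2.ip_diff[OF EL EL EL])
  qed
  moreover have "H_inner g d = H_inner d d + H_inner x d"
    using GH.ip_diff[OF g x dG] by (simp add: d_def)
  moreover have "lam * H_inner x d = Aip b d" using foc[OF dG] by (simp add: b_def)
  ultimately have main: "L2_inner \<mu> (E d) (E d) + lam * H_inner d d
      = L2_inner \<mu> e (E d) + (L2_inner \<mu> (E b) (E d) - Aip b d)"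
    by (simp add: distrib_left)
  \<comment> \<open>The empirical operator is replaced in one argument at a time: its error at the
    bias stays paired with \<open>E d\<close>, and its error at \<open>d\<close> is paired with
    \<open>A b\<close>.\<close>
  have split: "L2_inner \<mu> (E b) (E d) - Aip b d = L2_inner \<mu> (D b) (E d) + L2_inner \<mu> (A b) (D d)"
    unfolding D_def Aip_def
    by (simp add: L2.ip_diff[OF EL A_mem[OF bG] EL] L2.ip_diff'[OF EL A_mem[OF dG] A_mem[OF bG]])
  \<comment> \<open>The quantity that the first-order conditions control; each term on the right of
    \<open>main\<close> is to be bounded linearly in \<open>R\<close>.\<close>
  define R where "R = sqrt (L2_inner \<mu> (E d) (E d) + lam * H_inner d d)"
  have nn: "0 \<le> L2_inner \<mu> (E d) (E d)" "0 \<le> lam * H_inner d d"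
    using L2.nonneg[OF EL] GH.nonneg[OF dG] lam by auto
  have R0: "R \<ge> 0" using nn by (simp add: R_def)
  have R2: "R * R = L2_inner \<mu> (E d) (E d) + lam * H_inner d d" using nn by (simp add: R_def)
  have EdR: "L2.nrm \<mu> (E d) \<le> R" unfolding R_def L2.nrm_def using nn by simp
  have HdR: "Hn d \<le> R / sqrt lam"
  proof -
    have "sqrt (lam * H_inner d d) \<le> R" unfolding R_def using nn by simp
    then show ?thesis using lam by (simp add: GH.nrm_def real_sqrt_mult field_simps)
  qed
  have sl: "0 < sqrt lam" "sqrt lam \<le> 1" using lam by auto
  have RR: "R \<le> R / sqrt lam" using R0 sl by (simp add: le_divide_eq mult_left_le)
  \<comment> \<open>Coercivity holds for \<open>A\<close>; replacing \<open>A\<close> by the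
    empirical operator costs \<open>C * \<Delta> * Gn d\<close>, at most half of the left side.
    Absorbing it turns \<open>2 * C\<close> into \<open>4 * C\<close>.\<close>
  have Gd: "Gn d \<le> 4 * C / sqrt lam * R"
  proof -
    have "An d \<le> L2.nrm \<mu> (E d) + L2.nrm \<mu> (D d)"
    proof -
      have "(\<lambda>t. E d t - D d t) = A d" by (auto simp: D_def)
      then show ?thesis using L2.nrm_diff[OF EL DL[OF dG], of d] by simp
    qed
    then have "An d + Hn d \<le> (R / sqrt lam + R / sqrt lam) + \<Delta> * Gn d"
      using EdR HdR RR Dn[OF dG] by linarith
    then have "C * (An d + Hn d) \<le> C * ((R / sqrt lam + R / sqrt lam) + \<Delta> * Gn d)"
      using C(1) by (intro mult_left_mono) auto
    then have "Gn d \<le> 2 * C * (R / sqrt lam) + (C * \<Delta>) * Gn d"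
      using C(2)[OF dG] by (simp add: algebra_simps)
    moreover have "(C * \<Delta>) * Gn d \<le> (1/2) * Gn d"
      using \<Delta>(2) Gn_bounds(4)[OF dG, of 0] by (intro mult_right_mono) auto
    ultimately show ?thesis by simp
  qed
  have "R * R \<le> L2.nrm \<mu> e * R + (\<Delta> * Gn b) * R + (\<Delta> * (4 * C * Hn g0)) * R"
  proof -
    have "L2_inner \<mu> e (E d) \<le> L2.nrm \<mu> e * L2.nrm \<mu> (E d)" using L2.cauchy_schwarz[OF eL EL, of d] by linarith
    also have "\<dots> \<le> L2.nrm \<mu> e * R" using L2.nrm_nonneg[OF eL] EdR by (intro mult_left_mono)
    finally have 1: "L2_inner \<mu> e (E d) \<le> L2.nrm \<mu> e * R" .
    have "L2_inner \<mu> (D b) (E d) \<le> L2.nrm \<mu> (D b) * L2.nrm \<mu> (E d)" using L2.cauchy_schwarz[OF DL[OF bG] EL, of d] by linarith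
    also have "\<dots> \<le> (\<Delta> * Gn b) * R"
      using Dn[OF bG] EdR L2.nrm_nonneg[OF DL[OF bG]] L2.nrm_nonneg[OF EL, of d]
      by (intro mult_mono) auto
    finally have 2: "L2_inner \<mu> (D b) (E d) \<le> (\<Delta> * Gn b) * R" .
    \<comment> \<open>The delicate term: bounding \<open>Gn d\<close> by \<open>R\<close> costs a
      factor \<open>1 / sqrt lam\<close>, which the factor \<open>sqrt lam\<close> in the bound on
      \<open>An b\<close> cancels.\<close>
    have "L2_inner \<mu> (A b) (D d) \<le> An b * L2.nrm \<mu> (D d)" using L2.cauchy_schwarz[OF A_mem[OF bG] DL[OF dG]] by linarith
    also have "\<dots> \<le> (sqrt lam * Hn g0) * (\<Delta> * Gn d)"
    proof (rule mult_mono)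
      show "An b \<le> sqrt lam * Hn g0" unfolding b_def by (rule tikhonov_bounds(1)[OF lam(1) g0 x foc])
    qed (use Dn[OF dG] L2.nrm_nonneg[OF DL[OF dG]] GH.nrm_nonneg[OF g0] lam in auto)
    also have "\<dots> \<le> (sqrt lam * Hn g0) * (\<Delta> * (4 * C / sqrt lam * R))"
      using Gd \<Delta>(1) GH.nrm_nonneg[OF g0] lam by (intro mult_left_mono) auto
    also have "\<dots> = (\<Delta> * (4 * C * Hn g0)) * R" using sl by (simp add: field_simps)
    finally show ?thesis using 1 2 main split R2 by linarith
  qed
  then have "R * R \<le> (L2.nrm \<mu> e + \<Delta> * (Gn b + 4 * C * Hn g0)) * R" by (simp add: algebra_simps)
  moreover have "0 \<le> L2.nrm \<mu> e + \<Delta> * (Gn b + 4 * C * Hn g0)"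
    using L2.nrm_nonneg[OF eL] \<Delta>(1) Gn_bounds(4)[OF bG, of 0] C(1) GH.nrm_nonneg[OF g0] by simp
  ultimately have "R \<le> L2.nrm \<mu> e + \<Delta> * (Gn b + 4 * C * Hn g0)"
    using R0 mult_right_le_imp_le[of R R] by (cases "R = 0") auto
  then have "4 * C / sqrt lam * R \<le> 4 * C / sqrt lam * (L2.nrm \<mu> e + \<Delta> * (Gn b + 4 * C * Hn g0))"
    using C(1) lam by (intro mult_left_mono) auto
  then show ?thesis using Gd unfolding b_def d_def e_def by linarith
qed

end

section \<open>Second moments of empirical averages\<close>

context prob_space
begin

text \<open>Distinct terms are independent and centred, so the cross products have mean zero and
  only the diagonal remains.\<close>

lemma indep_sum_square:
  fixes X :: "nat \<Rightarrow> 'a \<Rightarrow> real"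
  assumes indep: "indep_vars (\<lambda>_. borel) X UNIV"
    and sq: "\<And>i. integrable M (\<lambda>\<omega>. (X i \<omega>)\<^sup>2)"
    and mean: "\<And>i. expectation (X i) = 0" and var: "\<And>i. expectation (\<lambda>\<omega>. (X i \<omega>)\<^sup>2) \<le> v"
  shows "integrable M (\<lambda>\<omega>. (\<Sum>i<n. X i \<omega>)\<^sup>2)" "expectation (\<lambda>\<omega>. (\<Sum>i<n. X i \<omega>)\<^sup>2) \<le> real n * v"
proof -
  have rv[measurable]: "X i \<in> borel_measurable M" for i using indep by (auto simp: indep_vars_def)
  have int: "integrable M (X i)" for i by (rule square_integrable_imp_integrable[OF rv sq])
  have l2X: "X i \<in> l2 M" for i using sq rv by (simp add: l2_def)
  have prod: "expectation (\<lambda>\<omega>. X i \<omega> * X j \<omega>) = 0" if "i \<noteq> j" for i j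
  proof -
    have "indep_vars (\<lambda>_. borel) X {i, j}" using indep_vars_subset[OF indep] by simp
    then have "expectation (\<lambda>\<omega>. \<Prod>k\<in>{i, j}. X k \<omega>) = (\<Prod>k\<in>{i, j}. expectation (X k))"
      by (intro indep_vars_lebesgue_integral) (auto intro: int)
    then show ?thesis using that mean by simp
  qed
  have eq: "(\<Sum>i<n. X i \<omega>)\<^sup>2 = (\<Sum>i<n. \<Sum>j<n. X i \<omega> * X j \<omega>)" for \<omega>
    unfolding power2_eq_square by (rule sum_product)
  show "integrable M (\<lambda>\<omega>. (\<Sum>i<n. X i \<omega>)\<^sup>2)"
    unfolding eq by (intro Bochner_Integration.integrable_sum l2_mult_integrable l2X)
  have "expectation (\<lambda>\<omega>. (\<Sum>i<n. X i \<omega>)\<^sup>2) = (\<Sum>i<n. \<Sum>j<n. expectation (\<lambda>\<omega>. X i \<omega> * X j \<omega>))"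
    unfolding eq
    by (simp add: Bochner_Integration.integral_sum Bochner_Integration.integrable_sum l2_mult_integrable[OF l2X l2X])
  also have "\<dots> = (\<Sum>i<n. \<Sum>j<n. if j = i then expectation (\<lambda>\<omega>. (X i \<omega>)\<^sup>2) else 0)"
    using prod by (intro sum.cong refl) (auto simp: power2_eq_square)
  also have "\<dots> = (\<Sum>i<n. expectation (\<lambda>\<omega>. (X i \<omega>)\<^sup>2))" by (intro sum.cong refl) simp
  also have "\<dots> \<le> (\<Sum>i<n. v)" by (intro sum_mono var)
  finally show "expectation (\<lambda>\<omega>. (\<Sum>i<n. X i \<omega>)\<^sup>2) \<le> real n * v" by simp
qed

text \<open>Moments are taken under the common law \<open>L\<close>, which makes one bound serve all
  indices; the variance is bounded by the second moment.\<close>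

lemma iid_centered_square_real:
  fixes V :: "nat \<Rightarrow> 'a \<Rightarrow> 'v::topological_space" and f :: "'v \<Rightarrow> real"
  assumes indep: "indep_vars (\<lambda>_. borel) V UNIV" and dist: "\<And>i. distr M borel (V i) = L"
    and f[measurable]: "f \<in> borel_measurable borel" and sq: "integrable L (\<lambda>v. (f v)\<^sup>2)"
  shows "integrable M (\<lambda>\<omega>. (\<Sum>i<n. f (V i \<omega>) - (\<integral>v. f v \<partial>L))\<^sup>2)"
    "expectation (\<lambda>\<omega>. (\<Sum>i<n. f (V i \<omega>) - (\<integral>v. f v \<partial>L))\<^sup>2) \<le> real n * (\<integral>v. (f v)\<^sup>2 \<partial>L)"
proof -
  have Vm[measurable]: "V i \<in> measurable M borel" for i using indep by (auto simp: indep_vars_def)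
  define m where "m = (\<integral>v. f v \<partial>L)"
  have mi: "expectation (\<lambda>\<omega>. f (V i \<omega>)) = m" for i
    unfolding m_def dist[of i, symmetric] by (rule integral_distr[symmetric]) auto
  have si: "expectation (\<lambda>\<omega>. (f (V i \<omega>))\<^sup>2) = (\<integral>v. (f v)\<^sup>2 \<partial>L)" for i
    unfolding dist[of i, symmetric] by (rule integral_distr[symmetric]) auto
  have isq: "integrable M (\<lambda>\<omega>. (f (V i \<omega>))\<^sup>2)" for i
    using sq integrable_distr_eq[OF Vm[of i], of "\<lambda>v. (f v)\<^sup>2"] unfolding dist by auto
  have ii: "integrable M (\<lambda>\<omega>. f (V i \<omega>))" for i
    by (rule square_integrable_imp_integrable[OF _ isq]) measurable
  have ind: "indep_vars (\<lambda>_. borel) (\<lambda>i \<omega>. f (V i \<omega>) - m) UNIV"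
    by (rule indep_vars_compose2[OF indep]) auto
  have sq2: "(f (V i \<omega>) - m)\<^sup>2 = (f (V i \<omega>))\<^sup>2 - 2 * m * f (V i \<omega>) + m\<^sup>2" for i \<omega>
    by (simp add: power2_eq_square algebra_simps)
  have 1: "integrable M (\<lambda>\<omega>. (f (V i \<omega>) - m)\<^sup>2)" for i unfolding sq2 using isq ii by auto
  have 2: "expectation (\<lambda>\<omega>. f (V i \<omega>) - m) = 0" for i using ii mi by (simp add: prob_space)
  have 3: "expectation (\<lambda>\<omega>. (f (V i \<omega>) - m)\<^sup>2) \<le> (\<integral>v. (f v)\<^sup>2 \<partial>L)" for i
  proof -
    have "expectation (\<lambda>\<omega>. (f (V i \<omega>) - m)\<^sup>2) = (\<integral>v. (f v)\<^sup>2 \<partial>L) - m\<^sup>2"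
      unfolding sq2 using isq ii mi si by (simp add: prob_space power2_eq_square)
    then show ?thesis by simp
  qed
  show "integrable M (\<lambda>\<omega>. (\<Sum>i<n. f (V i \<omega>) - (\<integral>v. f v \<partial>L))\<^sup>2)"
    "expectation (\<lambda>\<omega>. (\<Sum>i<n. f (V i \<omega>) - (\<integral>v. f v \<partial>L))\<^sup>2) \<le> real n * (\<integral>v. (f v)\<^sup>2 \<partial>L)"
    using indep_sum_square[OF ind 1 2 3] by (auto simp: m_def)
qed

text \<open>Real and imaginary parts are treated separately, and their second moments add up to that
  of \<open>cmod\<close>. The nonnegative integral prepares an exchange of integrals.\<close>

lemma iid_mean_square:
  fixes V :: "nat \<Rightarrow> 'a \<Rightarrow> 'v::topological_space" and f :: "'v \<Rightarrow> complex"
  assumes indep: "indep_vars (\<lambda>_. borel) V UNIV" and dist: "\<And>i. distr M borel (V i) = L"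
    and f[measurable]: "f \<in> borel_measurable borel" and sq: "integrable L (\<lambda>v. (cmod (f v))\<^sup>2)"
    and n: "n > 0"
  shows "(\<integral>\<^sup>+\<omega>. ennreal ((cmod (complex_of_real (1 / real n) * (\<Sum>i<n. f (V i \<omega>)) - (\<integral>v. f v \<partial>L)))\<^sup>2) \<partial>M)
    \<le> ennreal ((\<integral>v. (cmod (f v))\<^sup>2 \<partial>L) / real n)"
proof -
  have Vm[measurable]: "V i \<in> measurable M borel" for i using indep by (auto simp: indep_vars_def)
  have LM: "L = distr M borel (V 0)" using dist by simp
  have fL[measurable]: "f \<in> borel_measurable L" unfolding LM by simp
  interpret L: prob_space L unfolding LM by (rule prob_space_distr) simp
  have sqR: "integrable L (\<lambda>v. (Re (f v))\<^sup>2)" and sqI: "integrable L (\<lambda>v. (Im (f v))\<^sup>2)"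
    by (rule Bochner_Integration.integrable_bound[OF sq]; auto simp: cmod_power2)+
  have intf: "integrable L f"
  proof (rule integrable_norm_cancel)
    show "integrable L (\<lambda>v. norm (f v))" by (rule L.square_integrable_imp_integrable[OF _ sq]) measurable
  qed measurable
  define a where "a = (\<lambda>\<omega>. \<Sum>i<n. Re (f (V i \<omega>)) - (\<integral>v. Re (f v) \<partial>L))"
  define b where "b = (\<lambda>\<omega>. \<Sum>i<n. Im (f (V i \<omega>)) - (\<integral>v. Im (f v) \<partial>L))"
  have R: "integrable M (\<lambda>\<omega>. (a \<omega>)\<^sup>2)" "expectation (\<lambda>\<omega>. (a \<omega>)\<^sup>2) \<le> real n * (\<integral>v. (Re (f v))\<^sup>2 \<partial>L)"
    using iid_centered_square_real[OF indep dist _ sqR, of n] by (simp_all add: a_def)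
  have I: "integrable M (\<lambda>\<omega>. (b \<omega>)\<^sup>2)" "expectation (\<lambda>\<omega>. (b \<omega>)\<^sup>2) \<le> real n * (\<integral>v. (Im (f v))\<^sup>2 \<partial>L)"
    using iid_centered_square_real[OF indep dist _ sqI, of n] by (simp_all add: b_def)
  have eq: "(cmod (complex_of_real (1 / real n) * (\<Sum>i<n. f (V i \<omega>)) - (\<integral>v. f v \<partial>L)))\<^sup>2
      = ((a \<omega>)\<^sup>2 + (b \<omega>)\<^sup>2) / (real n)\<^sup>2" for \<omega>
  proof -
    have "complex_of_real (1 / real n) * (\<Sum>i<n. f (V i \<omega>)) - (\<integral>v. f v \<partial>L) = Complex (a \<omega>) (b \<omega>) / complex_of_real (real n)"
      using n intf by (simp add: complex_eq_iff a_def b_def sum_subtractf field_simps integral_Re[OF intf] integral_Im[OF intf])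
    then show ?thesis by (simp add: norm_divide power_divide cmod_power2)
  qed
  have i: "integrable M (\<lambda>\<omega>. ((a \<omega>)\<^sup>2 + (b \<omega>)\<^sup>2) / (real n)\<^sup>2)" using R(1) I(1) by simp
  have "(\<integral>\<^sup>+\<omega>. ennreal ((cmod (complex_of_real (1 / real n) * (\<Sum>i<n. f (V i \<omega>)) - (\<integral>v. f v \<partial>L)))\<^sup>2) \<partial>M)
      = ennreal (expectation (\<lambda>\<omega>. ((a \<omega>)\<^sup>2 + (b \<omega>)\<^sup>2) / (real n)\<^sup>2))"
    unfolding eq by (rule nn_integral_eq_integral[OF i]) simp
  also have "\<dots> \<le> ennreal ((\<integral>v. (cmod (f v))\<^sup>2 \<partial>L) / real n)"
  proof (rule ennreal_leI)
    have "expectation (\<lambda>\<omega>. ((a \<omega>)\<^sup>2 + (b \<omega>)\<^sup>2) / (real n)\<^sup>2) = (expectation (\<lambda>\<omega>. (a \<omega>)\<^sup>2) + expectation (\<lambda>\<omega>. (b \<omega>)\<^sup>2)) / (real n)\<^sup>2"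
      using R(1) I(1) by simp
    also have "\<dots> \<le> (real n * (\<integral>v. (Re (f v))\<^sup>2 \<partial>L) + real n * (\<integral>v. (Im (f v))\<^sup>2 \<partial>L)) / (real n)\<^sup>2"
      using R(2) I(2) by (intro divide_right_mono add_mono) auto
    also have "\<dots> = (\<integral>v. (cmod (f v))\<^sup>2 \<partial>L) / real n"
    proof -
      have "(\<integral>v. (cmod (f v))\<^sup>2 \<partial>L) = (\<integral>v. (Re (f v))\<^sup>2 \<partial>L) + (\<integral>v. (Im (f v))\<^sup>2 \<partial>L)"
        using sqR sqI by (simp add: cmod_power2)
      then show ?thesis using n by (simp add: power2_eq_square field_simps)
    qed
    finally show "expectation (\<lambda>\<omega>. ((a \<omega>)\<^sup>2 + (b \<omega>)\<^sup>2) / (real n)\<^sup>2) \<le> (\<integral>v. (cmod (f v))\<^sup>2 \<partial>L) / real n" .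
  qed
  finally show ?thesis .
qed

text \<open>A second moment bound in the Hilbert space over \<open>N\<close>, reached without
  Hilbert-space valued variables: Tonelli moves the expectation inside, and for each
  \<open>\<theta>\<close> the scalar bound holds with a majorant \<open>k\<close> that does not
  depend on \<open>\<theta>\<close>.\<close>

lemma iid_mean_square_L2:
  fixes V :: "nat \<Rightarrow> 'a \<Rightarrow> 'v::topological_space" and F :: "'v \<Rightarrow> 'th \<Rightarrow> complex"
  assumes indep: "indep_vars (\<lambda>_. borel) V UNIV" and dist: "\<And>i. distr M borel (V i) = L"
    and N: "prob_space N" and F: "(\<lambda>(v, \<theta>). F v \<theta>) \<in> borel_measurable (borel \<Otimes>\<^sub>M N)"
    and k: "\<And>v \<theta>. cmod (F v \<theta>) \<le> k v" "k \<in> borel_measurable borel" "integrable L (\<lambda>v. (k v)\<^sup>2)"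
    and n: "n > 0"
  defines "S \<equiv> \<lambda>\<omega>. \<integral>\<^sup>+\<theta>. ennreal ((cmod (complex_of_real (1 / real n) * (\<Sum>i<n. F (V i \<omega>) \<theta>) - (\<integral>v. F v \<theta> \<partial>L)))\<^sup>2) \<partial>N"
  shows "S \<in> borel_measurable M" "(\<integral>\<^sup>+\<omega>. S \<omega> \<partial>M) \<le> ennreal ((\<integral>v. (k v)\<^sup>2 \<partial>L) / real n)"
proof -
  interpret N: prob_space N by (rule N)
  have Vm[measurable]: "V i \<in> measurable M borel" for i using indep by (auto simp: indep_vars_def)
  have LM: "L = distr M borel (V 0)" using dist by simp
  interpret L: prob_space L unfolding LM by (rule prob_space_distr) simp
  have sL[measurable_cong]: "sets L = sets borel" unfolding LM by simp
  interpret MN: pair_sigma_finite M N ..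
  have FV[measurable]: "(\<lambda>p. F (V i (fst p)) (snd p)) \<in> borel_measurable (M \<Otimes>\<^sub>M N)" for i
    using measurable_compose[OF _ F, of "\<lambda>p. (V i (fst p), snd p)"] by simp
  have sNL: "sets (N \<Otimes>\<^sub>M L) = sets (N \<Otimes>\<^sub>M borel)" by (rule sets_pair_measure_cong[OF refl sL])
  have "(\<lambda>p. F (snd p) (fst p)) \<in> borel_measurable (N \<Otimes>\<^sub>M borel)"
    using measurable_compose[OF _ F, of "\<lambda>p. (snd p, fst p)"] by simp
  then have "(\<lambda>p. F (snd p) (fst p)) \<in> borel_measurable (N \<Otimes>\<^sub>M L)" by (simp add: measurable_cong_sets[OF sNL refl])
  then have EF[measurable]: "(\<lambda>\<theta>. \<integral>v. F v \<theta> \<partial>L) \<in> borel_measurable N"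
    by (intro L.borel_measurable_lebesgue_integral) (simp add: case_prod_unfold)
  define h where "h = (\<lambda>p. ennreal ((cmod (complex_of_real (1 / real n) * (\<Sum>i<n. F (V i (fst p)) (snd p)) - (\<integral>v. F v (snd p) \<partial>L)))\<^sup>2))"
  have hm[measurable]: "h \<in> borel_measurable (M \<Otimes>\<^sub>M N)" unfolding h_def by measurable
  have Sh: "S = (\<lambda>\<omega>. \<integral>\<^sup>+\<theta>. h (\<omega>, \<theta>) \<partial>N)" by (simp add: S_def h_def)
  show "S \<in> borel_measurable M" unfolding Sh by measurable
  have Fv: "(\<lambda>v. F v \<theta>) \<in> borel_measurable borel" if "\<theta> \<in> space N" for \<theta>
    using measurable_compose[OF _ F, of "\<lambda>v. (v, \<theta>)" borel] that by simp
  have "(\<integral>\<^sup>+\<omega>. S \<omega> \<partial>M) = (\<integral>\<^sup>+\<theta>. \<integral>\<^sup>+\<omega>. h (\<omega>, \<theta>) \<partial>M \<partial>N)"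
    unfolding Sh by (rule MN.Fubini[symmetric, OF hm])
  also have "\<dots> \<le> (\<integral>\<^sup>+\<theta>. ennreal ((\<integral>v. (k v)\<^sup>2 \<partial>L) / real n) \<partial>N)"
  proof (rule nn_integral_mono)
    fix \<theta> assume \<theta>: "\<theta> \<in> space N"
    have kL: "integrable L (\<lambda>v. (cmod (F v \<theta>))\<^sup>2)"
    proof (rule Bochner_Integration.integrable_bound[OF k(3)])
      show "(\<lambda>v. (cmod (F v \<theta>))\<^sup>2) \<in> borel_measurable L" using Fv[OF \<theta>] by measurable
      show "AE v in L. norm ((cmod (F v \<theta>))\<^sup>2) \<le> norm ((k v)\<^sup>2)"
        using k(1) by (intro AE_I2) (auto intro!: power_mono)
    qed
    have "(\<integral>\<^sup>+\<omega>. h (\<omega>, \<theta>) \<partial>M) \<le> ennreal ((\<integral>v. (cmod (F v \<theta>))\<^sup>2 \<partial>L) / real n)"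
      unfolding h_def using iid_mean_square[OF indep dist Fv[OF \<theta>] kL n] by simp
    also have "\<dots> \<le> ennreal ((\<integral>v. (k v)\<^sup>2 \<partial>L) / real n)"
      using k(1) by (intro ennreal_leI divide_right_mono integral_mono kL k(3) power_mono) auto
    finally show "(\<integral>\<^sup>+\<omega>. h (\<omega>, \<theta>) \<partial>M) \<le> ennreal ((\<integral>v. (k v)\<^sup>2 \<partial>L) / real n)" .
  qed
  also have "\<dots> = ennreal ((\<integral>v. (k v)\<^sup>2 \<partial>L) / real n)" by (simp add: N.emeasure_space_1)
  finally show "(\<integral>\<^sup>+\<omega>. S \<omega> \<partial>M) \<le> ennreal ((\<integral>v. (k v)\<^sup>2 \<partial>L) / real n)" .
qed

end

section \<open>Control of the empirical operator, uniformly over functions\<close>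

text \<open>The uniform law. As a probability measure it can be multiplied with \<open>\<mu>\<close>
  to index the averages in \<open>iid_mean_square_L2\<close>.\<close>

definition unif01 :: "real measure" where
  "unif01 = density lborel (\<lambda>y. ennreal (indicator {0..1} y))"

lemma sets_unif01[measurable_cong, simp]: "sets unif01 = sets borel"
  by (simp add: unif01_def)

lemma space_unif01[simp]: "space unif01 = UNIV"
  by (simp add: unif01_def)

lemma prob_space_unif01: "prob_space unif01"
proof (rule prob_spaceI)
  have "emeasure unif01 UNIV = (\<integral>\<^sup>+y. ennreal (indicator {0..1::real} y) * indicator UNIV y \<partial>lborel)"
    unfolding unif01_def by (subst emeasure_density) simp_all
  also have "\<dots> = (\<integral>\<^sup>+y. indicator {0..1::real} y \<partial>lborel)"
    by (rule nn_integral_cong) (auto simp: indicator_def)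
  also have "\<dots> = 1" by (subst nn_integral_indicator) auto
  finally have "emeasure unif01 UNIV = 1" .
  then show "emeasure unif01 (space unif01) = 1" by simp
qed

lemma integral_unif01:
  fixes f :: "real \<Rightarrow> 'b::{banach, second_countable_topology}"
  assumes "f \<in> borel_measurable borel"
  shows "(\<integral>y. f y \<partial>unif01) = (\<integral>y. indicator {0..1} y *\<^sub>R f y \<partial>lborel)"
  unfolding unif01_def using assms by (subst integral_density) auto

context npiv
begin

text \<open>The derivative continued by constants, which makes it Borel on the line and bounded by
  \<open>Gn g\<close> everywhere.\<close>

definition gd :: "(real \<Rightarrow> real) \<Rightarrow> real \<Rightarrow> real" where
  "gd g y = deriv01 g (clampi 0 1 y)"

lemma gd_measurable[measurable]: assumes "g \<in> G_space" shows "gd g \<in> borel_measurable borel"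
proof -
  have "continuous_on UNIV (\<lambda>x. deriv01 g (clampi 0 1 x))"
    by (rule continuous_on_compose2[OF deriv01_continuous[OF assms] continuous_on_clampi]) (auto simp: clampi_def)
  then show ?thesis unfolding gd_def[abs_def] by (rule borel_measurable_continuous_onI)
qed

lemma gd_bound: "g \<in> G_space \<Longrightarrow> \<bar>gd g y\<bar> \<le> Gn g"
  unfolding gd_def by (rule Gn_bounds(2)) (auto simp: clampi_def)

text \<open>The fundamental theorem of calculus with the upper limit written as an indicator. This
  separates variables: under the integral \<open>g\<close> enters through \<open>gd g\<close> alone
  and the point \<open>z\<close> through the indicator alone.\<close>

lemma G_eq_integral_unif01:
  assumes g: "g \<in> G_space" and z: "z \<in> {0..1}"
  shows "g z = g 0 + (\<integral>y. gd g y * of_bool (y \<le> z) \<partial>unif01)"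
proof -
  have "(\<integral>y. gd g y * of_bool (y \<le> z) \<partial>unif01) = (\<integral>y. indicator {0..1} y *\<^sub>R (gd g y * of_bool (y \<le> z)) \<partial>lborel)"
    using g by (intro integral_unif01) measurable
  also have "\<dots> = (LINT y:{0..z}|lborel. deriv01 g y)"
    unfolding set_lebesgue_integral_def
    by (rule Bochner_Integration.integral_cong) (use z in \<open>auto simp: gd_def clampi_def indicator_def\<close>)
  also have "\<dots> = integral {0..z} (deriv01 g)"
    by (intro set_borel_integral_eq_integral(2) borel_integrable_atLeastAtMost' continuous_on_subset[OF deriv01_continuous[OF g]])
      (use z in auto)
  also have "\<dots> = g z - g 0" using G_ftc[OF g, of 0 z] z by (intro integral_unique) auto
  finally show ?thesis by simp
qed

text \<open>The kernel of the representation \<open>A g = g(0) A 1 + \<integral> g'(y) Bk(y) dy\<close>, which makes the bound on the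
  empirical operator uniform in \<open>g\<close>.\<close>

definition Bk :: "real \<Rightarrow> real ^ 'p \<Rightarrow> complex" where
  "Bk y t = (\<integral>\<omega>. of_bool (y \<le> Z \<omega>) * iexp (W \<omega> \<bullet> t) \<partial>P)"

text \<open>Fubini's theorem, applied to the representation of \<open>g (Z \<omega>)\<close> by
  \<open>G_eq_integral_unif01\<close>.\<close>

lemma A_eq_integral_unif01:
  assumes g: "g \<in> G_space"
  shows "A g t = complex_of_real (g 0) * A (\<lambda>_. 1) t + (\<integral>y. complex_of_real (gd g y) * Bk y t \<partial>unif01)"
proof -
  interpret U: prob_space unif01 by (rule prob_space_unif01)
  interpret PU: pair_prob_space P unif01 ..
  have [measurable]: "gd g \<in> borel_measurable borel" by (rule gd_measurable[OF g])
  define f where "f = (\<lambda>\<omega> y. complex_of_real (gd g y) * (of_bool (y \<le> Z \<omega>) * iexp (W \<omega> \<bullet> t)))"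
  have fm: "(\<lambda>(\<omega>, y). f \<omega> y) \<in> borel_measurable (P \<Otimes>\<^sub>M unif01)" unfolding f_def by measurable
  have "integrable (P \<Otimes>\<^sub>M unif01) (\<lambda>(\<omega>, y). f \<omega> y)"
    by (rule PU.P.integrable_const_bound[OF _ fm, of "Gn g"])
      (auto simp: f_def norm_mult of_bool_def intro!: AE_I2 gd_bound[OF g] Gn_bounds(4)[OF g, of 0])
  from PU.Fubini_integral[OF this]
  have fub: "(\<integral>y. \<integral>\<omega>. f \<omega> y \<partial>P \<partial>unif01) = (\<integral>\<omega>. \<integral>y. f \<omega> y \<partial>unif01 \<partial>P)" .
  have 1: "(\<integral>\<omega>. f \<omega> y \<partial>P) = complex_of_real (gd g y) * Bk y t" for y
    unfolding f_def Bk_def by simp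
  have 2: "(\<integral>y. f \<omega> y \<partial>unif01) = complex_of_real (g (Z \<omega>) - g 0) * iexp (W \<omega> \<bullet> t)" if "\<omega> \<in> space P" for \<omega>
  proof -
    have "(\<integral>y. f \<omega> y \<partial>unif01) = (\<integral>y. complex_of_real (gd g y * of_bool (y \<le> Z \<omega>)) * iexp (W \<omega> \<bullet> t) \<partial>unif01)"
      by (rule Bochner_Integration.integral_cong) (auto simp: f_def)
    also have "\<dots> = complex_of_real (\<integral>y. gd g y * of_bool (y \<le> Z \<omega>) \<partial>unif01) * iexp (W \<omega> \<bullet> t)"
      by (simp only: integral_mult_left_zero integral_complex_of_real)
    finally show ?thesis using G_eq_integral_unif01[OF g Z01[OF that]] by simp
  qed
  have "A g t - complex_of_real (g 0) * A (\<lambda>_. 1) t = (\<integral>\<omega>. complex_of_real (g (Z \<omega>) - g 0) * iexp (W \<omega> \<bullet> t) \<partial>P)"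
    using A_integrand(1)[OF g, of t] A_integrand(1)[OF affine_G[of 1 0], of t]
    by (simp add: op_A_def left_diff_distrib)
  also have "\<dots> = (\<integral>\<omega>. \<integral>y. f \<omega> y \<partial>unif01 \<partial>P)"
    by (rule Bochner_Integration.integral_cong[OF refl]) (simp add: 2)
  finally have "A g t - complex_of_real (g 0) * A (\<lambda>_. 1) t = (\<integral>y. complex_of_real (gd g y) * Bk y t \<partial>unif01)"
    unfolding fub[symmetric] 1 .
  then show ?thesis by (simp add: algebra_simps)
qed

lemma Bk_measurable: "(\<lambda>(y, t). Bk y t) \<in> borel_measurable (unif01 \<Otimes>\<^sub>M \<mu>)"
  unfolding Bk_def case_prod_unfold
  by (rule borel_measurable_lebesgue_integral) measurable

text \<open>The sample version of \<open>A_eq_integral_unif01\<close>. Subtracting the two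
  representations leaves a difference of kernels in which \<open>g\<close> no longer occurs.\<close>

lemma ecf_eq_integral_unif01:
  assumes g: "g \<in> G_space" and z: "\<And>i. i < n \<Longrightarrow> z i \<in> {0..1}"
  shows "ecf n (\<lambda>i. g (z i)) w t = complex_of_real (g 0) * ecf n (\<lambda>_. 1) w t +
    (\<integral>y. complex_of_real (gd g y) * ecf n (\<lambda>i. of_bool (y \<le> z i)) w t \<partial>unif01)"
proof -
  interpret U: prob_space unif01 by (rule prob_space_unif01)
  have [measurable]: "gd g \<in> borel_measurable borel" by (rule gd_measurable[OF g])
  have i: "integrable unif01 (\<lambda>y. complex_of_real (gd g y) * (of_bool (y \<le> z i) * iexp (w i \<bullet> t)))" for i
    by (rule U.integrable_const_bound[of _ "Gn g"])
      (auto simp: norm_mult of_bool_def intro!: AE_I2 gd_bound[OF g] Gn_bounds(4)[OF g, of 0])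
  have e: "(\<integral>y. complex_of_real (gd g y) * (of_bool (y \<le> z i) * iexp (w i \<bullet> t)) \<partial>unif01)
      = complex_of_real (g (z i) - g 0) * iexp (w i \<bullet> t)" if "i < n" for i
  proof -
    have "(\<integral>y. complex_of_real (gd g y) * (of_bool (y \<le> z i) * iexp (w i \<bullet> t)) \<partial>unif01)
        = (\<integral>y. complex_of_real (gd g y * of_bool (y \<le> z i)) * iexp (w i \<bullet> t) \<partial>unif01)"
      by (rule Bochner_Integration.integral_cong) auto
    also have "\<dots> = complex_of_real (\<integral>y. gd g y * of_bool (y \<le> z i) \<partial>unif01) * iexp (w i \<bullet> t)"
      by (simp only: integral_mult_left_zero integral_complex_of_real)
    finally show ?thesis using G_eq_integral_unif01[OF g z[OF that]] by simp
  qed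
  have "(\<integral>y. complex_of_real (gd g y) * ecf n (\<lambda>i. of_bool (y \<le> z i)) w t \<partial>unif01)
      = (\<integral>y. complex_of_real (1 / real n) * (\<Sum>i<n. complex_of_real (gd g y) * (of_bool (y \<le> z i) * iexp (w i \<bullet> t))) \<partial>unif01)"
    by (rule Bochner_Integration.integral_cong) (auto simp: ecf_def sum_distrib_left mult_ac of_bool_def intro!: sum.cong)
  also have "\<dots> = complex_of_real (1 / real n) * (\<Sum>i<n. complex_of_real (g (z i) - g 0) * iexp (w i \<bullet> t))"
    unfolding integral_mult_right_zero Bochner_Integration.integral_sum[OF i]
    by (intro arg_cong2[where f="(*)"] sum.cong refl e) simp
  also have "\<dots> = ecf n (\<lambda>i. g (z i)) w t - complex_of_real (g 0) * ecf n (\<lambda>_. 1) w t"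
    by (simp add: ecf_def left_diff_distrib sum_subtractf right_diff_distrib sum_distrib_left mult_ac)
  finally show ?thesis by simp
qed

text \<open>On the right \<open>g\<close> occurs through \<open>Gn g\<close> only. For fixed
  \<open>t\<close> both \<open>\<bar>g 0\<bar>\<close> and \<open>\<bar>gd g y\<bar>\<close> are at
  most \<open>Gn g\<close>; then \<open>(a + b)^2 \<le> 2 * (a^2 + b^2)\<close> gives the factor 2,
  and Cauchy-Schwarz moves the square inside the integral over the probability measure
  \<open>unif01\<close>.\<close>

lemma ecf_A_diff_bound:
  assumes g: "g \<in> G_space" and z: "\<And>i. i < n \<Longrightarrow> z i \<in> {0..1}"
  shows "(\<integral>\<^sup>+t. ennreal ((cmod (ecf n (\<lambda>i. g (z i)) w t - A g t))\<^sup>2) \<partial>\<mu>) \<le> ennreal (2 * (Gn g)\<^sup>2) *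
    ((\<integral>\<^sup>+t. ennreal ((cmod (ecf n (\<lambda>_. 1) w t - A (\<lambda>_. 1) t))\<^sup>2) \<partial>\<mu>) +
     (\<integral>\<^sup>+p. ennreal ((cmod (ecf n (\<lambda>i. of_bool (fst p \<le> z i)) w (snd p) - Bk (fst p) (snd p)))\<^sup>2) \<partial>(unif01 \<Otimes>\<^sub>M \<mu>)))"
proof -
  interpret U: prob_space unif01 by (rule prob_space_unif01)
  interpret UM: pair_sigma_finite unif01 \<mu> ..
  have [measurable]: "gd g \<in> borel_measurable borel" by (rule gd_measurable[OF g])
  define D0 where "D0 = (\<lambda>t. ecf n (\<lambda>_. 1) w t - A (\<lambda>_. 1) t)"
  define D where "D = (\<lambda>y t. ecf n (\<lambda>i. of_bool (y \<le> z i)) w t - Bk y t)"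
  have D0m[measurable]: "D0 \<in> borel_measurable \<mu>"
    unfolding D0_def using ecf_mem[of n "\<lambda>_. 1" w] A_measurable[OF affine_G[of 1 0]] by (auto simp: L2_space_def)
  have ecm: "(\<lambda>p. ecf n (\<lambda>i. of_bool (fst p \<le> z i)) w (snd p)) \<in> borel_measurable (unif01 \<Otimes>\<^sub>M \<mu>)"
    unfolding ecf_def by measurable
  have Dm[measurable]: "(\<lambda>p. D (fst p) (snd p)) \<in> borel_measurable (unif01 \<Otimes>\<^sub>M \<mu>)"
    unfolding D_def using ecm Bk_measurable by (simp add: case_prod_unfold)
  have Dy[measurable]: "(\<lambda>y. D y t) \<in> borel_measurable unif01" for t
    using measurable_compose[OF _ Dm, of "\<lambda>y. (y, t)" unif01] by simp
  have Db: "cmod (D y t) \<le> 2" for y t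
  proof -
    have "cmod (ecf n (\<lambda>i. of_bool (y \<le> z i)) w t) \<le> \<bar>1 / real n\<bar> * (\<Sum>i<n. 1)"
      unfolding ecf_def norm_mult norm_of_real
      by (intro mult_left_mono order_trans[OF norm_sum] sum_mono) (auto simp: norm_mult of_bool_def)
    also have "\<dots> \<le> 1" by simp
    finally have 1: "cmod (ecf n (\<lambda>i. of_bool (y \<le> z i)) w t) \<le> 1" .
    have "cmod (Bk y t) \<le> (\<integral>\<omega>. norm (of_bool (y \<le> Z \<omega>) * iexp (W \<omega> \<bullet> t)) \<partial>P)"
      unfolding Bk_def by (rule integral_norm_bound)
    also have "\<dots> \<le> 1"
    proof (rule integral_le_const)
      show "integrable P (\<lambda>\<omega>. norm (of_bool (y \<le> Z \<omega>) * iexp (W \<omega> \<bullet> t)))"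
        by (rule integrable_const_bound[of _ 1]) (auto simp: norm_mult of_bool_def)
    qed (auto simp: norm_mult of_bool_def)
    finally have 2: "cmod (Bk y t) \<le> 1" .
    show ?thesis using norm_triangle_ineq4[of "ecf n (\<lambda>i. of_bool (y \<le> z i)) w t" "Bk y t"] 1 2 by (simp add: D_def)
  qed
  have Dl2: "(\<lambda>y. cmod (D y t)) \<in> l2 unif01" for t
  proof -
    have "integrable unif01 (\<lambda>y. (cmod (D y t))\<^sup>2)"
    proof (rule U.integrable_const_bound[of _ "2\<^sup>2"])
      show "AE y in unif01. norm ((cmod (D y t))\<^sup>2) \<le> 2\<^sup>2"
        using power_mono[OF Db norm_ge_zero, of _ t 2] by (intro AE_I2) simp
    qed measurable
    then show ?thesis by (simp add: l2_def)
  qed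
  have pt: "(cmod (ecf n (\<lambda>i. g (z i)) w t - A g t))\<^sup>2 \<le> 2 * (Gn g)\<^sup>2 * ((cmod (D0 t))\<^sup>2 + (\<integral>y. (cmod (D y t))\<^sup>2 \<partial>unif01))" for t
  proof -
    have ie: "integrable unif01 (\<lambda>y. complex_of_real (gd g y) * ecf n (\<lambda>i. of_bool (y \<le> z i)) w t)"
      "integrable unif01 (\<lambda>y. complex_of_real (gd g y) * Bk y t)"
    proof -
      have Bkb: "cmod (Bk y t) \<le> 1" for y
      proof -
        have "cmod (Bk y t) \<le> (\<integral>\<omega>. norm (of_bool (y \<le> Z \<omega>) * iexp (W \<omega> \<bullet> t)) \<partial>P)"
          unfolding Bk_def by (rule integral_norm_bound)
        also have "\<dots> \<le> 1"
        proof (rule integral_le_const)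
          show "integrable P (\<lambda>\<omega>. norm (of_bool (y \<le> Z \<omega>) * iexp (W \<omega> \<bullet> t)))"
            by (rule integrable_const_bound[of _ 1]) (auto simp: norm_mult of_bool_def)
        qed (auto simp: norm_mult of_bool_def)
        finally show ?thesis .
      qed
      have [measurable]: "(\<lambda>y. Bk y t) \<in> borel_measurable unif01"
        using measurable_compose[OF _ Bk_measurable, of "\<lambda>y. (y, t)" unif01] by simp
      show 2: "integrable unif01 (\<lambda>y. complex_of_real (gd g y) * Bk y t)"
      proof (rule U.integrable_const_bound[of _ "Gn g"])
        have "\<bar>gd g y\<bar> * cmod (Bk y t) \<le> Gn g" for y
          using mult_mono[OF gd_bound[OF g] Bkb Gn_bounds(4)[OF g, of 0] norm_ge_zero, of y y] by simp
        then show "AE y in unif01. norm (complex_of_real (gd g y) * Bk y t) \<le> Gn g" by (simp add: norm_mult)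
      qed measurable
      have "integrable unif01 (\<lambda>y. complex_of_real (gd g y) * D y t)"
        by (rule U.integrable_const_bound[of _ "Gn g * 2"])
          (auto simp: norm_mult intro!: AE_I2 mult_mono gd_bound[OF g] Gn_bounds(4)[OF g, of 0] Db)
      from Bochner_Integration.integrable_add[OF this 2]
      show "integrable unif01 (\<lambda>y. complex_of_real (gd g y) * ecf n (\<lambda>i. of_bool (y \<le> z i)) w t)"
        by (simp add: D_def algebra_simps)
    qed
    have "ecf n (\<lambda>i. g (z i)) w t - A g t = complex_of_real (g 0) * D0 t + (\<integral>y. complex_of_real (gd g y) * D y t \<partial>unif01)"
      using ecf_eq_integral_unif01[of g n z w t, OF g z] A_eq_integral_unif01[OF g, of t] ie
      by (simp add: D_def D0_def right_diff_distrib)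
    also have "cmod \<dots> \<le> \<bar>g 0\<bar> * cmod (D0 t) + (\<integral>y. norm (complex_of_real (gd g y) * D y t) \<partial>unif01)"
      by (intro norm_triangle_mono integral_norm_bound) (simp add: norm_mult)
    also have "\<dots> \<le> Gn g * cmod (D0 t) + (\<integral>y. Gn g * cmod (D y t) \<partial>unif01)"
    proof (intro add_mono mult_right_mono integral_mono_AE)
      have iD: "integrable unif01 (\<lambda>y. cmod (D y t))"
        by (rule U.integrable_const_bound[of _ 2]) (use Db in auto)
      then show "integrable unif01 (\<lambda>y. Gn g * cmod (D y t))" by simp
      show "integrable unif01 (\<lambda>y. norm (complex_of_real (gd g y) * D y t))"
        by (rule U.integrable_const_bound[of _ "Gn g * 2"])
          (auto simp: norm_mult intro!: AE_I2 mult_mono gd_bound[OF g] Gn_bounds(4)[OF g, of 0] Db)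
      show "AE y in unif01. norm (complex_of_real (gd g y) * D y t) \<le> Gn g * cmod (D y t)"
        by (auto simp: norm_mult intro!: AE_I2 mult_right_mono gd_bound[OF g])
    qed (use Gn_bounds(1)[OF g, of 0] in auto)
    finally have "cmod (ecf n (\<lambda>i. g (z i)) w t - A g t) \<le> Gn g * (cmod (D0 t) + (\<integral>y. cmod (D y t) \<partial>unif01))"
      by (simp add: distrib_left)
    then have "(cmod (ecf n (\<lambda>i. g (z i)) w t - A g t))\<^sup>2 \<le> (Gn g * (cmod (D0 t) + (\<integral>y. cmod (D y t) \<partial>unif01)))\<^sup>2"
      by (intro power_mono) auto
    also have "\<dots> \<le> (Gn g)\<^sup>2 * (2 * ((cmod (D0 t))\<^sup>2 + (\<integral>y. (cmod (D y t))\<^sup>2 \<partial>unif01)))"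
      unfolding power_mult_distrib
    proof (rule mult_left_mono)
      have "(\<lambda>_. 1) \<in> l2 unif01" by (simp add: l2_def)
      from l2.cauchy_schwarz_sq[OF Dl2 this, of t]
      have "(\<integral>y. cmod (D y t) \<partial>unif01)\<^sup>2 \<le> (\<integral>y. (cmod (D y t))\<^sup>2 \<partial>unif01)"
        using U.prob_space by (simp add: power2_eq_square)
      moreover have "(a + b)\<^sup>2 \<le> 2 * (a\<^sup>2 + b\<^sup>2)" for a b :: real
        using zero_le_power2[of "a - b"] by (simp add: power2_eq_square algebra_simps)
      ultimately show "(cmod (D0 t) + (\<integral>y. cmod (D y t) \<partial>unif01))\<^sup>2 \<le> 2 * ((cmod (D0 t))\<^sup>2 + (\<integral>y. (cmod (D y t))\<^sup>2 \<partial>unif01))"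
        by (smt (verit, best))
    qed simp
    finally show ?thesis by (simp add: algebra_simps)
  qed
  have "(\<integral>\<^sup>+t. ennreal ((cmod (ecf n (\<lambda>i. g (z i)) w t - A g t))\<^sup>2) \<partial>\<mu>) \<le>
      (\<integral>\<^sup>+t. ennreal (2 * (Gn g)\<^sup>2) * (ennreal ((cmod (D0 t))\<^sup>2) + (\<integral>\<^sup>+y. ennreal ((cmod (D y t))\<^sup>2) \<partial>unif01)) \<partial>\<mu>)"
  proof (rule nn_integral_mono)
    fix t
    have "(\<integral>\<^sup>+y. ennreal ((cmod (D y t))\<^sup>2) \<partial>unif01) = ennreal (\<integral>y. (cmod (D y t))\<^sup>2 \<partial>unif01)"
      using Dl2[of t] by (intro nn_integral_eq_integral) (auto simp: l2_def)
    moreover have "0 \<le> (\<integral>y. (cmod (D y t))\<^sup>2 \<partial>unif01)" by (rule integral_nonneg_AE) simp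
    ultimately have "ennreal (2 * (Gn g)\<^sup>2) * (ennreal ((cmod (D0 t))\<^sup>2) + (\<integral>\<^sup>+y. ennreal ((cmod (D y t))\<^sup>2) \<partial>unif01))
        = ennreal (2 * (Gn g)\<^sup>2 * ((cmod (D0 t))\<^sup>2 + (\<integral>y. (cmod (D y t))\<^sup>2 \<partial>unif01)))"
      by (simp add: ennreal_mult' ennreal_plus)
    then show "ennreal ((cmod (ecf n (\<lambda>i. g (z i)) w t - A g t))\<^sup>2) \<le>
        ennreal (2 * (Gn g)\<^sup>2) * (ennreal ((cmod (D0 t))\<^sup>2) + (\<integral>\<^sup>+y. ennreal ((cmod (D y t))\<^sup>2) \<partial>unif01))"
      using ennreal_leI[OF pt[of t]] by simp
  qed
  also have "\<dots> = ennreal (2 * (Gn g)\<^sup>2) * ((\<integral>\<^sup>+t. ennreal ((cmod (D0 t))\<^sup>2) \<partial>\<mu>) +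
      (\<integral>\<^sup>+t. \<integral>\<^sup>+y. ennreal ((cmod (D y t))\<^sup>2) \<partial>unif01 \<partial>\<mu>))"
  proof -
    have Dm': "(\<lambda>p. ennreal ((cmod (D (snd p) (fst p)))\<^sup>2)) \<in> borel_measurable (\<mu> \<Otimes>\<^sub>M unif01)"
      using measurable_compose[OF _ Dm, of "\<lambda>p. (snd p, fst p)" "\<mu> \<Otimes>\<^sub>M unif01"] by simp
    have "(\<lambda>t. \<integral>\<^sup>+y. ennreal ((cmod (D y t))\<^sup>2) \<partial>unif01) \<in> borel_measurable \<mu>"
      by (rule U.borel_measurable_nn_integral) (use Dm' in \<open>simp add: case_prod_unfold\<close>)
    then show ?thesis
      by (subst nn_integral_cmult) (auto simp: nn_integral_add)
  qed
  also have "(\<integral>\<^sup>+t. \<integral>\<^sup>+y. ennreal ((cmod (D y t))\<^sup>2) \<partial>unif01 \<partial>\<mu>)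
      = (\<integral>\<^sup>+p. ennreal ((cmod (D (fst p) (snd p)))\<^sup>2) \<partial>(unif01 \<Otimes>\<^sub>M \<mu>))"
    using UM.nn_integral_snd[of "\<lambda>(y, t). ennreal ((cmod (D y t))\<^sup>2)"] by (simp add: case_prod_unfold)
  finally show ?thesis unfolding D0_def D_def .
qed

end

lemma outer_measure_of_le_emeasure:
  assumes "A \<subseteq> B" "B \<in> sets M" shows "outer_measure_of M A \<le> emeasure M B"
  using outer_measure_of_mono[OF assms(1), of M] outer_measure_of_eq[OF assms(2)] by simp

lemma sup01_abs_le:
  assumes "\<And>z. z \<in> {0..1} \<Longrightarrow> \<bar>f z\<bar> \<le> K" shows "\<bar>sup01 f\<bar> \<le> K"
proof -
  have "sup01 f \<le> K" unfolding sup01_def by (rule cSUP_least) (use assms in auto)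
  moreover have "\<bar>f 0\<bar> \<le> sup01 f"
    unfolding sup01_def by (rule cSUP_upper) (use assms in \<open>auto intro!: bdd_aboveI[of _ K]\<close>)
  ultimately show ?thesis by simp
qed

text \<open>Markov's inequality at the scale \<open>1 / n\<close>; the factor \<open>n\<close>
  cancels, so the bound is the same for every sample size.\<close>

lemma (in prob_space) markov_scaled:
  assumes S: "S \<in> borel_measurable M" "(\<integral>\<^sup>+\<omega>. S \<omega> \<partial>M) \<le> ennreal (K / real n)" and c: "c > 0" and n: "n > 0"
  shows "emeasure M {\<omega> \<in> space M. S \<omega> > ennreal (c / real n)} \<le> ennreal (K / c)"
proof -
  have "emeasure M {\<omega> \<in> space M. S \<omega> > ennreal (c / real n)} \<le> emeasure M {\<omega> \<in> space M. 1 \<le> ennreal (real n / c) * S \<omega>}"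
  proof (rule emeasure_mono)
    show "{\<omega> \<in> space M. S \<omega> > ennreal (c / real n)} \<subseteq> {\<omega> \<in> space M. 1 \<le> ennreal (real n / c) * S \<omega>}"
    proof safe
      fix \<omega> assume "S \<omega> > ennreal (c / real n)"
      then have "ennreal (real n / c) * ennreal (c / real n) \<le> ennreal (real n / c) * S \<omega>" by (intro mult_left_mono) auto
      moreover have "ennreal (real n / c) * ennreal (c / real n) = 1" using c n by (simp add: ennreal_mult'[symmetric])
      ultimately show "1 \<le> ennreal (real n / c) * S \<omega>" by simp
    qed
    show "{\<omega> \<in> space M. 1 \<le> ennreal (real n / c) * S \<omega>} \<in> sets M" using S(1) by measurable
  qed
  also have "\<dots> \<le> ennreal (real n / c) * (\<integral>\<^sup>+\<omega>. S \<omega> * indicator (space M) \<omega> \<partial>M)"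
    by (rule nn_integral_Markov_inequality) (use S(1) in auto)
  also have "(\<integral>\<^sup>+\<omega>. S \<omega> * indicator (space M) \<omega> \<partial>M) = (\<integral>\<^sup>+\<omega>. S \<omega> \<partial>M)" by (rule nn_integral_cong) simp
  also have "ennreal (real n / c) * (\<integral>\<^sup>+\<omega>. S \<omega> \<partial>M) \<le> ennreal (real n / c) * ennreal (K / real n)"
    by (rule mult_left_mono[OF S(2)]) simp
  also have "\<dots> = ennreal (K / c)" using c n by (simp add: ennreal_mult'[symmetric])
  finally show ?thesis .
qed

section \<open>Rates in probability\<close>

text \<open>Exogeneity is recorded as a moment condition at every frequency \<open>t\<close>, the
  form in which the noise average is centred.\<close>

locale npiv_sample = npiv P \<mu> Z W
  for P :: "'a measure" and \<mu> :: "(real ^ 'p) measure" and Z W +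
  fixes Y :: "'a \<Rightarrow> real" and Ys Zs :: "nat \<Rightarrow> 'a \<Rightarrow> real" and Ws :: "nat \<Rightarrow> 'a \<Rightarrow> real ^ 'p"
    and g0 :: "real \<Rightarrow> real"
  assumes Ym[measurable]: "Y \<in> borel_measurable P" and Y2: "integrable P (\<lambda>\<omega>. (Y \<omega>)\<^sup>2)"
    and g0: "g0 \<in> G_space"
    and exo: "\<And>t. (\<integral>\<omega>. complex_of_real (Y \<omega> - g0 (Z \<omega>)) * iexp (W \<omega> \<bullet> t) \<partial>P) = 0"
    and indep: "indep_vars (\<lambda>_. borel) (\<lambda>i \<omega>. (Ys i \<omega>, Zs i \<omega>, Ws i \<omega>)) UNIV"
    and law: "\<And>i. distr P borel (\<lambda>\<omega>. (Ys i \<omega>, Zs i \<omega>, Ws i \<omega>)) = distr P borel (\<lambda>\<omega>. (Y \<omega>, Z \<omega>, W \<omega>))"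
begin

definition V :: "nat \<Rightarrow> 'a \<Rightarrow> real \<times> real \<times> (real ^ 'p)" where
  "V i \<omega> = (Ys i \<omega>, Zs i \<omega>, Ws i \<omega>)"

definition L :: "(real \<times> real \<times> (real ^ 'p)) measure" where
  "L = distr P borel (\<lambda>\<omega>. (Y \<omega>, Z \<omega>, W \<omega>))"

lemma V_indep: "indep_vars (\<lambda>_. borel) V UNIV"
  using indep by (simp add: V_def[abs_def])

lemma V_law: "distr P borel (V i) = L"
  using law by (simp add: V_def[abs_def] L_def)

lemma V_measurable[measurable]: "V i \<in> borel_measurable P"
  using V_indep by (auto simp: indep_vars_def)

lemma YZW_measurable[measurable]: "(\<lambda>\<omega>. (Y \<omega>, Z \<omega>, W \<omega>)) \<in> borel_measurable P"
  by (intro borel_measurable_Pair) measurable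

lemma coord_measurable[measurable]:
  "(fst :: real \<times> real \<times> (real ^ 'p) \<Rightarrow> real) \<in> borel_measurable borel"
  "(\<lambda>v :: real \<times> real \<times> (real ^ 'p). fst (snd v)) \<in> borel_measurable borel"
  "(\<lambda>v :: real \<times> real \<times> (real ^ 'p). snd (snd v)) \<in> borel_measurable borel"
  by (intro borel_measurable_continuous_onI continuous_intros)+

lemma coord_pair_measurable[measurable]:
  "(\<lambda>p :: (real \<times> real \<times> (real ^ 'p)) \<times> 'n. fst (fst p)) \<in> borel_measurable (borel \<Otimes>\<^sub>M N)"
  "(\<lambda>p :: (real \<times> real \<times> (real ^ 'p)) \<times> 'n. fst (snd (fst p))) \<in> borel_measurable (borel \<Otimes>\<^sub>M N)"
  "(\<lambda>p :: (real \<times> real \<times> (real ^ 'p)) \<times> 'n. snd (snd (fst p))) \<in> borel_measurable (borel \<Otimes>\<^sub>M N)"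
  using measurable_compose[OF measurable_fst coord_measurable(1)]
    measurable_compose[OF measurable_fst coord_measurable(2)]
    measurable_compose[OF measurable_fst coord_measurable(3)] by auto

lemma integral_L:
  fixes f :: "real \<times> real \<times> (real ^ 'p) \<Rightarrow> 'b::{banach, second_countable_topology}"
  assumes "f \<in> borel_measurable borel"
  shows "(\<integral>v. f v \<partial>L) = (\<integral>\<omega>. f (Y \<omega>, Z \<omega>, W \<omega>) \<partial>P)"
  unfolding L_def by (rule integral_distr[OF YZW_measurable assms])

text \<open>The sample inherits the range of \<open>Z\<close> from the common law, hence almost
  surely, and for all indices at once since they are countable.\<close>

lemma Zs_01: "AE \<omega> in P. \<forall>i. Zs i \<omega> \<in> {0..1}"
proof (rule AE_all_countable[THEN iffD2], rule allI)
  fix i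
  have m: "{v :: real \<times> real \<times> (real ^ 'p). fst (snd v) \<in> {0..1}} \<in> sets borel"
    using measurable_sets[OF coord_measurable(2), of "{0..1}"] by (simp add: vimage_def)
  have "AE v in L. fst (snd v) \<in> {0..1}"
    unfolding L_def using m Z01 by (subst AE_distr_iff) (auto intro!: AE_I2)
  then have "AE v in distr P borel (V i). fst (snd v) \<in> {0..1}" unfolding V_law .
  then show "AE \<omega> in P. Zs i \<omega> \<in> {0..1}"
    using m by (subst (asm) AE_distr_iff) (auto simp: V_def)
qed

lemma ennreal_nrm_sq: "l \<in> L2_space \<mu> \<Longrightarrow> ennreal ((L2.nrm \<mu> l)\<^sup>2) = (\<integral>\<^sup>+t. ennreal ((cmod (l t))\<^sup>2) \<partial>\<mu>)"
  unfolding L2.nrm_sq L2_inner_self by (rule nn_integral_eq_integral[symmetric]) (auto simp: L2_space_def)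

text \<open>When all \<open>Zs i\<close> lie in \<open>[0,1]\<close>, the squared noise norm equals
  a variable that is measurable and to which the second moment bound applies; \<open>exo\<close>
  makes its centring term zero.\<close>

lemma noise_bound:
  obtains K S where "K \<ge> 0" "\<And>n. n > 0 \<Longrightarrow> S n \<in> borel_measurable P"
    "\<And>n. n > 0 \<Longrightarrow> (\<integral>\<^sup>+\<omega>. S n \<omega> \<partial>P) \<le> ennreal (K / real n)"
    "\<And>n \<omega>. \<forall>i. Zs i \<omega> \<in> {0..1} \<Longrightarrow>
      ennreal ((L2.nrm \<mu> (ecf n (\<lambda>i. Ys i \<omega> - g0 (Zs i \<omega>)) (\<lambda>i. Ws i \<omega>)))\<^sup>2) = S n \<omega>"
proof -
  \<comment> \<open>\<open>g0\<close> is regular on \<open>[0,1]\<close> only; its constant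
    extension is Borel on the line.\<close>
  define gc where "gc = (\<lambda>z. g0 (clampi 0 1 z))"
  have gcm[measurable]: "gc \<in> borel_measurable borel"
  proof -
    have "continuous_on UNIV gc" unfolding gc_def
      by (rule continuous_on_compose2[OF G_continuous[OF g0] continuous_on_clampi]) (auto simp: clampi_def)
    then show ?thesis by (rule borel_measurable_continuous_onI)
  qed
  have gc: "gc z = g0 z" if "z \<in> {0..1}" for z using that by (simp add: gc_def clampi_def)
  define F where "F = (\<lambda>(v :: real \<times> real \<times> (real ^ 'p)) t. complex_of_real (fst v - gc (fst (snd v))) * iexp (snd (snd v) \<bullet> t))"
  define k where "k = (\<lambda>v :: real \<times> real \<times> (real ^ 'p). \<bar>fst v - gc (fst (snd v))\<bar>)"
  have Fm: "(\<lambda>(v, t). F v t) \<in> borel_measurable (borel \<Otimes>\<^sub>M \<mu>)"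
    unfolding F_def case_prod_unfold by measurable
  have Fv: "(\<lambda>v. F v t) \<in> borel_measurable borel" for t unfolding F_def by measurable
  have km: "k \<in> borel_measurable borel" unfolding k_def by measurable
  have Fk: "cmod (F v t) \<le> k v" for v t by (simp add: F_def k_def norm_mult)
  have k2: "integrable L (\<lambda>v. (k v)\<^sup>2)"
  proof -
    have yl: "Y \<in> l2 P" using Y2 by (simp add: l2_def)
    have "integrable P (\<lambda>\<omega>. (g0 (Z \<omega>))\<^sup>2)"
    proof (rule integrable_const_bound[of _ "(Gn g0)\<^sup>2"])
      show "(\<lambda>\<omega>. (g0 (Z \<omega>))\<^sup>2) \<in> borel_measurable P" using G_comp_measurable[OF g0] by simp
      show "AE \<omega> in P. norm ((g0 (Z \<omega>))\<^sup>2) \<le> (Gn g0)\<^sup>2"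
        using power_mono[OF Gn_bounds(1)[OF g0 Z01] abs_ge_zero, of _ 2] by (intro AE_I2) simp
    qed
    then have gl: "(\<lambda>\<omega>. g0 (Z \<omega>)) \<in> l2 P" using G_comp_measurable[OF g0] by (simp add: l2_def)
    have "integrable P (\<lambda>\<omega>. (Y \<omega> - g0 (Z \<omega>))\<^sup>2)" using l2.diff_mem[OF yl gl] by (simp add: l2_def)
    then have "integrable P (\<lambda>\<omega>. (k (Y \<omega>, Z \<omega>, W \<omega>))\<^sup>2)"
      by (rule Bochner_Integration.integrable_cong[THEN iffD1, rotated 2]) (auto simp: k_def gc[OF Z01])
    then show ?thesis unfolding L_def using km by (subst integrable_distr_eq) auto
  qed
  have EF: "(\<integral>v. F v t \<partial>L) = 0" for t
  proof -
    have "(\<integral>v. F v t \<partial>L) = (\<integral>\<omega>. F (Y \<omega>, Z \<omega>, W \<omega>) t \<partial>P)" by (rule integral_L[OF Fv])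
    also have "\<dots> = (\<integral>\<omega>. complex_of_real (Y \<omega> - g0 (Z \<omega>)) * iexp (W \<omega> \<bullet> t) \<partial>P)"
      by (rule Bochner_Integration.integral_cong) (auto simp: F_def gc[OF Z01])
    finally show ?thesis using exo by simp
  qed
  define S where "S = (\<lambda>n \<omega>. \<integral>\<^sup>+t. ennreal ((cmod (complex_of_real (1 / real n) * (\<Sum>i<n. F (V i \<omega>) t) - (\<integral>v. F v t \<partial>L)))\<^sup>2) \<partial>\<mu>)"
  show ?thesis
  proof (rule that[of "\<integral>v. (k v)\<^sup>2 \<partial>L" S])
    show "0 \<le> (\<integral>v. (k v)\<^sup>2 \<partial>L)" by (rule integral_nonneg_AE) simp
    show "S n \<in> borel_measurable P" "(\<integral>\<^sup>+\<omega>. S n \<omega> \<partial>P) \<le> ennreal ((\<integral>v. (k v)\<^sup>2 \<partial>L) / real n)" if "n > 0" for n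
      unfolding S_def using iid_mean_square_L2[OF V_indep V_law mu.prob_space_axioms Fm Fk km k2 that] by auto
    fix n \<omega> assume z: "\<forall>i. Zs i \<omega> \<in> {0..1}"
    show "ennreal ((L2.nrm \<mu> (ecf n (\<lambda>i. Ys i \<omega> - g0 (Zs i \<omega>)) (\<lambda>i. Ws i \<omega>)))\<^sup>2) = S n \<omega>"
      unfolding ennreal_nrm_sq[OF ecf_mem] S_def EF
      by (rule nn_integral_cong) (use z gc in \<open>simp add: ecf_def F_def V_def\<close>)
  qed
qed

text \<open>Two instances of \<open>iid_mean_square_L2\<close>, for the weight 1 over
  \<open>\<mu>\<close> and for the indicators over \<open>unif01 \<Otimes>\<^sub>M \<mu>\<close>,
  each of size \<open>1 / n\<close>; the factor 2 of \<open>ecf_A_diff_bound\<close> makes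
  \<open>4 / n\<close>. A single variable \<open>S n\<close> serves all \<open>g\<close>.\<close>

lemma operator_bound:
  obtains S where "\<And>n. n > 0 \<Longrightarrow> S n \<in> borel_measurable P"
    "\<And>n. n > 0 \<Longrightarrow> (\<integral>\<^sup>+\<omega>. S n \<omega> \<partial>P) \<le> ennreal (4 / real n)"
    "\<And>n \<omega> g. g \<in> G_space \<Longrightarrow> \<forall>i. Zs i \<omega> \<in> {0..1} \<Longrightarrow>
      ennreal ((L2.nrm \<mu> (\<lambda>t. ecf n (\<lambda>i. g (Zs i \<omega>)) (\<lambda>i. Ws i \<omega>) t - A g t))\<^sup>2) \<le> ennreal ((Gn g)\<^sup>2) * S n \<omega>"
proof -
  interpret U: prob_space unif01 by (rule prob_space_unif01)
  interpret UM: pair_prob_space unif01 \<mu> ..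
  interpret LP: prob_space L unfolding L_def by (rule prob_space_distr) simp
  define F1 where "F1 = (\<lambda>(v :: real \<times> real \<times> (real ^ 'p)) (t :: real ^ 'p). iexp (snd (snd v) \<bullet> t))"
  define F2 where "F2 = (\<lambda>(v :: real \<times> real \<times> (real ^ 'p)) (p :: real \<times> (real ^ 'p)).
    of_bool (fst p \<le> fst (snd v)) * iexp (snd (snd v) \<bullet> snd p))"
  have F1m: "(\<lambda>(v, t). F1 v t) \<in> borel_measurable (borel \<Otimes>\<^sub>M \<mu>)"
    unfolding F1_def case_prod_unfold by measurable
  have F2m: "(\<lambda>(v, t). F2 v t) \<in> borel_measurable (borel \<Otimes>\<^sub>M (unif01 \<Otimes>\<^sub>M \<mu>))"
    unfolding F2_def case_prod_unfold by measurable
  have F1v: "(\<lambda>v. F1 v t) \<in> borel_measurable borel" for t unfolding F1_def by measurable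
  have F2v: "(\<lambda>v. F2 v p) \<in> borel_measurable borel" for p unfolding F2_def by measurable
  have F1k: "cmod (F1 v t) \<le> 1" for v t by (simp add: F1_def)
  have F2k: "cmod (F2 v p) \<le> 1" for v p by (simp add: F2_def norm_mult of_bool_def)
  have E1: "(\<integral>v. F1 v t \<partial>L) = A (\<lambda>_. 1) t" for t
    unfolding integral_L[OF F1v] by (simp add: F1_def op_A_def)
  have E2: "(\<integral>v. F2 v p \<partial>L) = Bk (fst p) (snd p)" for p
    unfolding integral_L[OF F2v] by (simp add: F2_def Bk_def)
  define S1 where "S1 = (\<lambda>n \<omega>. \<integral>\<^sup>+t. ennreal ((cmod (complex_of_real (1 / real n) * (\<Sum>i<n. F1 (V i \<omega>) t) - (\<integral>v. F1 v t \<partial>L)))\<^sup>2) \<partial>\<mu>)"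
  define S2 where "S2 = (\<lambda>n \<omega>. \<integral>\<^sup>+p. ennreal ((cmod (complex_of_real (1 / real n) * (\<Sum>i<n. F2 (V i \<omega>) p) - (\<integral>v. F2 v p \<partial>L)))\<^sup>2) \<partial>(unif01 \<Otimes>\<^sub>M \<mu>))"
  have S1: "S1 n \<in> borel_measurable P" "(\<integral>\<^sup>+\<omega>. S1 n \<omega> \<partial>P) \<le> ennreal (1 / real n)" if "n > 0" for n
    unfolding S1_def
    using iid_mean_square_L2[OF V_indep V_law mu.prob_space_axioms F1m F1k _ _ that] LP.prob_space by auto
  have S2: "S2 n \<in> borel_measurable P" "(\<integral>\<^sup>+\<omega>. S2 n \<omega> \<partial>P) \<le> ennreal (1 / real n)" if "n > 0" for n
    unfolding S2_def
    using iid_mean_square_L2[OF V_indep V_law UM.prob_space_axioms F2m F2k _ _ that] LP.prob_space by auto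
  show ?thesis
  proof (rule that[of "\<lambda>n \<omega>. 2 * (S1 n \<omega> + S2 n \<omega>)"])
    fix n :: nat assume n: "n > 0"
    note [measurable] = S1(1)[OF n] S2(1)[OF n]
    show "(\<lambda>\<omega>. 2 * (S1 n \<omega> + S2 n \<omega>)) \<in> borel_measurable P" by measurable
    have "(\<integral>\<^sup>+\<omega>. 2 * (S1 n \<omega> + S2 n \<omega>) \<partial>P) = 2 * ((\<integral>\<^sup>+\<omega>. S1 n \<omega> \<partial>P) + (\<integral>\<^sup>+\<omega>. S2 n \<omega> \<partial>P))"
      by (subst nn_integral_cmult) (auto simp: nn_integral_add)
    also have "\<dots> \<le> 2 * (ennreal (1 / real n) + ennreal (1 / real n))"
      by (intro mult_left_mono add_mono S1(2)[OF n] S2(2)[OF n]) auto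
    also have "\<dots> = ennreal 2 * ennreal (1 / real n + 1 / real n)" by (subst ennreal_plus) auto
    also have "\<dots> = ennreal (4 / real n)" by (subst ennreal_mult'[symmetric]) auto
    finally show "(\<integral>\<^sup>+\<omega>. 2 * (S1 n \<omega> + S2 n \<omega>) \<partial>P) \<le> ennreal (4 / real n)" .
  next
    fix n \<omega> g assume g: "g \<in> G_space" and z: "\<forall>i. Zs i \<omega> \<in> {0..1}"
    have s1: "S1 n \<omega> = (\<integral>\<^sup>+t. ennreal ((cmod (ecf n (\<lambda>_. 1) (\<lambda>i. Ws i \<omega>) t - A (\<lambda>_. 1) t))\<^sup>2) \<partial>\<mu>)"
      unfolding S1_def E1 by (simp add: ecf_def F1_def V_def)
    have s2: "S2 n \<omega> = (\<integral>\<^sup>+p. ennreal ((cmod (ecf n (\<lambda>i. of_bool (fst p \<le> Zs i \<omega>)) (\<lambda>i. Ws i \<omega>) (snd p) - Bk (fst p) (snd p)))\<^sup>2) \<partial>(unif01 \<Otimes>\<^sub>M \<mu>))"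
    proof -
      have "of_bool b = complex_of_real (of_bool b)" for b by simp
      then show ?thesis unfolding S2_def E2 by (simp add: ecf_def F2_def V_def)
    qed
    have "ennreal ((L2.nrm \<mu> (\<lambda>t. ecf n (\<lambda>i. g (Zs i \<omega>)) (\<lambda>i. Ws i \<omega>) t - A g t))\<^sup>2)
        = (\<integral>\<^sup>+t. ennreal ((cmod (ecf n (\<lambda>i. g (Zs i \<omega>)) (\<lambda>i. Ws i \<omega>) t - A g t))\<^sup>2) \<partial>\<mu>)"
      by (rule ennreal_nrm_sq[OF L2.diff_mem[OF ecf_mem A_mem[OF g]]])
    also have "\<dots> \<le> ennreal (2 * (Gn g)\<^sup>2) * (S1 n \<omega> + S2 n \<omega>)"
      unfolding s1 s2 by (rule ecf_A_diff_bound[OF g]) (use z in blast)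
    also have "\<dots> = ennreal ((Gn g)\<^sup>2) * (2 * (S1 n \<omega> + S2 n \<omega>))"
      by (simp add: ennreal_mult' mult_ac distrib_left)
    finally show "ennreal ((L2.nrm \<mu> (\<lambda>t. ecf n (\<lambda>i. g (Zs i \<omega>)) (\<lambda>i. Ws i \<omega>) t - A g t))\<^sup>2)
        \<le> ennreal ((Gn g)\<^sup>2) * (2 * (S1 n \<omega> + S2 n \<omega>))" .
  qed
qed

text \<open>The exceptional sets \<open>B\<close> are measurable although the selected minimisers
  need not be: they consist of large values of the noise and operator variables and of a null set,
  and off them the estimate is deterministic.\<close>

lemma stochastic_error:
  assumes lam_pos: "\<And>n. lam n > 0" and lam0: "lam \<longlonglongrightarrow> 0"
    and ghat: "\<And>n. n \<ge> 2 \<Longrightarrow> AE \<omega> in P. is_arg_min (criterion \<mu> n (lam n) (\<lambda>i. Ys i \<omega>) (\<lambda>i. Zs i \<omega>) (\<lambda>i. Ws i \<omega>))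
                            (\<lambda>g. g \<in> G_space) (ghat n \<omega>)"
    and x: "\<And>n. x n \<in> G_space" "\<And>n h. h \<in> G_space \<Longrightarrow> Aip (\<lambda>z. g0 z - x n z) h = lam n * H_inner (x n) h"
    and e: "e > 0"
  obtains K where "K > 0" "\<forall>\<^sub>F n in sequentially. \<exists>B\<in>sets P. emeasure P B < ennreal e \<and>
    (\<forall>\<omega>\<in>space P - B. ghat n \<omega> \<in> G_space \<and> Gn (\<lambda>z. ghat n \<omega> z - x n z) \<le> K * (1 / sqrt (real n * lam n)))"
proof -
  obtain C where C: "C > 0" "\<And>g. g \<in> G_space \<Longrightarrow> Gn g \<le> C * (An g + Hn g)" using A_coercive by blast
  obtain Ke Se where Se: "Ke \<ge> 0" "\<And>n. n > 0 \<Longrightarrow> Se n \<in> borel_measurable P"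
    "\<And>n. n > 0 \<Longrightarrow> (\<integral>\<^sup>+\<omega>. Se n \<omega> \<partial>P) \<le> ennreal (Ke / real n)"
    "\<And>n \<omega>. \<forall>i. Zs i \<omega> \<in> {0..1} \<Longrightarrow>
      ennreal ((L2.nrm \<mu> (ecf n (\<lambda>i. Ys i \<omega> - g0 (Zs i \<omega>)) (\<lambda>i. Ws i \<omega>)))\<^sup>2) = Se n \<omega>"
    by (rule noise_bound) (rule that)
  obtain So where So: "\<And>n. n > 0 \<Longrightarrow> So n \<in> borel_measurable P"
    "\<And>n. n > 0 \<Longrightarrow> (\<integral>\<^sup>+\<omega>. So n \<omega> \<partial>P) \<le> ennreal (4 / real n)"
    "\<And>n \<omega> g. g \<in> G_space \<Longrightarrow> \<forall>i. Zs i \<omega> \<in> {0..1} \<Longrightarrow>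
      ennreal ((L2.nrm \<mu> (\<lambda>t. ecf n (\<lambda>i. g (Zs i \<omega>)) (\<lambda>i. Ws i \<omega>) t - A g t))\<^sup>2) \<le> ennreal ((Gn g)\<^sup>2) * So n \<omega>"
    by (rule operator_bound) (rule that)
  \<comment> \<open>Markov's inequality leaves probability
    \<open>Ke / c + 4 / c = (Ke + 4) / (Ke + 5) * e\<close>, which is below
    \<open>e\<close>.\<close>
  define c where "c = (Ke + 5) / e"
  have c0: "c > 0" using Se(1) e by (simp add: c_def)
  have ce: "Ke / c + 4 / c < e"
  proof -
    have "Ke / c + 4 / c = (Ke + 4) / c" by (rule add_divide_distrib[symmetric])
    also have "\<dots> = (Ke + 4) / (Ke + 5) * e" by (simp add: c_def)
    also have "\<dots> < 1 * e" using Se(1) e by (intro mult_strict_right_mono) auto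
    finally show ?thesis by simp
  qed
  have h0: "Hn g0 \<ge> 0" by (rule GH.nrm_nonneg[OF g0])
  \<comment> \<open>The 7 is \<open>3 + 4\<close>: \<open>3 * C * Hn g0\<close> bounds
    \<open>Gn\<close> of the bias, and \<open>4 * C * Hn g0\<close> is the summand in
    \<open>estimator_error_bound\<close>.\<close>
  define K where "K = 4 * C * sqrt c * (1 + 7 * C * Hn g0)"
  have K0: "K > 0" unfolding K_def using C(1) c0 h0 by (intro mult_pos_pos add_pos_nonneg) auto
  \<comment> \<open>The last inequality is the smallness of \<open>\<Delta> = sqrt (c / n)\<close>
    that carries coercivity over to the empirical operator.\<close>
  have ev: "\<forall>\<^sub>F n in sequentially. n \<ge> 2 \<and> lam n \<le> 1 \<and> C * sqrt (c / real n) \<le> 1 / 2"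
  proof -
    have "(\<lambda>n. C * sqrt (c / real n)) \<longlonglongrightarrow> C * sqrt 0"
      by (intro tendsto_intros tendsto_divide_0[OF tendsto_const] filterlim_at_top_imp_at_infinity filterlim_real_sequentially)
    then have "\<forall>\<^sub>F n in sequentially. C * sqrt (c / real n) < 1 / 2" by (rule order_tendstoD) simp
    moreover have "\<forall>\<^sub>F n in sequentially. lam n < 1" by (rule order_tendstoD[OF lam0]) simp
    ultimately show ?thesis using eventually_ge_at_top[of 2] by eventually_elim auto
  qed
  have "\<forall>\<^sub>F n in sequentially. \<exists>B\<in>sets P. emeasure P B < ennreal e \<and>
    (\<forall>\<omega>\<in>space P - B. ghat n \<omega> \<in> G_space \<and> Gn (\<lambda>z. ghat n \<omega> z - x n z) \<le> K * (1 / sqrt (real n * lam n)))"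
    using ev
  proof eventually_elim
    fix n :: nat assume n: "n \<ge> 2 \<and> lam n \<le> 1 \<and> C * sqrt (c / real n) \<le> 1 / 2"
    then have n0: "n > 0" and lam1: "lam n \<le> 1" by auto
    have "AE \<omega> in P. is_arg_min (criterion \<mu> n (lam n) (\<lambda>i. Ys i \<omega>) (\<lambda>i. Zs i \<omega>) (\<lambda>i. Ws i \<omega>))
                            (\<lambda>g. g \<in> G_space) (ghat n \<omega>) \<and> (\<forall>i. Zs i \<omega> \<in> {0..1})"
      using ghat[of n] Zs_01 n by auto
    then obtain N0 where N0: "N0 \<in> null_sets P"
      "\<And>\<omega>. \<omega> \<in> space P - N0 \<Longrightarrow> is_arg_min (criterion \<mu> n (lam n) (\<lambda>i. Ys i \<omega>) (\<lambda>i. Zs i \<omega>) (\<lambda>i. Ws i \<omega>))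
                            (\<lambda>g. g \<in> G_space) (ghat n \<omega>) \<and> (\<forall>i. Zs i \<omega> \<in> {0..1})"
      by (rule AE_E3) blast
    define B1 where "B1 = {\<omega> \<in> space P. Se n \<omega> > ennreal (c / real n)}"
    define B2 where "B2 = {\<omega> \<in> space P. So n \<omega> > ennreal (c / real n)}"
    have B12: "B1 \<in> sets P" "B2 \<in> sets P"
      unfolding B1_def B2_def using Se(2)[OF n0] So(1)[OF n0] by measurable
    have eB: "emeasure P (B1 \<union> B2 \<union> N0) < ennreal e"
    proof -
      have "emeasure P (B1 \<union> B2 \<union> N0) = emeasure P (B1 \<union> B2)"
        by (rule emeasure_Un_null_set) (use B12 N0 in auto)
      also have "\<dots> \<le> emeasure P B1 + emeasure P B2" by (rule emeasure_subadditive[OF B12])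
      also have "\<dots> \<le> ennreal (Ke / c) + ennreal (4 / c)"
        unfolding B1_def B2_def
        by (intro add_mono markov_scaled[OF Se(2)[OF n0] Se(3)[OF n0] c0 n0] markov_scaled[OF So(1)[OF n0] So(2)[OF n0] c0 n0])
      also have "\<dots> = ennreal (Ke / c + 4 / c)" using Se(1) c0 by (intro ennreal_plus[symmetric]) auto
      also have "\<dots> < ennreal e" using ce e by (intro ennreal_lessI) auto
      finally show ?thesis .
    qed
    have main: "ghat n \<omega> \<in> G_space \<and> Gn (\<lambda>z. ghat n \<omega> z - x n z) \<le> K * (1 / sqrt (real n * lam n))"
      if \<omega>: "\<omega> \<in> space P - (B1 \<union> B2 \<union> N0)" for \<omega>
    proof -
      have am: "is_arg_min (criterion \<mu> n (lam n) (\<lambda>i. Ys i \<omega>) (\<lambda>i. Zs i \<omega>) (\<lambda>i. Ws i \<omega>)) (\<lambda>g. g \<in> G_space) (ghat n \<omega>)"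
        and z: "\<forall>i. Zs i \<omega> \<in> {0..1}" using N0(2)[of \<omega>] \<omega> by auto
      have s: "Se n \<omega> \<le> ennreal (c / real n)" "So n \<omega> \<le> ennreal (c / real n)"
        using \<omega> by (auto simp: B1_def B2_def not_less)
      let ?r = "sqrt (c / real n)"
      have r0: "?r \<ge> 0" using c0 by simp
      let ?en = "L2.nrm \<mu> (ecf n (\<lambda>i. Ys i \<omega> - g0 (Zs i \<omega>)) (\<lambda>i. Ws i \<omega>))"
      have en: "?en \<le> ?r"
      proof (rule real_le_rsqrt)
        have "ennreal (?en\<^sup>2) \<le> ennreal (c / real n)" using Se(4)[OF z, of n] s by simp
        then show "?en\<^sup>2 \<le> c / real n" using c0 by (simp add: ennreal_le_iff)
      qed
      have op: "L2.nrm \<mu> (\<lambda>t. ecf n (\<lambda>i. g (Zs i \<omega>)) (\<lambda>i. Ws i \<omega>) t - A g t) \<le> ?r * Gn g" if g: "g \<in> G_space" for g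
      proof (rule power2_le_imp_le)
        let ?d = "L2.nrm \<mu> (\<lambda>t. ecf n (\<lambda>i. g (Zs i \<omega>)) (\<lambda>i. Ws i \<omega>) t - A g t)"
        have "ennreal (?d\<^sup>2) \<le> ennreal ((Gn g)\<^sup>2) * So n \<omega>" by (rule So(3)[OF g z])
        also have "\<dots> \<le> ennreal ((Gn g)\<^sup>2) * ennreal (c / real n)" by (rule mult_left_mono[OF s(2)]) simp
        also have "\<dots> = ennreal ((Gn g)\<^sup>2 * (c / real n))" by (rule ennreal_mult'[symmetric]) simp
        finally have "?d\<^sup>2 \<le> (Gn g)\<^sup>2 * (c / real n)" using c0 by (simp add: ennreal_le_iff)
        also have "\<dots> = (?r * Gn g)\<^sup>2" using c0 by (simp add: power_mult_distrib)
        finally show "?d\<^sup>2 \<le> (?r * Gn g)\<^sup>2" .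
        show "0 \<le> ?r * Gn g" using r0 Gn_bounds(4)[OF g, of 0] by simp
      qed
      have "Gn (\<lambda>v. ghat n \<omega> v - x n v) \<le> 4 * C / sqrt (lam n) * (?en + ?r * (Gn (\<lambda>v. g0 v - x n v) + 4 * C * Hn g0))"
        by (rule estimator_error_bound[OF am lam_pos lam1 g0 x(1) x(2) C r0 _ op]) (use n in auto)
      also have "\<dots> \<le> 4 * C / sqrt (lam n) * (?r + ?r * (3 * C * Hn g0 + 4 * C * Hn g0))"
      proof (intro mult_left_mono add_mono en order_refl)
        have bG: "(\<lambda>v. g0 v - x n v) \<in> G_space" by (rule GH.diff_mem[OF g0 x(1)])
        have "An (\<lambda>v. g0 v - x n v) \<le> sqrt (lam n) * Hn g0" "Hn (\<lambda>v. g0 v - x n v) \<le> 2 * Hn g0"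
          by (rule tikhonov_bounds[OF lam_pos g0 x(1) x(2)]; assumption)+
        moreover have "sqrt (lam n) * Hn g0 \<le> 1 * Hn g0" using lam1 h0 by (intro mult_right_mono) auto
        ultimately have "C * (An (\<lambda>v. g0 v - x n v) + Hn (\<lambda>v. g0 v - x n v)) \<le> C * (3 * Hn g0)"
          using C(1) by (intro mult_left_mono) auto
        then show "Gn (\<lambda>v. g0 v - x n v) \<le> 3 * C * Hn g0" using C(2)[OF bG] by simp
      qed (use r0 C(1) lam_pos[of n] in auto)
      also have "\<dots> = K * (1 / sqrt (real n * lam n))"
        unfolding K_def using n0 lam_pos[of n] by (simp add: real_sqrt_divide real_sqrt_mult field_simps)
      finally show ?thesis using am by (simp add: is_arg_min_def)
    qed
    have "B1 \<union> B2 \<union> N0 \<in> sets P" using B12 N0(1) by auto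
    then show "\<exists>B\<in>sets P. emeasure P B < ennreal e \<and>
        (\<forall>\<omega>\<in>space P - B. ghat n \<omega> \<in> G_space \<and> Gn (\<lambda>z. ghat n \<omega> z - x n z) \<le> K * (1 / sqrt (real n * lam n)))"
      using eB main by blast
  qed
  then show ?thesis using that K0 by blast
qed

text \<open>All conclusions go through the same population minimisers \<open>x n\<close>; only the
  bias is treated differently, by \<open>A_stable\<close> for consistency and by the source
  condition for the rate.\<close>

lemma consistency_and_rate:
  assumes lam_pos: "\<And>n. lam n > 0" and lam0: "lam \<longlonglongrightarrow> 0"
    and nlam: "filterlim (\<lambda>n. real n * lam n) at_top sequentially"
    and ghat: "\<And>n. n \<ge> 2 \<Longrightarrow> AE \<omega> in P. is_arg_min (criterion \<mu> n (lam n) (\<lambda>i. Ys i \<omega>) (\<lambda>i. Zs i \<omega>) (\<lambda>i. Ws i \<omega>))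
                            (\<lambda>g. g \<in> G_space) (ghat n \<omega>)"
  shows "little_o_p P (\<lambda>n \<omega>. sup01 (\<lambda>z. ghat n \<omega> z - g0 z)) (\<lambda>_. 1)"
    and "little_o_p P (\<lambda>n \<omega>. sup01 (\<lambda>z. deriv01 (ghat n \<omega>) z - deriv01 g0 z)) (\<lambda>_. 1)"
    and "singular_system T \<mu> J \<sigma> \<phi> \<psi> \<Longrightarrow> \<gamma> > 0 \<Longrightarrow>
      (\<lambda>j. \<sigma> j powr (- 2 * \<gamma>) * \<bar>H_inner (\<lambda>z. g0 z - g0 0 - deriv01 g0 0 * z) (\<phi> j)\<bar>\<^sup>2) summable_on J \<Longrightarrow>
      big_O_p P (\<lambda>n \<omega>. sup01 (\<lambda>z. ghat n \<omega> z - g0 z)) (\<lambda>n. 1 / sqrt (real n * lam n) + lam n powr (min \<gamma> 2 / 2)) \<and>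
      big_O_p P (\<lambda>n \<omega>. sup01 (\<lambda>z. deriv01 (ghat n \<omega>) z - deriv01 g0 z)) (\<lambda>n. 1 / sqrt (real n * lam n) + lam n powr (min \<gamma> 2 / 2))"
proof -
  have "\<exists>X. X \<in> G_space \<and> (\<forall>h\<in>G_space. Aip (\<lambda>z. g0 z - X z) h = lam n * H_inner X h)" for n
    using tikhonov_minimiser[OF lam_pos[of n] g0] by metis
  then obtain x where x: "\<And>n. x n \<in> G_space" "\<And>n h. h \<in> G_space \<Longrightarrow> Aip (\<lambda>z. g0 z - x n z) h = lam n * H_inner (x n) h"
    by metis
  define b where "b = (\<lambda>n z. g0 z - x n z)"
  have bG: "b n \<in> G_space" for n unfolding b_def by (rule GH.diff_mem[OF g0 x(1)])
  have sups: "\<bar>sup01 (\<lambda>z. ghat n \<omega> z - g0 z)\<bar> \<le> R + D" "\<bar>sup01 (\<lambda>z. deriv01 (ghat n \<omega>) z - deriv01 g0 z)\<bar> \<le> R + D"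
    if g: "ghat n \<omega> \<in> G_space" and R: "Gn (\<lambda>z. ghat n \<omega> z - x n z) \<le> R"
      and D: "\<And>z. z \<in> {0..1} \<Longrightarrow> \<bar>b n z\<bar> \<le> D \<and> \<bar>deriv01 (b n) z\<bar> \<le> D" for n \<omega> R D
  proof -
    have dG: "(\<lambda>z. ghat n \<omega> z - x n z) \<in> G_space" by (rule GH.diff_mem[OF g x(1)])
    show "\<bar>sup01 (\<lambda>z. ghat n \<omega> z - g0 z)\<bar> \<le> R + D"
    proof (rule sup01_abs_le)
      fix z :: real assume z: "z \<in> {0..1}"
      show "\<bar>ghat n \<omega> z - g0 z\<bar> \<le> R + D"
        using Gn_bounds(1)[OF dG z] R D[OF z, THEN conjunct1] unfolding b_def by linarith
    qed
    show "\<bar>sup01 (\<lambda>z. deriv01 (ghat n \<omega>) z - deriv01 g0 z)\<bar> \<le> R + D"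
    proof (rule sup01_abs_le)
      fix z :: real assume z: "z \<in> {0..1}"
      show "\<bar>deriv01 (ghat n \<omega>) z - deriv01 g0 z\<bar> \<le> R + D"
        using Gn_bounds(2)[OF dG z] R D[OF z, THEN conjunct2] deriv01_diff[OF g x(1)[of n] z] deriv01_diff[OF g0 x(1)[of n] z]
        unfolding b_def by linarith
    qed
  qed
  have r0: "(\<lambda>n. 1 / sqrt (real n * lam n)) \<longlonglongrightarrow> 0"
    by (intro tendsto_divide_0[OF tendsto_const] filterlim_at_top_imp_at_infinity filterlim_compose[OF sqrt_at_top nlam])
  have "\<forall>\<^sub>F n in sequentially. \<exists>B\<in>sets P. emeasure P B < ennreal r \<and>
      (\<forall>\<omega>\<in>space P - B. \<bar>sup01 (\<lambda>z. ghat n \<omega> z - g0 z)\<bar> \<le> e \<and> \<bar>sup01 (\<lambda>z. deriv01 (ghat n \<omega>) z - deriv01 g0 z)\<bar> \<le> e)"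
    if e: "e > 0" and r: "r > 0" for e r
  proof -
    obtain K where K: "K > 0" "\<forall>\<^sub>F n in sequentially. \<exists>B\<in>sets P. emeasure P B < ennreal r \<and>
      (\<forall>\<omega>\<in>space P - B. ghat n \<omega> \<in> G_space \<and> Gn (\<lambda>z. ghat n \<omega> z - x n z) \<le> K * (1 / sqrt (real n * lam n)))"
      using stochastic_error[OF lam_pos lam0 ghat x r] by blast
    have h0: "Hn g0 \<ge> 0" by (rule GH.nrm_nonneg[OF g0])
    \<comment> \<open>The bias has seminorm at most \<open>2 * Hn g0\<close> for every
      \<open>n\<close>, so \<open>\<eta>\<close> can be fixed before \<open>n\<close>; the bound on
      \<open>An\<close> then falls below it as \<open>lam n\<close> tends to zero.\<close>
    obtain \<eta> where \<eta>: "\<eta> > 0" "\<And>g z. g \<in> G_space \<Longrightarrow> Hn g \<le> 2 * Hn g0 \<Longrightarrow> An g \<le> \<eta> \<Longrightarrow> z \<in> {0..1} \<Longrightarrow>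
        \<bar>g z\<bar> \<le> e / 2 \<and> \<bar>deriv01 g z\<bar> \<le> e / 2"
      using A_stable[of "e / 2" "2 * Hn g0"] e h0 by auto
    have "(\<lambda>n. K * (1 / sqrt (real n * lam n))) \<longlonglongrightarrow> K * 0" by (intro tendsto_intros r0)
    then have 1: "\<forall>\<^sub>F n in sequentially. K * (1 / sqrt (real n * lam n)) < e / 2" by (rule order_tendstoD) (use e in simp)
    have "(\<lambda>n. sqrt (lam n) * Hn g0) \<longlonglongrightarrow> sqrt 0 * Hn g0" by (intro tendsto_intros lam0)
    then have 2: "\<forall>\<^sub>F n in sequentially. sqrt (lam n) * Hn g0 < \<eta>" by (rule order_tendstoD) (use \<eta> in simp)
    show ?thesis
      using K(2) 1 2
    proof eventually_elim
      case (elim n)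
      then obtain B where B: "B \<in> sets P" "emeasure P B < ennreal r"
        "\<And>\<omega>. \<omega> \<in> space P - B \<Longrightarrow> ghat n \<omega> \<in> G_space \<and> Gn (\<lambda>z. ghat n \<omega> z - x n z) \<le> K * (1 / sqrt (real n * lam n))"
        by blast
      have "An (b n) \<le> sqrt (lam n) * Hn g0" "Hn (b n) \<le> 2 * Hn g0"
        unfolding b_def by (rule tikhonov_bounds[OF lam_pos g0 x(1) x(2)]; assumption)+
      then have D: "\<bar>b n z\<bar> \<le> e / 2 \<and> \<bar>deriv01 (b n) z\<bar> \<le> e / 2" if "z \<in> {0..1}" for z
        using \<eta>(2)[OF bG _ _ that, of n] elim by linarith
      have "\<bar>sup01 (\<lambda>z. ghat n \<omega> z - g0 z)\<bar> \<le> e \<and> \<bar>sup01 (\<lambda>z. deriv01 (ghat n \<omega>) z - deriv01 g0 z)\<bar> \<le> e"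
        if "\<omega> \<in> space P - B" for \<omega>
        using sups[of n \<omega> "e / 2" "e / 2"] B(3)[OF that] D elim by simp
      then show ?case using B by blast
    qed
  qed
  note consistent = this
  \<comment> \<open>The bad event may fail to be measurable, but it is contained in
    \<open>B\<close>, so its outer measure is at most the measure of \<open>B\<close>.\<close>
  have bad: "outer_measure_of P {\<omega> \<in> space P. \<bar>X \<omega>\<bar> > c} < ennreal r"
    if "B \<in> sets P" "emeasure P B < ennreal r" "\<And>\<omega>. \<omega> \<in> space P - B \<Longrightarrow> \<bar>X \<omega>\<bar> \<le> c" for X :: "'a \<Rightarrow> real" and c B r
  proof -
    have "{\<omega> \<in> space P. \<bar>X \<omega>\<bar> > c} \<subseteq> B" using that(3) by force
    from outer_measure_of_le_emeasure[OF this that(1)] show ?thesis using that(2) by simp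
  qed
  show "little_o_p P (\<lambda>n \<omega>. sup01 (\<lambda>z. ghat n \<omega> z - g0 z)) (\<lambda>_. 1)"
    unfolding little_o_p_def
  proof (intro allI impI tendsto_zero_ennreal)
    fix e r :: real assume "e > 0" "r > 0"
    from consistent[OF this] show "\<forall>\<^sub>F n in sequentially. outer_measure_of P {\<omega> \<in> space P. \<bar>sup01 (\<lambda>z. ghat n \<omega> z - g0 z)\<bar> > e * 1} < ennreal r"
      by (rule eventually_mono) (auto intro!: bad)
  qed
  show "little_o_p P (\<lambda>n \<omega>. sup01 (\<lambda>z. deriv01 (ghat n \<omega>) z - deriv01 g0 z)) (\<lambda>_. 1)"
    unfolding little_o_p_def
  proof (intro allI impI tendsto_zero_ennreal)
    fix e r :: real assume "e > 0" "r > 0"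
    from consistent[OF this] show "\<forall>\<^sub>F n in sequentially. outer_measure_of P {\<omega> \<in> space P. \<bar>sup01 (\<lambda>z. deriv01 (ghat n \<omega>) z - deriv01 g0 z)\<bar> > e * 1} < ennreal r"
      by (rule eventually_mono) (auto intro!: bad)
  qed
  assume ss: "singular_system T \<mu> J \<sigma> \<phi> \<psi>" and \<gamma>: "\<gamma> > 0"
    and src: "(\<lambda>j. \<sigma> j powr (- 2 * \<gamma>) * \<bar>H_inner (\<lambda>z. g0 z - g0 0 - deriv01 g0 0 * z) (\<phi> j)\<bar>\<^sup>2) summable_on J"
  obtain K1 where K1: "K1 \<ge> 0" "\<And>lam x. 0 < lam \<Longrightarrow> lam \<le> 1 \<Longrightarrow> x \<in> G_space \<Longrightarrow>
     (\<And>h. h \<in> G_space \<Longrightarrow> Aip (\<lambda>z. g0 z - x z) h = lam * H_inner x h) \<Longrightarrow>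
     Gn (\<lambda>z. g0 z - x z) \<le> K1 * lam powr (min \<gamma> 2 / 2)"
    by (rule tikhonov_source_rate[OF g0 ss \<gamma> src]) (erule that, blast)
  let ?r = "\<lambda>n. 1 / sqrt (real n * lam n) + lam n powr (min \<gamma> 2 / 2)"
  have rate: "\<exists>K>0. \<forall>\<^sub>F n in sequentially. \<exists>B\<in>sets P. emeasure P B < ennreal e \<and>
      (\<forall>\<omega>\<in>space P - B. \<bar>sup01 (\<lambda>z. ghat n \<omega> z - g0 z)\<bar> \<le> K * ?r n \<and>
         \<bar>sup01 (\<lambda>z. deriv01 (ghat n \<omega>) z - deriv01 g0 z)\<bar> \<le> K * ?r n)" if e: "e > 0" for e
  proof -
    obtain K where K: "K > 0" "\<forall>\<^sub>F n in sequentially. \<exists>B\<in>sets P. emeasure P B < ennreal e \<and>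
      (\<forall>\<omega>\<in>space P - B. ghat n \<omega> \<in> G_space \<and> Gn (\<lambda>z. ghat n \<omega> z - x n z) \<le> K * (1 / sqrt (real n * lam n)))"
      using stochastic_error[OF lam_pos lam0 ghat x e] by blast
    \<comment> \<open>The bias bound \<open>K1\<close> is available only for penalties at most
      1.\<close>
    have "\<forall>\<^sub>F n in sequentially. lam n < 1" by (rule order_tendstoD[OF lam0]) simp
    with K(2) have "\<forall>\<^sub>F n in sequentially. \<exists>B\<in>sets P. emeasure P B < ennreal e \<and>
      (\<forall>\<omega>\<in>space P - B. \<bar>sup01 (\<lambda>z. ghat n \<omega> z - g0 z)\<bar> \<le> (K + K1) * ?r n \<and>
         \<bar>sup01 (\<lambda>z. deriv01 (ghat n \<omega>) z - deriv01 g0 z)\<bar> \<le> (K + K1) * ?r n)"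
    proof eventually_elim
      case (elim n)
      then obtain B where B: "B \<in> sets P" "emeasure P B < ennreal e"
        "\<And>\<omega>. \<omega> \<in> space P - B \<Longrightarrow> ghat n \<omega> \<in> G_space \<and> Gn (\<lambda>z. ghat n \<omega> z - x n z) \<le> K * (1 / sqrt (real n * lam n))"
        by blast
      have "Gn (b n) \<le> K1 * lam n powr (min \<gamma> 2 / 2)"
        unfolding b_def by (rule K1(2)[OF lam_pos _ x(1) x(2)]) (use elim in auto)
      then have D: "\<bar>b n z\<bar> \<le> K1 * lam n powr (min \<gamma> 2 / 2) \<and> \<bar>deriv01 (b n) z\<bar> \<le> K1 * lam n powr (min \<gamma> 2 / 2)"
        if "z \<in> {0..1}" for z
        using Gn_bounds(1,2)[OF bG that, of n] by linarith
      have "K * (1 / sqrt (real n * lam n)) + K1 * lam n powr (min \<gamma> 2 / 2) \<le> (K + K1) * ?r n"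
      proof -
        have "0 \<le> K1 * (1 / sqrt (real n * lam n))" "0 \<le> K * lam n powr (min \<gamma> 2 / 2)"
          using K1(1) K(1) lam_pos[of n] by auto
        then show ?thesis by (simp only: distrib_left distrib_right)
      qed
      then have "\<bar>sup01 (\<lambda>z. ghat n \<omega> z - g0 z)\<bar> \<le> (K + K1) * ?r n \<and>
         \<bar>sup01 (\<lambda>z. deriv01 (ghat n \<omega>) z - deriv01 g0 z)\<bar> \<le> (K + K1) * ?r n" if "\<omega> \<in> space P - B" for \<omega>
        using sups[OF _ _ D, of \<omega> "K * (1 / sqrt (real n * lam n))"] B(3)[OF that] by (meson order_trans)
      then show ?case using B by blast
    qed
    then show ?thesis using K(1) K1(1) by (intro exI[of _ "K + K1"]) auto
  qed
  show "big_O_p P (\<lambda>n \<omega>. sup01 (\<lambda>z. ghat n \<omega> z - g0 z)) ?r \<and>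
      big_O_p P (\<lambda>n \<omega>. sup01 (\<lambda>z. deriv01 (ghat n \<omega>) z - deriv01 g0 z)) ?r"
    unfolding big_O_p_def
  proof (intro conjI allI impI)
    fix e :: real assume e: "e > 0"
    obtain K where K: "K > 0" "\<forall>\<^sub>F n in sequentially. \<exists>B\<in>sets P. emeasure P B < ennreal e \<and>
      (\<forall>\<omega>\<in>space P - B. \<bar>sup01 (\<lambda>z. ghat n \<omega> z - g0 z)\<bar> \<le> K * ?r n \<and>
         \<bar>sup01 (\<lambda>z. deriv01 (ghat n \<omega>) z - deriv01 g0 z)\<bar> \<le> K * ?r n)"
      using rate[OF e] by blast
    have "\<forall>\<^sub>F n in sequentially. outer_measure_of P {\<omega> \<in> space P. \<bar>sup01 (\<lambda>z. ghat n \<omega> z - g0 z)\<bar> > K * ?r n} < ennreal e"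
      using K(2) by (rule eventually_mono) (elim bexE conjE, rule bad, assumption+, blast)
    then show "\<exists>K>0. \<forall>\<^sub>F n in sequentially. outer_measure_of P {\<omega> \<in> space P. \<bar>sup01 (\<lambda>z. ghat n \<omega> z - g0 z)\<bar> > K * ?r n} < ennreal e"
      using K(1) by blast
    have "\<forall>\<^sub>F n in sequentially. outer_measure_of P {\<omega> \<in> space P. \<bar>sup01 (\<lambda>z. deriv01 (ghat n \<omega>) z - deriv01 g0 z)\<bar> > K * ?r n} < ennreal e"
      using K(2) by (rule eventually_mono) (elim bexE conjE, rule bad, assumption+, blast)
    then show "\<exists>K>0. \<forall>\<^sub>F n in sequentially. outer_measure_of P {\<omega> \<in> space P. \<bar>sup01 (\<lambda>z. deriv01 (ghat n \<omega>) z - deriv01 g0 z)\<bar> > K * ?r n} < ennreal e"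
      using K(1) by blast
  qed
qed

end

text \<open>The cosine and sine of \<open>W \<omega> \<bullet> t\<close> are bounded and measurable
  for the sigma-algebra generated by \<open>W\<close>, so in the integral \<open>\<epsilon>\<close>
  may be replaced by its conditional expectation, which is zero.\<close>

lemma exogeneity_char:
  fixes W :: "'a \<Rightarrow> real ^ 'p"
  assumes "prob_space P" and W[measurable]: "W \<in> borel_measurable P" and \<epsilon>: "integrable P \<epsilon>"
    and exo: "AE \<omega> in P. real_cond_exp P (sigma_gen P W) \<epsilon> \<omega> = 0"
  shows "(\<integral>\<omega>. complex_of_real (\<epsilon> \<omega>) * iexp (W \<omega> \<bullet> t) \<partial>P) = 0"
proof -
  interpret prob_space P by fact
  have [measurable]: "\<epsilon> \<in> borel_measurable P" using \<epsilon> by auto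
  have sub: "subalgebra P (sigma_gen P W)"
    unfolding subalgebra_def sigma_gen_def by (simp add: sets_vimage_algebra2 measurable_sets subset_eq)
      (auto intro: measurable_sets[OF W])
  interpret S: finite_measure_subalgebra P "sigma_gen P W" by standard (rule sub)
  have zero: "(\<integral>\<omega>. f (W \<omega>) * \<epsilon> \<omega> \<partial>P) = 0"
    if f[measurable]: "f \<in> borel_measurable borel" and b: "\<And>w. \<bar>f w\<bar> \<le> 1" for f :: "real ^ 'p \<Rightarrow> real"
  proof -
    have "W \<in> measurable (sigma_gen P W) borel" unfolding sigma_gen_def by (rule measurable_vimage_algebra1) simp
    then have m: "(\<lambda>\<omega>. f (W \<omega>)) \<in> borel_measurable (sigma_gen P W)" by (rule measurable_compose[OF _ f])
    have i: "integrable P (\<lambda>\<omega>. f (W \<omega>) * \<epsilon> \<omega>)"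
      by (rule Bochner_Integration.integrable_bound[OF \<epsilon>]) (use b in \<open>auto simp: abs_mult mult_left_le_one_le\<close>)
    have "(\<integral>\<omega>. f (W \<omega>) * \<epsilon> \<omega> \<partial>P) = (\<integral>\<omega>. f (W \<omega>) * real_cond_exp P (sigma_gen P W) \<epsilon> \<omega> \<partial>P)"
      by (rule S.real_cond_exp_intg(2)[symmetric, OF i m]) measurable
    also have "\<dots> = 0" by (rule integral_eq_zero_AE) (use exo in \<open>eventually_elim, simp\<close>)
    finally show ?thesis .
  qed
  have i: "integrable P (\<lambda>\<omega>. complex_of_real (\<epsilon> \<omega>) * iexp (W \<omega> \<bullet> t))"
    by (rule Bochner_Integration.integrable_bound[OF \<epsilon>]) (auto simp: norm_mult)
  show ?thesis
  proof (rule complex_eqI)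
    have "Re (\<integral>\<omega>. complex_of_real (\<epsilon> \<omega>) * iexp (W \<omega> \<bullet> t) \<partial>P) = (\<integral>\<omega>. cos (W \<omega> \<bullet> t) * \<epsilon> \<omega> \<partial>P)"
      unfolding integral_Re[OF i, symmetric] by (simp add: Re_exp mult.commute)
    also have "\<dots> = 0" by (rule zero) auto
    finally show "Re (\<integral>\<omega>. complex_of_real (\<epsilon> \<omega>) * iexp (W \<omega> \<bullet> t) \<partial>P) = Re 0" by simp
    have "Im (\<integral>\<omega>. complex_of_real (\<epsilon> \<omega>) * iexp (W \<omega> \<bullet> t) \<partial>P) = (\<integral>\<omega>. sin (W \<omega> \<bullet> t) * \<epsilon> \<omega> \<partial>P)"
      unfolding integral_Im[OF i, symmetric] by (simp add: Im_exp mult.commute)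
    also have "\<dots> = 0" by (rule zero) auto
    finally show "Im (\<integral>\<omega>. complex_of_real (\<epsilon> \<omega>) * iexp (W \<omega> \<bullet> t) \<partial>P) = Im 0" by simp
  qed
qed

theorem theorem3p1:
  fixes P :: "'a measure"
    and Y Z \<epsilon> :: "'a \<Rightarrow> real" and W :: "'a \<Rightarrow> real ^ 'p"
    and Ys Zs :: "nat \<Rightarrow> 'a \<Rightarrow> real" and Ws :: "nat \<Rightarrow> 'a \<Rightarrow> real ^ 'p"
    and \<mu> :: "(real ^ 'p) measure"
    and f\<^sub>Z :: "real \<Rightarrow> real"
    and g\<^sub>0 :: "real \<Rightarrow> real"
    and lam :: "nat \<Rightarrow> real"
    and ghat :: "nat \<Rightarrow> 'a \<Rightarrow> real \<Rightarrow> real"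
  assumes "prob_space P"
    and "Y \<in> borel_measurable P" "Z \<in> borel_measurable P" "W \<in> borel_measurable P"
    and "\<forall>\<omega>\<in>space P. Z \<omega> \<in> {0..1}"
    and model: "\<forall>\<omega>\<in>space P. Y \<omega> = g\<^sub>0 (Z \<omega>) + \<epsilon> \<omega>"
    and exogeneity: "AE \<omega> in P. real_cond_exp P (sigma_gen P W) \<epsilon> \<omega> = 0"
    and sample_indep: "prob_space.indep_vars P (\<lambda>_. borel) (\<lambda>i \<omega>. (Ys i \<omega>, Zs i \<omega>, Ws i \<omega>)) UNIV"
    and sample_law: "\<forall>i. distr P borel (\<lambda>\<omega>. (Ys i \<omega>, Zs i \<omega>, Ws i \<omega>))
                        = distr P borel (\<lambda>\<omega>. (Y \<omega>, Z \<omega>, W \<omega>))"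
    and a1a: "integrable P (\<lambda>\<omega>. (Y \<omega>)\<^sup>2)"
    and a1b: "distributed P lborel Z (\<lambda>z. ennreal (f\<^sub>Z z))"
             "\<exists>C. \<forall>z\<in>{0..1}. 0 \<le> f\<^sub>Z z \<and> f\<^sub>Z z \<le> C"
    and a1c: "prob_space \<mu>" "sets \<mu> = sets borel" "distr \<mu> borel uminus = \<mu>"
             "measure_support \<mu> = UNIV"
    and a1d: "(\<integral>\<^sup>+t. (\<integral>\<^sup>+z\<in>{0..1}.
                ennreal ((cmod (LINT \<omega>|P. iexp (W \<omega> \<bullet> t) * complex_of_real (f\<^sub>Z z)))\<^sup>2)
                \<partial>lborel) \<partial>\<mu>) < \<infinity>"
    and a1e: "\<exists>k. \<forall>c. measure P {\<omega> \<in> space P. W \<omega> $ k = c} = 0"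
    and a2: "g\<^sub>0 \<in> G_space"
            "\<forall>g1\<in>G_space. \<forall>g2\<in>G_space.
               (AE \<omega> in P. real_cond_exp P (sigma_gen P W) (\<lambda>\<omega>. g1 (Z \<omega>)) \<omega>
                         = real_cond_exp P (sigma_gen P W) (\<lambda>\<omega>. g2 (Z \<omega>)) \<omega>)
               \<longrightarrow> (\<forall>z\<in>{0..1}. g1 z = g2 z)"
    and lambda_pos: "\<forall>n. lam n > 0"
    and ghat: "\<forall>n\<ge>2. AE \<omega> in P.
                 is_arg_min (criterion \<mu> n (lam n) (\<lambda>i. Ys i \<omega>) (\<lambda>i. Zs i \<omega>) (\<lambda>i. Ws i \<omega>))
                            (\<lambda>g. g \<in> G_space) (ghat n \<omega>)"
    and lambda_lim: "lam \<longlonglongrightarrow> 0" "filterlim (\<lambda>n. real n * lam n) at_top sequentially"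
  shows "little_o_p P (\<lambda>n \<omega>. sup01 (\<lambda>z. ghat n \<omega> z - g\<^sub>0 z)) (\<lambda>_. 1) \<and>
         little_o_p P (\<lambda>n \<omega>. sup01 (\<lambda>z. deriv01 (ghat n \<omega>) z - deriv01 g\<^sub>0 z)) (\<lambda>_. 1) \<and>
         (\<forall>J \<sigma> \<phi> \<psi> \<gamma>.
            singular_system (op_T P Z W \<mu>) \<mu> J \<sigma> \<phi> \<psi> \<and> \<gamma> > 0 \<and>
            (\<lambda>j. \<sigma> j powr (- 2 * \<gamma>) *
                 \<bar>H_inner (\<lambda>z. g\<^sub>0 z - g\<^sub>0 0 - deriv01 g\<^sub>0 0 * z) (\<phi> j)\<bar>\<^sup>2) summable_on J
            \<longrightarrow> big_O_p P (\<lambda>n \<omega>. sup01 (\<lambda>z. ghat n \<omega> z - g\<^sub>0 z))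
                  (\<lambda>n. 1 / sqrt (real n * lam n) + lam n powr (min \<gamma> 2 / 2)) \<and>
                big_O_p P (\<lambda>n \<omega>. sup01 (\<lambda>z. deriv01 (ghat n \<omega>) z - deriv01 g\<^sub>0 z))
                  (\<lambda>n. 1 / sqrt (real n * lam n) + lam n powr (min \<gamma> 2 / 2)))"
proof -
  have npiv: "npiv P \<mu> Z W"
  proof (intro npiv.intro npiv_axioms.intro)
    show "prob_space P" "prob_space \<mu>" "Z \<in> borel_measurable P" "W \<in> borel_measurable P"
      "sets \<mu> = sets borel" "measure_support \<mu> = UNIV" by fact+
    show "Z \<omega> \<in> {0..1}" if "\<omega> \<in> space P" for \<omega>
      using \<open>\<forall>\<omega>\<in>space P. Z \<omega> \<in> {0..1}\<close> that by blast
    show "g1 z = g2 z" if "g1 \<in> G_space" "g2 \<in> G_space" "z \<in> {0..1}"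
      "AE \<omega> in P. real_cond_exp P (sigma_gen P W) (\<lambda>\<omega>. g1 (Z \<omega>)) \<omega>
         = real_cond_exp P (sigma_gen P W) (\<lambda>\<omega>. g2 (Z \<omega>)) \<omega>" for g1 g2 z
      using a2(2) that by blast
  qed
  then interpret N: npiv P \<mu> Z W .
  \<comment> \<open>Leads to integrability of \<open>\<epsilon>\<close>, which equals
    \<open>Y\<close> minus the bounded variable \<open>g\<^sub>0 (Z \<omega>)\<close>; the
    conditional expectation of \<open>\<epsilon>\<close> can then be used.\<close>
  have "integrable P Y"
    by (rule N.square_integrable_imp_integrable[OF \<open>Y \<in> borel_measurable P\<close> a1a])
  then have "integrable P (\<lambda>\<omega>. Y \<omega> - g\<^sub>0 (Z \<omega>))"
    using N.A_integrand(2)[OF a2(1)] by (rule Bochner_Integration.integrable_diff)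
  then have "integrable P \<epsilon>"
    by (rule Bochner_Integration.integrable_cong[THEN iffD1, rotated 2]) (use model in auto)
  from exogeneity_char[OF \<open>prob_space P\<close> \<open>W \<in> borel_measurable P\<close> this exogeneity]
  have "(\<integral>\<omega>. complex_of_real (\<epsilon> \<omega>) * iexp (W \<omega> \<bullet> t) \<partial>P) = 0" for t .
  moreover have "(\<integral>\<omega>. complex_of_real (Y \<omega> - g\<^sub>0 (Z \<omega>)) * iexp (W \<omega> \<bullet> t) \<partial>P)
      = (\<integral>\<omega>. complex_of_real (\<epsilon> \<omega>) * iexp (W \<omega> \<bullet> t) \<partial>P)" for t
    by (rule Bochner_Integration.integral_cong) (use model in auto)
  ultimately have exo: "(\<integral>\<omega>. complex_of_real (Y \<omega> - g\<^sub>0 (Z \<omega>)) * iexp (W \<omega> \<bullet> t) \<partial>P) = 0" for t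
    by simp
  interpret S: npiv_sample P \<mu> Z W Y Ys Zs Ws g\<^sub>0
    by (intro npiv_sample.intro npiv_sample_axioms.intro npiv a1a a2(1) exo sample_indep
        \<open>Y \<in> borel_measurable P\<close> spec[OF sample_law])
  have "AE \<omega> in P. is_arg_min (criterion \<mu> n (lam n) (\<lambda>i. Ys i \<omega>) (\<lambda>i. Zs i \<omega>) (\<lambda>i. Ws i \<omega>))
      (\<lambda>g. g \<in> G_space) (ghat n \<omega>)" if "n \<ge> 2" for n
    using ghat that by blast
  note main = S.consistency_and_rate[where lam = lam and ghat = ghat,
      OF spec[OF lambda_pos] lambda_lim this]
  show ?thesis using main by blast
qed

end
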